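(* Assume that $\psi(k)\ll k^{-(1+\delta)}$ for some $\delta>0$ (i.e. $\sup_{k\ge 1} k^{1+\delta}\psi(k)<\infty$). Then the function $\Gamma(s,t)$ is symmetric, positive semidefinite and continuous on the unit square $[0,1]^2$, and $$\sqrt{N}\,(F_N(t)-t)\overset{D[0,1]}{\longrightarrow}K(t)\quad\text{as }N\to\infty,$$ where $K(t)$ is a mean zero Gaussian process on $[0,1]$ with covariance function $\Gamma(s,t)$.
   Context: $X_1,X_2,\dots$ are independent, identically distributed real-valued random variables, $S_k=\sum_{j=1}^k X_j$, $\{\cdot\}$ denotes fractional part, and $\psi(k)=\sup_{t\in[0,1]}|\mathbb{P}(\{S_k\}\le t)-t|$. The empirical distribution function of the sequence $\{S_k\}$ is $F_N(t)=\frac1N\sum_{k=1}^N I_{[0,t)}(\{S_k\})$, $0\le t\le 1$. $\mathcal{F}$ is the set of all $1$-periodic functions $f:\mathbb{R}\to\mathbb{R}$ of bounded variation on $[0,1]$ with $\int_0^1 f(x)\,\mathrm{d}x=0$. For $f,g\in\mathcal{F}$, $$C(f,g)=\mathbb{E} f(U)g(U)+\sum_{k=1}^{\infty}\mathbb{E} f(U)g(U+S_k)+\sum_{k=1}^{\infty}\mathbb{E} g(U)f(U+S_k),$$ where $U$ is uniformly distributed on $[0,1)$ and independent of $X_1,X_2,\dots$ (under the assumption on $\psi$ these series converge absolutely). For an interval $J\subseteq[0,1)$ of length $\lambda(J)$, $f_J(x)=I_J(\{x\})-\lambda(J)$ is its centered indicator extended with period $1$, and $\Gamma(s,t)=C(f_{[0,s)},f_{[0,t)})$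 for $s,t\in[0,1]$. $\overset{D[0,1]}{\longrightarrow}$ denotes weak convergence in the Skorohod space $D[0,1]$ (functions on $[0,1]$ with one-sided limits, with the Skorohod $J_1$ topology); since $F_N$ is left-continuous, $D[0,1]$ is understood with the left-continuous-with-right-limits convention. *)

theory Defs
  imports "HOL-Probability.Probability"
begin

section \<open>The Skorohod space of left-continuous functions with right limits\<close>

text \<open>
  The empirical distribution function below counts points in \<open>[0, t)\<close> and is therefore
  left-continuous, so the mirror image (under \<open>t \<mapsto> 1 - t\<close>) of the usual cadlag
  convention is used. As nothing lies to the left of \<open>0\<close>, only the existence of a right limit
  is required there, and a jump at \<open>0\<close> is allowed. Membership in \<open>extensional {0..1}\<close> makes
  the total functions of the logic represent functions on \<open>[0, 1]\<close> uniquely.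
\<close>

definition D01 :: "(real \<Rightarrow> real) set" where
  "D01 = {x \<in> extensional {0..1}.
            (\<forall>t\<in>{0<..1}. (x \<longlongrightarrow> x t) (at_left t)) \<and>
            (\<forall>t\<in>{0..<1}. \<exists>l. (x \<longlongrightarrow> l) (at_right t))}"

definition time_changes :: "(real \<Rightarrow> real) set" where
  "time_changes = {\<tau>. strict_mono_on {0..1} \<tau> \<and> continuous_on {0..1} \<tau> \<and> \<tau> ` {0..1} = {0..1}}"

definition J1_cost :: "(real \<Rightarrow> real) \<Rightarrow> (real \<Rightarrow> real) \<Rightarrow> (real \<Rightarrow> real) \<Rightarrow> real" where
  "J1_cost x y \<tau> =
     max (SUP t\<in>{0..1}. \<bar>\<tau> t - t\<bar>) (SUP t\<in>{0..1}. \<bar>x t - y (\<tau> t)\<bar>)"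

text \<open>
  The value \<open>0\<close> off \<open>D01\<close> is a dummy; the locale \<open>Metric_space\<close> wants nonnegativity and
  symmetry on the whole type.
\<close>

definition J1_dist :: "(real \<Rightarrow> real) \<Rightarrow> (real \<Rightarrow> real) \<Rightarrow> real" where
  "J1_dist x y =
     (if x \<in> D01 \<and> y \<in> D01 then INF \<tau>\<in>time_changes. J1_cost x y \<tau> else 0)"

definition J1_topology :: "(real \<Rightarrow> real) topology" where
  "J1_topology = Metric_space.mtopology D01 J1_dist"

definition J1_borel :: "(real \<Rightarrow> real) measure" where
  "J1_borel = sigma D01 {U. openin J1_topology U}"

lemma D01_bounded:
  assumes "x \<in> D01"
  obtains B where "B \<ge> 0" "\<And>t. t \<in> {0..1} \<Longrightarrow> \<bar>x t\<bar> \<le> B"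
proof -
  have "\<exists>d B. d > 0 \<and> (\<forall>s\<in>{0..1}. \<bar>s - t\<bar> < d \<longrightarrow> \<bar>x s\<bar> \<le> B)" if t: "t \<in> {0..1}" for t
  proof -
    have "\<exists>d B. d > 0 \<and> (\<forall>s\<in>{0..1}. s < t \<and> t - s < d \<longrightarrow> \<bar>x s\<bar> \<le> B)"
    proof (cases "t = 0")
      case True
      then show ?thesis by (auto intro!: exI[of _ 1])
    next
      case False
      then have "(x \<longlongrightarrow> x t) (at_left t)" using assms t by (auto simp: D01_def)
      then have "\<forall>\<^sub>F s in at_left t. dist (x s) (x t) < 1" by (rule tendstoD) simp
      then obtain b where b: "b < t" "\<And>s. s > b \<Longrightarrow> s < t \<Longrightarrow> dist (x s) (x t) < 1"
        by (auto simp: eventually_at_left_field)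
      have "\<bar>x s\<bar> \<le> \<bar>x t\<bar> + 1" if "s < t" "t - s < t - b" for s
        using b(2)[of s] that by (auto simp: dist_real_def)
      then show ?thesis using b(1) by (intro exI[of _ "t - b"] exI[of _ "\<bar>x t\<bar> + 1"]) auto
    qed
    then obtain d1 B1 where 1: "d1 > 0" "\<And>s. s \<in> {0..1} \<Longrightarrow> s < t \<Longrightarrow> t - s < d1 \<Longrightarrow> \<bar>x s\<bar> \<le> B1"
      by blast
    have "\<exists>d B. d > 0 \<and> (\<forall>s\<in>{0..1}. s > t \<and> s - t < d \<longrightarrow> \<bar>x s\<bar> \<le> B)"
    proof (cases "t = 1")
      case True
      then show ?thesis by (auto intro!: exI[of _ 1])
    next
      case False
      then obtain l where "(x \<longlongrightarrow> l) (at_right t)" using assms t by (force simp: D01_def)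
      then have "\<forall>\<^sub>F s in at_right t. dist (x s) l < 1" by (rule tendstoD) simp
      then obtain b where b: "b > t" "\<And>s. s > t \<Longrightarrow> s < b \<Longrightarrow> dist (x s) l < 1"
        by (auto simp: eventually_at_right_field)
      have "\<bar>x s\<bar> \<le> \<bar>l\<bar> + 1" if "s > t" "s - t < b - t" for s
        using b(2)[of s] that by (auto simp: dist_real_def)
      then show ?thesis using b(1) by (intro exI[of _ "b - t"] exI[of _ "\<bar>l\<bar> + 1"]) auto
    qed
    then obtain d2 B2 where 2: "d2 > 0" "\<And>s. s \<in> {0..1} \<Longrightarrow> s > t \<Longrightarrow> s - t < d2 \<Longrightarrow> \<bar>x s\<bar> \<le> B2"
      by blast
    have "\<bar>x s\<bar> \<le> max \<bar>x t\<bar> (max B1 B2)" if "s \<in> {0..1}" "\<bar>s - t\<bar> < min d1 d2" for s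
      using 1(2)[of s] 2(2)[of s] that by (cases s t rule: linorder_cases) auto
    then show ?thesis
      using 1(1) 2(1) by (intro exI[of _ "min d1 d2"] exI[of _ "max \<bar>x t\<bar> (max B1 B2)"]) auto
  qed
  then obtain d B where dB: "\<And>t. t \<in> {0..1} \<Longrightarrow> d t > (0::real)"
    "\<And>t s. t \<in> {0..1} \<Longrightarrow> s \<in> {0..1} \<Longrightarrow> \<bar>s - t\<bar> < d t \<Longrightarrow> \<bar>x s\<bar> \<le> B t"
    by metis
  obtain F where F: "F \<subseteq> {0..1::real}" "finite F" "{0..1} \<subseteq> (\<Union>t\<in>F. ball t (d t))"
    by (rule compactE_image[of "{0..1::real}" "{0..1}" "\<lambda>t. ball t (d t)"]) (use dB(1) in force)+
  show ?thesis
  proof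
    show "(\<Sum>t\<in>F. \<bar>B t\<bar>) \<ge> 0" by (simp add: sum_nonneg)
    fix s :: real assume s: "s \<in> {0..1}"
    then obtain t where t: "t \<in> F" "s \<in> ball t (d t)" using F(3) by blast
    then have "\<bar>x s\<bar> \<le> B t"
      using dB(2)[of t s] s F(1) by (auto simp: dist_real_def abs_minus_commute)
    also have "\<dots> \<le> \<bar>B t\<bar>" by simp
    also have "\<dots> \<le> (\<Sum>t\<in>F. \<bar>B t\<bar>)" using t(1) F(2) by (intro member_le_sum) auto
    finally show "\<bar>x s\<bar> \<le> (\<Sum>t\<in>F. \<bar>B t\<bar>)" .
  qed
qed

lemma time_changes_mem: "\<tau> \<in> time_changes \<Longrightarrow> t \<in> {0..1} \<Longrightarrow> \<tau> t \<in> {0..1}"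
  unfolding time_changes_def by blast

lemma id_time_change: "(\<lambda>t. t) \<in> time_changes"
  by (auto simp: time_changes_def strict_mono_on_def)

lemma time_changes_comp:
  assumes "\<tau> \<in> time_changes" "\<mu> \<in> time_changes"
  shows "(\<lambda>t. \<mu> (\<tau> t)) \<in> time_changes"
proof -
  have t: "strict_mono_on {0..1} \<tau>" "continuous_on {0..1} \<tau>" "\<tau> ` {0..1} = {0..1}"
    and m: "strict_mono_on {0..1} \<mu>" "continuous_on {0..1} \<mu>" "\<mu> ` {0..1} = {0..1}"
    using assms by (simp_all add: time_changes_def)
  have "strict_mono_on {0..1} (\<lambda>t. \<mu> (\<tau> t))"
    using strict_mono_onD[OF t(1)] strict_mono_onD[OF m(1)] time_changes_mem[OF assms(1)]
    by (intro strict_mono_onI) blast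
  moreover have "continuous_on {0..1} (\<lambda>t. \<mu> (\<tau> t))"
    using continuous_on_compose2[OF m(2) t(2)] t(3) by simp
  moreover have "(\<lambda>t. \<mu> (\<tau> t)) ` {0..1} = \<mu> ` \<tau> ` {0..1}"
    by (simp only: image_image)
  ultimately show ?thesis using t(3) m(3) by (simp add: time_changes_def)
qed

lemma time_changes_inv:
  assumes "\<tau> \<in> time_changes"
  obtains \<mu> where "\<mu> \<in> time_changes" "\<And>t. t \<in> {0..1} \<Longrightarrow> \<tau> (\<mu> t) = t"
proof
  let ?\<mu> = "inv_into {0..1} \<tau>"
  have sm: "strict_mono_on {0..1} \<tau>" and co: "continuous_on {0..1} \<tau>"
    and im: "\<tau> ` {0..1} = {0..1}" using assms by (auto simp: time_changes_def)
  have inj: "inj_on \<tau> {0..1}" using sm by (rule strict_mono_on_imp_inj_on)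
  show 1: "\<tau> (?\<mu> t) = t" if "t \<in> {0..1}" for t
    using that im by (intro f_inv_into_f) auto
  have mem: "?\<mu> t \<in> {0..1}" if "t \<in> {0..1}" for t
    using that im by (intro inv_into_into) auto
  have "continuous_on {0..1} ?\<mu>"
    using continuous_on_inv[OF co, of ?\<mu>] inv_into_f_f[OF inj] im by simp
  moreover have "?\<mu> ` {0..1} = {0..1}"
    using inv_into_image_cancel[OF inj, of "{0..1}"] im by simp
  moreover have "strict_mono_on {0..1} ?\<mu>"
  proof (rule strict_mono_onI)
    fix r s :: real assume rs: "r \<in> {0..1}" "s \<in> {0..1}" "r < s"
    show "?\<mu> r < ?\<mu> s"
    proof (rule ccontr)
      assume "\<not> ?\<mu> r < ?\<mu> s"
      then have "\<tau> (?\<mu> s) \<le> \<tau> (?\<mu> r)"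
        using mem rs sm by (intro strict_mono_on_leD[OF sm]) auto
      then show False using 1 rs by simp
    qed
  qed
  ultimately show "?\<mu> \<in> time_changes" by (simp add: time_changes_def)
qed

lemma J1_cost_le_iff:
  assumes "x \<in> D01" "y \<in> D01" "\<tau> \<in> time_changes"
  shows "J1_cost x y \<tau> \<le> e \<longleftrightarrow>
    (\<forall>t\<in>{0..1}. \<bar>\<tau> t - t\<bar> \<le> e) \<and> (\<forall>t\<in>{0..1}. \<bar>x t - y (\<tau> t)\<bar> \<le> e)"
proof -
  obtain B where B: "\<And>t. t \<in> {0..1} \<Longrightarrow> \<bar>x t\<bar> \<le> B" using D01_bounded[OF assms(1)] by blast
  obtain C where C: "\<And>t. t \<in> {0..1} \<Longrightarrow> \<bar>y t\<bar> \<le> C" using D01_bounded[OF assms(2)] by blast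
  have "\<bar>x t - y (\<tau> t)\<bar> \<le> B + C" if "t \<in> {0..1}" for t
    using B[OF that] C[OF time_changes_mem[OF assms(3) that]] by linarith
  then have 1: "bdd_above ((\<lambda>t. \<bar>x t - y (\<tau> t)\<bar>) ` {0..1})"
    by (intro bdd_aboveI2[where M = "B + C"]) auto
  have "\<bar>\<tau> t - t\<bar> \<le> 1" if "t \<in> {0..1}" for t
    using time_changes_mem[OF assms(3) that] that by auto
  then have 2: "bdd_above ((\<lambda>t. \<bar>\<tau> t - t\<bar>) ` {0..1})"
    by (intro bdd_aboveI2[where M = 1]) auto
  show ?thesis
    using cSUP_le_iff[OF _ 1, of e] cSUP_le_iff[OF _ 2, of e] by (simp add: J1_cost_def)
qed

lemma J1_cost_nonneg:
  assumes "x \<in> D01" "y \<in> D01" "\<tau> \<in> time_changes"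
  shows "J1_cost x y \<tau> \<ge> 0"
  using J1_cost_le_iff[OF assms, of "J1_cost x y \<tau>"] by force

lemma J1_dist_le_cost:
  assumes "x \<in> D01" "y \<in> D01" "\<tau> \<in> time_changes"
  shows "J1_dist x y \<le> J1_cost x y \<tau>"
  using assms J1_cost_nonneg
  by (auto simp: J1_dist_def intro!: cINF_lower bdd_belowI2[where m = 0])

lemma J1_dist_less:
  assumes "x \<in> D01" "y \<in> D01" "J1_dist x y < e"
  obtains \<tau> where "\<tau> \<in> time_changes" "J1_cost x y \<tau> < e"
proof -
  have "bdd_below (J1_cost x y ` time_changes)"
    using assms J1_cost_nonneg by (intro bdd_belowI2[where m = 0]) auto
  then show ?thesis
    using assms that id_time_change cINF_less_iff[of time_changes "J1_cost x y" e]
    by (auto simp: J1_dist_def)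
qed

lemma J1_dist_commute_le:
  assumes "x \<in> D01" "y \<in> D01"
  shows "J1_dist y x \<le> J1_dist x y"
proof (rule field_le_epsilon)
  fix e :: real assume "e > 0"
  then have "J1_dist x y < J1_dist x y + e" by simp
  then obtain \<tau> where l: "\<tau> \<in> time_changes" "J1_cost x y \<tau> < J1_dist x y + e"
    using J1_dist_less[OF assms] by blast
  obtain \<mu> where m: "\<mu> \<in> time_changes" "\<And>t. t \<in> {0..1} \<Longrightarrow> \<tau> (\<mu> t) = t"
    using time_changes_inv[OF l(1)] by blast
  have "J1_cost y x \<mu> \<le> J1_cost x y \<tau>"
    unfolding J1_cost_le_iff[OF assms(2,1) m(1)]
  proof (intro conjI ballI)
    fix t :: real assume t: "t \<in> {0..1}"
    note * = J1_cost_le_iff[OF assms l(1), THEN iffD1, OF order_refl]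
    have "\<mu> t \<in> {0..1}" using time_changes_mem[OF m(1) t] .
    then show "\<bar>\<mu> t - t\<bar> \<le> J1_cost x y \<tau>" "\<bar>y t - x (\<mu> t)\<bar> \<le> J1_cost x y \<tau>"
      using * m(2)[OF t] by (metis abs_minus_commute)+
  qed
  then show "J1_dist y x \<le> J1_dist x y + e"
    using J1_dist_le_cost[OF assms(2,1) m(1)] l(2) by linarith
qed

lemma J1_dist_eq_0_imp:
  assumes x: "x \<in> D01" and y: "y \<in> D01" and "J1_dist x y = 0"
  shows "x = y"
proof (rule extensionalityI[of _ "{0..1}"])
  show "x \<in> extensional {0..1}" "y \<in> extensional {0..1}" using x y by (auto simp: D01_def)
  fix t :: real assume t: "t \<in> {0..1}"
  have ex: "\<exists>\<tau>\<in>time_changes. (\<forall>t\<in>{0..1}. \<bar>\<tau> t - t\<bar> \<le> e) \<and> (\<forall>t\<in>{0..1}. \<bar>x t - y (\<tau> t)\<bar> \<le> e)"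
    if "e > 0" for e
  proof -
    have "J1_dist x y < e" using assms(3) that by simp
    then obtain \<tau> where "\<tau> \<in> time_changes" "J1_cost x y \<tau> < e"
      by (rule J1_dist_less[OF x y])
    then show ?thesis
      using J1_cost_le_iff[OF x y, of \<tau> e] by force
  qed
  have "\<bar>x t - y t\<bar> \<le> 3 * e" if e: "e > 0" for e
  proof (cases "t = 0")
    case True
    obtain \<tau> where l: "\<tau> \<in> time_changes" "\<And>t. t \<in> {0..1} \<Longrightarrow> \<bar>x t - y (\<tau> t)\<bar> \<le> e"
      using ex[OF e] by blast
    have "0 \<in> \<tau> ` {0..1}" using l(1) by (simp add: time_changes_def)
    then obtain s where s: "s \<in> {0..1}" "\<tau> s = 0" by (metis imageE)
    have "s = 0"
    proof (rule ccontr)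
      assume "s \<noteq> 0"
      then have "\<tau> 0 < \<tau> s"
        using s l(1) strict_mono_onD[of "{0..1}" \<tau> 0 s] by (simp add: time_changes_def)
      then show False using s time_changes_mem[OF l(1), of 0] by auto
    qed
    then show ?thesis using l(2)[of 0] s True e by auto
  next
    case False
    then have "(x \<longlongrightarrow> x t) (at_left t)" "(y \<longlongrightarrow> y t) (at_left t)"
      using x y t by (auto simp: D01_def)
    then have "\<forall>\<^sub>F s in at_left t. dist (x s) (x t) < e \<and> dist (y s) (y t) < e"
      using e by (intro eventually_conj tendstoD)
    then obtain b where b: "b < t"
      "\<And>s. s > b \<Longrightarrow> s < t \<Longrightarrow> dist (x s) (x t) < e \<and> dist (y s) (y t) < e"
      by (auto simp: eventually_at_left_field)
    define a where "a = max b 0"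
    define s where "s = (a + t) / 2"
    have a: "a < t" "b \<le> a" "0 \<le> a" using b t False by (auto simp: a_def)
    then have s: "a < s" "s < t" by (auto simp: s_def)
    define h where "h = min e ((t - a) / 4)"
    have h: "h > 0" "h \<le> e" "h \<le> (t - a) / 4"
      unfolding h_def using e a by (simp_all only: min.cobounded1 min.cobounded2) simp
    obtain \<tau> where l: "\<tau> \<in> time_changes" "\<And>t. t \<in> {0..1} \<Longrightarrow> \<bar>\<tau> t - t\<bar> \<le> h"
      "\<And>t. t \<in> {0..1} \<Longrightarrow> \<bar>x t - y (\<tau> t)\<bar> \<le> h"
      using ex[OF h(1)] by blast
    have s01: "s \<in> {0..1}" using s a t by auto
    have "a < \<tau> s" "\<tau> s < t"
      using l(2)[OF s01] h(3) a(1) by (auto simp: s_def abs_le_iff field_simps)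
    then show ?thesis
      using b(2)[of s] b(2)[of "\<tau> s"] l(3)[OF s01] s a h(2)
      by (auto simp: dist_real_def)
  qed
  from this[of "\<bar>x t - y t\<bar> / 4"] show "x t = y t" by (cases "x t = y t") auto
qed

lemma Metric_space_J1: "Metric_space D01 J1_dist"
proof
  show "0 \<le> J1_dist x y" for x y
  proof (cases "x \<in> D01 \<and> y \<in> D01")
    case True
    then show ?thesis
      using J1_cost_nonneg id_time_change by (auto simp: J1_dist_def intro!: cINF_greatest)
  qed (auto simp: J1_dist_def)
  show "J1_dist x y = J1_dist y x" for x y
    using J1_dist_commute_le[of x y] J1_dist_commute_le[of y x]
    by (cases "x \<in> D01 \<and> y \<in> D01") (auto simp: J1_dist_def)
  show "J1_dist x y = 0 \<longleftrightarrow> x = y" if xy: "x \<in> D01" "y \<in> D01" for x y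
  proof
    assume "x = y"
    moreover have "J1_cost x x (\<lambda>t. t) \<le> 0"
      by (subst J1_cost_le_iff[OF xy(1) xy(1) id_time_change]) auto
    ultimately show "J1_dist x y = 0"
      using J1_dist_le_cost[OF xy(1) xy(1) id_time_change] \<open>0 \<le> J1_dist x y\<close> by simp
  qed (rule J1_dist_eq_0_imp[OF xy])
  show "J1_dist x z \<le> J1_dist x y + J1_dist y z"
    if xyz: "x \<in> D01" "y \<in> D01" "z \<in> D01" for x y z
  proof (rule field_le_epsilon)
    fix e :: real assume "e > 0"
    then have "J1_dist x y < J1_dist x y + e / 2" "J1_dist y z < J1_dist y z + e / 2" by simp_all
    then obtain \<tau> \<mu> where l: "\<tau> \<in> time_changes" "J1_cost x y \<tau> < J1_dist x y + e / 2"
      and m: "\<mu> \<in> time_changes" "J1_cost y z \<mu> < J1_dist y z + e / 2"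
      using J1_dist_less xyz by metis
    note c = time_changes_comp[OF l(1) m(1)]
    have "J1_cost x z (\<lambda>t. \<mu> (\<tau> t)) \<le> J1_cost x y \<tau> + J1_cost y z \<mu>"
      unfolding J1_cost_le_iff[OF xyz(1,3) c]
    proof (intro conjI ballI)
      fix t :: real assume t: "t \<in> {0..1}"
      note 1 = J1_cost_le_iff[OF xyz(1,2) l(1), THEN iffD1, OF order_refl]
      note 2 = J1_cost_le_iff[OF xyz(2,3) m(1), THEN iffD1, OF order_refl]
      have lt: "\<tau> t \<in> {0..1}" using time_changes_mem[OF l(1) t] .
      have "\<bar>\<tau> t - t\<bar> \<le> J1_cost x y \<tau>" "\<bar>\<mu> (\<tau> t) - \<tau> t\<bar> \<le> J1_cost y z \<mu>"
        using 1 2 t lt by blast+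
      then show "\<bar>\<mu> (\<tau> t) - t\<bar> \<le> J1_cost x y \<tau> + J1_cost y z \<mu>" by linarith
      have "\<bar>x t - y (\<tau> t)\<bar> \<le> J1_cost x y \<tau>" "\<bar>y (\<tau> t) - z (\<mu> (\<tau> t))\<bar> \<le> J1_cost y z \<mu>"
        using 1 2 t lt by blast+
      then show "\<bar>x t - z (\<mu> (\<tau> t))\<bar> \<le> J1_cost x y \<tau> + J1_cost y z \<mu>" by linarith
    qed
    then show "J1_dist x z \<le> J1_dist x y + J1_dist y z + e"
      using J1_dist_le_cost[OF xyz(1,3) c] l(2) m(2) by linarith
  qed
qed

text \<open>
  Processes are indexed by time first. Measurability with respect to the Borel
  sets of the Skorohod topology includes that the restricted paths lie in \<open>D01\<close>.
\<close>

definition path01 :: "(real \<Rightarrow> 'a \<Rightarrow> real) \<Rightarrow> 'a \<Rightarrow> real \<Rightarrow> real" where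
  "path01 Y \<omega> = (\<lambda>t\<in>{0..1}. Y t \<omega>)"

definition converges_weakly_D01 ::
  "'a measure \<Rightarrow> (nat \<Rightarrow> real \<Rightarrow> 'a \<Rightarrow> real) \<Rightarrow> 'b measure \<Rightarrow> (real \<Rightarrow> 'b \<Rightarrow> real) \<Rightarrow> bool"
where
  "converges_weakly_D01 M Y P K \<longleftrightarrow>
     (\<forall>N. path01 (Y N) \<in> measurable M J1_borel) \<and>
     path01 K \<in> measurable P J1_borel \<and>
     (\<forall>h. continuous_map J1_topology euclideanreal h \<and> bounded (h ` D01) \<longrightarrow>
        (\<lambda>N. \<integral>\<omega>. h (path01 (Y N) \<omega>) \<partial>M) \<longlonglongrightarrow> (\<integral>\<omega>. h (path01 K \<omega>) \<partial>P))"


section \<open>Gaussian processes\<close>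

text \<open>Point masses count as (degenerate) normal laws.\<close>

definition normal_law :: "real measure \<Rightarrow> bool" where
  "normal_law \<mu> \<longleftrightarrow>
     (\<exists>m. \<mu> = return borel m) \<or> (\<exists>m \<sigma>. \<sigma> > 0 \<and> \<mu> = density lborel (normal_density m \<sigma>))"

definition gaussian_process :: "'b measure \<Rightarrow> 't set \<Rightarrow> ('t \<Rightarrow> 'b \<Rightarrow> real) \<Rightarrow> bool" where
  "gaussian_process P T K \<longleftrightarrow>
     (\<forall>t\<in>T. K t \<in> borel_measurable P) \<and>
     (\<forall>I c. finite I \<and> I \<subseteq> T \<longrightarrow> normal_law (distr P borel (\<lambda>\<omega>. \<Sum>t\<in>I. c t * K t \<omega>)))"

definition covariance :: "'b measure \<Rightarrow> ('b \<Rightarrow> real) \<Rightarrow> ('b \<Rightarrow> real) \<Rightarrow> real" where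
  "covariance P Y Z =
     (\<integral>\<omega>. (Y \<omega> - (\<integral>\<omega>'. Y \<omega>' \<partial>P)) * (Z \<omega> - (\<integral>\<omega>'. Z \<omega>' \<partial>P)) \<partial>P)"


section \<open>Partial sums modulo one\<close>

definition partial_sum :: "(nat \<Rightarrow> 'a \<Rightarrow> real) \<Rightarrow> nat \<Rightarrow> 'a \<Rightarrow> real" where
  "partial_sum X k \<omega> = (\<Sum>j=1..k. X j \<omega>)"

definition psi :: "'a measure \<Rightarrow> (nat \<Rightarrow> 'a \<Rightarrow> real) \<Rightarrow> nat \<Rightarrow> real" where
  "psi M X k =
     (SUP t\<in>{0..1}. \<bar>measure M {\<omega> \<in> space M. frac (partial_sum X k \<omega>) \<le> t} - t\<bar>)"

definition empirical_df :: "(nat \<Rightarrow> 'a \<Rightarrow> real) \<Rightarrow> nat \<Rightarrow> real \<Rightarrow> 'a \<Rightarrow> real" where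
  "empirical_df X N t \<omega> =
     1 / real N * (\<Sum>k=1..N. indicator {0..<t} (frac (partial_sum X k \<omega>)))"

definition unif01 :: "real measure" where
  "unif01 = uniform_measure lborel {0..<1}"

text \<open>
  A uniform variable independent of the sequence is realised as the first coordinate of the
  product space \<open>unif01 \<Otimes>\<^sub>M M\<close>, so that \<open>M\<close> itself need not carry one.
\<close>

definition C_cov ::
  "'a measure \<Rightarrow> (nat \<Rightarrow> 'a \<Rightarrow> real) \<Rightarrow> (real \<Rightarrow> real) \<Rightarrow> (real \<Rightarrow> real) \<Rightarrow> real"
where
  "C_cov M X f g =
     (\<integral>u. f u * g u \<partial>unif01)
     + (\<Sum>k. \<integral>(u, \<omega>). f u * g (u + partial_sum X (Suc k) \<omega>) \<partial>(unif01 \<Otimes>\<^sub>M M))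
     + (\<Sum>k. \<integral>(u, \<omega>). g u * f (u + partial_sum X (Suc k) \<omega>) \<partial>(unif01 \<Otimes>\<^sub>M M))"

definition centered_indicator :: "real set \<Rightarrow> real \<Rightarrow> real" where
  "centered_indicator J x = indicator J (frac x) - measure lborel J"

definition Gamma_cov :: "'a measure \<Rightarrow> (nat \<Rightarrow> 'a \<Rightarrow> real) \<Rightarrow> real \<Rightarrow> real \<Rightarrow> real" where
  "Gamma_cov M X s t = C_cov M X (centered_indicator {0..<s}) (centered_indicator {0..<t})"

end

theory Submission
  imports Defs "HOL-Probability.Probability"
begin

text \<open>
  The positions \<open>S_k\<close> modulo one form a random walk on the circle, for which the uniform law is
  stationary. The hypothesis says that its transition operator \<open>Q k f x = E f (x + S_k)\<close> tends to
  the mean of \<open>f\<close> at a summable rate when \<open>f\<close> is the indicator of an initial arc, hence for every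
  step function and uniformly in \<open>x\<close> (\<open>mixing_step\<close>).

  \<^emph>\<open>Finite dimensional distributions.\<close> For a step function \<open>f\<close> of mean zero the series
  \<open>g = \<Sum>k. Q k f\<close> converges uniformly and solves \<open>g - Q 1 g = f\<close>. So the sum of the \<open>f (S_k)\<close> is, up
  to a bounded term, a sum of martingale differences (\<open>martingale_approximation\<close>). Their conditional
  variances are functions of the walk with stationary mean \<open>C(f, f)\<close>
  (\<open>integral_cond_var_poisson\<close>) and obey a law of large numbers (\<open>cond_var_lln\<close>), which gives the
  central limit theorem \<open>clt_step_fn\<close>. Linear combinations of centred indicators are step functions,
  so the values of the empirical process at finitely many times are jointly asymptotically normal
  with covariance \<open>\<Gamma>\<close> (\<open>emp_process_char\<close>). Nonnegativity of the conditional variance makes \<open>\<Gamma>\<close>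
  positive semidefinite, and \<open>C(f, f)\<close> is bounded by a multiple of the \<open>L\<^sup>1\<close> norm of \<open>f\<close>, which
  gives continuity of \<open>\<Gamma>\<close>.

  \<^emph>\<open>Tightness.\<close> Freedman's inequality for the martingale, together with an exponential bound for the
  sum of conditional variances, shows that increments over \<open>[s, t]\<close> have exponential tails on a scale
  slightly larger than \<open>sqrt (t - s)\<close> (\<open>exp_increment\<close>). High moments of the increments over dyadic
  intervals are then small enough for chaining, down to intervals of length about \<open>1 / sqrt N\<close>, and
  below that length monotonicity of the empirical distribution function suffices. So the process is
  uniformly close to its step function approximation on a fixed dyadic grid
  (\<open>emp_process_oscillation\<close>).

  \<^emph>\<open>The limit.\<close> A Cholesky decomposition of \<open>\<Gamma>\<close> on the dyadic rationals gives a Gaussian sequence,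
  and chaining extends it to a process with continuous paths (\<open>continuous_gaussian_process\<close>).

  \<^emph>\<open>Weak convergence.\<close> Continuous test functions on the Skorohod space can be replaced by Lipschitz
  ones (\<open>weak_limit_lipschitz_test\<close>), Lipschitz functions of paths by Lipschitz functions of
  finitely many coordinates, and these by trigonometric polynomials (\<open>finite_dim_limit\<close>).
  Measurability of the paths with respect to the Borel sets of the Skorohod topology is obtained by
  approximation with countably valued maps (\<open>measurable_J1_limit\<close>).
\<close>

section \<open>Periodic functions and step functions on the circle\<close>

definition periodic1 :: "(real \<Rightarrow> 'c) \<Rightarrow> bool" where
  "periodic1 f \<longleftrightarrow> (\<forall>x. f (x + 1) = f x)"

lemma periodic1_add_of_int:
  assumes "periodic1 f" shows "f (x + of_int n) = f x"
proof (induction n rule: int_induct[where k = 0])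
  case (step1 i)
  have "f (x + of_int (i + 1)) = f ((x + of_int i) + 1)" by (simp add: add.assoc)
  then show ?case using assms step1 by (simp add: periodic1_def)
next
  case (step2 i)
  have "f (x + of_int (i - 1)) = f ((x + of_int (i - 1)) + 1)"
    using assms[unfolded periodic1_def] by metis
  also have "(x + of_int (i - 1)) + 1 = x + of_int i" by simp
  finally show ?case using step2 by simp
qed simp

lemma frac_measurable [measurable]: "frac \<in> borel_measurable (borel :: real measure)"
  unfolding frac_def[abs_def] by measurable

lemma sets_unif01 [simp, measurable_cong]: "sets unif01 = sets borel"
  by (simp add: unif01_def)

lemma space_unif01 [simp]: "space unif01 = UNIV"
  by (simp add: unif01_def)

lemma prob_space_unif01: "prob_space unif01"
  unfolding unif01_def by (rule prob_space_uniform_measure) simp_all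

lemma integral_unif01:
  fixes f :: "real \<Rightarrow> 'b::{banach, second_countable_topology}"
  assumes [measurable]: "f \<in> borel_measurable borel"
  shows "(\<integral>u. f u \<partial>unif01) = (LINT u:{0..<1}|lborel. f u)"
proof -
  have "unif01 = density lborel (\<lambda>x. ennreal (indicator {0..<1} x))"
    unfolding unif01_def uniform_measure_def
    by (intro density_cong) (auto simp: indicator_def)
  then have "(\<integral>u. f u \<partial>unif01) = (\<integral>u. f u \<partial>density lborel (\<lambda>x. ennreal (indicator {0..<1} x)))"
    by simp
  then show ?thesis
    by (simp add: integral_density set_lebesgue_integral_def)
qed

lemma integrable_unif01:
  assumes "f \<in> borel_measurable borel" "\<And>x. norm (f x) \<le> B"
  shows "integrable unif01 (f :: real \<Rightarrow> 'b::{banach, second_countable_topology})"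
proof -
  interpret prob_space unif01 by (rule prob_space_unif01)
  show ?thesis using assms by (intro integrable_const_bound[of _ B]) (auto cong: measurable_cong_sets)
qed

text \<open>
  Lebesgue measure on the circle is rotation invariant: cut the shifted interval at \<open>1\<close>
  and move the part beyond \<open>1\<close> back by one period.
\<close>

lemma unif01_shift:
  fixes f :: "real \<Rightarrow> real"
  assumes [measurable]: "f \<in> borel_measurable borel" and per: "periodic1 f" and bd: "\<And>x. \<bar>f x\<bar> \<le> B"
  shows "(\<integral>u. f (u + a) \<partial>unif01) = (\<integral>u. f u \<partial>unif01)"
proof -
  define \<alpha> where "\<alpha> = frac a"
  have al: "0 \<le> \<alpha>" "\<alpha> < 1" by (auto simp: \<alpha>_def frac_lt_1)
  have fa: "f (u + a) = f (u + \<alpha>)" for u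
    using periodic1_add_of_int[OF per, of "u + \<alpha>" "\<lfloor>a\<rfloor>"] by (simp add: \<alpha>_def frac_def)
  have int: "set_integrable lborel {s..<t} f" for s t
    unfolding set_integrable_def
    by (rule integrableI_bounded_set_indicator[where B = B]) (use emeasure_bounded_finite[of "{s..<t}"] in \<open>auto simp: bd\<close>)
  have "(\<integral>u. f (u + a) \<partial>unif01) = (LINT u:{0..<1}|lborel. f (u + \<alpha>))"
    by (subst integral_unif01) (auto simp: fa)
  also have "\<dots> = (LINT u:{\<alpha>..<1+\<alpha>}|lborel. f u)"
    unfolding set_lebesgue_integral_def
    by (subst (2) lborel_integral_real_affine[of 1 _ \<alpha>])
       (auto intro!: Bochner_Integration.integral_cong simp: indicator_def add.commute)
  also have "{\<alpha>..<1+\<alpha>} = {\<alpha>..<1} \<union> {1..<1+\<alpha>}" using al by auto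
  also have "(LINT u:{\<alpha>..<1} \<union> {1..<1+\<alpha>}|lborel. f u) = (LINT u:{\<alpha>..<1}|lborel. f u) + (LINT u:{1..<1+\<alpha>}|lborel. f u)"
    by (rule set_integral_Un) (auto simp: int)
  also have "(LINT u:{1..<1+\<alpha>}|lborel. f u) = (LINT u:{0..<\<alpha>}|lborel. f u)"
    unfolding set_lebesgue_integral_def
    using per by (subst lborel_integral_real_affine[of 1 _ 1])
       (auto intro!: Bochner_Integration.integral_cong simp: indicator_def add.commute periodic1_def)
  also have "(LINT u:{\<alpha>..<1}|lborel. f u) + (LINT u:{0..<\<alpha>}|lborel. f u) = (LINT u:{0..<\<alpha>} \<union> {\<alpha>..<1}|lborel. f u)"
    by (subst set_integral_Un) (auto simp: int)
  also have "{0..<\<alpha>} \<union> {\<alpha>..<1} = {0..<1}" using al by auto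
  also have "(LINT u:{0..<1}|lborel. f u) = (\<integral>u. f u \<partial>unif01)"
    by (rule integral_unif01[symmetric]) simp
  finally show ?thesis .
qed

text \<open>
  Every step function on the circle is a combination of indicators of initial arcs \<open>[0, p)\<close>,
  and these are the sets whose probabilities \<open>psi\<close> controls. The index \<open>V\<close> is the total
  weight of such a representation; it bounds the sup norm and, up to a factor 3, the mixing constant.
\<close>

inductive step_fn :: "real \<Rightarrow> (real \<Rightarrow> real) \<Rightarrow> bool" where
  step_indicator: "0 \<le> p \<Longrightarrow> p \<le> 1 \<Longrightarrow> step_fn 1 (\<lambda>x. indicator {0..<p} (frac x))"
| step_add: "step_fn V f \<Longrightarrow> step_fn W g \<Longrightarrow> step_fn (V + W) (\<lambda>x. f x + g x)"
| step_scale: "step_fn V f \<Longrightarrow> step_fn (\<bar>c\<bar> * V) (\<lambda>x. c * f x)"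

lemma step_fn_nonneg: "step_fn V f \<Longrightarrow> 0 \<le> V"
  by (induction rule: step_fn.induct) auto

lemma step_fn_measurable: "step_fn V f \<Longrightarrow> f \<in> borel_measurable borel"
proof (induction rule: step_fn.induct)
  case (step_indicator p)
  show ?case by measurable
qed auto

lemma step_fn_periodic: "step_fn V f \<Longrightarrow> periodic1 f"
  by (induction rule: step_fn.induct) (auto simp: periodic1_def frac_1_eq)

lemma step_fn_bound: "step_fn V f \<Longrightarrow> \<bar>f x\<bar> \<le> V"
proof (induction rule: step_fn.induct)
  case (step_add V f W g) then show ?case by linarith
next
  case (step_scale V f c) then show ?case by (simp add: abs_mult mult_left_mono)
qed (auto simp: indicator_def)

lemma step_fn_const: "step_fn \<bar>c\<bar> (\<lambda>x. c)"
proof -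
  have "(\<lambda>x::real. c * indicator {0..<1} (frac x)) = (\<lambda>x. c)"
    by (auto simp: indicator_def frac_lt_1)
  then show ?thesis using step_scale[OF step_indicator[of 1], of c] by simp
qed

lemma step_fn_mult:
  assumes "step_fn V f" "step_fn W g"
  shows "step_fn (V * W) (\<lambda>x. f x * g x)"
  using assms
proof (induction arbitrary: W g rule: step_fn.induct)
  case (step_indicator p)
  from step_indicator(3) show ?case
  proof (induction rule: step_fn.induct)
    case (step_indicator q)
    have "(\<lambda>x::real. indicator {0..<p} (frac x) * indicator {0..<q} (frac x)) = (\<lambda>x. indicator {0..<min p q} (frac x) :: real)"
      by (auto simp: indicator_def)
    then show ?case using step_fn.step_indicator[of "min p q"] step_indicator \<open>0 \<le> p\<close> \<open>p \<le> 1\<close> by simp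
  next
    case (step_add V f W g)
    from step_fn.step_add[OF step_add.IH] show ?case by (simp add: algebra_simps)
  next
    case (step_scale V f c)
    from step_fn.step_scale[OF step_scale.IH, of c] show ?case by (simp add: algebra_simps)
  qed
next
  case (step_add V f V' f')
  from step_fn.step_add[OF step_add.IH[OF step_add.prems]] show ?case by (simp add: algebra_simps)
next
  case (step_scale V f c)
  from step_fn.step_scale[OF step_scale.IH[OF step_scale.prems], of c] show ?case by (simp add: algebra_simps)
qed

text \<open>
  An arc that wraps around \<open>0\<close> is a combination of three initial arcs, hence the factor 3.
\<close>

lemma step_fn_shift:
  assumes "step_fn V f" shows "step_fn (3 * V) (\<lambda>x. f (x + a))"
  using assms
proof (induction rule: step_fn.induct)
  case (step_indicator p)
  define \<alpha> where "\<alpha> = frac a"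
  have al: "0 \<le> \<alpha>" "\<alpha> < 1" by (auto simp: \<alpha>_def frac_lt_1)
  have ind: "indicator {0..<p} (frac (x + a)) = indicator {0..<max 0 (p - \<alpha>)} (frac x)
      + (indicator {0..<min 1 (1 + p - \<alpha>)} (frac x) + (-1) * indicator {0..<1 - \<alpha>} (frac x) :: real)" for x :: real
  proof -
    define r where "r = frac x"
    have r: "0 \<le> r" "r < 1" by (auto simp: r_def frac_lt_1)
    have "frac (x + a) = (if r + \<alpha> < 1 then r + \<alpha> else r + \<alpha> - 1)"
      by (simp add: frac_add r_def \<alpha>_def)
    then show ?thesis using al r step_indicator unfolding r_def[symmetric]
      by (auto simp: indicator_def)
  qed
  show ?case unfolding ind
    using step_add[OF step_fn.step_indicator[of "max 0 (p - \<alpha>)"] step_add[OF step_fn.step_indicator[of "min 1 (1 + p - \<alpha>)"]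
       step_scale[OF step_fn.step_indicator[of "1 - \<alpha>"], of "-1"]]] al step_indicator
    by simp
next
  case (step_add V f W g)
  from step_fn.step_add[OF step_add.IH] show ?case by (simp add: algebra_simps)
next
  case (step_scale V f c)
  from step_fn.step_scale[OF step_scale.IH, of c] show ?case by (simp add: algebra_simps)
qed

lemma integral_unif01_indicator:
  assumes "0 \<le> p" "p \<le> 1" shows "(\<integral>u. indicator {0..<p} (frac u) \<partial>unif01) = (p :: real)"
proof -
  have "(\<integral>u. indicator {0..<p} (frac u) \<partial>unif01) = (LINT u:{0..<1}|lborel. indicator {0..<p} (frac u) :: real)"
    by (rule integral_unif01) measurable
  also have "\<dots> = (\<integral>u. indicator {0..<p} u \<partial>lborel)"
    unfolding set_lebesgue_integral_def
    using assms by (intro Bochner_Integration.integral_cong) (auto simp: indicator_def frac_eq)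
  finally show ?thesis using assms by simp
qed

section \<open>Random walks and the Feynman--Kac formula\<close>

context prob_space begin

lemma bounded_integrable:
  assumes "f \<in> borel_measurable M" "\<And>x. x \<in> space M \<Longrightarrow> norm (f x) \<le> B"
  shows "integrable M (f :: 'a \<Rightarrow> 'b::{banach, second_countable_topology})"
  using assms by (intro integrable_const_bound[of _ B]) auto

lemma norm_expectation_le:
  fixes f :: "'a \<Rightarrow> 'b::{banach, second_countable_topology}"
  assumes "\<And>x. x \<in> space M \<Longrightarrow> norm (f x) \<le> B" and B: "0 \<le> B"
  shows "norm (\<integral>x. f x \<partial>M) \<le> B"
proof (cases "integrable M f")
  case True
  have "norm (\<integral>x. f x \<partial>M) \<le> (\<integral>x. norm (f x) \<partial>M)" by (rule integral_norm_bound)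
  also have "\<dots> \<le> (\<integral>x. B \<partial>M)" using True assms by (intro integral_mono) auto
  finally show ?thesis by (simp add: prob_space)
qed (simp add: not_integrable_integral_eq B)

end

lemma prob_fubini:
  fixes f :: "'a \<Rightarrow> 'b \<Rightarrow> 'c::{banach, second_countable_topology}"
  assumes "prob_space A" "prob_space B" and f: "case_prod f \<in> borel_measurable (A \<Otimes>\<^sub>M B)"
    and bd: "\<And>x y. x \<in> space A \<Longrightarrow> y \<in> space B \<Longrightarrow> norm (f x y) \<le> C"
  shows "(\<integral>y. (\<integral>x. f x y \<partial>A) \<partial>B) = (\<integral>x. (\<integral>y. f x y \<partial>B) \<partial>A)"
    and "(\<integral>p. f (fst p) (snd p) \<partial>(A \<Otimes>\<^sub>M B)) = (\<integral>x. (\<integral>y. f x y \<partial>B) \<partial>A)"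
proof -
  interpret A: prob_space A by fact
  interpret B: prob_space B by fact
  interpret AB: pair_prob_space A B ..
  have i: "integrable (A \<Otimes>\<^sub>M B) (case_prod f)"
    using bd by (intro AB.bounded_integrable[OF f, of C]) (auto simp: space_pair_measure)
  show "(\<integral>y. (\<integral>x. f x y \<partial>A) \<partial>B) = (\<integral>x. (\<integral>y. f x y \<partial>B) \<partial>A)"
    by (rule AB.Fubini_integral[OF i])
  show "(\<integral>p. f (fst p) (snd p) \<partial>(A \<Otimes>\<^sub>M B)) = (\<integral>x. (\<integral>y. f x y \<partial>B) \<partial>A)"
    using AB.integral_fst'[OF i] by (simp add: case_prod_beta')
qed

locale iid_walk = prob_space M for M :: "'a measure" +
  fixes X :: "nat \<Rightarrow> 'a \<Rightarrow> real"
  assumes indep: "indep_vars (\<lambda>_. borel) X {1..}"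
    and ident: "\<And>j. j \<ge> 1 \<Longrightarrow> distr M borel (X j) = distr M borel (X 1)"
begin

abbreviation S :: "nat \<Rightarrow> 'a \<Rightarrow> real" where "S \<equiv> partial_sum X"

definition step_law :: "real measure" where "step_law = distr M borel (X 1)"

lemma X_measurable [measurable]: "j \<ge> 1 \<Longrightarrow> X j \<in> borel_measurable M"
  using indep by (auto simp: indep_vars_def)

lemma S_measurable [measurable]: "S k \<in> borel_measurable M"
  unfolding partial_sum_def by (intro borel_measurable_sum) auto

lemma S_0 [simp]: "S 0 \<omega> = 0" by (simp add: partial_sum_def)

lemma S_Suc: "S (Suc k) \<omega> = S k \<omega> + X (Suc k) \<omega>" by (simp add: partial_sum_def)

lemma sets_step_law [simp, measurable_cong]: "sets step_law = sets borel"
  and space_step_law [simp]: "space step_law = UNIV"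
  by (simp_all add: step_law_def)

lemma prob_space_step_law: "prob_space step_law"
  unfolding step_law_def by (rule prob_space_distr) simp

definition past :: "nat \<Rightarrow> 'a \<Rightarrow> nat \<Rightarrow> real" where
  "past n \<omega> = (\<lambda>i\<in>{0<..n}. X i \<omega>)"

lemma past_measurable [measurable]: "past n \<in> measurable M (PiM {0<..n} (\<lambda>_. borel))"
  unfolding past_def by (rule measurable_restrict) auto

lemma past_joint:
  "distr M (PiM {0<..n} (\<lambda>_. borel) \<Otimes>\<^sub>M borel) (\<lambda>\<omega>. (past n \<omega>, X (Suc n) \<omega>)) =
   distr M (PiM {0<..n} (\<lambda>_. borel)) (past n) \<Otimes>\<^sub>M step_law"
proof -
  let ?P = "PiM {0<..n} (\<lambda>_. borel) :: (nat \<Rightarrow> real) measure"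
  let ?R = "PiM {Suc n} (\<lambda>_. borel) :: (nat \<Rightarrow> real) measure"
  let ?D = "distr M ?R (\<lambda>\<omega>. \<lambda>i\<in>{Suc n}. X i \<omega>)"
  have "indep_var (PiM {0<..n} (\<lambda>_. borel)) (\<lambda>\<omega>. restrict (\<lambda>i. X i \<omega>) {0<..n})
          (PiM {Suc n} (\<lambda>_. borel)) (\<lambda>\<omega>. restrict (\<lambda>i. X i \<omega>) {Suc n})"
    by (rule indep_var_restrict[OF indep]) auto
  then have joint: "distr M ?P (past n) \<Otimes>\<^sub>M ?D = distr M (?P \<Otimes>\<^sub>M ?R) (\<lambda>\<omega>. (past n \<omega>, \<lambda>i\<in>{Suc n}. X i \<omega>))"
    by (simp add: indep_var_distribution_eq past_def[abs_def])
  have [measurable]: "(\<lambda>\<omega>. \<lambda>i\<in>{Suc n}. X i \<omega>) \<in> measurable M ?R"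
    by (rule measurable_restrict) auto
  have [measurable]: "(\<lambda>q. q (Suc n)) \<in> measurable ?R borel"
    by (rule measurable_component_singleton) simp
  have D: "distr ?D borel (\<lambda>q. q (Suc n)) = step_law"
    using ident[of "Suc n"] by (simp add: distr_distr comp_def step_law_def)
  interpret L: prob_space step_law by (rule prob_space_step_law)
  have "distr M ?P (past n) \<Otimes>\<^sub>M step_law = distr (distr M ?P (past n)) ?P (\<lambda>p. p) \<Otimes>\<^sub>M distr ?D borel (\<lambda>q. q (Suc n))"
    by (simp add: D distr_distr comp_def)
  also have "\<dots> = distr (distr M ?P (past n) \<Otimes>\<^sub>M ?D) (?P \<Otimes>\<^sub>M borel) (\<lambda>(p, q). (p, q (Suc n)))"
    by (rule pair_measure_distr) (simp_all add: D L.sigma_finite_measure_axioms)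
  also have "\<dots> = distr M (?P \<Otimes>\<^sub>M borel) (\<lambda>\<omega>. (past n \<omega>, X (Suc n) \<omega>))"
    unfolding joint by (subst distr_distr) (simp_all add: comp_def)
  finally show ?thesis by simp
qed

text \<open>
  The type of \<open>W\<close> is left general because complex exponentials are used for the central limit
  theorem and real ones for tail bounds.
\<close>

definition adapted :: "nat \<Rightarrow> ('a \<Rightarrow> 'b::topological_space) \<Rightarrow> bool" where
  "adapted n W \<longleftrightarrow> (\<exists>w\<in>borel_measurable (PiM {0<..n} (\<lambda>_. borel)). W = (\<lambda>\<omega>. w (past n \<omega>)))"

lemma adapted_S: "k \<le> n \<Longrightarrow> adapted n (S k)"
  unfolding adapted_def
proof (intro bexI ext)
  assume "k \<le> n"
  then show "S k \<omega> = (\<Sum>i=1..k. past n \<omega> i)" for \<omega>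
    by (auto simp: partial_sum_def past_def intro!: sum.cong)
  show "(\<lambda>p. \<Sum>i=1..k. p i :: real) \<in> borel_measurable (PiM {0<..n} (\<lambda>_. borel))"
  proof (rule borel_measurable_sum)
    fix i assume "i \<in> {1..k}"
    then show "(\<lambda>p. p i :: real) \<in> borel_measurable (PiM {0<..n} (\<lambda>_. borel))"
      using \<open>k \<le> n\<close> by (intro measurable_component_singleton) auto
  qed
qed

lemma adapted_compose2:
  fixes H :: "real \<Rightarrow> real \<Rightarrow> 'b::topological_space"
  assumes "adapted n U" "adapted n V" and H: "case_prod H \<in> borel_measurable (borel \<Otimes>\<^sub>M borel)"
  shows "adapted n (\<lambda>\<omega>. H (U \<omega>) (V \<omega>))"
proof -
  obtain u v where u [measurable]: "u \<in> borel_measurable (PiM {0<..n} (\<lambda>_. borel))" "U = (\<lambda>\<omega>. u (past n \<omega>))"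
    and v [measurable]: "v \<in> borel_measurable (PiM {0<..n} (\<lambda>_. borel))" "V = (\<lambda>\<omega>. v (past n \<omega>))"
    using assms by (auto simp: adapted_def)
  have "(\<lambda>p. case_prod H (u p, v p)) \<in> borel_measurable (PiM {0<..n} (\<lambda>_. borel))"
    by (rule measurable_compose[OF _ H]) measurable
  then show ?thesis unfolding adapted_def u v by (intro bexI[of _ "\<lambda>p. H (u p) (v p)"]) auto
qed

lemma adapted_prod:
  fixes f :: "'i \<Rightarrow> 'a \<Rightarrow> 'b::{real_normed_field, second_countable_topology}"
  assumes "\<And>i. i \<in> I \<Longrightarrow> adapted n (f i)"
  shows "adapted n (\<lambda>\<omega>. \<Prod>i\<in>I. f i \<omega>)"
proof -
  obtain w where w: "\<And>i. i \<in> I \<Longrightarrow> w i \<in> borel_measurable (PiM {0<..n} (\<lambda>_. borel))"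
     "\<And>i. i \<in> I \<Longrightarrow> f i = (\<lambda>\<omega>. w i (past n \<omega>))"
    using assms unfolding adapted_def by metis
  show ?thesis unfolding adapted_def
    using w by (intro bexI[of _ "\<lambda>p. \<Prod>i\<in>I. w i p"]) (auto intro!: borel_measurable_prod)
qed

text \<open>
  The Markov property in integrated form: given the past, the next position is the present one
  plus an independent step.
\<close>

lemma markov_step:
  fixes W :: "'a \<Rightarrow> 'b::{banach, real_normed_field, second_countable_topology}"
  assumes "adapted n W" and W: "\<And>\<omega>. norm (W \<omega>) \<le> B"
    and H [measurable]: "case_prod H \<in> borel_measurable (borel \<Otimes>\<^sub>M borel)" and HB: "\<And>x y. norm (H x y) \<le> C"
  shows "(\<integral>\<omega>. W \<omega> * H (S n \<omega>) (S (Suc n) \<omega>) \<partial>M) =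
         (\<integral>\<omega>. W \<omega> * (\<integral>y. H (S n \<omega>) (S n \<omega> + y) \<partial>step_law) \<partial>M)"
proof -
  let ?P = "PiM {0<..n} (\<lambda>_. borel) :: (nat \<Rightarrow> real) measure"
  let ?D = "distr M ?P (past n)"
  obtain w where w [measurable]: "w \<in> borel_measurable ?P" "W = (\<lambda>\<omega>. w (past n \<omega>))"
    using assms(1) by (auto simp: adapted_def)
  obtain s where s [measurable]: "s \<in> borel_measurable ?P" "S n = (\<lambda>\<omega>. s (past n \<omega>))"
    using adapted_S[of n n] by (auto simp: adapted_def)
  interpret D: prob_space ?D by (rule prob_space_distr) simp
  interpret L: prob_space step_law by (rule prob_space_step_law)
  have C: "0 \<le> C" using HB[of 0 0] norm_ge_zero order_trans by blast
  have B: "0 \<le> B" using W[of undefined] norm_ge_zero order_trans by blast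
  (* The bound on w is known only on the range of the past; w' is bounded everywhere, as Fubini's
     theorem requires. *)
  define w' where "w' p = (if norm (w p) \<le> B then w p else 0)" for p
  have w'_meas [measurable]: "w' \<in> borel_measurable ?P" unfolding w'_def[abs_def] by measurable
  have w': "w (past n \<omega>) = w' (past n \<omega>)" for \<omega> using W[of \<omega>] by (simp add: w'_def w(2))
  have w'B: "norm (w' p) \<le> B" for p using B by (simp add: w'_def)
  have *: "(\<lambda>z. w' (fst z) * H (s (fst z)) (s (fst z) + snd z)) \<in> borel_measurable (?P \<Otimes>\<^sub>M borel)"
  proof -
    have "(\<lambda>z. case_prod H (s (fst z), s (fst z) + snd z)) \<in> borel_measurable (?P \<Otimes>\<^sub>M borel)"
      by (rule measurable_compose[OF _ H]) measurable
    then have [measurable]: "(\<lambda>z. H (s (fst z)) (s (fst z) + snd z)) \<in> borel_measurable (?P \<Otimes>\<^sub>M borel)" by simp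
    show ?thesis by measurable
  qed
  have "(\<integral>\<omega>. W \<omega> * H (S n \<omega>) (S (Suc n) \<omega>) \<partial>M) =
     (\<integral>\<omega>. (\<lambda>z. w' (fst z) * H (s (fst z)) (s (fst z) + snd z)) (past n \<omega>, X (Suc n) \<omega>) \<partial>M)"
    by (simp add: S_Suc s(2) w(2) w')
  also have "\<dots> = (\<integral>z. w' (fst z) * H (s (fst z)) (s (fst z) + snd z)
      \<partial>distr M (?P \<Otimes>\<^sub>M borel) (\<lambda>\<omega>. (past n \<omega>, X (Suc n) \<omega>)))"
    by (rule integral_distr[symmetric, OF _ *]) measurable
  also have "\<dots> = (\<integral>p. (\<integral>y. w' p * H (s p) (s p + y) \<partial>step_law) \<partial>?D)"
    unfolding past_joint
  proof (rule prob_fubini(2)[OF D.prob_space_axioms L.prob_space_axioms, of "\<lambda>p y. w' p * H (s p) (s p + y)"])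
    show "(\<lambda>(p, y). w' p * H (s p) (s p + y)) \<in> borel_measurable (?D \<Otimes>\<^sub>M step_law)"
      using * by (simp add: case_prod_beta' cong: measurable_cong_sets)
    show "norm (w' p * H (s p) (s p + y)) \<le> B * C" for p y
      using w'B[of p] HB[of "s p" "s p + y"] B by (simp add: norm_mult mult_mono)
  qed
  also have "\<dots> = (\<integral>\<omega>. (\<integral>y. w' (past n \<omega>) * H (s (past n \<omega>)) (s (past n \<omega>) + y) \<partial>step_law) \<partial>M)"
  proof (rule integral_distr)
    have "(\<lambda>(p, y). w' p * H (s p) (s p + y)) \<in> borel_measurable (?P \<Otimes>\<^sub>M step_law)"
      using * by (simp add: case_prod_beta' cong: measurable_cong_sets)
    from L.borel_measurable_lebesgue_integral[OF this]
    show "(\<lambda>p. \<integral>y. w' p * H (s p) (s p + y) \<partial>step_law) \<in> borel_measurable ?P" .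
  qed simp
  finally show ?thesis by (simp add: s(2) w(2) w')
qed

text \<open>
  The transition operator twisted by a multiplicative weight \<open>G\<close> on the jump from \<open>x\<close> to
  \<open>x + y\<close>.
\<close>

definition feynman :: "(real \<Rightarrow> real \<Rightarrow> 'b) \<Rightarrow> (real \<Rightarrow> 'b) \<Rightarrow> real \<Rightarrow> 'b::{banach, real_normed_field, second_countable_topology}" where
  "feynman G \<phi> x = (\<integral>y. G x (x + y) * \<phi> (x + y) \<partial>step_law)"

lemma feynman_measurable:
  assumes [measurable]: "case_prod G \<in> borel_measurable (borel \<Otimes>\<^sub>M borel)" "\<phi> \<in> borel_measurable borel"
  shows "feynman G \<phi> \<in> borel_measurable borel"
proof -
  interpret L: prob_space step_law by (rule prob_space_step_law)
  have "(\<lambda>z. case_prod G (fst z, fst z + snd z)) \<in> borel_measurable (borel \<Otimes>\<^sub>M borel)"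
    by (rule measurable_compose[OF _ assms(1)]) measurable
  then have [measurable]: "(\<lambda>z. G (fst z) (fst z + snd z)) \<in> borel_measurable (borel \<Otimes>\<^sub>M borel)" by simp
  have "(\<lambda>(x, y). G x (x + y) * \<phi> (x + y)) \<in> borel_measurable (borel \<Otimes>\<^sub>M step_law)"
    by (simp add: case_prod_beta' cong: measurable_cong_sets)
  from L.borel_measurable_lebesgue_integral[OF this] show ?thesis
    by (simp add: feynman_def[abs_def])
qed

lemma feynman_bound:
  assumes "\<And>x y. norm (G x y) \<le> C" "\<And>x. norm (\<phi> x) \<le> B"
  shows "norm (feynman G \<phi> x) \<le> C * B"
proof -
  interpret L: prob_space step_law by (rule prob_space_step_law)
  have "0 \<le> C" "0 \<le> B" using assms(1)[of 0 0] assms(2)[of 0] norm_ge_zero order_trans by blast+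
  then show ?thesis unfolding feynman_def
    by (intro L.norm_expectation_le) (auto simp: norm_mult assms intro!: mult_mono)
qed

text \<open>
  Expectations of products along the path are iterates of the twisted operator. This replaces
  conditional expectations and the theory of martingales: a pointwise bound on one application of
  the operator gives a bound on the expectation of the whole product.
\<close>

lemma feynman_kac:
  assumes G: "case_prod G \<in> borel_measurable (borel \<Otimes>\<^sub>M borel)" and GC: "\<And>x y. norm (G x y) \<le> C"
    and "\<phi> \<in> borel_measurable borel" "\<And>x. norm (\<phi> x) \<le> B"
  shows "(\<integral>\<omega>. (\<Prod>k<N. G (S k \<omega>) (S (Suc k) \<omega>)) * \<phi> (S N \<omega>) \<partial>M) = (feynman G ^^ N) \<phi> 0"
  using assms(3,4)
proof (induction N arbitrary: \<phi> B)
  case 0 then show ?case by (simp add: prob_space)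
next
  case (Suc N)
  have [measurable]: "\<phi> \<in> borel_measurable borel" "case_prod G \<in> borel_measurable (borel \<Otimes>\<^sub>M borel)" by fact+
  have C: "0 \<le> C" "0 \<le> B" using GC[of 0 0] Suc.prems(2)[of 0] norm_ge_zero order_trans by blast+
  have "(\<integral>\<omega>. (\<Prod>k<Suc N. G (S k \<omega>) (S (Suc k) \<omega>)) * \<phi> (S (Suc N) \<omega>) \<partial>M) =
     (\<integral>\<omega>. (\<Prod>k<N. G (S k \<omega>) (S (Suc k) \<omega>)) * (\<lambda>x y. G x y * \<phi> y) (S N \<omega>) (S (Suc N) \<omega>) \<partial>M)"
    by (simp add: mult.assoc)
  also have "\<dots> = (\<integral>\<omega>. (\<Prod>k<N. G (S k \<omega>) (S (Suc k) \<omega>)) * (\<integral>y. G (S N \<omega>) (S N \<omega> + y) * \<phi> (S N \<omega> + y) \<partial>step_law) \<partial>M)"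
  proof (rule markov_step)
    show "adapted N (\<lambda>\<omega>. \<Prod>k<N. G (S k \<omega>) (S (Suc k) \<omega>))"
      by (intro adapted_prod adapted_compose2[OF _ _ G] adapted_S) auto
    show "norm (\<Prod>k<N. G (S k \<omega>) (S (Suc k) \<omega>)) \<le> C ^ N" for \<omega>
      using prod_mono[of "{..<N}" "\<lambda>k. norm (G (S k \<omega>) (S (Suc k) \<omega>))" "\<lambda>_. C"] GC by (simp add: prod_norm[symmetric])
    show "norm (G x y * \<phi> y) \<le> C * B" for x y
      using GC[of x y] Suc.prems(2)[of y] C by (simp add: norm_mult mult_mono)
    show "(\<lambda>(x, y). G x y * \<phi> y) \<in> borel_measurable (borel \<Otimes>\<^sub>M borel)"
    proof -
      have "(\<lambda>z. case_prod G z * \<phi> (snd z)) \<in> borel_measurable (borel \<Otimes>\<^sub>M borel)" by measurable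
      then show ?thesis by (simp add: case_prod_beta')
    qed
  qed
  also have "\<dots> = (\<integral>\<omega>. (\<Prod>k<N. G (S k \<omega>) (S (Suc k) \<omega>)) * feynman G \<phi> (S N \<omega>) \<partial>M)"
    by (simp add: feynman_def)
  also have "\<dots> = (feynman G ^^ N) (feynman G \<phi>) 0"
    by (rule Suc.IH[OF feynman_measurable[OF G Suc.prems(1)] feynman_bound[OF GC Suc.prems(2)]])
  finally show ?case by (simp add: funpow_swap1)
qed

text \<open>
  The transition operator of the walk after \<open>k\<close> steps.
\<close>

definition Q :: "nat \<Rightarrow> (real \<Rightarrow> real) \<Rightarrow> real \<Rightarrow> real" where
  "Q k f x = (\<integral>\<omega>. f (x + S k \<omega>) \<partial>M)"

lemma Q_0 [simp]: "Q 0 f = f" by (rule ext) (simp add: Q_def prob_space)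

lemma Q_measurable [measurable]:
  assumes [measurable]: "f \<in> borel_measurable borel" shows "Q k f \<in> borel_measurable borel"
  unfolding Q_def[abs_def] by measurable

lemma Q_1: "f \<in> borel_measurable borel \<Longrightarrow> Q (Suc 0) f x = (\<integral>y. f (x + y) \<partial>step_law)"
  by (simp add: Q_def step_law_def integral_distr S_Suc)

lemma Q_periodic: "periodic1 f \<Longrightarrow> periodic1 (Q k f)"
proof -
  assume f: "periodic1 f"
  have "f (x + 1 + s) = f (x + s)" for x s
    using f[unfolded periodic1_def, rule_format, of "x + s"] by (simp add: add_ac)
  then show ?thesis by (simp add: periodic1_def Q_def)
qed

lemma Q_bound: "(\<And>x. \<bar>f x\<bar> \<le> B) \<Longrightarrow> \<bar>Q k f x\<bar> \<le> B"
  using norm_expectation_le[of "\<lambda>\<omega>. f (x + S k \<omega>)" B] abs_ge_zero[of "f 0"] unfolding Q_def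
  by (metis order_trans real_norm_def)

lemma Q_integrable:
  fixes f :: "real \<Rightarrow> real"
  assumes [measurable]: "f \<in> borel_measurable borel" and "\<And>x. \<bar>f x\<bar> \<le> B"
  shows "integrable M (\<lambda>\<omega>. f (x + S k \<omega>))"
  using assms by (intro bounded_integrable[of _ B]) auto

lemma Q_add:
  assumes "f \<in> borel_measurable borel" "\<And>x. \<bar>f x\<bar> \<le> B" "g \<in> borel_measurable borel" "\<And>x. \<bar>g x\<bar> \<le> C"
  shows "Q k (\<lambda>x. f x + g x) x = Q k f x + Q k g x"
  unfolding Q_def using assms by (intro Bochner_Integration.integral_add Q_integrable) auto

lemma Q_scale: "Q k (\<lambda>x. c * f x) x = c * Q k f x"
  by (simp add: Q_def)

lemma Q_Suc:
  assumes [measurable]: "f \<in> borel_measurable borel" and bd: "\<And>x. \<bar>f x\<bar> \<le> B"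
  shows "Q (Suc k) f = Q k (Q (Suc 0) f)"
proof
  fix x
  have "(\<integral>\<omega>. 1 * (\<lambda>a b. f (x + b)) (S k \<omega>) (S (Suc k) \<omega>) \<partial>M) =
        (\<integral>\<omega>. 1 * (\<integral>y. f (x + (S k \<omega> + y)) \<partial>step_law) \<partial>M)"
    by (rule markov_step[where B = 1 and C = B]) (use bd in \<open>auto simp: adapted_def case_prod_beta' intro!: bexI[of _ "\<lambda>_. 1"]\<close>)
  then show "Q (Suc k) f x = Q k (Q (Suc 0) f) x"
    by (simp add: Q_def[of k] Q_def[of "Suc k"] Q_1[OF assms(1)] add.assoc)
qed

lemma Q_commute:
  assumes "f \<in> borel_measurable borel" and "\<And>x. \<bar>f x\<bar> \<le> B"
  shows "Q (Suc 0) (Q k f) = Q (Suc k) f"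
  using assms
proof (induction k arbitrary: f)
  case (Suc k)
  have "Q (Suc 0) (Q (Suc k) f) = Q (Suc 0) (Q k (Q (Suc 0) f))"
    by (simp only: Q_Suc[OF Suc.prems, of k])
  also have "\<dots> = Q (Suc k) (Q (Suc 0) f)"
    by (rule Suc.IH[OF Q_measurable[OF Suc.prems(1)] Q_bound[OF Suc.prems(2)]])
  also have "\<dots> = Q (Suc (Suc k)) f" by (rule Q_Suc[OF Suc.prems, symmetric])
  finally show ?case .
qed simp

lemma integral_Q_unif01:
  assumes [measurable]: "f \<in> borel_measurable borel" and "periodic1 f" "\<And>x. \<bar>f x\<bar> \<le> B"
  shows "(\<integral>u. Q k f u \<partial>unif01) = (\<integral>u. f u \<partial>unif01)"
proof -
  have "(\<integral>u. Q k f u \<partial>unif01) = (\<integral>\<omega>. (\<integral>u. f (u + S k \<omega>) \<partial>unif01) \<partial>M)"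
    unfolding Q_def
    by (rule prob_fubini(1)[OF prob_space_axioms prob_space_unif01, of "\<lambda>\<omega> u. f (u + S k \<omega>)" B])
       (use assms in \<open>auto simp: case_prod_beta'\<close>)
  then show ?thesis using unif01_shift[OF assms] by (simp add: prob_space)
qed

end

section \<open>Mixing of the walk modulo one\<close>

text \<open>
  The sequence \<open>\<rho>\<close> dominates \<open>psi\<close>; the value \<open>\<rho> 0 \<ge> 2\<close> lets the mixing estimate hold at time
  \<open>0\<close>, where a bounded function can differ from its mean by twice its bound.
\<close>

locale mixing_walk = iid_walk +
  fixes \<rho> :: "nat \<Rightarrow> real" and d :: real
  assumes rho_nonneg: "\<And>k. 0 \<le> \<rho> k" and rho_0: "2 \<le> \<rho> 0"
    and psi_le_rho: "\<And>k. 1 \<le> k \<Longrightarrow> psi M X k \<le> \<rho> k"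
    and d_pos: "0 < d" and d_le_1: "d \<le> 1"
    and rho_summable: "summable (\<lambda>k. \<rho> k * (real k + 1) powr d)"
begin

lemma psi_bound:
  assumes "1 \<le> k" "t \<in> {0..1}"
  shows "\<bar>measure M {\<omega> \<in> space M. frac (S k \<omega>) \<le> t} - t\<bar> \<le> \<rho> k"
proof -
  have "\<bar>measure M {\<omega> \<in> space M. frac (S k \<omega>) \<le> t} - t\<bar> \<le> psi M X k"
    unfolding psi_def
  proof (rule cSUP_upper[OF assms(2)])
    have "\<bar>measure M {\<omega> \<in> space M. frac (S k \<omega>) \<le> t} - t\<bar> \<le> 1" if "t \<in> {0..1}" for t
      using that prob_le_1[of "{\<omega> \<in> space M. frac (S k \<omega>) \<le> t}"] measure_nonneg[of M "{\<omega> \<in> space M. frac (S k \<omega>) \<le> t}"]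
      by (simp add: abs_le_iff algebra_simps add_increasing2 add_increasing)
    then show "bdd_above ((\<lambda>t. \<bar>measure M {\<omega> \<in> space M. frac (S k \<omega>) \<le> t} - t\<bar>) ` {0..1})"
      by (intro bdd_aboveI2[of _ _ 1]) auto
  qed
  then show ?thesis using psi_le_rho[OF assms(1)] by simp
qed

text \<open>
  The bound for closed arcs \<open>[0, t]\<close> passes to \<open>[0, p)\<close> as \<open>t\<close> increases to \<open>p\<close>.
\<close>

lemma psi_bound_strict:
  assumes k: "1 \<le> k" and p: "0 \<le> p" "p \<le> 1"
  shows "\<bar>measure M {\<omega> \<in> space M. frac (S k \<omega>) < p} - p\<bar> \<le> \<rho> k"
proof (cases "p = 0")
  case True
  have "{\<omega> \<in> space M. frac (S k \<omega>) < p} = {}"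
    using True by (auto simp: not_less)
  then have "measure M {\<omega> \<in> space M. frac (S k \<omega>) < p} = 0" by (simp only: measure_empty)
  then show ?thesis using True rho_nonneg[of k] by simp
next
  case False
  have up: "measure M {\<omega> \<in> space M. frac (S k \<omega>) < p} \<le> measure M {\<omega> \<in> space M. frac (S k \<omega>) \<le> p}"
    by (rule finite_measure_mono) auto
  have "p - \<rho> k \<le> measure M {\<omega> \<in> space M. frac (S k \<omega>) < p} + e" if e: "e > 0" for e
  proof -
    define t where "t = max 0 (p - e)"
    have t: "t \<in> {0..1}" "t < p" "p - e \<le> t" using p False e by (auto simp: t_def)
    have "measure M {\<omega> \<in> space M. frac (S k \<omega>) \<le> t} \<le> measure M {\<omega> \<in> space M. frac (S k \<omega>) < p}"
      by (rule finite_measure_mono) (use t in auto)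
    then show ?thesis using psi_bound[OF k t(1)] t(3) by linarith
  qed
  then have "p - \<rho> k \<le> measure M {\<omega> \<in> space M. frac (S k \<omega>) < p}" by (rule field_le_epsilon)
  then show ?thesis using up psi_bound[OF k, of p] p by (simp add: abs_le_iff)
qed

lemma step_estimate:
  assumes "step_fn V f" shows "\<bar>Q k f 0 - (\<integral>u. f u \<partial>unif01)\<bar> \<le> V * \<rho> k"
proof (cases "k = 0")
  case True
  interpret U: prob_space unif01 by (rule prob_space_unif01)
  have "\<bar>\<integral>u. f u \<partial>unif01\<bar> \<le> V"
    using U.norm_expectation_le[of f V] step_fn_bound[OF assms] step_fn_nonneg[OF assms] by simp
  then have "\<bar>Q k f 0 - (\<integral>u. f u \<partial>unif01)\<bar> \<le> V * 2"
    using step_fn_bound[OF assms, of 0] True by simp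
  also have "\<dots> \<le> V * \<rho> k" using rho_0 True step_fn_nonneg[OF assms] by (intro mult_left_mono) auto
  finally show ?thesis .
next
  case False
  then have k: "1 \<le> k" by simp
  from assms show ?thesis
  proof (induction rule: step_fn.induct)
    case (step_indicator p)
    have "Q k (\<lambda>x. indicator {0..<p} (frac x)) 0 = (\<integral>\<omega>. indicator {\<omega> \<in> space M. frac (S k \<omega>) < p} \<omega> \<partial>M)"
      unfolding Q_def by (intro Bochner_Integration.integral_cong) (auto simp: indicator_def)
    also have "\<dots> = measure M {\<omega> \<in> space M. frac (S k \<omega>) < p}" by simp
    finally show ?case
      using psi_bound_strict[OF k step_indicator] by (simp add: integral_unif01_indicator step_indicator)
  next
    case (step_add V f W g)
    note f = step_fn_measurable[OF step_add.hyps(1)] step_fn_bound[OF step_add.hyps(1)]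
    note g = step_fn_measurable[OF step_add.hyps(2)] step_fn_bound[OF step_add.hyps(2)]
    have "(\<integral>u. f u + g u \<partial>unif01) = (\<integral>u. f u \<partial>unif01) + (\<integral>u. g u \<partial>unif01)"
      using f g by (intro Bochner_Integration.integral_add integrable_unif01) auto
    then show ?case using step_add.IH Q_add[OF f g, of k 0] by (simp add: distrib_right)
  next
    case (step_scale V f c)
    have "\<bar>c * Q k f 0 - c * (\<integral>u. f u \<partial>unif01)\<bar> = \<bar>c\<bar> * \<bar>Q k f 0 - (\<integral>u. f u \<partial>unif01)\<bar>"
      by (simp add: abs_mult flip: right_diff_distrib)
    then show ?case using step_scale.IH by (simp add: Q_scale mult.assoc mult_left_mono)
  qed
qed

text \<open>
  Convergence of \<open>Q k f\<close> to the mean of \<open>f\<close>, uniformly in the starting point and with the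
  rate \<open>\<rho>\<close>. One constant bounds the function and the rate, so that the class is stable under
  sums, averages over a parameter, shifts and \<open>Q\<close>.
\<close>

definition mixing :: "real \<Rightarrow> (real \<Rightarrow> real) \<Rightarrow> bool" where
  "mixing B f \<longleftrightarrow> f \<in> borel_measurable borel \<and> periodic1 f \<and> (\<forall>x. \<bar>f x\<bar> \<le> B) \<and>
     (\<forall>k x. \<bar>Q k f x - (\<integral>u. f u \<partial>unif01)\<bar> \<le> B * \<rho> k)"

lemma mixingD:
  assumes "mixing B f"
  shows "f \<in> borel_measurable borel" "periodic1 f" "\<bar>f x\<bar> \<le> B" "0 \<le> B"
    "\<bar>Q k f x - (\<integral>u. f u \<partial>unif01)\<bar> \<le> B * \<rho> k"
  using assms abs_ge_zero[of "f 0"] order_trans unfolding mixing_def by blast+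

text \<open>
  The hypothesis on \<open>psi\<close> concerns the walk started at \<open>0\<close>. Starting it at \<open>x\<close> amounts to
  shifting \<open>f\<close>, and the shift of a step function is again a step function.
\<close>

lemma mixing_step:
  assumes "step_fn V f" shows "mixing (3 * V) f"
  unfolding mixing_def
proof (intro conjI allI)
  show "f \<in> borel_measurable borel" "periodic1 f" using step_fn_measurable step_fn_periodic assms by auto
  show "\<bar>f x\<bar> \<le> 3 * V" for x using step_fn_bound[OF assms, of x] step_fn_nonneg[OF assms] by linarith
  fix k x
  have "Q k f x = Q k (\<lambda>y. f (y + x)) 0" by (simp add: Q_def add.commute)
  moreover have "(\<integral>u. f (u + x) \<partial>unif01) = (\<integral>u. f u \<partial>unif01)"
    by (rule unif01_shift[OF step_fn_measurable[OF assms] step_fn_periodic[OF assms] step_fn_bound[OF assms]])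
  ultimately show "\<bar>Q k f x - (\<integral>u. f u \<partial>unif01)\<bar> \<le> 3 * V * \<rho> k"
    using step_estimate[OF step_fn_shift[OF assms, of x], of k] by simp
qed

lemma mixing_add:
  assumes f: "mixing B f" and g: "mixing C g" shows "mixing (B + C) (\<lambda>x. f x + g x)"
  unfolding mixing_def
proof (intro conjI allI)
  note [measurable] = mixingD(1)[OF f] mixingD(1)[OF g]
  show "(\<lambda>x. f x + g x) \<in> borel_measurable borel" by measurable
  show "periodic1 (\<lambda>x. f x + g x)" using mixingD(2)[OF f] mixingD(2)[OF g] by (auto simp: periodic1_def)
  show "\<bar>f x + g x\<bar> \<le> B + C" for x using mixingD(3)[OF f, of x] mixingD(3)[OF g, of x] by linarith
  fix k x
  have "(\<integral>u. f u + g u \<partial>unif01) = (\<integral>u. f u \<partial>unif01) + (\<integral>u. g u \<partial>unif01)"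
    using mixingD[OF f] mixingD[OF g] by (intro Bochner_Integration.integral_add integrable_unif01) auto
  then show "\<bar>Q k (\<lambda>x. f x + g x) x - (\<integral>u. f u + g u \<partial>unif01)\<bar> \<le> (B + C) * \<rho> k"
    using mixingD(5)[OF f, of k x] mixingD(5)[OF g, of k x]
      Q_add[OF mixingD(1,3)[OF f] mixingD(1,3)[OF g], of k x] by (simp add: distrib_right)
qed

lemma mixing_scale:
  assumes f: "mixing B f" shows "mixing (\<bar>c\<bar> * B) (\<lambda>x. c * f x)"
  unfolding mixing_def
proof (intro conjI allI)
  note [measurable] = mixingD(1)[OF f]
  show "(\<lambda>x. c * f x) \<in> borel_measurable borel" by measurable
  show "periodic1 (\<lambda>x. c * f x)" using mixingD(2)[OF f] by (auto simp: periodic1_def)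
  show "\<bar>c * f x\<bar> \<le> \<bar>c\<bar> * B" for x using mixingD(3)[OF f, of x] by (simp add: abs_mult mult_left_mono)
  fix k x
  have "\<bar>c * Q k f x - c * (\<integral>u. f u \<partial>unif01)\<bar> = \<bar>c\<bar> * \<bar>Q k f x - (\<integral>u. f u \<partial>unif01)\<bar>"
    by (simp add: abs_mult flip: right_diff_distrib)
  then show "\<bar>Q k (\<lambda>x. c * f x) x - (\<integral>u. c * f u \<partial>unif01)\<bar> \<le> \<bar>c\<bar> * B * \<rho> k"
    using mixingD(5)[OF f, of k x] by (simp add: Q_scale mult.assoc mult_left_mono)
qed

lemma mixing_sum:
  assumes "finite I" "\<And>i. i \<in> I \<Longrightarrow> mixing (B i) (f i)"
  shows "mixing (\<Sum>i\<in>I. B i) (\<lambda>x. \<Sum>i\<in>I. f i x)"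
  using assms
proof (induction I rule: finite_induct)
  case empty
  then show ?case using mixing_step[OF step_fn_const[of 0]] by simp
next
  case (insert i I)
  then show ?case using mixing_add[of "B i" "f i"] by simp
qed

lemma mixing_average:
  assumes N: "prob_space N" and meas: "case_prod \<phi> \<in> borel_measurable (N \<Otimes>\<^sub>M borel)"
    and mix: "\<And>z. z \<in> space N \<Longrightarrow> mixing B (\<phi> z)"
  shows "mixing B (\<lambda>x. \<integral>z. \<phi> z x \<partial>N)"
  unfolding mixing_def
proof (intro conjI allI)
  interpret N: prob_space N by fact
  obtain z0 where "z0 \<in> space N" using N.not_empty by blast
  then have B: "0 \<le> B" using mixingD(4)[OF mix] by blast
  have meas': "(\<lambda>z. \<phi> (snd z) (fst z)) \<in> borel_measurable (borel \<Otimes>\<^sub>M N)"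
  proof -
    have "(\<lambda>z. case_prod \<phi> (snd z, fst z)) \<in> borel_measurable (borel \<Otimes>\<^sub>M N)"
      by (rule measurable_compose[OF _ meas]) measurable
    then show ?thesis by simp
  qed
  show "(\<lambda>x. \<integral>z. \<phi> z x \<partial>N) \<in> borel_measurable borel"
    using meas' by (intro N.borel_measurable_lebesgue_integral) (simp add: case_prod_beta')
  show "periodic1 (\<lambda>x. \<integral>z. \<phi> z x \<partial>N)"
    using mixingD(2)[OF mix] by (auto simp: periodic1_def intro!: Bochner_Integration.integral_cong)
  show "\<bar>\<integral>z. \<phi> z x \<partial>N\<bar> \<le> B" for x
    using N.norm_expectation_le[of "\<lambda>z. \<phi> z x" B] mixingD(3)[OF mix] B by auto
  fix k x
  have m1: "(\<lambda>p. \<phi> (fst p) (x + S k (snd p))) \<in> borel_measurable (N \<Otimes>\<^sub>M M)"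
  proof -
    have "(\<lambda>p. case_prod \<phi> (fst p, x + S k (snd p))) \<in> borel_measurable (N \<Otimes>\<^sub>M M)"
      by (rule measurable_compose[OF _ meas]) measurable
    then show ?thesis by simp
  qed
  have m2: "(\<lambda>p. \<phi> (fst p) (snd p)) \<in> borel_measurable (N \<Otimes>\<^sub>M unif01)"
    using meas by (simp add: case_prod_beta' cong: measurable_cong_sets)
  have 1: "Q k (\<lambda>x. \<integral>z. \<phi> z x \<partial>N) x = (\<integral>z. Q k (\<phi> z) x \<partial>N)"
    unfolding Q_def
    by (rule prob_fubini(1)[OF N prob_space_axioms, of "\<lambda>z \<omega>. \<phi> z (x + S k \<omega>)" B])
       (use m1 mixingD(3)[OF mix] in \<open>auto simp: case_prod_beta'\<close>)
  have 2: "(\<integral>u. (\<integral>z. \<phi> z u \<partial>N) \<partial>unif01) = (\<integral>z. (\<integral>u. \<phi> z u \<partial>unif01) \<partial>N)"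
    by (rule prob_fubini(1)[OF N prob_space_unif01, of "\<phi>" B])
       (use m2 mixingD(3)[OF mix] in \<open>auto simp: case_prod_beta'\<close>)
  have i1: "integrable N (\<lambda>z. Q k (\<phi> z) x)"
    unfolding Q_def
  proof (rule N.bounded_integrable[of _ B])
    show "(\<lambda>z. \<integral>\<omega>. \<phi> z (x + S k \<omega>) \<partial>M) \<in> borel_measurable N"
      using m1 by (intro borel_measurable_lebesgue_integral) (simp add: case_prod_beta')
    show "norm (expectation (\<lambda>\<omega>. \<phi> z (x + S k \<omega>))) \<le> B" if "z \<in> space N" for z
      using mixingD(3)[OF mix[OF that]] B by (intro norm_expectation_le) auto
  qed
  have i2: "integrable N (\<lambda>z. \<integral>u. \<phi> z u \<partial>unif01)"
  proof (rule N.bounded_integrable[of _ B])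
    interpret U: prob_space unif01 by (rule prob_space_unif01)
    show "(\<lambda>z. \<integral>u. \<phi> z u \<partial>unif01) \<in> borel_measurable N"
      using m2 by (intro U.borel_measurable_lebesgue_integral) (simp add: case_prod_beta')
    show "norm (\<integral>u. \<phi> z u \<partial>unif01) \<le> B" if "z \<in> space N" for z
      using mixingD(3)[OF mix[OF that]] B by (intro U.norm_expectation_le) auto
  qed
  have "Q k (\<lambda>x. \<integral>z. \<phi> z x \<partial>N) x - (\<integral>u. (\<integral>z. \<phi> z u \<partial>N) \<partial>unif01) =
        (\<integral>z. Q k (\<phi> z) x - (\<integral>u. \<phi> z u \<partial>unif01) \<partial>N)"
    unfolding 1 2 using i1 i2 by simp
  then show "\<bar>Q k (\<lambda>x. \<integral>z. \<phi> z x \<partial>N) x - (\<integral>u. (\<integral>z. \<phi> z u \<partial>N) \<partial>unif01)\<bar> \<le> B * \<rho> k"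
    using N.norm_expectation_le[of "\<lambda>z. Q k (\<phi> z) x - (\<integral>u. \<phi> z u \<partial>unif01)" "B * \<rho> k"]
      mixingD(5)[OF mix] B rho_nonneg by auto
qed

lemma mixing_shift:
  assumes f: "mixing B f" shows "mixing B (\<lambda>x. f (x + a))"
  unfolding mixing_def
proof (intro conjI allI)
  note [measurable] = mixingD(1)[OF f]
  show "(\<lambda>x. f (x + a)) \<in> borel_measurable borel" by measurable
  show "periodic1 (\<lambda>x. f (x + a))"
    unfolding periodic1_def
  proof
    fix x show "f (x + 1 + a) = f (x + a)"
      using mixingD(2)[OF f, unfolded periodic1_def, rule_format, of "x + a"] by (simp add: add.assoc add.commute[of a])
  qed
  show "\<bar>f (x + a)\<bar> \<le> B" for x by (rule mixingD(3)[OF f])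
  fix k x
  have "Q k (\<lambda>x. f (x + a)) x = Q k f (x + a)" by (simp add: Q_def add.assoc add.commute[of a])
  then show "\<bar>Q k (\<lambda>x. f (x + a)) x - (\<integral>u. f (u + a) \<partial>unif01)\<bar> \<le> B * \<rho> k"
    using mixingD(5)[OF f, of k "x + a"] unif01_shift[OF mixingD(1-3)[OF f], of a] by simp
qed

lemma mixing_Q:
  assumes f: "mixing B f" shows "mixing B (Q k f)"
proof -
  note [measurable] = mixingD(1)[OF f]
  have "mixing B (\<lambda>x. \<integral>\<omega>. f (x + S k \<omega>) \<partial>M)"
    by (rule mixing_average[OF prob_space_axioms _ mixing_shift[OF f]]) simp
  then show ?thesis by (simp add: Q_def[abs_def])
qed

text \<open>
  The product of two \<open>Q\<close>-transforms is no longer a step function, but it is an average of products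
  of two shifted copies of \<open>f\<close>, which are step functions with a common bound: each shift and the
  passage to \<open>mixing\<close> contribute a factor 3. This is what makes the conditional variances below
  accessible to the law of large numbers.
\<close>

lemma mixing_Q_mult:
  assumes f: "step_fn V f" shows "mixing (27 * V\<^sup>2) (\<lambda>x. Q i f x * Q j f x)"
proof -
  note [measurable] = step_fn_measurable[OF f]
  have 1: "mixing (27 * V\<^sup>2) (\<lambda>x. f (x + a) * f (x + b))" for a b
    using mixing_step[OF step_fn_mult[OF step_fn_shift[OF f, of a] step_fn_shift[OF f, of b]]]
    by (simp add: power2_eq_square mult_ac)
  have "mixing (27 * V\<^sup>2) (\<lambda>x. \<integral>\<omega>. f (x + a) * f (x + S j \<omega>) \<partial>M)" for a
    by (rule mixing_average[OF prob_space_axioms _ 1]) simp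
  then have 2: "mixing (27 * V\<^sup>2) (\<lambda>x. f (x + a) * Q j f x)" for a by (simp add: Q_def[abs_def])
  have "mixing (27 * V\<^sup>2) (\<lambda>x. \<integral>\<omega>. f (x + S i \<omega>) * Q j f x \<partial>M)"
    by (rule mixing_average[OF prob_space_axioms _ 2]) measurable
  then show ?thesis by (simp add: Q_def[abs_def])
qed

end

section \<open>The Poisson equation and martingale differences\<close>

context mixing_walk begin

definition rho_sum :: real where "rho_sum = (\<Sum>k. \<rho> k * (real k + 1) powr d)"

lemma rho_le: "\<rho> k \<le> \<rho> k * (real k + 1) powr d"
  using rho_nonneg[of k] d_pos ge_one_powr_ge_zero[of "real k + 1" d] by (simp add: mult_le_cancel_left1)

lemma summable_rho: "summable \<rho>"
  by (rule summable_comparison_test'[OF rho_summable, of 0]) (use rho_nonneg rho_le in auto)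

lemma suminf_rho_le: "suminf \<rho> \<le> rho_sum"
  unfolding rho_sum_def by (rule suminf_le[OF rho_le summable_rho rho_summable])

lemma rho_sum_ge_2: "2 \<le> rho_sum"
proof -
  have "\<rho> 0 \<le> suminf \<rho>" using sum_le_suminf[OF summable_rho, of "{0}"] rho_nonneg by simp
  then show ?thesis using suminf_rho_le rho_0 by linarith
qed

text \<open>
  The weight \<open>(k + 1) powr d\<close> in the summability assumption is what turns into a rate here.
\<close>

lemma rho_tail: "(\<Sum>k. \<rho> (k + n)) \<le> rho_sum * (real n + 1) powr (- d)"
proof -
  let ?w = "\<lambda>k. \<rho> k * (real k + 1) powr d"
  have s: "summable (\<lambda>k. ?w (k + n))" using rho_summable by (rule summable_ignore_initial_segment)
  have le: "\<rho> (k + n) \<le> (real n + 1) powr (- d) * ?w (k + n)" for k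
  proof -
    have "(real n + 1) powr d \<le> (real (k + n) + 1) powr d" using d_pos by (intro powr_mono2) auto
    then have "1 \<le> (real n + 1) powr (- d) * (real (k + n) + 1) powr d"
      by (simp add: powr_minus field_simps)
    then show ?thesis using rho_nonneg[of "k + n"]
      by (metis mult.left_commute mult_left_mono mult.right_neutral)
  qed
  have "(\<Sum>k. \<rho> (k + n)) \<le> (\<Sum>k. (real n + 1) powr (- d) * ?w (k + n))"
    by (rule suminf_le[OF le]) (use summable_rho s in \<open>auto intro: summable_ignore_initial_segment summable_mult\<close>)
  also have "\<dots> = (real n + 1) powr (- d) * (\<Sum>k. ?w (k + n))" by (rule suminf_mult[OF s])
  also have "(\<Sum>k. ?w (k + n)) \<le> rho_sum"
    unfolding rho_sum_def suminf_split_initial_segment[OF rho_summable, of n]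
    using rho_nonneg by (simp add: sum_nonneg)
  finally show ?thesis by (simp add: mult.commute mult_left_mono)
qed

definition centered :: "real \<Rightarrow> (real \<Rightarrow> real) \<Rightarrow> bool" where
  "centered B f \<longleftrightarrow> mixing B f \<and> (\<integral>u. f u \<partial>unif01) = 0"

lemma centeredD:
  assumes "centered B f"
  shows "mixing B f" "(\<integral>u. f u \<partial>unif01) = 0" "f \<in> borel_measurable borel" "periodic1 f" "\<bar>f x\<bar> \<le> B" "0 \<le> B"
    "\<bar>Q k f x\<bar> \<le> B * \<rho> k"
  using assms mixingD[of B f] by (auto simp: centered_def dest!: mixingD(5)[of _ _ k x])

lemma centered_recenter:
  assumes f: "mixing B f" shows "centered (2 * B) (\<lambda>x. f x - (\<integral>u. f u \<partial>unif01))"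
proof -
  interpret U: prob_space unif01 by (rule prob_space_unif01)
  let ?m = "\<integral>u. f u \<partial>unif01"
  note [measurable] = mixingD(1)[OF f]
  have m: "\<bar>?m\<bar> \<le> B" using U.norm_expectation_le[of f B] mixingD(3,4)[OF f] by auto
  have i: "integrable unif01 f" using mixingD[OF f] by (intro integrable_unif01[of _ B]) auto
  then have z: "(\<integral>u. f u - ?m \<partial>unif01) = 0" using U.prob_space by simp
  have "Q k (\<lambda>x. f x - ?m) x = Q k f x - ?m" for k x
    using Q_integrable[OF mixingD(1,3)[OF f], of x k] by (simp add: Q_def prob_space)
  moreover have "\<bar>Q k f x - ?m\<bar> \<le> 2 * B * \<rho> k" for k x
    using mixingD(5)[OF f, of k x] mult_nonneg_nonneg[OF mixingD(4)[OF f] rho_nonneg[of k]] by linarith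
  moreover have "\<bar>f x - ?m\<bar> \<le> 2 * B" for x using mixingD(3)[OF f, of x] m by linarith
  ultimately show ?thesis unfolding centered_def mixing_def
    using mixingD(2)[OF f] z by (auto simp: periodic1_def)
qed

text \<open>
  The solution \<open>g\<close> of the Poisson equation \<open>g - Q 1 g = f\<close> for a centred \<open>f\<close>, as a Neumann
  series; \<open>trunc\<close> are its partial sums.
\<close>

definition poisson :: "(real \<Rightarrow> real) \<Rightarrow> real \<Rightarrow> real" where
  "poisson f x = (\<Sum>k. Q k f x)"

definition trunc :: "nat \<Rightarrow> (real \<Rightarrow> real) \<Rightarrow> real \<Rightarrow> real" where
  "trunc n f x = (\<Sum>k<n. Q k f x)"

lemma Q_summable: "centered B f \<Longrightarrow> summable (\<lambda>k. Q k f x)"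
  by (rule summable_comparison_test'[OF summable_mult[OF summable_rho, of B], of 0]) (simp add: centeredD(7))

lemma poisson_measurable [measurable]:
  "f \<in> borel_measurable borel \<Longrightarrow> poisson f \<in> borel_measurable borel"
  unfolding poisson_def[abs_def] by measurable

lemma trunc_measurable [measurable]:
  "f \<in> borel_measurable borel \<Longrightarrow> trunc n f \<in> borel_measurable borel"
  unfolding trunc_def[abs_def] by measurable

lemma poisson_periodic: "periodic1 f \<Longrightarrow> periodic1 (poisson f)"
  using Q_periodic[of f] by (simp add: periodic1_def poisson_def)

lemma poisson_minus_trunc:
  assumes f: "centered B f"
  shows "\<bar>poisson f x - trunc n f x\<bar> \<le> B * rho_sum * (real n + 1) powr (- d)"
proof -
  have s: "summable (\<lambda>k. \<rho> (k + n))" by (rule summable_ignore_initial_segment[OF summable_rho])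
  have "poisson f x - trunc n f x = (\<Sum>k. Q (k + n) f x)"
    unfolding poisson_def trunc_def suminf_split_initial_segment[OF Q_summable[OF f], of x n] by simp
  also have "\<bar>\<dots>\<bar> \<le> (\<Sum>k. B * \<rho> (k + n))"
    unfolding real_norm_def[symmetric]
  proof (rule norm_suminf_le)
    show "norm (Q (k + n) f x) \<le> B * \<rho> (k + n)" for k using centeredD(7)[OF f, of "k + n" x] by simp
    show "summable (\<lambda>k. B * \<rho> (k + n))" by (rule summable_mult[OF s])
  qed
  also have "\<dots> = B * (\<Sum>k. \<rho> (k + n))" by (rule suminf_mult[OF s])
  also have "\<dots> \<le> B * (rho_sum * (real n + 1) powr (- d))"
    using rho_tail centeredD(6)[OF f] by (intro mult_left_mono)
  finally show ?thesis by (simp add: mult.assoc)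
qed

lemma poisson_bound: "centered B f \<Longrightarrow> \<bar>poisson f x\<bar> \<le> B * rho_sum"
  using poisson_minus_trunc[of B f x 0] by (simp add: trunc_def)

lemma trunc_bound:
  assumes f: "centered B f" shows "\<bar>trunc n f x\<bar> \<le> B * rho_sum"
proof -
  have "\<bar>trunc n f x\<bar> \<le> (\<Sum>k<n. \<bar>Q k f x\<bar>)" unfolding trunc_def by (rule sum_abs)
  also have "\<dots> \<le> (\<Sum>k<n. B * \<rho> k)" by (intro sum_mono centeredD(7)[OF f])
  also have "\<dots> = B * (\<Sum>k<n. \<rho> k)" by (simp add: sum_distrib_left)
  also have "\<dots> \<le> B * rho_sum"
    using sum_le_suminf[OF summable_rho, of "{..<n}"] rho_nonneg suminf_rho_le centeredD(6)[OF f]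
    by (intro mult_left_mono) (auto intro: order_trans)
  finally show ?thesis .
qed

lemma Q_poisson:
  assumes f: "centered B f" shows "Q (Suc 0) (poisson f) x = poisson f x - f x"
proof -
  note [measurable] = centeredD(3)[OF f]
  have "Q (Suc 0) (poisson f) x = (\<Sum>k. \<integral>\<omega>. Q k f (x + S (Suc 0) \<omega>) \<partial>M)"
    unfolding Q_def[of "Suc 0"] poisson_def
  proof (rule integral_suminf)
    show "integrable M (\<lambda>\<omega>. Q k f (x + S (Suc 0) \<omega>))" for k
      by (rule Q_integrable[OF Q_measurable[OF centeredD(3)[OF f]] centeredD(7)[OF f]])
    have "summable (\<lambda>k. \<bar>Q k f z\<bar>)" for z
      by (rule summable_comparison_test'[OF summable_mult[OF summable_rho, of B], of 0]) (simp add: centeredD(7)[OF f])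
    then show "AE \<omega> in M. summable (\<lambda>k. norm (Q k f (x + S (Suc 0) \<omega>)))" by simp
    have "\<bar>\<integral>\<omega>. \<bar>Q k f (x + S (Suc 0) \<omega>)\<bar> \<partial>M\<bar> \<le> B * \<rho> k" for k
      using norm_expectation_le[of "\<lambda>\<omega>. \<bar>Q k f (x + S (Suc 0) \<omega>)\<bar>" "B * \<rho> k"] centeredD(6,7)[OF f] rho_nonneg by auto
    then show "summable (\<lambda>k. \<integral>\<omega>. norm (Q k f (x + S (Suc 0) \<omega>)) \<partial>M)"
      by (intro summable_comparison_test'[OF summable_mult[OF summable_rho, of B], of 0]) simp
  qed
  also have "\<dots> = (\<Sum>k. Q (Suc k) f x)"
    using Q_commute[OF centeredD(3,5)[OF f]] by (simp add: Q_def[of "Suc 0", symmetric])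
  also have "\<dots> = poisson f x - f x"
    unfolding poisson_def using suminf_split_head[OF Q_summable[OF f, of x]] by simp
  finally show ?thesis .
qed

text \<open>
  Evaluated along the walk, \<open>mdiff g\<close> gives martingale differences, and \<open>cond_var g\<close> is their
  conditional variance, which is again a function of the present position.
\<close>

definition mdiff :: "(real \<Rightarrow> real) \<Rightarrow> real \<Rightarrow> real \<Rightarrow> real" where
  "mdiff g x y = g y - Q (Suc 0) g x"

definition cond_var :: "(real \<Rightarrow> real) \<Rightarrow> real \<Rightarrow> real" where
  "cond_var g x = Q (Suc 0) (\<lambda>y. (g y)\<^sup>2) x - (Q (Suc 0) g x)\<^sup>2"

lemma mdiff_bound: "(\<And>x. \<bar>g x\<bar> \<le> c) \<Longrightarrow> \<bar>mdiff g x y\<bar> \<le> 2 * c"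
  using Q_bound[of g c "Suc 0" x] by (smt (verit) mdiff_def)

lemma mdiff_measurable [measurable]:
  assumes [measurable]: "g \<in> borel_measurable borel"
  shows "(\<lambda>z. mdiff g (fst z) (snd z)) \<in> borel_measurable (borel \<Otimes>\<^sub>M borel)"
  unfolding mdiff_def by measurable

lemma cond_var_measurable [measurable]:
  assumes [measurable]: "g \<in> borel_measurable borel" shows "cond_var g \<in> borel_measurable borel"
  unfolding cond_var_def[abs_def] by measurable

lemma integral_step_law_bounded:
  assumes "f \<in> borel_measurable borel" "\<And>x. norm (f x) \<le> B"
  shows "integrable step_law (f :: real \<Rightarrow> 'b::{banach, second_countable_topology})"
proof -
  interpret L: prob_space step_law by (rule prob_space_step_law)
  show ?thesis using assms by (intro L.bounded_integrable[of _ B]) (auto cong: measurable_cong_sets)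
qed

lemma mdiff_moments:
  assumes [measurable]: "g \<in> borel_measurable borel" and c: "\<And>x. \<bar>g x\<bar> \<le> c"
  shows "(\<integral>y. mdiff g x (x + y) \<partial>step_law) = 0"
    and "(\<integral>y. (mdiff g x (x + y))\<^sup>2 \<partial>step_law) = cond_var g x"
proof -
  interpret L: prob_space step_law by (rule prob_space_step_law)
  have c0: "0 \<le> c" using c[of 0] by linarith
  have i: "integrable step_law (\<lambda>y. g (x + y))"
    using c by (intro integral_step_law_bounded[of _ c]) auto
  have i2: "integrable step_law (\<lambda>y. (g (x + y))\<^sup>2)"
    using c c0 by (intro integral_step_law_bounded[of _ "c\<^sup>2"]) (auto simp: power2_le_iff_abs_le)
  let ?m = "Q (Suc 0) g x"
  have m: "?m = (\<integral>y. g (x + y) \<partial>step_law)" by (rule Q_1) simp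
  show "(\<integral>y. mdiff g x (x + y) \<partial>step_law) = 0"
    using i L.prob_space by (simp add: mdiff_def m)
  have "(\<integral>y. (mdiff g x (x + y))\<^sup>2 \<partial>step_law) = (\<integral>y. (g (x + y))\<^sup>2 - 2 * ?m * g (x + y) + ?m\<^sup>2 \<partial>step_law)"
    by (intro Bochner_Integration.integral_cong) (auto simp: mdiff_def power2_eq_square algebra_simps)
  also have "\<dots> = (\<integral>y. (g (x + y))\<^sup>2 \<partial>step_law) - 2 * ?m * ?m + ?m\<^sup>2"
    using i i2 L.prob_space by (simp add: m)
  also have "(\<integral>y. (g (x + y))\<^sup>2 \<partial>step_law) = Q (Suc 0) (\<lambda>y. (g y)\<^sup>2) x" by (rule Q_1[symmetric]) simp
  finally show "(\<integral>y. (mdiff g x (x + y))\<^sup>2 \<partial>step_law) = cond_var g x"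
    by (simp add: cond_var_def power2_eq_square)
qed

lemma cond_var_bounds:
  assumes "g \<in> borel_measurable borel" and c: "\<And>x. \<bar>g x\<bar> \<le> c"
  shows "0 \<le> cond_var g x" "cond_var g x \<le> c\<^sup>2"
proof -
  have c0: "0 \<le> c" using c[of 0] by linarith
  show "0 \<le> cond_var g x" using mdiff_moments(2)[OF assms, of x, symmetric] by simp
  have "\<bar>Q (Suc 0) (\<lambda>y. (g y)\<^sup>2) x\<bar> \<le> c\<^sup>2"
    using c c0 by (intro Q_bound) (auto simp: power2_le_iff_abs_le)
  then show "cond_var g x \<le> c\<^sup>2" unfolding cond_var_def by (smt (verit) zero_le_power2)
qed

lemma square_diff_bound:
  assumes "\<bar>a\<bar> \<le> c" "\<bar>b\<bar> \<le> c" "\<bar>a - b\<bar> \<le> (e::real)" shows "\<bar>a\<^sup>2 - b\<^sup>2\<bar> \<le> 2 * c * e"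
proof -
  have "\<bar>a\<^sup>2 - b\<^sup>2\<bar> = \<bar>a + b\<bar> * \<bar>a - b\<bar>" by (simp add: power2_eq_square algebra_simps flip: abs_mult)
  also have "\<dots> \<le> (2 * c) * e" using assms by (intro mult_mono) auto
  finally show ?thesis .
qed

text \<open>
  Conditional variances depend Lipschitz continuously on \<open>g\<close>, so those of \<open>poisson f\<close> may be
  replaced by those of its truncations.
\<close>

lemma cond_var_close:
  assumes [measurable]: "g \<in> borel_measurable borel" "h \<in> borel_measurable borel"
    and g: "\<And>x. \<bar>g x\<bar> \<le> c" and h: "\<And>x. \<bar>h x\<bar> \<le> c" and gh: "\<And>x. \<bar>g x - h x\<bar> \<le> e"
  shows "\<bar>cond_var g x - cond_var h x\<bar> \<le> 4 * c * e"
proof -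
  have c0: "0 \<le> c" using g[of 0] by linarith
  have 1: "Q (Suc 0) g x - Q (Suc 0) h x = Q (Suc 0) (\<lambda>y. g y - h y) x"
    using Q_add[of g c "\<lambda>y. -1 * h y" c "Suc 0" x] Q_scale[of "Suc 0" "-1" h x] g h by simp
  have b2: "\<bar>(g y)\<^sup>2\<bar> \<le> c\<^sup>2" "\<bar>-1 * (h y)\<^sup>2\<bar> \<le> c\<^sup>2" for y using g h c0 by (auto simp: power2_le_iff_abs_le)
  have 2: "Q (Suc 0) (\<lambda>y. (g y)\<^sup>2) x - Q (Suc 0) (\<lambda>y. (h y)\<^sup>2) x = Q (Suc 0) (\<lambda>y. (g y)\<^sup>2 - (h y)\<^sup>2) x"
    using Q_add[OF _ b2(1) _ b2(2), where k = "Suc 0" and x = x] Q_scale[of "Suc 0" "-1" "\<lambda>y. (h y)\<^sup>2" x] by simp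
  have 3: "\<bar>Q (Suc 0) (\<lambda>y. (g y)\<^sup>2 - (h y)\<^sup>2) x\<bar> \<le> 2 * c * e"
    by (intro Q_bound square_diff_bound g h gh)
  have 4: "\<bar>(Q (Suc 0) g x)\<^sup>2 - (Q (Suc 0) h x)\<^sup>2\<bar> \<le> 2 * c * e"
    by (intro square_diff_bound Q_bound g h) (simp add: 1 Q_bound gh)
  show ?thesis using 2 3 4 unfolding cond_var_def by linarith
qed

lemma Q_trunc:
  assumes f: "centered B f" shows "Q (Suc 0) (trunc n f) x = (\<Sum>k<n. Q (Suc k) f x)"
proof -
  have "Q (Suc 0) (trunc n f) x = (\<Sum>k<n. Q (Suc 0) (Q k f) x)"
    unfolding Q_def[of "Suc 0"] trunc_def
    by (rule Bochner_Integration.integral_sum)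
       (rule Q_integrable[OF Q_measurable[OF centeredD(3)[OF f]] centeredD(7)[OF f]])
  then show ?thesis using Q_commute[OF centeredD(3,5)[OF f]] by simp
qed

text \<open>
  For a truncation the conditional variance is a finite sum of products of \<open>Q\<close>-transforms of
  \<open>f\<close>, \<open>n\<^sup>2\<close> terms of each of two kinds. The constant grows with \<open>n\<close>, so it is
  not available for \<open>poisson f\<close> itself.
\<close>

lemma mixing_cond_var_trunc:
  assumes f: "step_fn V f" and mean: "(\<integral>u. f u \<partial>unif01) = 0"
  shows "mixing ((real n)\<^sup>2 * (54 * V\<^sup>2)) (cond_var (trunc n f))"
proof -
  have c: "centered (3 * V) f" using mixing_step[OF f] mean by (simp add: centered_def)
  note [measurable] = centeredD(3)[OF c]
  let ?h = "\<lambda>(i, j) x. Q (Suc 0) (\<lambda>y. Q i f y * Q j f y) x + (-1) * (Q (Suc i) f x * Q (Suc j) f x)"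
  have "mixing (54 * V\<^sup>2) (?h p)" for p
    using mixing_add[OF mixing_Q[OF mixing_Q_mult[OF f, of "fst p" "snd p"], of "Suc 0"]
        mixing_scale[OF mixing_Q_mult[OF f, of "Suc (fst p)" "Suc (snd p)"], of "-1"]]
    by (simp add: case_prod_beta')
  then have "mixing (\<Sum>p\<in>{..<n} \<times> {..<n}. 54 * V\<^sup>2) (\<lambda>x. \<Sum>p\<in>{..<n} \<times> {..<n}. ?h p x)"
    by (intro mixing_sum) auto
  moreover have "(\<lambda>x. \<Sum>p\<in>{..<n} \<times> {..<n}. ?h p x) = cond_var (trunc n f)"
  proof
    fix x
    have i: "integrable M (\<lambda>\<omega>. Q i f (x + S (Suc 0) \<omega>) * Q j f (x + S (Suc 0) \<omega>))" for i j
    proof (rule Q_integrable[of "\<lambda>y. Q i f y * Q j f y" "(3 * V * \<rho> i) * (3 * V * \<rho> j)"])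
      show "\<bar>Q i f y * Q j f y\<bar> \<le> (3 * V * \<rho> i) * (3 * V * \<rho> j)" for y
        unfolding abs_mult using centeredD(6)[OF c] rho_nonneg by (intro mult_mono centeredD(7)[OF c]) auto
    qed measurable
    have "Q (Suc 0) (\<lambda>y. (trunc n f y)\<^sup>2) x = Q (Suc 0) (\<lambda>y. \<Sum>p\<in>{..<n} \<times> {..<n}. Q (fst p) f y * Q (snd p) f y) x"
      by (simp add: trunc_def power2_eq_square sum_product sum.cartesian_product case_prod_beta')
    also have "\<dots> = (\<Sum>p\<in>{..<n} \<times> {..<n}. Q (Suc 0) (\<lambda>y. Q (fst p) f y * Q (snd p) f y) x)"
      unfolding Q_def[of "Suc 0"] by (rule Bochner_Integration.integral_sum) (rule i)
    finally have 1: "Q (Suc 0) (\<lambda>y. (trunc n f y)\<^sup>2) x = \<dots>" .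
    have "(Q (Suc 0) (trunc n f) x)\<^sup>2 = (\<Sum>p\<in>{..<n} \<times> {..<n}. Q (Suc (fst p)) f x * Q (Suc (snd p)) f x)"
      by (simp add: Q_trunc[OF c] power2_eq_square sum_product sum.cartesian_product case_prod_beta')
    then show "(\<Sum>p\<in>{..<n} \<times> {..<n}. ?h p x) = cond_var (trunc n f) x"
      unfolding cond_var_def 1 by (simp add: case_prod_beta' sum_subtractf)
  qed
  ultimately show ?thesis by (simp add: power2_eq_square)
qed

text \<open>
  Supermartingale estimate: if one application of the twisted operator to \<open>1\<close> stays below
  \<open>\<kappa>\<close>, then \<open>N\<close> applications stay below \<open>\<kappa> ^ N\<close>.
\<close>

lemma feynman_le_power:
  fixes G :: "real \<Rightarrow> real \<Rightarrow> real"
  assumes G: "case_prod G \<in> borel_measurable (borel \<Otimes>\<^sub>M borel)" and G0: "\<And>x y. 0 \<le> G x y" and GC: "\<And>x y. G x y \<le> C"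
    and le: "\<And>x. feynman G (\<lambda>_. 1) x \<le> \<kappa>"
  shows "(feynman G ^^ N) (\<lambda>_. 1) x \<le> \<kappa> ^ N"
proof -
  interpret L: prob_space step_law by (rule prob_space_step_law)
  have C0: "0 \<le> C" using G0[of 0 0] GC[of 0 0] by linarith
  have k0: "0 \<le> \<kappa>" using le[of 0] G0 by (smt (verit) Bochner_Integration.integral_nonneg feynman_def mult_nonneg_nonneg)
  have "(feynman G ^^ N) (\<lambda>_. 1) \<in> borel_measurable borel \<and>
        (\<forall>x. 0 \<le> (feynman G ^^ N) (\<lambda>_. 1) x \<and> (feynman G ^^ N) (\<lambda>_. 1) x \<le> \<kappa> ^ N)"
  proof (induction N)
    case (Suc N)
    define h where "h = (feynman G ^^ N) (\<lambda>_. 1)"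
    have h [measurable]: "h \<in> borel_measurable borel" and hb: "0 \<le> h x" "h x \<le> \<kappa> ^ N" for x
      using Suc.IH by (auto simp: h_def)
    have Gm [measurable]: "(\<lambda>y. G x (x + y)) \<in> borel_measurable borel" for x
    proof -
      have "(\<lambda>y. case_prod G (x, x + y)) \<in> borel_measurable borel" by (rule measurable_compose[OF _ G]) measurable
      then show ?thesis by simp
    qed
    have "feynman G h x \<le> \<kappa> ^ Suc N" for x
    proof -
      have "feynman G h x \<le> (\<integral>y. (G x (x + y) * 1) * \<kappa> ^ N \<partial>step_law)"
        unfolding feynman_def
      proof (rule integral_mono)
        show "integrable step_law (\<lambda>y. G x (x + y) * h (x + y))"
          using G0 GC hb C0 by (intro integral_step_law_bounded[of _ "C * \<kappa> ^ N"]) (auto simp: abs_mult intro!: mult_mono)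
        show "integrable step_law (\<lambda>y. G x (x + y) * 1 * \<kappa> ^ N)"
          using G0 GC k0 C0 by (intro integral_step_law_bounded[of _ "C * \<kappa> ^ N"]) (auto simp: abs_mult intro!: mult_mono)
      qed (use G0 hb in \<open>auto intro!: mult_left_mono\<close>)
      also have "\<dots> = feynman G (\<lambda>_. 1) x * \<kappa> ^ N"
        by (simp only: feynman_def Bochner_Integration.integral_mult_left_zero)
      also have "\<dots> \<le> \<kappa> * \<kappa> ^ N" using le k0 by (intro mult_right_mono) auto
      finally show ?thesis by simp
    qed
    moreover have "0 \<le> feynman G h x" for x unfolding feynman_def using G0 hb by simp
    ultimately show ?case using feynman_measurable[OF G h] by (simp add: h_def)
  qed simp
  then show ?thesis by blast
qed

lemma sum_mdiff_poisson:
  assumes f: "centered B f"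
  shows "(\<Sum>k<N. f (S k \<omega>)) = (\<Sum>k<N. mdiff (poisson f) (S k \<omega>) (S (Suc k) \<omega>)) + poisson f 0 - poisson f (S N \<omega>)"
proof (induction N)
  case (Suc N)
  then show ?case using Q_poisson[OF f, of "S N \<omega>"] by (simp add: mdiff_def)
qed simp

text \<open>
  The Poisson equation makes \<open>f (S k)\<close> a martingale difference plus a telescoping term, so the
  two sums differ by boundary terms only.
\<close>

lemma martingale_approximation:
  assumes f: "centered B f"
  shows "\<bar>(\<Sum>k<N. f (S (Suc k) \<omega>)) - (\<Sum>k<N. mdiff (poisson f) (S k \<omega>) (S (Suc k) \<omega>))\<bar> \<le> 2 * (B * rho_sum)"
proof -
  let ?g = "poisson f" and ?D = "\<Sum>k<N. mdiff (poisson f) (S k \<omega>) (S (Suc k) \<omega>)"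
  have "(\<Sum>k<N. f (S (Suc k) \<omega>)) = (\<Sum>k<N. f (S k \<omega>)) + f (S N \<omega>) - f 0"
    using sum.lessThan_Suc_shift[of "\<lambda>k. f (S k \<omega>)" N] by simp
  also have "\<dots> = ?D + (?g 0 - f 0) - (?g (S N \<omega>) - f (S N \<omega>))"
    unfolding sum_mdiff_poisson[OF f] by simp
  also have "\<dots> = ?D + Q (Suc 0) ?g 0 - Q (Suc 0) ?g (S N \<omega>)" by (simp add: Q_poisson[OF f])
  finally have eq: "(\<Sum>k<N. f (S (Suc k) \<omega>)) = ?D + Q (Suc 0) ?g 0 - Q (Suc 0) ?g (S N \<omega>)" .
  have "\<bar>Q (Suc 0) ?g x\<bar> \<le> B * rho_sum" for x by (rule Q_bound) (rule poisson_bound[OF f])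
  from this[of 0] this[of "S N \<omega>"] show ?thesis unfolding eq by linarith
qed

text \<open>
  The Azuma--Hoeffding inequality: Hoeffding's lemma bounds one application of the twisted
  operator. Negative \<open>\<theta>\<close> is reduced to positive \<open>\<theta>\<close> by changing the sign of \<open>g\<close>.
\<close>

lemma exp_mdiff_bound:
  assumes [measurable]: "g \<in> borel_measurable borel" and c: "\<And>x. \<bar>g x\<bar> \<le> c"
  shows "(\<integral>\<omega>. exp (\<theta> * (\<Sum>k<N. mdiff g (S k \<omega>) (S (Suc k) \<omega>))) \<partial>M) \<le> exp (real N * (\<theta>\<^sup>2 * c\<^sup>2 / 2))"
proof -
  interpret L: prob_space step_law by (rule prob_space_step_law)
  let ?G = "\<lambda>x y. exp (\<theta> * mdiff g x y)"
  have pos: "feynman (\<lambda>x y. exp (t * mdiff h x y)) (\<lambda>_. 1) x \<le> exp (t\<^sup>2 * c\<^sup>2 / 2)"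
    if [measurable]: "h \<in> borel_measurable borel" and c: "\<And>x. \<bar>h x\<bar> \<le> c" and t: "0 < t" for t x h
  proof -
    interpret I: interval_bounded_random_variable step_law "\<lambda>y. h (x + y)" "- c" c
    proof
      show "(\<lambda>y. h (x + y)) \<in> borel_measurable step_law" by measurable
      show "AE y in step_law. h (x + y) \<in> {- c..c}" using c by (auto simp: abs_le_iff minus_le_iff)
    qed
    have m: "Q (Suc 0) h x = (\<integral>y. h (x + y) \<partial>step_law)" by (rule Q_1) simp
    have "(\<integral>\<^sup>+y. ennreal (exp (t * (h (x + y) - (\<integral>y. h (x + y) \<partial>step_law)))) \<partial>step_law) \<le> ennreal (exp (t\<^sup>2 * (c - - c)\<^sup>2 / 8))"
      by (rule I.Hoeffdings_lemma_nn_integral[OF t])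
    then have nn: "(\<integral>\<^sup>+y. ennreal (exp (t * mdiff h x (x + y))) \<partial>step_law) \<le> ennreal (exp (t\<^sup>2 * c\<^sup>2 / 2))"
      by (simp add: mdiff_def m power2_eq_square mult_ac)
    have "integral\<^sup>L step_law (\<lambda>y. exp (t * mdiff h x (x + y))) \<le> exp (t\<^sup>2 * c\<^sup>2 / 2)"
    proof (rule order_trans[OF _ enn2real_leI[OF _ nn]])
      have [measurable]: "(\<lambda>y. mdiff h x (x + y)) \<in> borel_measurable borel" unfolding mdiff_def by measurable
      show "integral\<^sup>L step_law (\<lambda>y. exp (t * mdiff h x (x + y))) \<le> enn2real (\<integral>\<^sup>+y. ennreal (exp (t * mdiff h x (x + y))) \<partial>step_law)"
        by (subst integral_eq_nn_integral) (auto cong: measurable_cong_sets)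
    qed simp
    then show ?thesis by (simp add: feynman_def)
  qed
  have le: "feynman ?G (\<lambda>_. 1) x \<le> exp (\<theta>\<^sup>2 * c\<^sup>2 / 2)" for x
  proof (cases \<theta> "0 :: real" rule: linorder_cases)
    case less
    have "(\<lambda>x y. exp (- \<theta> * mdiff (\<lambda>x. - g x) x y)) = ?G"
      using Q_scale[of "Suc 0" "-1" g] by (simp add: mdiff_def fun_eq_iff algebra_simps)
    then show ?thesis using pos[of "\<lambda>x. - g x" "- \<theta>" x] c less by simp
  next
    case equal then show ?thesis by (simp add: feynman_def L.prob_space)
  next
    case greater then show ?thesis using pos[of g] c by simp
  qed
  have Gb: "?G x y \<le> exp (\<bar>\<theta>\<bar> * (2 * c))" for x y
  proof -
    have "\<theta> * mdiff g x y \<le> \<bar>\<theta>\<bar> * \<bar>mdiff g x y\<bar>" by (metis abs_ge_self abs_mult)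
    also have "\<dots> \<le> \<bar>\<theta>\<bar> * (2 * c)" using mdiff_bound[of g c x y] c by (intro mult_left_mono) auto
    finally show ?thesis by simp
  qed
  have Gm: "case_prod ?G \<in> borel_measurable (borel \<Otimes>\<^sub>M borel)" by (simp add: case_prod_beta')
  have "(\<integral>\<omega>. exp (\<theta> * (\<Sum>k<N. mdiff g (S k \<omega>) (S (Suc k) \<omega>))) \<partial>M) =
        (\<integral>\<omega>. (\<Prod>k<N. ?G (S k \<omega>) (S (Suc k) \<omega>)) * (\<lambda>_. 1) (S N \<omega>) \<partial>M)"
    by (simp add: sum_distrib_left exp_sum)
  also have "\<dots> = (feynman ?G ^^ N) (\<lambda>_. 1) 0"
    by (rule feynman_kac[OF Gm, of "exp (\<bar>\<theta>\<bar> * (2 * c))" _ 1]) (use Gb in auto)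
  also have "\<dots> \<le> exp (\<theta>\<^sup>2 * c\<^sup>2 / 2) ^ N"
    by (rule feynman_le_power[OF Gm _ Gb le]) simp
  finally show ?thesis by (simp only: exp_of_nat_mult)
qed

lemma exp_abs_le_add: "exp \<bar>z\<bar> \<le> exp z + exp (- z :: real)"
  by (cases "0 \<le> z") auto

text \<open>
  The martingale approximation transfers the Azuma--Hoeffding bound to additive functionals.
\<close>

lemma exp_sum_centered:
  assumes f: "centered B f" and \<theta>: "0 \<le> \<theta>"
  shows "(\<integral>\<omega>. exp (\<theta> * \<bar>\<Sum>k<N. f (S k \<omega>)\<bar>) \<partial>M)
     \<le> 2 * exp (2 * \<theta> * (B * rho_sum) + real N * (\<theta>\<^sup>2 * (B * rho_sum)\<^sup>2 / 2))"
proof -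
  let ?c = "B * rho_sum"
  let ?g = "poisson f"
  note [measurable] = centeredD(3)[OF f]
  note c = poisson_bound[OF f]
  let ?M = "\<lambda>\<omega>. \<Sum>k<N. mdiff ?g (S k \<omega>) (S (Suc k) \<omega>)"
  have [measurable]: "(\<lambda>\<omega>. mdiff ?g (S k \<omega>) (S (Suc k) \<omega>)) \<in> borel_measurable M" for k
    unfolding mdiff_def by measurable
  have Mb: "\<bar>?M \<omega>\<bar> \<le> real N * (2 * ?c)" for \<omega>
  proof -
    have "\<bar>?M \<omega>\<bar> \<le> (\<Sum>k<N. 2 * ?c)"
      by (rule order_trans[OF sum_abs sum_mono]) (rule mdiff_bound[OF c])
    then show ?thesis by simp
  qed
  have ie: "integrable M (\<lambda>\<omega>. exp (t * ?M \<omega>))" for t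
  proof (rule bounded_integrable[of _ "exp (\<bar>t\<bar> * (real N * (2 * ?c)))"])
    show "norm (exp (t * ?M \<omega>)) \<le> exp (\<bar>t\<bar> * (real N * (2 * ?c)))" for \<omega>
      using mult_left_mono[OF Mb[of \<omega>], of "\<bar>t\<bar>"] abs_le_D1[of "t * ?M \<omega>"] by (simp add: abs_mult)
  qed measurable
  have pt: "exp (\<theta> * \<bar>\<Sum>k<N. f (S k \<omega>)\<bar>) \<le> exp (2 * \<theta> * ?c) * (exp (\<theta> * ?M \<omega>) + exp (- \<theta> * ?M \<omega>))" for \<omega>
  proof -
    have "\<bar>\<Sum>k<N. f (S k \<omega>)\<bar> \<le> 2 * ?c + \<bar>?M \<omega>\<bar>"
      unfolding sum_mdiff_poisson[OF f] using c[of 0] c[of "S N \<omega>"] by linarith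
    then have "\<theta> * \<bar>\<Sum>k<N. f (S k \<omega>)\<bar> \<le> 2 * \<theta> * ?c + \<bar>\<theta> * ?M \<omega>\<bar>"
      using mult_left_mono[of _ _ \<theta>] \<theta> by (fastforce simp: abs_mult algebra_simps)
    then have "exp (\<theta> * \<bar>\<Sum>k<N. f (S k \<omega>)\<bar>) \<le> exp (2 * \<theta> * ?c) * exp \<bar>\<theta> * ?M \<omega>\<bar>"
      by (simp flip: exp_add)
    also have "\<dots> \<le> exp (2 * \<theta> * ?c) * (exp (\<theta> * ?M \<omega>) + exp (- \<theta> * ?M \<omega>))"
      using exp_abs_le_add[of "\<theta> * ?M \<omega>"] by (intro mult_left_mono) auto
    finally show ?thesis .
  qed
  have "(\<integral>\<omega>. exp (\<theta> * \<bar>\<Sum>k<N. f (S k \<omega>)\<bar>) \<partial>M) \<le> (\<integral>\<omega>. exp (2 * \<theta> * ?c) * (exp (\<theta> * ?M \<omega>) + exp (- \<theta> * ?M \<omega>)) \<partial>M)"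
  proof (rule integral_mono[OF _ _ pt])
    show "integrable M (\<lambda>\<omega>. exp (2 * \<theta> * ?c) * (exp (\<theta> * ?M \<omega>) + exp (- \<theta> * ?M \<omega>)))"
      by (intro Bochner_Integration.integrable_mult_right Bochner_Integration.integrable_add ie)
    show "integrable M (\<lambda>\<omega>. exp (\<theta> * \<bar>\<Sum>k<N. f (S k \<omega>)\<bar>))"
    proof (rule bounded_integrable[of _ "exp (\<theta> * (real N * B))"])
      have "\<bar>\<Sum>k<N. f (S k \<omega>)\<bar> \<le> (\<Sum>k<N. B)" for \<omega>
        by (rule order_trans[OF sum_abs sum_mono]) (rule centeredD(5)[OF f])
      then show "norm (exp (\<theta> * \<bar>\<Sum>k<N. f (S k \<omega>)\<bar>)) \<le> exp (\<theta> * (real N * B))" for \<omega>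
        using \<theta> by (simp add: mult_left_mono)
    qed measurable
  qed
  also have "\<dots> = exp (2 * \<theta> * ?c) * ((\<integral>\<omega>. exp (\<theta> * ?M \<omega>) \<partial>M) + (\<integral>\<omega>. exp (- \<theta> * ?M \<omega>) \<partial>M))"
    by (subst Bochner_Integration.integral_mult_right_zero, subst Bochner_Integration.integral_add[OF ie ie]) simp
  also have "\<dots> \<le> exp (2 * \<theta> * ?c) * (exp (real N * (\<theta>\<^sup>2 * ?c\<^sup>2 / 2)) + exp (real N * (\<theta>\<^sup>2 * ?c\<^sup>2 / 2)))"
    using exp_mdiff_bound[of ?g ?c \<theta> N] exp_mdiff_bound[of ?g ?c "- \<theta>" N] c
    by (intro mult_left_mono add_mono) auto
  finally show ?thesis by (simp add: exp_add)
qed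

end

section \<open>Law of large numbers and central limit theorem\<close>

context mixing_walk begin

text \<open>
  The covariance \<open>C(f, h)\<close> with the expectation over the walk carried out.
\<close>

definition cov_form :: "(real \<Rightarrow> real) \<Rightarrow> (real \<Rightarrow> real) \<Rightarrow> real" where
  "cov_form f h = (\<integral>u. f u * h u \<partial>unif01) + (\<Sum>k. \<integral>u. f u * Q (Suc k) h u \<partial>unif01)
     + (\<Sum>k. \<integral>u. h u * Q (Suc k) f u \<partial>unif01)"

lemma correlation_bound:
  assumes f: "centered B f" and h [measurable]: "h \<in> borel_measurable borel" and C: "\<And>x. \<bar>h x\<bar> \<le> C"
  shows "\<bar>\<integral>u. h u * Q k f u \<partial>unif01\<bar> \<le> (\<integral>u. \<bar>h u\<bar> \<partial>unif01) * (B * \<rho> k)"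
proof -
  note [measurable] = centeredD(3)[OF f]
  have ih: "integrable unif01 (\<lambda>u. \<bar>h u\<bar>)" using C by (intro integrable_unif01[of _ C]) auto
  have "\<bar>\<integral>u. h u * Q k f u \<partial>unif01\<bar> \<le> (\<integral>u. \<bar>h u * Q k f u\<bar> \<partial>unif01)" by (rule integral_abs_bound)
  also have "\<dots> \<le> (\<integral>u. \<bar>h u\<bar> * (B * \<rho> k) \<partial>unif01)"
  proof (rule integral_mono)
    show "integrable unif01 (\<lambda>u. \<bar>h u * Q k f u\<bar>)"
    proof (rule integrable_unif01[of _ "C * (B * \<rho> k)"])
      show "norm \<bar>h u * Q k f u\<bar> \<le> C * (B * \<rho> k)" for u
        unfolding real_norm_def abs_abs abs_mult using C[of 0] C[of u] by (intro mult_mono centeredD(7)[OF f]) auto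
    qed measurable
    show "\<bar>h u * Q k f u\<bar> \<le> \<bar>h u\<bar> * (B * \<rho> k)" for u
      unfolding abs_mult by (intro mult_left_mono centeredD(7)[OF f]) auto
  qed (use ih in auto)
  finally show ?thesis by simp
qed

lemma integral_abs_le:
  fixes h :: "real \<Rightarrow> real"
  assumes C: "\<And>x. \<bar>h x\<bar> \<le> C" shows "(\<integral>u. \<bar>h u\<bar> \<partial>unif01) \<le> C"
proof -
  interpret U: prob_space unif01 by (rule prob_space_unif01)
  have "0 \<le> C" using order_trans[OF abs_ge_zero C[of 0]] .
  then show ?thesis using U.norm_expectation_le[of "\<lambda>u. \<bar>h u\<bar>" C] C by auto
qed

lemma correlation_summable:
  assumes f: "centered B f" and h: "h \<in> borel_measurable borel" and C: "\<And>x. \<bar>h x\<bar> \<le> C"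
  shows "summable (\<lambda>k. \<integral>u. h u * Q k f u \<partial>unif01)"
  by (rule summable_comparison_test'[OF summable_mult[OF summable_mult[OF summable_rho]], of 0])
     (use correlation_bound[OF f h C] in auto)

lemma integral_mult_poisson:
  assumes f: "centered B f" and h [measurable]: "h \<in> borel_measurable borel" and C: "\<And>x. \<bar>h x\<bar> \<le> C"
  shows "(\<integral>u. h u * poisson f u \<partial>unif01) = (\<Sum>k. \<integral>u. h u * Q k f u \<partial>unif01)"
proof -
  note [measurable] = centeredD(3)[OF f]
  have C0: "0 \<le> C" using C[of 0] by linarith
  have b: "\<bar>h u * Q k f u\<bar> \<le> C * (B * \<rho> k)" for u k
    unfolding abs_mult using C C0 by (intro mult_mono centeredD(7)[OF f]) auto
  have "(\<integral>u. h u * poisson f u \<partial>unif01) = (\<integral>u. (\<Sum>k. h u * Q k f u) \<partial>unif01)"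
    unfolding poisson_def by (intro Bochner_Integration.integral_cong refl suminf_mult[symmetric] Q_summable[OF f])
  also have "\<dots> = (\<Sum>k. \<integral>u. h u * Q k f u \<partial>unif01)"
  proof (rule integral_suminf)
    show "integrable unif01 (\<lambda>u. h u * Q k f u)" for k
      using b by (intro integrable_unif01[of _ "C * (B * \<rho> k)"]) auto
    have "summable (\<lambda>k. norm (h u * Q k f u))" for u
      by (rule summable_comparison_test'[OF summable_mult[OF summable_mult[OF summable_rho]], of 0]) (use b in auto)
    then show "AE u in unif01. summable (\<lambda>k. norm (h u * Q k f u))" by simp
    have "\<bar>\<integral>u. \<bar>h u * Q k f u\<bar> \<partial>unif01\<bar> \<le> C * (B * \<rho> k)" for k
      using integral_abs_le[of "\<lambda>u. h u * Q k f u", OF b] by simp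
    then show "summable (\<lambda>k. \<integral>u. norm (h u * Q k f u) \<partial>unif01)"
      by (intro summable_comparison_test'[OF summable_mult[OF summable_mult[OF summable_rho]], of 0]) auto
  qed
  finally show ?thesis .
qed

text \<open>
  The variance of the limit. By the Poisson equation the conditional variance is
  \<open>Q g\<^sup>2 - (g - f)\<^sup>2\<close>; its integral is \<open>2 \<integral> f g - \<integral> f\<^sup>2\<close> because the uniform law is
  stationary, and inserting the series for \<open>g\<close> gives the covariance form.
\<close>

lemma integral_cond_var_poisson:
  assumes f: "centered B f"
  shows "(\<integral>u. cond_var (poisson f) u \<partial>unif01) = cov_form f f"
proof -
  let ?g = "poisson f" and ?c = "B * rho_sum"
  note [measurable] = centeredD(3)[OF f]
  note fb = centeredD(5)[OF f] and gb = poisson_bound[OF f]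
  have c0: "0 \<le> ?c" using gb[of 0] by linarith
  have B0: "0 \<le> B" by (rule centeredD(6)[OF f])
  have g2: "\<bar>(?g u)\<^sup>2\<bar> \<le> ?c\<^sup>2" for u using gb c0 by (simp add: power2_le_iff_abs_le)
  have i1: "integrable unif01 (\<lambda>u. (?g u)\<^sup>2)" using g2 by (intro integrable_unif01[of _ "?c\<^sup>2"]) auto
  have i2: "integrable unif01 (\<lambda>u. f u * ?g u)"
    using fb gb B0 c0
    by (intro integrable_unif01[of _ "B * ?c"]) (simp_all only: real_norm_def abs_mult, measurable, blast intro: mult_mono abs_ge_zero)
  have i3: "integrable unif01 (\<lambda>u. f u * f u)"
    using fb B0
    by (intro integrable_unif01[of _ "B * B"]) (simp_all only: real_norm_def abs_mult, measurable, blast intro: mult_mono abs_ge_zero)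
  have i4: "integrable unif01 (Q (Suc 0) (\<lambda>u. (?g u)\<^sup>2))"
    using Q_bound[OF g2] by (intro integrable_unif01[of _ "?c\<^sup>2"]) auto
  have "(\<integral>u. cond_var ?g u \<partial>unif01) = (\<integral>u. Q (Suc 0) (\<lambda>u. (?g u)\<^sup>2) u - (?g u)\<^sup>2 + 2 * (f u * ?g u) - f u * f u \<partial>unif01)"
    by (intro Bochner_Integration.integral_cong refl) (simp add: cond_var_def Q_poisson[OF f] power2_eq_square algebra_simps)
  also have "\<dots> = (\<integral>u. Q (Suc 0) (\<lambda>u. (?g u)\<^sup>2) u \<partial>unif01) - (\<integral>u. (?g u)\<^sup>2 \<partial>unif01)
      + 2 * (\<integral>u. f u * ?g u \<partial>unif01) - (\<integral>u. f u * f u \<partial>unif01)"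
    using i1 i2 i3 i4 by simp
  also have "(\<integral>u. Q (Suc 0) (\<lambda>u. (?g u)\<^sup>2) u \<partial>unif01) = (\<integral>u. (?g u)\<^sup>2 \<partial>unif01)"
    using poisson_periodic[OF centeredD(4)[OF f]] by (intro integral_Q_unif01[OF _ _ g2]) (auto simp: periodic1_def)
  also have "(\<integral>u. f u * ?g u \<partial>unif01) = (\<integral>u. f u * f u \<partial>unif01) + (\<Sum>k. \<integral>u. f u * Q (Suc k) f u \<partial>unif01)"
    using integral_mult_poisson[OF f centeredD(3)[OF f] fb] suminf_split_head[OF correlation_summable[OF f centeredD(3)[OF f] fb]]
    by simp
  finally show ?thesis by (simp add: cov_form_def)
qed

lemma one_over_sqrt_tendsto: "(\<lambda>N. C / sqrt (real N)) \<longlonglongrightarrow> 0"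
  by (rule tendsto_divide_0[OF tendsto_const filterlim_at_top_imp_at_infinity])
     (rule filterlim_compose[OF sqrt_at_top filterlim_real_sequentially])

text \<open>
  The exponential bound with \<open>\<theta> = 1 / sqrt N\<close> shows that the centred sum is of order \<open>sqrt N\<close>
  in mean.
\<close>

lemma mixing_lln:
  assumes f: "mixing B f"
  shows "(\<lambda>N. \<integral>\<omega>. \<bar>(\<Sum>k<N. f (S k \<omega>) - (\<integral>u. f u \<partial>unif01)) / real N\<bar> \<partial>M) \<longlonglongrightarrow> 0"
proof -
  let ?f = "\<lambda>x. f x - (\<integral>u. f u \<partial>unif01)"
  define C where "C = 2 * B * rho_sum"
  have cf: "centered (2 * B) ?f" by (rule centered_recenter[OF f])
  note [measurable] = centeredD(3)[OF cf]
  have C0: "0 \<le> C" using centeredD(6)[OF cf] rho_sum_ge_2 by (simp add: C_def)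
  define K where "K = 2 * exp (2 * C + C\<^sup>2 / 2)"
  let ?Z = "\<lambda>N \<omega>. \<bar>\<Sum>k<N. ?f (S k \<omega>)\<bar>"
  have Zb: "?Z N \<omega> \<le> real N * (2 * B)" for N \<omega>
    using order_trans[OF sum_abs sum_mono[of "{..<N}" "\<lambda>k. \<bar>?f (S k \<omega>)\<bar>" "\<lambda>_. 2 * B"]] centeredD(5)[OF cf] by simp
  have bound: "(\<integral>\<omega>. ?Z N \<omega> / real N \<partial>M) \<le> K / sqrt (real N)" if N: "1 \<le> N" for N
  proof -
    define \<theta> where "\<theta> = 1 / sqrt (real N)"
    have t: "0 \<le> \<theta>" "\<theta> \<le> 1" "real N * \<theta>\<^sup>2 = 1" using N by (auto simp: \<theta>_def power_divide)
    have "(\<integral>\<omega>. \<theta> * ?Z N \<omega> \<partial>M) \<le> (\<integral>\<omega>. exp (\<theta> * ?Z N \<omega>) \<partial>M)"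
    proof (rule integral_mono)
      show "integrable M (\<lambda>\<omega>. \<theta> * ?Z N \<omega>)"
        using Zb t by (intro bounded_integrable[of _ "\<theta> * (real N * (2 * B))"]) (auto simp: abs_mult intro!: mult_left_mono)
      show "integrable M (\<lambda>\<omega>. exp (\<theta> * ?Z N \<omega>))"
        using Zb t by (intro bounded_integrable[of _ "exp (\<theta> * (real N * (2 * B)))"]) (auto intro!: mult_left_mono)
      show "\<theta> * ?Z N \<omega> \<le> exp (\<theta> * ?Z N \<omega>)" for \<omega> using exp_ge_add_one_self[of "\<theta> * ?Z N \<omega>"] by linarith
    qed
    also have "\<dots> \<le> 2 * exp (2 * \<theta> * C + real N * (\<theta>\<^sup>2 * C\<^sup>2 / 2))"
      unfolding C_def by (rule exp_sum_centered[OF cf t(1)])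
    also have "2 * \<theta> * C + real N * (\<theta>\<^sup>2 * C\<^sup>2 / 2) = 2 * \<theta> * C + (real N * \<theta>\<^sup>2) * C\<^sup>2 / 2" by simp
    also have "2 * exp \<dots> \<le> K" using t C0 by (simp add: K_def mult_left_le_one_le mult.assoc)
    finally have "\<theta> * (\<integral>\<omega>. ?Z N \<omega> \<partial>M) \<le> K" by simp
    then have "\<theta> * (\<theta> * (\<integral>\<omega>. ?Z N \<omega> \<partial>M)) \<le> \<theta> * K" using t by (intro mult_left_mono)
    moreover have "(\<integral>\<omega>. ?Z N \<omega> / real N \<partial>M) = \<theta> * (\<theta> * (\<integral>\<omega>. ?Z N \<omega> \<partial>M))"
      using N by (simp add: \<theta>_def)
    ultimately show ?thesis by (simp add: \<theta>_def)
  qed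
  show ?thesis
  proof (rule tendsto_sandwich[OF _ _ tendsto_const one_over_sqrt_tendsto[of K]])
    show "\<forall>\<^sub>F N in sequentially. (\<integral>\<omega>. \<bar>(\<Sum>k<N. ?f (S k \<omega>)) / real N\<bar> \<partial>M) \<le> K / sqrt (real N)"
      using bound by (auto simp: eventually_sequentially intro!: exI[of _ 1])
  qed auto
qed

lemma powr_minus_tendsto: "(\<lambda>n. C * (real n + 1) powr (- d)) \<longlonglongrightarrow> 0"
proof -
  have "filterlim (\<lambda>n. real n + 1) at_top sequentially"
    by (intro filterlim_tendsto_add_at_top[OF tendsto_const, of _ _ 1, unfolded add.commute[of 1]] filterlim_real_sequentially)
  then have "(\<lambda>n. (real n + 1) powr (- d)) \<longlonglongrightarrow> 0" using d_pos by (intro tendsto_neg_powr) auto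
  from tendsto_mult_left[OF this, of C] show ?thesis by simp
qed

text \<open>
  Replace the conditional variance of \<open>poisson f\<close> by that of a truncation, uniformly with error
  \<open>\<eta> n\<close>, and use the law of large numbers for the truncation.
\<close>

lemma cond_var_lln:
  assumes f: "step_fn V f" and mean: "(\<integral>u. f u \<partial>unif01) = 0"
  shows "(\<lambda>N. \<integral>\<omega>. \<bar>(\<Sum>k<N. cond_var (poisson f) (S k \<omega>)) / real N - cov_form f f\<bar> \<partial>M) \<longlonglongrightarrow> 0"
    (is "?a \<longlonglongrightarrow> 0")
proof -
  have cf: "centered (3 * V) f" using mixing_step[OF f] mean by (simp add: centered_def)
  note [measurable] = centeredD(3)[OF cf]
  define c where "c = 3 * V * rho_sum"
  note gb = poisson_bound[OF cf, folded c_def] and tb = trunc_bound[OF cf, folded c_def]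
  define \<eta> where "\<eta> n = 4 * c * (c * (real n + 1) powr (- d))" for n
  have close: "\<bar>cond_var (poisson f) x - cond_var (trunc n f) x\<bar> \<le> \<eta> n" for n x
    unfolding \<eta>_def by (rule cond_var_close) (use gb tb poisson_minus_trunc[OF cf, folded c_def] in auto)
  have \<eta>: "\<eta> \<longlonglongrightarrow> 0" unfolding \<eta>_def[abs_def] using powr_minus_tendsto[of "4 * c * c"] by (simp add: mult.assoc)
  let ?v = "cond_var (poisson f)" and ?w = "\<lambda>n. cond_var (trunc n f)"
  let ?m = "\<lambda>n. \<integral>u. ?w n u \<partial>unif01"
  let ?b = "\<lambda>n N. \<integral>\<omega>. \<bar>(\<Sum>k<N. ?w n (S k \<omega>) - ?m n) / real N\<bar> \<partial>M"
  have vb: "\<bar>?v x\<bar> \<le> c\<^sup>2" "\<bar>?w n x\<bar> \<le> c\<^sup>2" for x n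
    using cond_var_bounds[of "poisson f" c x] cond_var_bounds[of "trunc n f" c x] gb tb by auto
  have mclose: "\<bar>cov_form f f - ?m n\<bar> \<le> \<eta> n" for n
  proof -
    have eq: "cov_form f f - ?m n = (\<integral>u. ?v u - ?w n u \<partial>unif01)"
      unfolding integral_cond_var_poisson[OF cf, symmetric]
      by (intro Bochner_Integration.integral_diff[symmetric] integrable_unif01[of _ "c\<^sup>2"]) (simp_all add: vb)
    have "(\<integral>u. \<bar>?v u - ?w n u\<bar> \<partial>unif01) \<le> \<eta> n" by (intro integral_abs_le close)
    then show ?thesis unfolding eq by (rule order_trans[OF integral_abs_bound])
  qed
  have le: "?a N \<le> 2 * \<eta> n + ?b n N" if N: "1 \<le> N" for n N
  proof -
    have pt: "\<bar>(\<Sum>k<N. ?v (S k \<omega>)) / real N - cov_form f f\<bar> \<le> 2 * \<eta> n + \<bar>(\<Sum>k<N. ?w n (S k \<omega>) - ?m n) / real N\<bar>" for \<omega>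
    proof -
      have "\<bar>\<Sum>k<N. ?v (S k \<omega>) - ?w n (S k \<omega>)\<bar> \<le> (\<Sum>k<N. \<eta> n)"
        by (rule order_trans[OF sum_abs sum_mono]) (rule close)
      then have "\<bar>\<Sum>k<N. ?v (S k \<omega>) - ?w n (S k \<omega>)\<bar> / real N \<le> \<eta> n" using N by (simp add: field_simps)
      then have 1: "\<bar>(\<Sum>k<N. ?v (S k \<omega>) - ?w n (S k \<omega>)) / real N\<bar> \<le> \<eta> n" using N by simp
      have "(\<Sum>k<N. ?v (S k \<omega>)) / real N - cov_form f f = (\<Sum>k<N. ?v (S k \<omega>) - ?w n (S k \<omega>)) / real N
          + (\<Sum>k<N. ?w n (S k \<omega>) - ?m n) / real N + (?m n - cov_form f f)"
        using N by (simp add: sum_subtractf field_simps)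
      then show ?thesis using 1 mclose[of n] by linarith
    qed
    have sb: "\<bar>(\<Sum>k<N. h (S k \<omega>)) / real N\<bar> \<le> C" if "\<And>x. \<bar>h x\<bar> \<le> C" for h :: "real \<Rightarrow> real" and C \<omega>
    proof -
      have "\<bar>\<Sum>k<N. h (S k \<omega>)\<bar> \<le> (\<Sum>k<N. C)" by (rule order_trans[OF sum_abs sum_mono]) (rule that)
      then show ?thesis using N by (simp add: field_simps)
    qed
    have "(\<integral>u. \<bar>?w n u\<bar> \<partial>unif01) \<le> c\<^sup>2" by (intro integral_abs_le vb(2))
    then have m2: "\<bar>?m n\<bar> \<le> c\<^sup>2" by (rule order_trans[OF integral_abs_bound])
    have wm: "\<bar>?w n x - ?m n\<bar> \<le> 2 * c\<^sup>2" for x using vb(2)[of n x] m2 by linarith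
    have i2: "integrable M (\<lambda>\<omega>. \<bar>(\<Sum>k<N. ?w n (S k \<omega>) - ?m n) / real N\<bar>)"
      using sb[of "\<lambda>x. ?w n x - ?m n", OF wm] by (intro bounded_integrable[of _ "2 * c\<^sup>2"]) auto
    have "?a N \<le> (\<integral>\<omega>. 2 * \<eta> n + \<bar>(\<Sum>k<N. ?w n (S k \<omega>) - ?m n) / real N\<bar> \<partial>M)"
    proof (rule integral_mono[OF _ _ pt])
      show "integrable M (\<lambda>\<omega>. \<bar>(\<Sum>k<N. ?v (S k \<omega>)) / real N - cov_form f f\<bar>)"
      proof (rule bounded_integrable[of _ "c\<^sup>2 + \<bar>cov_form f f\<bar>"])
        show "norm \<bar>(\<Sum>k<N. ?v (S k \<omega>)) / real N - cov_form f f\<bar> \<le> c\<^sup>2 + \<bar>cov_form f f\<bar>" for \<omega>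
          using sb[of ?v, OF vb(1), of \<omega>] unfolding real_norm_def by linarith
      qed measurable
    qed (use i2 in auto)
    also have "\<dots> = 2 * \<eta> n + ?b n N" using i2 by (simp add: prob_space)
    finally show ?thesis .
  qed
  show ?thesis
  proof (rule LIMSEQ_I)
    fix e :: real assume e: "0 < e"
    obtain n where n: "\<bar>\<eta> n\<bar> < e / 4" using LIMSEQ_D[OF \<eta>, of "e / 4"] e by auto
    have "(\<lambda>N. ?b n N) \<longlonglongrightarrow> 0" by (rule mixing_lln[OF mixing_cond_var_trunc[OF f mean]])
    moreover have "0 < e / 2" using e by simp
    ultimately have "\<exists>N0. \<forall>N\<ge>N0. norm (?b n N - 0) < e / 2" by (rule LIMSEQ_D)
    then obtain N0 where N0: "\<forall>N\<ge>N0. norm (?b n N - 0) < e / 2" by (rule exE)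
    have "norm (?a N - 0) < e" if N: "max 1 N0 \<le> N" for N
    proof -
      have 1: "1 \<le> N" "N0 \<le> N" using N by simp_all
      have "norm (?b n N - 0) < e / 2" using N0 1(2) by blast
      then have "?b n N < e / 2" unfolding real_norm_def by linarith
      then have "?a N < e" using le[OF 1(1), of n] n by linarith
      moreover have "0 \<le> ?a N" by (rule Bochner_Integration.integral_nonneg) simp
      ultimately show ?thesis unfolding real_norm_def by linarith
    qed
    then show "\<exists>N0. \<forall>N\<ge>N0. norm (?a N - 0) < e" by blast
  qed
qed

text \<open>
  If one application of the twisted operator moves \<open>1\<close> by at most \<open>\<eta>\<close>, then \<open>N\<close> applications
  move it by at most \<open>N\<close> times as much, up to the growth \<open>\<kappa> ^ N\<close> of the operator.
\<close>

lemma feynman_iter_close: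
  fixes G :: "real \<Rightarrow> real \<Rightarrow> complex"
  assumes G: "case_prod G \<in> borel_measurable (borel \<Otimes>\<^sub>M borel)" and GC: "\<And>x y. norm (G x y) \<le> \<kappa>" and \<kappa>: "1 \<le> \<kappa>"
    and le: "\<And>x. norm (feynman G (\<lambda>_. 1) x - 1) \<le> \<eta>"
  shows "norm ((feynman G ^^ N) (\<lambda>_. 1) x - 1) \<le> real N * \<kappa> ^ N * \<eta>"
proof -
  have \<eta>0: "0 \<le> \<eta>" using le[of 0] norm_ge_zero order_trans by blast
  have "(feynman G ^^ N) (\<lambda>_. 1) \<in> borel_measurable borel \<and>
      (\<forall>x. norm ((feynman G ^^ N) (\<lambda>_. 1) x) \<le> \<kappa> ^ N \<and> norm ((feynman G ^^ N) (\<lambda>_. 1) x - 1) \<le> real N * \<kappa> ^ N * \<eta>)"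
  proof (induction N)
    case (Suc N)
    define h where "h = (feynman G ^^ N) (\<lambda>_. 1)"
    have h [measurable]: "h \<in> borel_measurable borel" and hb: "norm (h x) \<le> \<kappa> ^ N"
      and hc: "norm (h x - 1) \<le> real N * \<kappa> ^ N * \<eta>" for x using Suc.IH by (auto simp: h_def)
    have Gm [measurable]: "(\<lambda>y. G x (x + y)) \<in> borel_measurable borel" for x
    proof -
      have "(\<lambda>y. case_prod G (x, x + y)) \<in> borel_measurable borel" by (rule measurable_compose[OF _ G]) measurable
      then show ?thesis by simp
    qed
    have "norm (feynman G h x - 1) \<le> real (Suc N) * \<kappa> ^ Suc N * \<eta>" for x
    proof -
      have i1: "integrable step_law (\<lambda>y. G x (x + y) * h (x + y))"
        using GC hb \<kappa> by (intro integral_step_law_bounded[of _ "\<kappa> * \<kappa> ^ N"]) (auto simp: norm_mult intro!: mult_mono)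
      have i2: "integrable step_law (\<lambda>y. G x (x + y))"
        using GC by (intro integral_step_law_bounded[of _ "\<kappa>"]) auto
      have "feynman G h x - feynman G (\<lambda>_. 1) x = feynman G (\<lambda>y. h y - 1) x"
        using i1 i2 by (simp add: feynman_def right_diff_distrib)
      moreover have "norm (feynman G (\<lambda>y. h y - 1) x) \<le> \<kappa> * (real N * \<kappa> ^ N * \<eta>)"
        by (rule feynman_bound[OF GC hc])
      ultimately have "norm (feynman G h x - 1) \<le> \<kappa> * (real N * \<kappa> ^ N * \<eta>) + \<eta>"
        using le[of x] norm_triangle_ineq[of "feynman G h x - feynman G (\<lambda>_. 1) x" "feynman G (\<lambda>_. 1) x - 1"]
        by (simp del: One_nat_def add: algebra_simps)
      moreover have "1 * \<eta> \<le> \<kappa> ^ Suc N * \<eta>" using \<eta>0 one_le_power[OF \<kappa>, of "Suc N"] by (intro mult_right_mono)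
      moreover have "\<kappa> * (real N * \<kappa> ^ N * \<eta>) + \<kappa> ^ Suc N * \<eta> = real (Suc N) * \<kappa> ^ Suc N * \<eta>" by (simp add: algebra_simps)
      ultimately show ?thesis by linarith
    qed
    moreover have "norm (feynman G h x) \<le> \<kappa> ^ Suc N" for x using feynman_bound[OF GC hb] by simp
    ultimately show ?case using feynman_measurable[OF G h] by (simp add: h_def)
  qed simp
  then show ?thesis by blast
qed

lemma cis_second_order: "norm (cis x - (1 + \<i> * of_real x - of_real (x\<^sup>2 / 2))) \<le> \<bar>x\<bar> ^ 3 / 6"
proof -
  have "(\<Sum>k\<le>2. (\<i> * complex_of_real x) ^ k / fact k) = 1 + \<i> * of_real x - of_real (x\<^sup>2 / 2)"
    by (simp add: eval_nat_numeral atMost_Suc power2_eq_square algebra_simps)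
  then show ?thesis using iexp_approx1[of x 2] by (simp add: cis_conv_exp eval_nat_numeral)
qed

lemma cis_diff_le: "norm (cis a - cis b) \<le> \<bar>a - b\<bar>"
proof -
  have "cis a - cis b = cis b * (cis (a - b) - 1)" by (simp add: algebra_simps cis_mult)
  moreover have "norm (cis (a - b) - 1) \<le> \<bar>a - b\<bar>" using iexp_approx1[of "a - b" 0] by (simp add: cis_conv_exp)
  ultimately show ?thesis by (simp add: norm_mult)
qed

text \<open>
  The weight \<open>exp (\<i> r D + r\<^sup>2 v / 2)\<close>, with \<open>D\<close> a martingale difference and \<open>v\<close> its
  conditional variance, has conditional mean \<open>1 + O(r\<^sup>3)\<close>: the first order terms vanish and
  the second order terms cancel.
\<close>

lemma feynman_clt_step:
  fixes r :: real
  assumes [measurable]: "g \<in> borel_measurable borel" and c: "\<And>x. \<bar>g x\<bar> \<le> c"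
    and r: "0 \<le> r" "r \<le> 1" "r\<^sup>2 * c\<^sup>2 \<le> 1"
  defines "G \<equiv> \<lambda>x y. exp (\<i> * of_real (r * mdiff g x y) + of_real (r\<^sup>2 * cond_var g x / 2))"
  shows "norm (feynman G (\<lambda>_. 1) x - 1) \<le> (3 * c ^ 3 + c ^ 4) * r ^ 3"
proof -
  interpret L: prob_space step_law by (rule prob_space_step_law)
  have c0: "0 \<le> c" using c[of 0] by linarith
  let ?d = "\<lambda>y. mdiff g x (x + y)"
  have dm [measurable]: "?d \<in> borel_measurable borel" unfolding mdiff_def by measurable
  have db: "\<bar>?d y\<bar> \<le> 2 * c" for y by (rule mdiff_bound[OF c])
  define a where "a = r\<^sup>2 * cond_var g x / 2"
  have v: "0 \<le> cond_var g x" "cond_var g x \<le> c\<^sup>2" using cond_var_bounds[OF assms(1) c] by auto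
  have a: "0 \<le> a" "a \<le> r\<^sup>2 * c\<^sup>2 / 2" using v r by (auto simp: a_def intro!: mult_left_mono divide_right_mono)
  have a1: "a \<le> 1 / 2" using a r by linarith
  define I where "I = (\<integral>y. cis (r * ?d y) \<partial>step_law)"
  have eq: "feynman G (\<lambda>_. 1) x = of_real (exp a) * I"
    unfolding feynman_def G_def I_def a_def[symmetric] exp_of_real[symmetric] cis_conv_exp
    by (simp only: exp_add mult_1_right Bochner_Integration.integral_mult_left_zero) (rule mult.commute)
  have i1: "integrable step_law (\<lambda>y. cis (r * ?d y))"
    by (intro integral_step_law_bounded[of _ 1]) (auto simp: cis_conv_exp)
  have i2: "integrable step_law ?d" using db by (intro integral_step_law_bounded[of _ "2 * c"]) auto
  have i3: "integrable step_law (\<lambda>y. (?d y)\<^sup>2)"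
  proof (rule integral_step_law_bounded[of _ "(2 * c)\<^sup>2"])
    have "(?d y)\<^sup>2 \<le> (2 * c)\<^sup>2" for y using db[of y] c0 by (simp only: power2_le_iff_abs_le)
    then show "norm ((?d y)\<^sup>2) \<le> (2 * c)\<^sup>2" for y by simp
  qed measurable
  let ?p = "\<lambda>y. 1 + \<i> * of_real (r * ?d y) - complex_of_real ((r * ?d y)\<^sup>2 / 2)"
  define A where "A y = complex_of_real (?d y)" for y
  define B where "B y = complex_of_real ((?d y)\<^sup>2)" for y
  have A: "integrable step_law A" "(\<integral>y. A y \<partial>step_law) = 0"
    using i2 mdiff_moments(1)[OF assms(1), of c x] c unfolding A_def[abs_def] by auto
  have B: "integrable step_law B" "(\<integral>y. B y \<partial>step_law) = of_real (cond_var g x)"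
    using i3 mdiff_moments(2)[OF assms(1), of c x] c unfolding B_def[abs_def] integral_complex_of_real
    by (auto simp del: of_real_power)
  have pAB: "?p = (\<lambda>y. 1 + \<i> * of_real r * A y - of_real (r\<^sup>2 / 2) * B y)"
    by (rule ext) (simp add: A_def B_def power_mult_distrib)
  have p: "(\<integral>y. ?p y \<partial>step_law) = 1 - of_real a"
    unfolding pAB using A B L.prob_space by (simp add: a_def)
  have i4: "integrable step_law ?p" unfolding pAB using A B by simp
  have "I - (1 - of_real a) = (\<integral>y. cis (r * ?d y) - ?p y \<partial>step_law)"
    unfolding I_def p[symmetric] by (rule Bochner_Integration.integral_diff[symmetric, OF i1 i4])
  also have "norm \<dots> \<le> (r * (2 * c)) ^ 3 / 6"
  proof (rule L.norm_expectation_le)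
    have "\<bar>r * ?d y\<bar> \<le> r * (2 * c)" for y using db r by (simp add: abs_mult mult_left_mono)
    then have "\<bar>r * ?d y\<bar> ^ 3 / 6 \<le> (r * (2 * c)) ^ 3 / 6" for y by (intro divide_right_mono power_mono) auto
    then show "norm (cis (r * ?d y) - ?p y) \<le> (r * (2 * c)) ^ 3 / 6" for y
      using order_trans[OF cis_second_order] by blast
  qed (use r c0 in simp)
  finally have I: "norm (I - (1 - of_real a)) \<le> 4 / 3 * (c ^ 3 * r ^ 3)" by (simp add: power_mult_distrib mult_ac)
  have e2: "exp a \<le> 2" using a1 exp_half_le2 by (metis exp_le_cancel_iff order_trans)
  have ea: "\<bar>exp a * (1 - a) - 1\<bar> \<le> a\<^sup>2"
  proof -
    have "1 - a \<le> exp (- a)" using exp_ge_add_one_self[of "- a"] by simp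
    then have "exp a * (1 - a) \<le> 1" by (simp add: exp_minus field_simps)
    moreover have "(1 + a) * (1 - a) \<le> exp a * (1 - a)" using exp_ge_add_one_self[of a] a1 by (intro mult_right_mono) auto
    moreover have "(1 + a) * (1 - a) = 1 - a\<^sup>2" by (simp add: power2_eq_square algebra_simps)
    ultimately show ?thesis by (simp add: abs_le_iff)
  qed
  have "a\<^sup>2 \<le> (r\<^sup>2 * c\<^sup>2 / 2)\<^sup>2" using a by (intro power_mono) auto
  also have "\<dots> = (r * r ^ 3) * c ^ 4 / 4" by (simp add: power2_eq_square eval_nat_numeral)
  also have "\<dots> \<le> r ^ 3 * c ^ 4 / 4" using r by (intro divide_right_mono mult_right_mono mult_left_le_one_le) auto
  also have "\<dots> \<le> c ^ 4 * r ^ 3"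
  proof -
    have "0 \<le> r ^ 3 * c ^ 4" using r c0 by simp
    then show ?thesis by (simp add: mult.commute)
  qed
  finally have a2: "a\<^sup>2 \<le> c ^ 4 * r ^ 3" .
  have "feynman G (\<lambda>_. 1) x - 1 = of_real (exp a) * (I - (1 - of_real a)) + of_real (exp a * (1 - a) - 1)"
    unfolding eq by (simp add: algebra_simps)
  then have "norm (feynman G (\<lambda>_. 1) x - 1) \<le> exp a * norm (I - (1 - of_real a)) + \<bar>exp a * (1 - a) - 1\<bar>"
    using norm_triangle_ineq[of "of_real (exp a) * (I - (1 - of_real a))" "of_real (exp a * (1 - a) - 1)"]
    by (simp add: norm_mult del: of_real_diff of_real_mult)
  also have "\<dots> \<le> 2 * (4 / 3 * (c ^ 3 * r ^ 3)) + c ^ 4 * r ^ 3"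
    using e2 I ea a2 by (intro add_mono mult_mono) auto
  also have "\<dots> \<le> (3 * c ^ 3 + c ^ 4) * r ^ 3" using r c0 by (simp add: algebra_simps)
  finally show ?thesis .
qed

lemma exp_diff_le: "a \<le> m \<Longrightarrow> b \<le> m \<Longrightarrow> \<bar>exp a - exp b\<bar> \<le> exp m * \<bar>a - b :: real\<bar>"
proof (induction a b rule: linorder_wlog)
  case (le a b)
  have "exp b * (1 + (a - b)) \<le> exp b * exp (a - b)" by (intro mult_left_mono exp_ge_add_one_self) auto
  then have "exp b - exp a \<le> exp b * (b - a)" by (simp add: exp_diff algebra_simps)
  also have "\<dots> \<le> exp m * (b - a)" using le by (intro mult_right_mono) auto
  finally show ?case using le by simp
qed (simp add: abs_minus_commute)

text \<open>
  With \<open>r = 1 / sqrt N\<close> the product of the compensated weights has expectation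
  \<open>1 + O(1 / sqrt N)\<close>. In this product the random normalised sum of conditional variances can be
  replaced by its limit \<open>\<sigma>\<close> at the cost of the error in the law of large numbers, and the
  martingale by the original sum at the cost of a bounded boundary term.
\<close>

theorem clt_step_fn:
  assumes f: "step_fn V f" and mean: "(\<integral>u. f u \<partial>unif01) = 0"
  shows "(\<lambda>N. \<integral>\<omega>. cis ((\<Sum>k<N. f (S (Suc k) \<omega>)) / sqrt (real N)) \<partial>M)
     \<longlonglongrightarrow> complex_of_real (exp (- cov_form f f / 2))"
proof -
  have cf: "centered (3 * V) f" using mixing_step[OF f] mean by (simp add: centered_def)
  note [measurable] = centeredD(3)[OF cf]
  define c where "c = 3 * V * rho_sum"
  note gb = poisson_bound[OF cf, folded c_def]
  let ?g = "poisson f" and ?v = "cond_var (poisson f)"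
  have c0: "0 \<le> c" using gb[of 0] by linarith
  have vb: "0 \<le> ?v x" "?v x \<le> c\<^sup>2" for x using cond_var_bounds[of "poisson f" c x] gb by auto
  define \<sigma> where "\<sigma> = cov_form f f"
  have "(\<integral>u. \<bar>?v u\<bar> \<partial>unif01) \<le> c\<^sup>2" by (intro integral_abs_le) (use vb in auto)
  then have "\<bar>\<integral>u. ?v u \<partial>unif01\<bar> \<le> c\<^sup>2" by (rule order_trans[OF integral_abs_bound])
  then have \<sigma>: "\<sigma> \<le> c\<^sup>2" unfolding \<sigma>_def integral_cond_var_poisson[OF cf, symmetric] by linarith
  define C0 where "C0 = 3 * c ^ 3 + c ^ 4"
  define V' where "V' N \<omega> = (\<Sum>k<N. ?v (S k \<omega>)) / real N" for N \<omega>
  define D where "D N \<omega> = (\<Sum>k<N. mdiff ?g (S k \<omega>) (S (Suc k) \<omega>))" for N \<omega>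
  define F where "F N \<omega> = (\<Sum>k<N. f (S (Suc k) \<omega>))" for N \<omega>
  have [measurable]: "V' N \<in> borel_measurable M" "D N \<in> borel_measurable M" "F N \<in> borel_measurable M" for N
    unfolding V'_def[abs_def] D_def[abs_def] F_def[abs_def] mdiff_def by measurable
  have FD: "\<bar>F N \<omega> - D N \<omega>\<bar> \<le> 2 * c" for N \<omega>
    unfolding F_def D_def c_def by (rule martingale_approximation[OF cf])
  let ?\<Phi> = "\<lambda>N. \<integral>\<omega>. cis (F N \<omega> / sqrt (real N)) \<partial>M"
  let ?L = "\<lambda>N. \<integral>\<omega>. \<bar>V' N \<omega> - \<sigma>\<bar> \<partial>M"
  (* The three errors come from the boundary term, from replacing V' by its limit, and from the
     expectation of the compensated product. *)
  have main: "norm (of_real (exp (\<sigma> / 2)) * ?\<Phi> N - 1) \<le> exp (c\<^sup>2 / 2) * (2 * c / sqrt N + ?L N / 2 + C0 / sqrt N)"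
    if N: "1 \<le> N" "c\<^sup>2 \<le> real N" for N
  proof -
    define r where "r = 1 / sqrt (real N)"
    have r: "0 \<le> r" "r \<le> 1" "r\<^sup>2 * c\<^sup>2 \<le> 1" "real N * r\<^sup>2 = 1" using N by (auto simp: r_def power_divide)
    define G where "G = (\<lambda>x y. exp (\<i> * of_real (r * mdiff ?g x y) + of_real (r\<^sup>2 * ?v x / 2)))"
    have Gm: "case_prod G \<in> borel_measurable (borel \<Otimes>\<^sub>M borel)"
      unfolding G_def by (simp add: case_prod_beta')
    define \<kappa> where "\<kappa> = exp (r\<^sup>2 * c\<^sup>2 / 2)"
    have \<kappa>1: "1 \<le> \<kappa>" by (simp add: \<kappa>_def)
    have GC: "norm (G x y) \<le> \<kappa>" for x y
      using vb(2)[of x] by (simp add: G_def \<kappa>_def norm_exp_eq_Re mult_left_mono)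
    have "norm ((feynman G ^^ N) (\<lambda>_. 1) 0 - 1) \<le> real N * \<kappa> ^ N * (C0 * r ^ 3)"
      unfolding C0_def G_def
      by (rule feynman_iter_close[OF Gm[unfolded G_def] GC[unfolded G_def] \<kappa>1 feynman_clt_step[OF _ gb r(1-3)]]) measurable
    also have "\<kappa> ^ N = exp (c\<^sup>2 / 2)"
      unfolding \<kappa>_def exp_of_nat_mult[symmetric] using r(4) by (metis mult.assoc mult_1 times_divide_eq_right)
    also have "real N * exp (c\<^sup>2 / 2) * (C0 * r ^ 3) = exp (c\<^sup>2 / 2) * (C0 * r) * (real N * r\<^sup>2)"
      by (simp add: power2_eq_square eval_nat_numeral)
    also have "\<dots> = exp (c\<^sup>2 / 2) * (C0 / sqrt N)" unfolding r(4) by (simp add: r_def)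
    finally have A1: "norm ((feynman G ^^ N) (\<lambda>_. 1) 0 - 1) \<le> exp (c\<^sup>2 / 2) * (C0 / sqrt N)" .
    have "(feynman G ^^ N) (\<lambda>_. 1) 0 = (\<integral>\<omega>. (\<Prod>k<N. G (S k \<omega>) (S (Suc k) \<omega>)) * (\<lambda>_. 1) (S N \<omega>) \<partial>M)"
      by (rule feynman_kac[OF Gm GC, symmetric, of _ 1]) auto
    also have "\<dots> = (\<integral>\<omega>. cis (r * D N \<omega>) * of_real (exp (V' N \<omega> / 2)) \<partial>M)"
    proof (intro Bochner_Integration.integral_cong refl)
      fix \<omega>
      have "(\<Prod>k<N. G (S k \<omega>) (S (Suc k) \<omega>)) = exp (\<Sum>k<N. \<i> * of_real (r * mdiff ?g (S k \<omega>) (S (Suc k) \<omega>)) + of_real (r\<^sup>2 * ?v (S k \<omega>) / 2))"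
        unfolding G_def by (rule exp_sum[symmetric]) simp
      also have "(\<Sum>k<N. \<i> * of_real (r * mdiff ?g (S k \<omega>) (S (Suc k) \<omega>)) + of_real (r\<^sup>2 * ?v (S k \<omega>) / 2)) =
          \<i> * of_real (r * D N \<omega>) + complex_of_real (r\<^sup>2 * (\<Sum>k<N. ?v (S k \<omega>)) / 2)"
        by (simp add: D_def sum.distrib sum_distrib_left sum_divide_distrib)
      also have "r\<^sup>2 * (\<Sum>k<N. ?v (S k \<omega>)) = V' N \<omega>" using N by (simp add: V'_def r_def power_divide)
      finally show "(\<Prod>k<N. G (S k \<omega>) (S (Suc k) \<omega>)) * 1 = cis (r * D N \<omega>) * of_real (exp (V' N \<omega> / 2))"
        by (simp add: exp_add cis_conv_exp flip: exp_of_real)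
    qed
    finally have A2: "(feynman G ^^ N) (\<lambda>_. 1) 0 = \<dots>" .
    have V'b: "V' N \<omega> \<le> c\<^sup>2" for \<omega>
    proof -
      have "(\<Sum>k<N. ?v (S k \<omega>)) \<le> (\<Sum>k<N. c\<^sup>2)" by (intro sum_mono vb)
      then show ?thesis using N by (simp add: V'_def field_simps)
    qed
    have V'0: "0 \<le> V' N \<omega>" for \<omega> unfolding V'_def using vb by (intro divide_nonneg_nonneg sum_nonneg) auto
    have iV: "integrable M (\<lambda>\<omega>. \<bar>V' N \<omega> - \<sigma>\<bar>)"
    proof (rule bounded_integrable[of _ "c\<^sup>2 + \<bar>\<sigma>\<bar>"])
      show "norm \<bar>V' N \<omega> - \<sigma>\<bar> \<le> c\<^sup>2 + \<bar>\<sigma>\<bar>" for \<omega> using V'b[of \<omega>] V'0[of \<omega>] unfolding real_norm_def by linarith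
    qed measurable
    define E where "E \<omega> = of_real (exp (\<sigma> / 2)) * cis (F N \<omega> / sqrt (real N)) - cis (r * D N \<omega>) * complex_of_real (exp (V' N \<omega> / 2))" for \<omega>
    define R where "R \<omega> = exp (c\<^sup>2 / 2) * (2 * c / sqrt N + \<bar>V' N \<omega> - \<sigma>\<bar> / 2)" for \<omega>
    have i1: "integrable M (\<lambda>\<omega>. cis (F N \<omega> / sqrt (real N)))"
      by (rule bounded_integrable[of _ 1]) (auto simp: cis_conv_exp)
    have i2: "integrable M (\<lambda>\<omega>. cis (r * D N \<omega>) * complex_of_real (exp (V' N \<omega> / 2)))"
    proof (rule bounded_integrable[of _ "exp (c\<^sup>2 / 2)"])
      show "norm (cis (r * D N \<omega>) * complex_of_real (exp (V' N \<omega> / 2))) \<le> exp (c\<^sup>2 / 2)" for \<omega>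
        using V'b[of \<omega>] by (simp add: norm_mult)
    qed (simp add: cis_conv_exp)
    have eqE: "of_real (exp (\<sigma> / 2)) * ?\<Phi> N - (feynman G ^^ N) (\<lambda>_. 1) 0 = (\<integral>\<omega>. E \<omega> \<partial>M)"
      unfolding A2 E_def using i1 i2 by simp
    have ER: "norm (E \<omega>) \<le> R \<omega>" for \<omega>
    proof -
      have 1: "norm (cis (F N \<omega> / sqrt (real N)) - cis (r * D N \<omega>)) \<le> 2 * c / sqrt N"
      proof -
        have "F N \<omega> / sqrt (real N) - r * D N \<omega> = (F N \<omega> - D N \<omega>) / sqrt N"
          by (simp add: r_def diff_divide_distrib)
        then have "\<bar>F N \<omega> / sqrt (real N) - r * D N \<omega>\<bar> = \<bar>F N \<omega> - D N \<omega>\<bar> / sqrt N" by simp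
        also have "\<dots> \<le> 2 * c / sqrt N" by (intro divide_right_mono FD) auto
        finally show ?thesis using cis_diff_le order_trans by blast
      qed
      have 2: "\<bar>exp (\<sigma> / 2) - exp (V' N \<omega> / 2)\<bar> \<le> exp (c\<^sup>2 / 2) * (\<bar>V' N \<omega> - \<sigma>\<bar> / 2)"
      proof -
        have "\<bar>\<sigma> / 2 - V' N \<omega> / 2\<bar> = \<bar>V' N \<omega> - \<sigma>\<bar> / 2" by (auto simp: abs_if field_simps)
        moreover have "\<bar>exp (\<sigma> / 2) - exp (V' N \<omega> / 2)\<bar> \<le> exp (c\<^sup>2 / 2) * \<bar>\<sigma> / 2 - V' N \<omega> / 2\<bar>"
          using \<sigma> V'b[of \<omega>] by (intro exp_diff_le) auto
        ultimately show ?thesis by (simp only:)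
      qed
      have "E \<omega> = of_real (exp (\<sigma> / 2)) * (cis (F N \<omega> / sqrt (real N)) - cis (r * D N \<omega>))
          + cis (r * D N \<omega>) * complex_of_real (exp (\<sigma> / 2) - exp (V' N \<omega> / 2))"
        unfolding E_def of_real_diff by (simp only: algebra_simps)
      then have "norm (E \<omega>) \<le> norm (of_real (exp (\<sigma> / 2)) * (cis (F N \<omega> / sqrt (real N)) - cis (r * D N \<omega>)))
          + norm (cis (r * D N \<omega>) * complex_of_real (exp (\<sigma> / 2) - exp (V' N \<omega> / 2)))"
        by (simp only: norm_triangle_ineq)
      also have "\<dots> = exp (\<sigma> / 2) * norm (cis (F N \<omega> / sqrt (real N)) - cis (r * D N \<omega>)) + \<bar>exp (\<sigma> / 2) - exp (V' N \<omega> / 2)\<bar>"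
        by (simp only: norm_mult norm_of_real norm_cis abs_exp_cancel mult_1_left)
      also have "\<dots> \<le> exp (c\<^sup>2 / 2) * (2 * c / sqrt N) + exp (c\<^sup>2 / 2) * (\<bar>V' N \<omega> - \<sigma>\<bar> / 2)"
        using 1 2 \<sigma> by (intro add_mono mult_mono) auto
      finally show ?thesis by (simp add: R_def distrib_left)
    qed
    have iR: "integrable M R" unfolding R_def[abs_def] using iV by auto
    have Em: "E \<in> borel_measurable M" unfolding E_def[abs_def] cis_conv_exp by measurable
    have iE: "integrable M (\<lambda>\<omega>. norm (E \<omega>))"
    proof (rule Bochner_Integration.integrable_bound[OF iR])
      show "AE \<omega> in M. norm (norm (E \<omega>)) \<le> norm (R \<omega>)"
      proof (rule AE_I2)
        show "norm (norm (E \<omega>)) \<le> norm (R \<omega>)" for \<omega>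
          unfolding real_norm_def abs_norm_cancel using ER[of \<omega>] by linarith
      qed
    qed (use Em in measurable)
    have "norm (\<integral>\<omega>. E \<omega> \<partial>M) \<le> (\<integral>\<omega>. norm (E \<omega>) \<partial>M)" by (rule integral_norm_bound)
    also have "\<dots> \<le> (\<integral>\<omega>. R \<omega> \<partial>M)" by (rule integral_mono[OF iE iR ER])
    also have "\<dots> = exp (c\<^sup>2 / 2) * (2 * c / sqrt N + ?L N / 2)" unfolding R_def using iV by (simp add: prob_space)
    finally have E2: "norm (of_real (exp (\<sigma> / 2)) * ?\<Phi> N - (feynman G ^^ N) (\<lambda>_. 1) 0) \<le> \<dots>" unfolding eqE .
    have "norm (of_real (exp (\<sigma> / 2)) * ?\<Phi> N - 1) \<le> norm (of_real (exp (\<sigma> / 2)) * ?\<Phi> N - (feynman G ^^ N) (\<lambda>_. 1) 0)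
        + norm ((feynman G ^^ N) (\<lambda>_. 1) 0 - 1)"
      using norm_triangle_ineq[of "of_real (exp (\<sigma> / 2)) * ?\<Phi> N - (feynman G ^^ N) (\<lambda>_. 1) 0" "(feynman G ^^ N) (\<lambda>_. 1) 0 - 1"]
      by (simp only: diff_add_cancel add_diff_eq)
    also have "\<dots> \<le> exp (c\<^sup>2 / 2) * (2 * c / sqrt N + ?L N / 2) + exp (c\<^sup>2 / 2) * (C0 / sqrt N)"
      by (intro add_mono E2 A1)
    finally show ?thesis by (simp only: distrib_left)
  qed
  have L0: "?L \<longlonglongrightarrow> 0" using cond_var_lln[OF f mean] by (simp add: V'_def \<sigma>_def)
  have "(\<lambda>N. exp (c\<^sup>2 / 2) * (2 * c / sqrt (real N) + ?L N / 2 + C0 / sqrt (real N))) \<longlonglongrightarrow> exp (c\<^sup>2 / 2) * (0 + 0 / 2 + 0)"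
    by (intro tendsto_intros one_over_sqrt_tendsto L0) simp
  then have lim: "(\<lambda>N. exp (c\<^sup>2 / 2) * (2 * c / sqrt (real N) + ?L N / 2 + C0 / sqrt (real N))) \<longlonglongrightarrow> 0"
    by (simp only: add_0 div_0 mult_zero_right)
  have ev: "\<forall>\<^sub>F N in sequentially. norm (of_real (exp (\<sigma> / 2)) * ?\<Phi> N - 1) \<le> exp (c\<^sup>2 / 2) * (2 * c / sqrt N + ?L N / 2 + C0 / sqrt N)"
  proof (rule eventually_sequentiallyI)
    fix N assume "max 1 (nat \<lceil>c\<^sup>2\<rceil>) \<le> N"
    then show "norm (of_real (exp (\<sigma> / 2)) * ?\<Phi> N - 1) \<le> exp (c\<^sup>2 / 2) * (2 * c / sqrt N + ?L N / 2 + C0 / sqrt N)"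
      by (intro main) (auto simp: nat_le_iff ceiling_le_iff)
  qed
  have 0: "(\<lambda>N. of_real (exp (\<sigma> / 2)) * ?\<Phi> N - 1) \<longlonglongrightarrow> 0" by (rule Lim_null_comparison[OF ev lim])
  have "(\<lambda>N. of_real (exp (- \<sigma> / 2)) * (of_real (exp (\<sigma> / 2)) * ?\<Phi> N - 1) + of_real (exp (- \<sigma> / 2))) \<longlonglongrightarrow>
      complex_of_real (exp (- \<sigma> / 2)) * 0 + of_real (exp (- \<sigma> / 2))"
    by (rule tendsto_add[OF tendsto_mult[OF tendsto_const 0] tendsto_const])
  moreover have "(\<lambda>N. of_real (exp (- \<sigma> / 2)) * (of_real (exp (\<sigma> / 2)) * ?\<Phi> N - 1) + of_real (exp (- \<sigma> / 2))) = ?\<Phi>"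
  proof
    fix N
    have "exp (- \<sigma> / 2) * exp (\<sigma> / 2) = 1" by (simp flip: exp_add)
    then have "complex_of_real (exp (- \<sigma> / 2)) * of_real (exp (\<sigma> / 2)) = 1"
      by (simp only: of_real_mult[symmetric] of_real_1)
    then show "of_real (exp (- \<sigma> / 2)) * (of_real (exp (\<sigma> / 2)) * ?\<Phi> N - 1) + of_real (exp (- \<sigma> / 2)) = ?\<Phi> N"
      by (simp only: right_diff_distrib mult.assoc[symmetric] mult_1_left mult_1_right diff_add_cancel)
  qed
  ultimately show ?thesis unfolding F_def[abs_def] \<sigma>_def by (simp only: mult_zero_right add_0)
qed

end

section \<open>The covariance form and the empirical process\<close>

lemma step_fn_mono:
  assumes "step_fn V f" "V \<le> W" shows "step_fn W f"
proof -
  let ?c = "(W - V) / 2"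
  have "step_fn (V + (\<bar>?c\<bar> + \<bar>- ?c\<bar>)) (\<lambda>x. f x + (?c + - ?c))"
    by (intro step_add assms(1) step_fn_const)
  then show ?thesis using assms(2) by simp
qed

abbreviation cind :: "real \<Rightarrow> real \<Rightarrow> real" where "cind t \<equiv> centered_indicator {0..<t}"

lemma cind_eq: "0 \<le> t \<Longrightarrow> cind t x = indicator {0..<t} (frac x) - t"
  by (simp add: centered_indicator_def)

lemma step_fn_cind:
  assumes "0 \<le> t" "t \<le> 1" shows "step_fn 2 (cind t)"
proof -
  have "cind t = (\<lambda>x. indicator {0..<t} (frac x) + - t)" using assms by (simp add: fun_eq_iff cind_eq)
  moreover have "step_fn (1 + \<bar>- t\<bar>) (\<lambda>x. indicator {0..<t} (frac x) + - t)"
    by (intro step_add step_indicator step_fn_const assms)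
  ultimately show ?thesis using step_fn_mono[of "1 + \<bar>- t\<bar>" "cind t" 2] assms by simp
qed

lemma integral_cind:
  assumes "0 \<le> t" "t \<le> 1" shows "(\<integral>u. cind t u \<partial>unif01) = 0"
proof -
  interpret U: prob_space unif01 by (rule prob_space_unif01)
  have "integrable unif01 (\<lambda>u. indicator {0..<t} (frac u) :: real)"
    by (rule integrable_unif01[of _ 1]) (auto simp: indicator_def)
  then show ?thesis using U.prob_space assms
    by (simp add: cind_eq integral_unif01_indicator)
qed

lemma step_fn_cind_diff:
  assumes "0 \<le> s" "s \<le> t" "t \<le> 1" shows "step_fn 4 (\<lambda>x. cind t x - cind s x)"
  using step_add[OF step_fn_cind[of t] step_scale[OF step_fn_cind[of s], of "-1"]] assms by simp

lemma integral_abs_cind_diff: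
  assumes st: "0 \<le> s" "s \<le> t" "t \<le> 1" shows "(\<integral>u. \<bar>cind t u - cind s u\<bar> \<partial>unif01) \<le> 2 * (t - s)"
proof -
  interpret U: prob_space unif01 by (rule prob_space_unif01)
  have i: "integrable unif01 (\<lambda>u. indicator {0..<p} (frac u) :: real)" for p
    by (rule integrable_unif01[of _ 1]) (auto simp: indicator_def)
  have [measurable]: "cind t \<in> borel_measurable borel" "cind s \<in> borel_measurable borel"
    using step_fn_measurable[OF step_fn_cind] st by auto
  have "(\<integral>u. \<bar>cind t u - cind s u\<bar> \<partial>unif01) \<le> (\<integral>u. (indicator {0..<t} (frac u) - indicator {0..<s} (frac u)) + (t - s) \<partial>unif01)"
  proof (rule integral_mono)
    show "integrable unif01 (\<lambda>u. \<bar>cind t u - cind s u\<bar>)"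
      using step_fn_bound[OF step_fn_cind_diff[OF st]] by (intro integrable_unif01[of _ 4]) auto
    show "integrable unif01 (\<lambda>u. (indicator {0..<t} (frac u) - indicator {0..<s} (frac u)) + (t - s))"
      using i by auto
    show "\<bar>cind t u - cind s u\<bar> \<le> (indicator {0..<t} (frac u) - indicator {0..<s} (frac u)) + (t - s)" for u
      using st by (auto simp: cind_eq indicator_def)
  qed
  also have "\<dots> = 2 * (t - s)"
    using i st U.prob_space by (simp add: integral_unif01_indicator)
  finally show ?thesis .
qed

text \<open>
  The domain on which the covariance form is bilinear and positive semidefinite.
\<close>

definition mean0_step :: "(real \<Rightarrow> real) \<Rightarrow> bool" where
  "mean0_step f \<longleftrightarrow> (\<exists>V. step_fn V f) \<and> (\<integral>u. f u \<partial>unif01) = 0"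

lemma mean0_stepD: "mean0_step f \<Longrightarrow> f \<in> borel_measurable borel" "mean0_step f \<Longrightarrow> integrable unif01 f"
proof -
  show "mean0_step f \<Longrightarrow> f \<in> borel_measurable borel" using step_fn_measurable by (auto simp: mean0_step_def)
  assume "mean0_step f"
  then obtain V where "step_fn V f" by (auto simp: mean0_step_def)
  then show "integrable unif01 f"
    using step_fn_measurable step_fn_bound by (intro integrable_unif01[of _ V]) auto
qed

lemma mean0_step_cind: "0 \<le> t \<Longrightarrow> t \<le> 1 \<Longrightarrow> mean0_step (cind t)"
  using step_fn_cind integral_cind unfolding mean0_step_def by blast

lemma mean0_step_scale: "mean0_step f \<Longrightarrow> mean0_step (\<lambda>x. c * f x)"
  unfolding mean0_step_def using step_scale by fastforce

lemma mean0_step_add: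
  assumes "mean0_step f" "mean0_step g" shows "mean0_step (\<lambda>x. f x + g x)"
  using assms mean0_stepD(2)[OF assms(1)] mean0_stepD(2)[OF assms(2)] unfolding mean0_step_def
  by (auto intro: step_add)

lemma mean0_step_zero: "mean0_step (\<lambda>_. 0)"
  unfolding mean0_step_def using step_fn_const[of 0] by auto

lemma mean0_step_sum: "finite I \<Longrightarrow> (\<And>i. i \<in> I \<Longrightarrow> mean0_step (f i)) \<Longrightarrow> mean0_step (\<lambda>x. \<Sum>i\<in>I. f i x)"
  by (induction I rule: finite_induct) (auto intro: mean0_step_zero mean0_step_add)

lemma mean0_step_diff: "mean0_step f \<Longrightarrow> mean0_step g \<Longrightarrow> mean0_step (\<lambda>x. f x - g x)"
  using mean0_step_add[of f "\<lambda>x. - 1 * g x"] mean0_step_scale[of g "-1"] by simp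

context mixing_walk begin

lemma mean0_step_centered: "mean0_step f \<Longrightarrow> \<exists>B. centered B f"
  using mixing_step by (auto simp: mean0_step_def centered_def)

lemma cov_form_commute: "cov_form f h = cov_form h f"
  by (simp add: cov_form_def mult.commute)

lemma mean0_step_correlation_summable:
  assumes "mean0_step f" "mean0_step h"
  shows "summable (\<lambda>k. \<integral>u. h u * Q (Suc k) f u \<partial>unif01)" "integrable unif01 (\<lambda>u. h u * Q k f u)"
proof -
  obtain B C where f: "centered B f" and h: "centered C h" using assms mean0_step_centered by blast
  note [measurable] = centeredD(3)[OF f] centeredD(3)[OF h]
  from correlation_summable[OF f centeredD(3,5)[OF h]]
  show "summable (\<lambda>k. \<integral>u. h u * Q (Suc k) f u \<partial>unif01)" by (subst summable_Suc_iff)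
  show "integrable unif01 (\<lambda>u. h u * Q k f u)"
  proof (rule integrable_unif01[of _ "C * B"])
    show "norm (h u * Q k f u) \<le> C * B" for u
      unfolding real_norm_def abs_mult
      by (intro mult_mono centeredD(5)[OF h] Q_bound centeredD(5)[OF f] centeredD(6)[OF h] abs_ge_zero)
  qed measurable
qed

lemma cov_form_scale: "cov_form (\<lambda>x. c * f x) h = c * cov_form f h" if "mean0_step f" "mean0_step h"
  using mean0_step_correlation_summable[OF that(1,2)] mean0_step_correlation_summable[OF that(2,1)]
  by (simp add: cov_form_def Q_scale[abs_def] mult.assoc mult.left_commute[of _ c] suminf_mult algebra_simps)

lemma cov_form_add:
  assumes f: "mean0_step f" and g: "mean0_step g" and h: "mean0_step h"
  shows "cov_form (\<lambda>x. f x + g x) h = cov_form f h + cov_form g h"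
proof -
  obtain B C where fB: "centered B f" and gC: "centered C g" using assms mean0_step_centered by blast
  have Qa: "Q k (\<lambda>x. f x + g x) u = Q k f u + Q k g u" for k u
    by (rule Q_add[OF centeredD(3,5)[OF fB] centeredD(3,5)[OF gC]])
  note i = mean0_step_correlation_summable(2)
  note s = mean0_step_correlation_summable(1)
  have 1: "(\<integral>u. (f u + g u) * h u \<partial>unif01) = (\<integral>u. f u * h u \<partial>unif01) + (\<integral>u. g u * h u \<partial>unif01)"
    using i[OF h f, of 0] i[OF h g, of 0] by (simp add: distrib_right)
  have 2: "(\<integral>u. (f u + g u) * Q (Suc k) h u \<partial>unif01) = (\<integral>u. f u * Q (Suc k) h u \<partial>unif01) + (\<integral>u. g u * Q (Suc k) h u \<partial>unif01)" for k
    using i[OF h f, of "Suc k"] i[OF h g, of "Suc k"] by (simp add: distrib_right)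
  have 3: "(\<integral>u. h u * Q (Suc k) (\<lambda>x. f x + g x) u \<partial>unif01) = (\<integral>u. h u * Q (Suc k) f u \<partial>unif01) + (\<integral>u. h u * Q (Suc k) g u \<partial>unif01)" for k
    using i[OF f h, of "Suc k"] i[OF g h, of "Suc k"] by (simp add: distrib_left Qa)
  show ?thesis
    unfolding cov_form_def 1 2 3 suminf_add[OF s[OF h f] s[OF h g], symmetric] suminf_add[OF s[OF f h] s[OF g h], symmetric]
    by simp
qed

lemma cov_form_sum_left:
  assumes "finite I" "\<And>i. i \<in> I \<Longrightarrow> mean0_step (f i)" and h: "mean0_step h"
  shows "cov_form (\<lambda>x. \<Sum>i\<in>I. c i * f i x) h = (\<Sum>i\<in>I. c i * cov_form (f i) h)"
  using assms(1,2)
proof (induction I rule: finite_induct)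
  case empty
  show ?case using cov_form_scale[OF mean0_step_zero h, of 0] by simp
next
  case (insert i I)
  then show ?case
    by (simp add: cov_form_add[OF mean0_step_scale mean0_step_sum[of I "\<lambda>i x. c i * f i x"] h] mean0_step_scale cov_form_scale h)
qed

lemma cov_form_sum:
  assumes I: "finite I" "\<And>i. i \<in> I \<Longrightarrow> mean0_step (f i)"
  shows "cov_form (\<lambda>x. \<Sum>i\<in>I. c i * f i x) (\<lambda>x. \<Sum>i\<in>I. c i * f i x) = (\<Sum>i\<in>I. \<Sum>j\<in>I. c i * c j * cov_form (f i) (f j))"
proof -
  have s: "mean0_step (\<lambda>x. \<Sum>i\<in>I. c i * f i x)" using I by (intro mean0_step_sum mean0_step_scale) auto
  have "cov_form (f i) (\<lambda>x. \<Sum>i\<in>I. c i * f i x) = (\<Sum>j\<in>I. c j * cov_form (f i) (f j))" if "i \<in> I" for i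
    unfolding cov_form_commute[of "f i"] using cov_form_sum_left[OF I I(2)[OF that], where c = c]
    by simp
  then show ?thesis
    by (simp add: cov_form_sum_left[OF I s] sum_distrib_left mult.assoc)
qed

text \<open>
  On the diagonal the form is the integral of a conditional variance.
\<close>

lemma cov_form_nonneg:
  assumes "mean0_step f" shows "0 \<le> cov_form f f"
proof -
  obtain B where f: "centered B f" using mean0_step_centered[OF assms] by blast
  note [measurable] = centeredD(3)[OF f]
  have "0 \<le> cond_var (poisson f) u" for u using cond_var_bounds(1)[of "poisson f"] poisson_bound[OF f] by auto
  then show ?thesis unfolding integral_cond_var_poisson[OF f, symmetric] by simp
qed

text \<open>
  The bound is linear in the \<open>L\<^sup>1\<close> norm of \<open>f\<close>. For the increments of the empirical process
  this norm is of the order of the length of the interval.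
\<close>

lemma cov_form_le:
  assumes f: "step_fn V f" and mean: "(\<integral>u. f u \<partial>unif01) = 0"
  shows "cov_form f f \<le> V * (1 + 6 * rho_sum) * (\<integral>u. \<bar>f u\<bar> \<partial>unif01)"
proof -
  have cf: "centered (3 * V) f" using mixing_step[OF f] mean by (simp add: centered_def)
  note [measurable] = centeredD(3)[OF cf]
  let ?I = "\<integral>u. \<bar>f u\<bar> \<partial>unif01"
  have I0: "0 \<le> ?I" by simp
  have V0: "0 \<le> V" by (rule step_fn_nonneg[OF f])
  have "(\<integral>u. f u * f u \<partial>unif01) \<le> (\<integral>u. V * \<bar>f u\<bar> \<partial>unif01)"
  proof (rule integral_mono)
    have "f u * f u \<le> V * \<bar>f u\<bar>" for u
      using mult_right_mono[OF step_fn_bound[OF f, of u], of "\<bar>f u\<bar>"] by (simp flip: abs_mult)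
    then show "f u * f u \<le> V * \<bar>f u\<bar>" for u .
    show "integrable unif01 (\<lambda>u. V * \<bar>f u\<bar>)"
      using integrable_unif01[of f V] step_fn_bound[OF f] by auto
    have b: "norm (f u * f u) \<le> V * V" for u
      unfolding real_norm_def abs_mult by (intro mult_mono step_fn_bound[OF f] V0 abs_ge_zero)
    show "integrable unif01 (\<lambda>u. f u * f u)"
      by (rule integrable_unif01[OF _ b]) measurable
  qed
  then have 1: "(\<integral>u. f u * f u \<partial>unif01) \<le> V * ?I" by simp
  have sm: "summable (\<lambda>k. ?I * (3 * V * \<rho> (Suc k)))"
    using summable_rho by (intro summable_mult) (simp add: summable_Suc_iff)
  have s0: "mean0_step f" using f mean by (auto simp: mean0_step_def)
  have "(\<Sum>k. \<integral>u. f u * Q (Suc k) f u \<partial>unif01) \<le> (\<Sum>k. ?I * (3 * V * \<rho> (Suc k)))"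
  proof (rule suminf_le[OF _ mean0_step_correlation_summable(1)[OF s0 s0] sm])
    show "(\<integral>u. f u * Q (Suc k) f u \<partial>unif01) \<le> ?I * (3 * V * \<rho> (Suc k))" for k
      using correlation_bound[OF cf centeredD(3,5)[OF cf], of "Suc k"] by (rule abs_le_D1)
  qed
  also have "\<dots> = ?I * (3 * V) * (\<Sum>k. \<rho> (Suc k))"
    using summable_rho by (subst suminf_mult[symmetric]) (auto simp: summable_Suc_iff mult.assoc)
  also have "(\<Sum>k. \<rho> (Suc k)) \<le> rho_sum"
    using suminf_split_head[OF summable_rho] rho_nonneg[of 0] suminf_rho_le by linarith
  finally have "(\<Sum>k. \<integral>u. f u * Q (Suc k) f u \<partial>unif01) \<le> ?I * (3 * V) * rho_sum"
    using I0 V0 by (simp add: mult_left_mono)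
  with 1 show ?thesis by (simp add: cov_form_def algebra_simps)
qed

definition cov_const :: real where "cov_const = 8 * (1 + 6 * rho_sum)"

lemma cov_const_pos: "0 < cov_const" using rho_sum_ge_2 by (simp add: cov_const_def)

lemma cov_form_cind_diff:
  assumes "0 \<le> s" "s \<le> t" "t \<le> 1"
  shows "cov_form (\<lambda>x. cind t x - cind s x) (\<lambda>x. cind t x - cind s x) \<le> cov_const * (t - s)"
proof -
  have "mean0_step (\<lambda>x. cind t x - cind s x)" using assms by (intro mean0_step_diff mean0_step_cind) auto
  then have "cov_form (\<lambda>x. cind t x - cind s x) (\<lambda>x. cind t x - cind s x)
     \<le> 4 * (1 + 6 * rho_sum) * (\<integral>u. \<bar>cind t u - cind s u\<bar> \<partial>unif01)"
    by (intro cov_form_le step_fn_cind_diff assms) (simp add: mean0_step_def)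
  also have "\<dots> \<le> 4 * (1 + 6 * rho_sum) * (2 * (t - s))"
    using rho_sum_ge_2 by (intro mult_left_mono integral_abs_cind_diff assms) auto
  finally show ?thesis by (simp add: cov_const_def algebra_simps)
qed

lemma C_cov_eq_cov_form:
  assumes "mean0_step f" "mean0_step h" shows "C_cov M X f h = cov_form f h"
proof -
  have *: "(\<integral>(u, \<omega>). f u * h (u + S k \<omega>) \<partial>(unif01 \<Otimes>\<^sub>M M)) = (\<integral>u. f u * Q k h u \<partial>unif01)"
    if f: "mean0_step f" and h: "mean0_step h" for f h k
  proof -
    note [measurable] = mean0_stepD(1)[OF f] mean0_stepD(1)[OF h]
    obtain B C where B: "centered B f" and C: "centered C h" using f h mean0_step_centered by blast
    have "(\<integral>p. f (fst p) * h (fst p + S k (snd p)) \<partial>(unif01 \<Otimes>\<^sub>M M)) = (\<integral>u. (\<integral>\<omega>. f u * h (u + S k \<omega>) \<partial>M) \<partial>unif01)"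
    proof (rule prob_fubini(2)[OF prob_space_unif01 prob_space_axioms, of "\<lambda>u \<omega>. f u * h (u + S k \<omega>)" "B * C"])
      show "norm (f u * h (u + S k \<omega>)) \<le> B * C" for u \<omega>
        unfolding real_norm_def abs_mult
        by (intro mult_mono centeredD(5)[OF B] centeredD(5)[OF C] centeredD(6)[OF B] abs_ge_zero)
    qed (simp add: case_prod_beta')
    then show ?thesis by (simp add: case_prod_beta' Q_def)
  qed
  show ?thesis unfolding C_cov_def cov_form_def *[OF assms] *[OF assms(2,1)] ..
qed

lemma Gamma_cov_eq: "s \<in> {0..1} \<Longrightarrow> t \<in> {0..1} \<Longrightarrow> Gamma_cov M X s t = cov_form (cind s) (cind t)"
  unfolding Gamma_cov_def by (rule C_cov_eq_cov_form) (auto intro: mean0_step_cind)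

lemma Gamma_cov_psd:
  assumes I: "finite I" "\<And>i. i \<in> I \<Longrightarrow> t i \<in> {0..1}"
  shows "0 \<le> (\<Sum>i\<in>I. \<Sum>j\<in>I. c i * c j * Gamma_cov M X (t i) (t j))"
proof -
  have "(\<Sum>i\<in>I. \<Sum>j\<in>I. c i * c j * Gamma_cov M X (t i) (t j)) = (\<Sum>i\<in>I. \<Sum>j\<in>I. c i * c j * cov_form (cind (t i)) (cind (t j)))"
    using I by (intro sum.cong refl) (simp add: Gamma_cov_eq)
  also have "\<dots> = cov_form (\<lambda>x. \<Sum>i\<in>I. c i * cind (t i) x) (\<lambda>x. \<Sum>i\<in>I. c i * cind (t i) x)"
    by (rule cov_form_sum[symmetric]) (use I in \<open>auto intro: mean0_step_cind\<close>)
  also have "\<dots> \<ge> 0" using I by (intro cov_form_nonneg mean0_step_sum mean0_step_scale mean0_step_cind) auto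
  finally show ?thesis .
qed

lemma Gamma_cov_increment:
  assumes "0 \<le> s" "s \<le> t" "t \<le> 1"
  shows "Gamma_cov M X t t - 2 * Gamma_cov M X s t + Gamma_cov M X s s \<le> cov_const * (t - s)"
proof -
  let ?c = "\<lambda>b. if b then 1 else - 1 :: real" and ?f = "\<lambda>b. if b then cind t else cind s"
  have "cov_form (\<lambda>x. \<Sum>b\<in>UNIV. ?c b * ?f b x) (\<lambda>x. \<Sum>b\<in>UNIV. ?c b * ?f b x) =
     (\<Sum>b\<in>UNIV. \<Sum>b'\<in>UNIV. ?c b * ?c b' * cov_form (?f b) (?f b'))"
    by (rule cov_form_sum) (use assms in \<open>auto intro: mean0_step_cind\<close>)
  then have "cov_form (\<lambda>x. cind t x - cind s x) (\<lambda>x. cind t x - cind s x) = cov_form (cind t) (cind t)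
     - 2 * cov_form (cind s) (cind t) + cov_form (cind s) (cind s)"
    by (simp add: UNIV_bool cov_form_commute[of "cind t" "cind s"])
  then show ?thesis using cov_form_cind_diff[OF assms] assms by (simp add: Gamma_cov_eq)
qed

text \<open>
  The Cauchy--Schwarz inequality in the form obtained from positivity on \<open>\<theta> f \<plusminus> h\<close>; the weight
  \<open>\<theta>\<close> is chosen later according to the size of \<open>f\<close>.
\<close>

lemma cov_form_cauchy:
  assumes f: "mean0_step f" and h: "mean0_step h" and \<theta>: "0 < \<theta>"
  shows "\<bar>cov_form f h\<bar> \<le> (\<theta> * cov_form f f + cov_form h h / \<theta>) / 2"
proof -
  have "0 \<le> \<theta> * cov_form f f + 2 * e * cov_form f h + cov_form h h / \<theta>" if "e = 1 \<or> e = -1" for e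
  proof -
    let ?k = "\<lambda>x. \<theta> * f x + e * h x"
    have "cov_form ?k g = \<theta> * cov_form f g + e * cov_form h g" if g: "mean0_step g" for g
      by (simp add: cov_form_add[OF mean0_step_scale[OF f] mean0_step_scale[OF h] g] cov_form_scale f g h)
    moreover have k: "mean0_step ?k" by (intro mean0_step_add mean0_step_scale f h)
    ultimately have "cov_form ?k ?k = \<theta> * cov_form ?k f + e * cov_form ?k h"
      using cov_form_commute by (metis (no_types))
    also have "\<dots> = \<theta> * (\<theta> * cov_form f f + e * cov_form h f) + e * (\<theta> * cov_form f h + e * cov_form h h)"
      using \<open>\<And>g. mean0_step g \<Longrightarrow> cov_form ?k g = \<theta> * cov_form f g + e * cov_form h g\<close> f h by simp
    also have "\<dots> = \<theta> * (\<theta> * cov_form f f + 2 * e * cov_form f h + cov_form h h / \<theta>)"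
      using \<theta> that cov_form_commute[of h f] by (auto simp: algebra_simps)
    finally have "0 \<le> \<theta> * (\<theta> * cov_form f f + 2 * e * cov_form f h + cov_form h h / \<theta>)"
      using cov_form_nonneg[OF k] by simp
    then show ?thesis using \<theta> by (simp add: zero_le_mult_iff)
  qed
  from this[of 1] this[of "-1"] show ?thesis by (auto simp: abs_le_iff)
qed

lemma Gamma_cov_holder:
  assumes s: "s \<in> {0..1}" "s' \<in> {0..1}" and t: "t \<in> {0..1}"
  shows "\<bar>Gamma_cov M X s t - Gamma_cov M X s' t\<bar> \<le> cov_const * sqrt \<bar>s - s'\<bar>"
proof -
  have *: "\<bar>Gamma_cov M X s t - Gamma_cov M X s' t\<bar> \<le> cov_const * sqrt (s - s')" if "s' < s" "s \<le> 1" "0 \<le> s'" for s s'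
  proof -
    let ?f = "\<lambda>x. cind s x - cind s' x"
    have f: "mean0_step ?f" using that by (intro mean0_step_diff mean0_step_cind) auto
    have h: "mean0_step (cind t)" using t by (intro mean0_step_cind) auto
    have "cov_form ?f (cind t) = cov_form (\<lambda>x. cind s x + (-1) * cind s' x) (cind t)" by simp
    also have "\<dots> = cov_form (cind s) (cind t) - cov_form (cind s') (cind t)"
      using that by (subst cov_form_add[OF _ mean0_step_scale h]; (subst cov_form_scale[OF _ h])?) (auto intro: mean0_step_cind)
    finally have eq: "Gamma_cov M X s t - Gamma_cov M X s' t = cov_form ?f (cind t)"
      using that t by (simp add: Gamma_cov_eq)
    (* This weight balances the two terms of the Cauchy--Schwarz bound. *)
    define \<theta> where "\<theta> = 1 / sqrt (s - s')"
    have th: "0 < \<theta>" "\<theta> * (s - s') = sqrt (s - s')" "1 / \<theta> = sqrt (s - s')"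
      using that by (auto simp: \<theta>_def real_div_sqrt)
    have "cov_form ?f ?f \<le> cov_const * (s - s')" using that by (intro cov_form_cind_diff) auto
    then have 1: "\<theta> * cov_form ?f ?f \<le> cov_const * sqrt (s - s')"
      using mult_left_mono[of _ _ \<theta>] th by (metis less_imp_le mult.left_commute)
    have "cov_form (\<lambda>x. cind t x - cind 0 x) (\<lambda>x. cind t x - cind 0 x) \<le> cov_const * (t - 0)"
      using t by (intro cov_form_cind_diff) auto
    moreover have "cind 0 x = 0" for x by (simp add: centered_indicator_def)
    ultimately have "cov_form (cind t) (cind t) \<le> cov_const * t" by simp
    also have "cov_const * t \<le> cov_const * 1" using t cov_const_pos by (intro mult_left_mono) auto
    finally have "cov_form (cind t) (cind t) * (1 / \<theta>) \<le> cov_const * (1 / \<theta>)"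
      using th(1) by (intro mult_right_mono) auto
    then have 2: "cov_form (cind t) (cind t) / \<theta> \<le> cov_const * sqrt (s - s')"
      by (simp only: th(3)[symmetric] mult_1_right times_divide_eq_right)
    have half: "a \<le> (x + y) / 2 \<Longrightarrow> x \<le> c \<Longrightarrow> y \<le> c \<Longrightarrow> a \<le> c" for a x y c :: real by (simp add: field_simps)
    show ?thesis unfolding eq by (rule half[OF cov_form_cauchy[OF f h th(1)] 1 2])
  qed
  show ?thesis
    using *[of s' s] *[of s s'] s by (cases s s' rule: linorder_cases) (auto simp: abs_minus_commute)
qed

lemma Gamma_cov_commute: "s \<in> {0..1} \<Longrightarrow> t \<in> {0..1} \<Longrightarrow> Gamma_cov M X s t = Gamma_cov M X t s"
  by (simp add: Gamma_cov_eq cov_form_commute)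

lemma continuous_Gamma_cov: "continuous_on ({0..1} \<times> {0..1}) (\<lambda>(s, t). Gamma_cov M X s t)"
  unfolding continuous_on_def
proof
  fix p :: "real \<times> real" assume p: "p \<in> {0..1} \<times> {0..1}"
  let ?b = "\<lambda>q. cov_const * sqrt \<bar>fst q - fst p\<bar> + cov_const * sqrt \<bar>snd q - snd p\<bar>"
  have "(?b \<longlongrightarrow> cov_const * sqrt \<bar>fst p - fst p\<bar> + cov_const * sqrt \<bar>snd p - snd p\<bar>) (at p within {0..1} \<times> {0..1})"
    by (intro tendsto_intros)
  then have b: "(?b \<longlongrightarrow> 0) (at p within {0..1} \<times> {0..1})" by simp
  have "((\<lambda>q. (case q of (s, t) \<Rightarrow> Gamma_cov M X s t) - (case p of (s, t) \<Rightarrow> Gamma_cov M X s t)) \<longlongrightarrow> 0) (at p within {0..1} \<times> {0..1})"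
  proof (rule Lim_null_comparison[OF _ b])
    have "\<bar>Gamma_cov M X (fst q) (snd q) - Gamma_cov M X (fst p) (snd p)\<bar> \<le> ?b q" if q: "q \<in> {0..1} \<times> {0..1}" for q
    proof -
      have m: "fst q \<in> {0..1}" "snd q \<in> {0..1}" "fst p \<in> {0..1}" "snd p \<in> {0..1}" using p q by auto
      show ?thesis
        using Gamma_cov_holder[OF m(1,3,2)] Gamma_cov_holder[OF m(2,4,3)]
          Gamma_cov_commute[OF m(3,2)] Gamma_cov_commute[OF m(3,4)] by linarith
    qed
    then show "\<forall>\<^sub>F q in at p within {0..1} \<times> {0..1}. norm ((case q of (s, t) \<Rightarrow> Gamma_cov M X s t) - (case p of (s, t) \<Rightarrow> Gamma_cov M X s t)) \<le> ?b q"
      by (auto simp: eventually_at_filter case_prod_beta' intro!: always_eventually)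
  qed
  then show "((\<lambda>(s, t). Gamma_cov M X s t) \<longlongrightarrow> (case p of (s, t) \<Rightarrow> Gamma_cov M X s t)) (at p within {0..1} \<times> {0..1})"
    by (simp add: LIM_zero_iff case_prod_beta')
qed

definition emp_process :: "nat \<Rightarrow> real \<Rightarrow> 'a \<Rightarrow> real" where
  "emp_process N t \<omega> = sqrt (real N) * (empirical_df X N t \<omega> - t)"

lemma emp_process_eq:
  assumes "0 \<le> t" shows "emp_process N t \<omega> = (\<Sum>k<N. cind t (S (Suc k) \<omega>)) / sqrt (real N)"
proof (cases "N = 0")
  case False
  have "(\<Sum>k=1..N. indicator {0..<t} (frac (S k \<omega>)) :: real) = (\<Sum>k<N. indicator {0..<t} (frac (S (Suc k) \<omega>)))"
    by (rule sum.reindex_bij_witness[of _ Suc "\<lambda>k. k - 1"]) auto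
  then have "(\<Sum>k<N. cind t (S (Suc k) \<omega>)) = real N * (empirical_df X N t \<omega> - t)"
    using False assms by (simp add: cind_eq sum_subtractf empirical_df_def right_diff_distrib)
  moreover have "real N / sqrt (real N) = sqrt (real N)" by (simp add: real_div_sqrt)
  ultimately show ?thesis unfolding emp_process_def by (metis times_divide_eq_left)
qed (simp add: emp_process_def)

lemma emp_process_measurable [measurable]:
  assumes "0 \<le> t" "t \<le> 1" shows "emp_process N t \<in> borel_measurable M"
proof -
  have [measurable]: "cind t \<in> borel_measurable borel" using step_fn_measurable[OF step_fn_cind[OF assms]] .
  show ?thesis unfolding emp_process_eq[OF assms(1), abs_def] by measurable
qed

text \<open>
  The Cramer--Wold device: a linear combination of values of the empirical process is the
  normalised sum of a single mean zero step function.
\<close>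

lemma emp_process_char:
  assumes I: "finite I" "\<And>i. i \<in> I \<Longrightarrow> t i \<in> {0..1}"
  shows "(\<lambda>N. \<integral>\<omega>. cis (\<Sum>i\<in>I. a i * emp_process N (t i) \<omega>) \<partial>M)
    \<longlonglongrightarrow> complex_of_real (exp (- (\<Sum>i\<in>I. \<Sum>j\<in>I. a i * a j * Gamma_cov M X (t i) (t j)) / 2))"
proof -
  let ?f = "\<lambda>x. \<Sum>i\<in>I. a i * cind (t i) x"
  have "mean0_step ?f" using I by (intro mean0_step_sum mean0_step_scale mean0_step_cind) auto
  then obtain V where V: "step_fn V ?f" "(\<integral>u. ?f u \<partial>unif01) = 0" by (auto simp: mean0_step_def)
  have eq: "(\<Sum>i\<in>I. a i * emp_process N (t i) \<omega>) = (\<Sum>k<N. ?f (S (Suc k) \<omega>)) / sqrt (real N)" for N \<omega>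
  proof -
    have "(\<Sum>i\<in>I. a i * emp_process N (t i) \<omega>) = (\<Sum>i\<in>I. \<Sum>k<N. a i * cind (t i) (S (Suc k) \<omega>)) / sqrt (real N)"
      using I by (auto simp: emp_process_eq sum_divide_distrib sum_distrib_left intro!: sum.cong)
    then show ?thesis by (subst (asm) sum.swap)
  qed
  have "cov_form ?f ?f = (\<Sum>i\<in>I. \<Sum>j\<in>I. a i * a j * cov_form (cind (t i)) (cind (t j)))"
    using I by (intro cov_form_sum) (auto intro: mean0_step_cind)
  also have "\<dots> = (\<Sum>i\<in>I. \<Sum>j\<in>I. a i * a j * Gamma_cov M X (t i) (t j))"
    using I by (intro sum.cong refl) (simp add: Gamma_cov_eq)
  finally show ?thesis using clt_step_fn[OF V] unfolding eq by simp
qed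

end

section \<open>Exponential moments of increments\<close>

lemma exp_le_quadratic:
  fixes z :: real assumes "\<bar>z\<bar> \<le> 1" shows "exp z \<le> 1 + z + z\<^sup>2"
proof (cases "0 \<le> z")
  case True then show ?thesis using assms by (intro exp_bound) auto
next
  case False
  define w where "w = - z"
  have w: "0 \<le> w" using False by (simp add: w_def)
  have q: "0 < 1 - w + w\<^sup>2"
  proof -
    have "1 - w + w\<^sup>2 = (w - 1 / 2)\<^sup>2 + 3 / 4" by (simp add: power2_eq_square algebra_simps)
    then show ?thesis using zero_le_power2[of "w - 1 / 2"] by linarith
  qed
  have "1 \<le> 1 + (w ^ 2 + w ^ 3 + w ^ 4) / 2" using w by simp
  also have "\<dots> = (1 + w + w\<^sup>2 / 2) * (1 - w + w\<^sup>2)" by (simp add: power2_eq_square eval_nat_numeral field_simps)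
  also have "\<dots> \<le> exp w * (1 - w + w\<^sup>2)"
    using exp_lower_Taylor_quadratic[OF w] q by (intro mult_right_mono) auto
  finally have "exp (- w) \<le> 1 - w + w\<^sup>2" by (simp add: exp_minus field_simps)
  then show ?thesis by (simp add: w_def)
qed

context mixing_walk begin

text \<open>
  Freedman's inequality. Compensation by the conditional variance, rather than by its supremum as
  in \<open>exp_mdiff_bound\<close>, is what makes the tail of an increment reflect the length of the
  interval.
\<close>

lemma exp_mdiff_freedman:
  assumes [measurable]: "g \<in> borel_measurable borel" and c: "\<And>x. \<bar>g x\<bar> \<le> c" and r: "4 * \<bar>r\<bar> * c \<le> 1"
  shows "(\<integral>\<omega>. exp (\<Sum>k<N. 2 * r * mdiff g (S k \<omega>) (S (Suc k) \<omega>) - 4 * r\<^sup>2 * cond_var g (S k \<omega>)) \<partial>M) \<le> 1"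
proof -
  interpret L: prob_space step_law by (rule prob_space_step_law)
  let ?G = "\<lambda>x y. exp (2 * r * mdiff g x y - 4 * r\<^sup>2 * cond_var g x)"
  have v: "0 \<le> cond_var g x" for x using cond_var_bounds(1)[of g c x] c by auto
  have zb: "\<bar>2 * r * mdiff g x y\<bar> \<le> 1" for x y
  proof -
    have "\<bar>2 * r * mdiff g x y\<bar> = 2 * \<bar>r\<bar> * \<bar>mdiff g x y\<bar>" by (simp add: abs_mult)
    also have "\<dots> \<le> 2 * \<bar>r\<bar> * (2 * c)" by (intro mult_left_mono mdiff_bound c) auto
    finally show ?thesis using r by simp
  qed
  have Gm: "case_prod ?G \<in> borel_measurable (borel \<Otimes>\<^sub>M borel)" by (simp add: case_prod_beta')
  have GC: "?G x y \<le> exp 1" for x y using zb[of x y] v[of x] by (auto simp: abs_le_iff intro: order_trans[of _ "2 * r * mdiff g x y"])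
  have le: "feynman ?G (\<lambda>_. 1) x \<le> 1" for x
  proof -
    have dm [measurable]: "(\<lambda>y. mdiff g x (x + y)) \<in> borel_measurable borel" unfolding mdiff_def by measurable
    have db: "\<bar>mdiff g x (x + y)\<bar> \<le> 2 * c" for y by (rule mdiff_bound[OF c])
    have i2: "integrable step_law (\<lambda>y. mdiff g x (x + y))" using db by (intro integral_step_law_bounded[of _ "2 * c"]) auto
    have i3: "integrable step_law (\<lambda>y. (mdiff g x (x + y))\<^sup>2)"
    proof (rule integral_step_law_bounded[of _ "(2 * c)\<^sup>2"])
      have "0 \<le> 2 * c" using db[of 0] by linarith
      then have "(mdiff g x (x + y))\<^sup>2 \<le> (2 * c)\<^sup>2" for y using db[of y] by (simp only: power2_le_iff_abs_le)
      then show "norm ((mdiff g x (x + y))\<^sup>2) \<le> (2 * c)\<^sup>2" for y by simp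
    qed measurable
    have i1: "integrable step_law (\<lambda>y. exp (2 * r * mdiff g x (x + y)))"
    proof (rule integral_step_law_bounded[of _ "exp 1"])
      show "norm (exp (2 * r * mdiff g x (x + y))) \<le> exp 1" for y using zb[of x "x + y"] by simp
    qed measurable
    have eq: "feynman ?G (\<lambda>_. 1) x = exp (- (4 * r\<^sup>2 * cond_var g x)) * (\<integral>y. exp (2 * r * mdiff g x (x + y)) \<partial>step_law)"
      unfolding feynman_def diff_conv_add_uminus exp_add
      by (simp only: mult_1_right Bochner_Integration.integral_mult_left_zero) (rule mult.commute)
    have "(\<integral>y. exp (2 * r * mdiff g x (x + y)) \<partial>step_law) \<le> (\<integral>y. 1 + 2 * r * mdiff g x (x + y) + 4 * r\<^sup>2 * (mdiff g x (x + y))\<^sup>2 \<partial>step_law)"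
    proof (rule integral_mono[OF i1])
      show "integrable step_law (\<lambda>y. 1 + 2 * r * mdiff g x (x + y) + 4 * r\<^sup>2 * (mdiff g x (x + y))\<^sup>2)" using i2 i3 by auto
      show "exp (2 * r * mdiff g x (x + y)) \<le> 1 + 2 * r * mdiff g x (x + y) + 4 * r\<^sup>2 * (mdiff g x (x + y))\<^sup>2" for y
        using exp_le_quadratic[OF zb[of x "x + y"]] by (simp add: power_mult_distrib)
    qed
    also have "\<dots> = 1 + 4 * r\<^sup>2 * cond_var g x"
      using i2 i3 L.prob_space mdiff_moments[OF assms(1) c] by simp
    also have "\<dots> \<le> exp (4 * r\<^sup>2 * cond_var g x)" by (rule exp_ge_add_one_self)
    finally have "feynman ?G (\<lambda>_. 1) x \<le> exp (- (4 * r\<^sup>2 * cond_var g x)) * exp (4 * r\<^sup>2 * cond_var g x)"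
      unfolding eq by (intro mult_left_mono) auto
    also have "\<dots> = 1" by (simp flip: exp_add)
    finally show ?thesis .
  qed
  have "(\<integral>\<omega>. exp (\<Sum>k<N. 2 * r * mdiff g (S k \<omega>) (S (Suc k) \<omega>) - 4 * r\<^sup>2 * cond_var g (S k \<omega>)) \<partial>M)
     = (\<integral>\<omega>. (\<Prod>k<N. ?G (S k \<omega>) (S (Suc k) \<omega>)) * (\<lambda>_. 1) (S N \<omega>) \<partial>M)"
    by (simp add: exp_sum)
  also have "\<dots> = (feynman ?G ^^ N) (\<lambda>_. 1) 0"
    by (rule feynman_kac[OF Gm, of "exp 1" _ 1]) (use GC in auto)
  also have "\<dots> \<le> 1 ^ N" by (rule feynman_le_power[OF Gm _ GC le]) simp
  finally show ?thesis by simp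
qed

text \<open>
  Write \<open>r M\<close> as the mean of \<open>2 r M - 4 r\<^sup>2 V\<close> and \<open>4 r\<^sup>2 V\<close> and use convexity of the
  exponential; Freedman's inequality takes care of the first part.
\<close>

lemma exp_sum_mdiff_le:
  assumes [measurable]: "g \<in> borel_measurable borel" and c: "\<And>x. \<bar>g x\<bar> \<le> c" and r: "4 * \<bar>r\<bar> * c \<le> 1"
  shows "(\<integral>\<omega>. exp (r * (\<Sum>k<N. mdiff g (S k \<omega>) (S (Suc k) \<omega>))) \<partial>M)
    \<le> (1 + (\<integral>\<omega>. exp (4 * r\<^sup>2 * (\<Sum>k<N. cond_var g (S k \<omega>))) \<partial>M)) / 2"
proof -
  let ?M = "\<lambda>\<omega>. \<Sum>k<N. mdiff g (S k \<omega>) (S (Suc k) \<omega>)" and ?V = "\<lambda>\<omega>. \<Sum>k<N. cond_var g (S k \<omega>)"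
  have c0: "0 \<le> c" using c[of 0] by linarith
  have [measurable]: "?M \<in> borel_measurable M" "?V \<in> borel_measurable M" unfolding mdiff_def by measurable
  have Mb: "\<bar>?M \<omega>\<bar> \<le> real N * (2 * c)" for \<omega>
  proof -
    have "\<bar>?M \<omega>\<bar> \<le> (\<Sum>k<N. 2 * c)" by (rule order_trans[OF sum_abs sum_mono]) (rule mdiff_bound[OF c])
    then show ?thesis by simp
  qed
  have v: "0 \<le> cond_var g x" "cond_var g x \<le> c\<^sup>2" for x using cond_var_bounds[of g c x] c by auto
  have Vb: "0 \<le> ?V \<omega>" "?V \<omega> \<le> real N * c\<^sup>2" for \<omega>
    using sum_mono[of "{..<N}" "\<lambda>k. cond_var g (S k \<omega>)" "\<lambda>_. c\<^sup>2"] v by (auto intro: sum_nonneg)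
  have ie: "integrable M (\<lambda>\<omega>. exp (a * ?M \<omega> + b * ?V \<omega>))" for a b
  proof (rule bounded_integrable[of _ "exp (\<bar>a\<bar> * (real N * (2 * c)) + \<bar>b\<bar> * (real N * c\<^sup>2))"])
    have "a * ?M \<omega> \<le> \<bar>a\<bar> * (real N * (2 * c))" for \<omega>
      by (rule order_trans[OF abs_ge_self], unfold abs_mult) (intro mult_left_mono Mb abs_ge_zero)
    moreover have "b * ?V \<omega> \<le> \<bar>b\<bar> * (real N * c\<^sup>2)" for \<omega>
      by (rule mult_mono[OF abs_ge_self Vb(2) abs_ge_zero Vb(1)])
    ultimately show "norm (exp (a * ?M \<omega> + b * ?V \<omega>)) \<le> exp (\<bar>a\<bar> * (real N * (2 * c)) + \<bar>b\<bar> * (real N * c\<^sup>2))" for \<omega>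
      by (simp add: add_mono)
  qed measurable
  have "(\<integral>\<omega>. exp (r * ?M \<omega>) \<partial>M) \<le> (\<integral>\<omega>. (exp (2 * r * ?M \<omega> - 4 * r\<^sup>2 * ?V \<omega>) + exp (4 * r\<^sup>2 * ?V \<omega>)) / 2 \<partial>M)"
  proof (rule integral_mono)
    show "integrable M (\<lambda>\<omega>. exp (r * ?M \<omega>))" using ie[of r 0] by simp
    show "integrable M (\<lambda>\<omega>. (exp (2 * r * ?M \<omega> - 4 * r\<^sup>2 * ?V \<omega>) + exp (4 * r\<^sup>2 * ?V \<omega>)) / 2)"
      using ie[of "2 * r" "- (4 * r\<^sup>2)"] ie[of 0 "4 * r\<^sup>2"] by auto
    show "exp (r * ?M \<omega>) \<le> (exp (2 * r * ?M \<omega> - 4 * r\<^sup>2 * ?V \<omega>) + exp (4 * r\<^sup>2 * ?V \<omega>)) / 2" for \<omega>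
    proof -
      have amgm: "exp ((a + b) / 2) \<le> (exp a + exp b) / 2" for a b :: real
      proof -
        have "0 \<le> (exp (a / 2) - exp (b / 2))\<^sup>2" by simp
        also have "\<dots> = exp a + exp b - 2 * exp ((a + b) / 2)"
          by (simp add: power2_diff exp_double[symmetric] add_divide_distrib exp_add)
        finally show ?thesis by simp
      qed
      have eq: "r * ?M \<omega> = ((2 * r * ?M \<omega> - 4 * r\<^sup>2 * ?V \<omega>) + 4 * r\<^sup>2 * ?V \<omega>) / 2" by simp
      show ?thesis by (subst eq) (rule amgm)
    qed
  qed
  also have "\<dots> = ((\<integral>\<omega>. exp (2 * r * ?M \<omega> - 4 * r\<^sup>2 * ?V \<omega>) \<partial>M) + (\<integral>\<omega>. exp (4 * r\<^sup>2 * ?V \<omega>) \<partial>M)) / 2"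
    using ie[of "2 * r" "- (4 * r\<^sup>2)"] ie[of 0 "4 * r\<^sup>2"] by simp
  also have "(\<integral>\<omega>. exp (2 * r * ?M \<omega> - 4 * r\<^sup>2 * ?V \<omega>) \<partial>M) \<le> 1"
    using exp_mdiff_freedman[OF assms(1) c r, of N]
    by (simp add: sum_subtractf sum_distrib_left)
  finally show ?thesis by simp
qed

text \<open>
  The sum of conditional variances concentrates around \<open>N\<close> times its stationary mean. The
  truncation level \<open>n\<close> balances the truncation error \<open>n powr - d\<close> against the mixing constant of
  order \<open>n\<^sup>2\<close>.
\<close>

lemma exp_cond_var_le:
  fixes n :: nat
  assumes f: "step_fn V f" and mean: "(\<integral>u. f u \<partial>unif01) = 0" and b: "0 \<le> b"
  defines "c \<equiv> 3 * V * rho_sum" and "K \<equiv> 2 * ((real n)\<^sup>2 * (54 * V\<^sup>2)) * rho_sum"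
  shows "(\<integral>\<omega>. exp (b * (\<Sum>k<N. cond_var (poisson f) (S k \<omega>))) \<partial>M)
    \<le> exp (b * real N * (cov_form f f + 8 * c\<^sup>2 * (real n + 1) powr (- d))) * (2 * exp (2 * b * K + real N * (b\<^sup>2 * K\<^sup>2 / 2)))"
proof -
  have cf: "centered (3 * V) f" using mixing_step[OF f] mean by (simp add: centered_def)
  note [measurable] = centeredD(3)[OF cf]
  note gb = poisson_bound[OF cf, folded c_def] and tb = trunc_bound[OF cf, folded c_def]
  define \<eta> where "\<eta> = 4 * c\<^sup>2 * (real n + 1) powr (- d)"
  let ?v = "cond_var (poisson f)" and ?w = "cond_var (trunc n f)"
  let ?m = "\<integral>u. ?w u \<partial>unif01"
  have close: "\<bar>?v x - ?w x\<bar> \<le> \<eta>" for x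
  proof -
    have "\<bar>?v x - ?w x\<bar> \<le> 4 * c * (c * (real n + 1) powr (- d))"
      by (rule cond_var_close) (use gb tb poisson_minus_trunc[OF cf, folded c_def] in auto)
    then show ?thesis by (simp add: \<eta>_def power2_eq_square mult.assoc)
  qed
  have vb: "\<bar>?v x\<bar> \<le> c\<^sup>2" "\<bar>?w x\<bar> \<le> c\<^sup>2" for x
    using cond_var_bounds[of "poisson f" c x] cond_var_bounds[of "trunc n f" c x] gb tb by auto
  have mle: "?m \<le> cov_form f f + \<eta>"
  proof -
    have iv: "integrable unif01 ?v" "integrable unif01 ?w"
      by (intro integrable_unif01[of _ "c\<^sup>2"]; simp add: vb)+
    interpret U: prob_space unif01 by (rule prob_space_unif01)
    have "?m \<le> (\<integral>u. ?v u + \<eta> \<partial>unif01)"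
    proof (rule integral_mono)
      show "?w u \<le> ?v u + \<eta>" for u using close[of u] by linarith
    qed (use iv in auto)
    also have "\<dots> = cov_form f f + \<eta>"
      using iv U.prob_space integral_cond_var_poisson[OF cf] by simp
    finally show ?thesis .
  qed
  let ?Z = "\<lambda>\<omega>. \<bar>\<Sum>k<N. ?w (S k \<omega>) - ?m\<bar>"
  define E where "E = exp (b * real N * (cov_form f f + 2 * \<eta>))"
  have mix: "mixing ((real n)\<^sup>2 * (54 * V\<^sup>2)) ?w" by (rule mixing_cond_var_trunc[OF f mean])
  have cw: "centered (2 * ((real n)\<^sup>2 * (54 * V\<^sup>2))) (\<lambda>x. ?w x - ?m)" by (rule centered_recenter[OF mix])
  have pt: "exp (b * (\<Sum>k<N. ?v (S k \<omega>))) \<le> E * exp (b * ?Z \<omega>)" for \<omega>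
  proof -
    have "(\<Sum>k<N. ?v (S k \<omega>)) \<le> (\<Sum>k<N. (?w (S k \<omega>) - ?m) + (cov_form f f + 2 * \<eta>))"
    proof (rule sum_mono)
      fix k show "?v (S k \<omega>) \<le> (?w (S k \<omega>) - ?m) + (cov_form f f + 2 * \<eta>)" using close[of "S k \<omega>"] mle by linarith
    qed
    also have "\<dots> \<le> ?Z \<omega> + real N * (cov_form f f + 2 * \<eta>)"
      unfolding sum.distrib sum_constant card_lessThan by (rule add_mono[OF abs_ge_self]) (simp add: distrib_left)
    finally have "b * (\<Sum>k<N. ?v (S k \<omega>)) \<le> b * (?Z \<omega> + real N * (cov_form f f + 2 * \<eta>))" using b by (rule mult_left_mono)
    then show ?thesis by (simp add: E_def algebra_simps flip: exp_add)
  qed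
  have sb: "\<bar>\<Sum>k<N. h (S k \<omega>)\<bar> \<le> real N * C" if "\<And>x. \<bar>h x\<bar> \<le> C" for h :: "real \<Rightarrow> real" and C \<omega>
  proof -
    have "\<bar>\<Sum>k<N. h (S k \<omega>)\<bar> \<le> (\<Sum>k<N. C)" by (rule order_trans[OF sum_abs sum_mono]) (rule that)
    then show ?thesis by simp
  qed
  have "(\<integral>\<omega>. exp (b * (\<Sum>k<N. ?v (S k \<omega>))) \<partial>M) \<le> (\<integral>\<omega>. E * exp (b * ?Z \<omega>) \<partial>M)"
  proof (rule integral_mono[OF _ _ pt])
    show "integrable M (\<lambda>\<omega>. exp (b * (\<Sum>k<N. ?v (S k \<omega>))))"
    proof (rule bounded_integrable[of _ "exp (b * (real N * c\<^sup>2))"])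
      show "norm (exp (b * (\<Sum>k<N. ?v (S k \<omega>)))) \<le> exp (b * (real N * c\<^sup>2))" for \<omega>
        using abs_le_D1[OF sb[of ?v "c\<^sup>2" \<omega>, OF vb(1)]] b by (simp add: mult_left_mono)
    qed measurable
    have "integrable M (\<lambda>\<omega>. exp (b * ?Z \<omega>))"
    proof (rule bounded_integrable[of _ "exp (b * (real N * (2 * ((real n)\<^sup>2 * (54 * V\<^sup>2)))))"])
      show "norm (exp (b * ?Z \<omega>)) \<le> exp (b * (real N * (2 * ((real n)\<^sup>2 * (54 * V\<^sup>2)))))" for \<omega>
        using sb[of "\<lambda>x. ?w x - ?m", OF centeredD(5)[OF cw], of \<omega>] b by (simp add: mult_left_mono)
    qed measurable
    then show "integrable M (\<lambda>\<omega>. E * exp (b * ?Z \<omega>))" by simp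
  qed
  also have "\<dots> = E * (\<integral>\<omega>. exp (b * ?Z \<omega>) \<partial>M)" by simp
  also have "\<dots> \<le> E * (2 * exp (2 * b * K + real N * (b\<^sup>2 * K\<^sup>2 / 2)))"
    unfolding K_def by (intro mult_left_mono exp_sum_centered[OF cw b]) (simp add: E_def)
  finally show ?thesis unfolding E_def \<eta>_def by (simp add: mult.assoc)
qed

lemma exp_increment_pointwise:
  assumes st: "0 \<le> s" "s \<le> t" "t \<le> 1"
  defines "f \<equiv> (\<lambda>x. cind t x - cind s x)"
  assumes r: "0 \<le> r" "4 * r * (12 * rho_sum) \<le> 1"
  shows "(\<integral>\<omega>. exp (r * \<bar>\<Sum>k<N. f (S (Suc k) \<omega>)\<bar>) \<partial>M)
     \<le> 2 * (1 + (\<integral>\<omega>. exp (4 * r\<^sup>2 * (\<Sum>k<N. cond_var (poisson f) (S k \<omega>))) \<partial>M))"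
proof -
  define c where "c = 12 * rho_sum"
  have c0: "0 \<le> c" using rho_sum_ge_2 by (simp add: c_def)
  have f: "step_fn 4 f" unfolding f_def by (rule step_fn_cind_diff[OF st])
  have mean: "(\<integral>u. f u \<partial>unif01) = 0"
    using mean0_step_diff[OF mean0_step_cind[of t] mean0_step_cind[of s]] st by (simp add: mean0_step_def f_def)
  have cf: "centered 12 f" using mixing_step[OF f] mean by (simp add: centered_def)
  note [measurable] = centeredD(3)[OF cf]
  note gb = poisson_bound[OF cf, folded c_def]
  let ?g = "poisson f"
  let ?M = "\<lambda>\<omega>. \<Sum>k<N. mdiff ?g (S k \<omega>) (S (Suc k) \<omega>)"
  let ?I = "\<integral>\<omega>. exp (4 * r\<^sup>2 * (\<Sum>k<N. cond_var ?g (S k \<omega>))) \<partial>M"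
  have [measurable]: "?M \<in> borel_measurable M" unfolding mdiff_def by measurable
  have FD: "\<bar>(\<Sum>k<N. f (S (Suc k) \<omega>)) - ?M \<omega>\<bar> \<le> 2 * c" for \<omega>
    unfolding c_def by (rule martingale_approximation[OF cf])
  have rc: "r * (2 * c) \<le> 1 / 2" using r by (simp add: c_def)
  have pt: "exp (r * \<bar>\<Sum>k<N. f (S (Suc k) \<omega>)\<bar>) \<le> 2 * (exp (r * ?M \<omega>) + exp (- r * ?M \<omega>))" for \<omega>
  proof -
    have "\<bar>\<Sum>k<N. f (S (Suc k) \<omega>)\<bar> \<le> 2 * c + \<bar>?M \<omega>\<bar>" using FD[of \<omega>] by linarith
    then have "r * \<bar>\<Sum>k<N. f (S (Suc k) \<omega>)\<bar> \<le> r * (2 * c + \<bar>?M \<omega>\<bar>)" using r by (intro mult_left_mono) auto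
    also have "\<dots> \<le> 1 / 2 + \<bar>r * ?M \<omega>\<bar>" using rc r by (simp add: distrib_left abs_mult)
    finally have "exp (r * \<bar>\<Sum>k<N. f (S (Suc k) \<omega>)\<bar>) \<le> exp (1 / 2) * exp \<bar>r * ?M \<omega>\<bar>" by (simp flip: exp_add)
    also have "\<dots> \<le> 2 * (exp (r * ?M \<omega>) + exp (- (r * ?M \<omega>)))"
      by (intro mult_mono exp_half_le2 exp_abs_le_add) auto
    finally show ?thesis by simp
  qed
  have Mb: "\<bar>?M \<omega>\<bar> \<le> real N * (2 * c)" for \<omega>
  proof -
    have "\<bar>?M \<omega>\<bar> \<le> (\<Sum>k<N. 2 * c)" by (rule order_trans[OF sum_abs sum_mono]) (rule mdiff_bound[OF gb])
    then show ?thesis by simp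
  qed
  have ie: "integrable M (\<lambda>\<omega>. exp (a * ?M \<omega>))" for a
  proof (rule bounded_integrable[of _ "exp (\<bar>a\<bar> * (real N * (2 * c)))"])
    show "norm (exp (a * ?M \<omega>)) \<le> exp (\<bar>a\<bar> * (real N * (2 * c)))" for \<omega>
      using mult_left_mono[OF Mb[of \<omega>], of "\<bar>a\<bar>"] abs_ge_self[of "a * ?M \<omega>"] by (simp add: abs_mult)
  qed measurable
  have Fb: "\<bar>\<Sum>k<N. f (S (Suc k) \<omega>)\<bar> \<le> real N * 12" for \<omega>
  proof -
    have "\<bar>\<Sum>k<N. f (S (Suc k) \<omega>)\<bar> \<le> (\<Sum>k<N. 12)" by (rule order_trans[OF sum_abs sum_mono]) (rule centeredD(5)[OF cf])
    then show ?thesis by simp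
  qed
  have "(\<integral>\<omega>. exp (r * \<bar>\<Sum>k<N. f (S (Suc k) \<omega>)\<bar>) \<partial>M) \<le> (\<integral>\<omega>. 2 * (exp (r * ?M \<omega>) + exp (- r * ?M \<omega>)) \<partial>M)"
  proof (rule integral_mono[OF _ _ pt])
    show "integrable M (\<lambda>\<omega>. exp (r * \<bar>\<Sum>k<N. f (S (Suc k) \<omega>)\<bar>))"
    proof (rule bounded_integrable[of _ "exp (r * (real N * 12))"])
      show "norm (exp (r * \<bar>\<Sum>k<N. f (S (Suc k) \<omega>)\<bar>)) \<le> exp (r * (real N * 12))" for \<omega>
        using mult_left_mono[OF Fb[of \<omega>], of r] r by simp
    qed measurable
    show "integrable M (\<lambda>\<omega>. 2 * (exp (r * ?M \<omega>) + exp (- r * ?M \<omega>)))"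
      by (intro Bochner_Integration.integrable_mult_right Bochner_Integration.integrable_add ie)
  qed
  also have "\<dots> = 2 * ((\<integral>\<omega>. exp (r * ?M \<omega>) \<partial>M) + (\<integral>\<omega>. exp (- r * ?M \<omega>) \<partial>M))"
    by (subst Bochner_Integration.integral_mult_right_zero, subst Bochner_Integration.integral_add[OF ie ie]) simp
  also have "\<dots> \<le> 2 * ((1 + ?I) / 2 + (1 + ?I) / 2)"
    using exp_sum_mdiff_le[of ?g c r N] exp_sum_mdiff_le[of ?g c "- r" N] gb r
    by (intro mult_left_mono add_mono) (auto simp: c_def)
  finally show ?thesis by simp
qed

text \<open>
  An increment over \<open>[s, t]\<close> is of order \<open>sqrt (t - s + n powr - d)\<close> with exponential tails.
  The conditional variances have stationary mean at most of order \<open>t - s\<close>, the truncation at level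
  \<open>n\<close> adds \<open>n powr - d\<close>, and the fluctuations of their sum contribute \<open>N b\<^sup>2 K\<^sup>2\<close> with
  \<open>b\<close> of order \<open>n / N\<close> and \<open>K\<close> of order \<open>n\<^sup>2\<close>; this is bounded when \<open>n ^ 6 \<le> N\<close>.
\<close>

lemma exp_increment:
  obtains \<kappa> C where "0 < \<kappa>" "\<And>N n s t. 1 \<le> n \<Longrightarrow> n ^ 6 \<le> N \<Longrightarrow> 0 \<le> s \<Longrightarrow> s \<le> t \<Longrightarrow> t \<le> 1 \<Longrightarrow>
     (\<integral>\<omega>. exp (\<kappa> / sqrt (t - s + real n powr (- d)) * \<bar>emp_process N t \<omega> - emp_process N s \<omega>\<bar>) \<partial>M) \<le> C"
proof -
  define c where "c = 12 * rho_sum"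
  have c: "0 < c" "1 \<le> c" using rho_sum_ge_2 by (auto simp: c_def)
  (* Keeps r in the range where the Freedman bound applies. *)
  define \<kappa> where "\<kappa> = 1 / (4 * c)"
  have \<kappa>: "0 < \<kappa>" "\<kappa> \<le> 1" using c by (auto simp: \<kappa>_def)
  define L where "L = 1728 * rho_sum"
  have L: "0 \<le> L" using rho_sum_ge_2 by (simp add: L_def)
  define A where "A = cov_const + 8 * c\<^sup>2"
  have A: "0 \<le> A" using cov_const_pos by (simp add: A_def)
  define C where "C = 2 * (1 + exp (4 * A) * (2 * exp (8 * L + 8 * L\<^sup>2)))"
  have "(\<integral>\<omega>. exp (\<kappa> / sqrt (t - s + real n powr (- d)) * \<bar>emp_process N t \<omega> - emp_process N s \<omega>\<bar>) \<partial>M) \<le> C"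
    if n: "1 \<le> n" "n ^ 6 \<le> N" and st: "0 \<le> s" "s \<le> t" "t \<le> 1" for N n s t
  proof -
    define f where "f = (\<lambda>x. cind t x - cind s x)"
    have f: "step_fn 4 f" unfolding f_def by (rule step_fn_cind_diff[OF st])
    have mean: "(\<integral>u. f u \<partial>unif01) = 0"
      using mean0_step_diff[OF mean0_step_cind[of t] mean0_step_cind[of s]] st by (simp add: mean0_step_def f_def)
    have nN: "real n ^ 6 \<le> real N" using n(2) by (metis of_nat_le_iff of_nat_power)
    have n1: "1 \<le> real n" using n by simp
    have N1: "1 \<le> real N" using nN one_le_power[OF n1, of 6] by linarith
    define \<sigma> where "\<sigma> = t - s + real n powr (- d)"
    have np: "0 < real n powr (- d)" using n1 by simp
    have \<sigma>0: "0 < \<sigma>" unfolding \<sigma>_def using np st by linarith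
    have "real n powr (- 1) \<le> real n powr (- d)" using n1 d_le_1 by (intro powr_mono) auto
    then have \<sigma>n: "1 / real n \<le> \<sigma>" using st n1 by (simp add: \<sigma>_def powr_minus_divide)
    (* The exponent for the normalised increment; r is the exponent for the unnormalised sum. *)
    define y where "y = \<kappa> / sqrt \<sigma>"
    have y0: "0 \<le> y" using \<kappa> \<sigma>0 by (simp add: y_def)
    have y2: "y\<^sup>2 * \<sigma> \<le> 1"
      using \<sigma>0 \<kappa> by (simp add: y_def power_divide power_le_one)
    have y2n: "y\<^sup>2 \<le> \<kappa>\<^sup>2 * real n"
    proof -
      have "y\<^sup>2 = \<kappa>\<^sup>2 * (1 / \<sigma>)" using \<sigma>0 by (simp add: y_def power_divide)
      also have "\<dots> \<le> \<kappa>\<^sup>2 * real n" using \<sigma>n \<sigma>0 n1 by (intro mult_left_mono) (auto simp: field_simps)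
      finally show ?thesis .
    qed
    have y2n1: "y\<^sup>2 \<le> real n"
      using y2n mult_right_mono[OF power_le_one[of \<kappa> 2], of "real n"] \<kappa> by simp
    define r where "r = y / sqrt (real N)"
    have r0: "0 \<le> r" using y0 by (simp add: r_def)
    have r2: "r\<^sup>2 * real N = y\<^sup>2" using N1 by (simp add: r_def power_divide)
    have r4: "4 * r * (12 * rho_sum) \<le> 1"
    proof -
      have "real n \<le> real n ^ 6" using n1 by (metis one_le_numeral power_increasing power_one_right)
      then have "y\<^sup>2 \<le> \<kappa>\<^sup>2 * real N" using y2n nN by (meson mult_left_mono order_trans zero_le_power2)
      then have "r\<^sup>2 \<le> \<kappa>\<^sup>2" using r2 N1 by (metis mult_le_cancel_right_pos less_le_trans zero_less_one)
      then have "r \<le> \<kappa>" by (rule power2_le_imp_le) (use \<kappa> in simp)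
      then have "4 * r * c \<le> 4 * \<kappa> * c" using c by simp
      also have "\<dots> = 1" using c by (simp add: \<kappa>_def)
      finally show ?thesis by (simp add: c_def)
    qed
    define K where "K = 2 * ((real n)\<^sup>2 * (54 * 4\<^sup>2)) * rho_sum"
    have K: "0 \<le> K" "K \<le> L * (real n)\<^sup>2"
    proof -
      show "K \<le> L * (real n)\<^sup>2" unfolding K_def L_def by (simp add: mult_ac)
      show "0 \<le> K" unfolding K_def using rho_sum_ge_2 by simp
    qed
    define b where "b = 4 * r\<^sup>2"
    have b0: "0 \<le> b" by (simp add: b_def)
    have bN: "b * real N = 4 * y\<^sup>2" using r2 by (simp add: b_def)
    have bN2: "b * real n ^ 3 \<le> 4"
    proof -
      have "(b * real n ^ 3) * real N = 4 * (y\<^sup>2 * real n ^ 3)" using bN by (simp add: mult_ac)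
      also have "\<dots> \<le> 4 * (real n * real n ^ 3)" using y2n1 by (simp add: mult_right_mono)
      also have "real n * real n ^ 3 = real n ^ 4" by (simp add: eval_nat_numeral)
      also have "real n ^ 4 \<le> real n ^ 6" using n1 by (intro power_increasing) auto
      finally have "(b * real n ^ 3) * real N \<le> 4 * real N" using nN by linarith
      then show ?thesis using N1 by (simp add: mult_le_cancel_right)
    qed
    have bn2: "b * (real n)\<^sup>2 \<le> 4"
    proof -
      have "(real n)\<^sup>2 \<le> real n ^ 3" using n1 by (intro power_increasing) auto
      then show ?thesis using mult_left_mono[OF _ b0] bN2 order_trans by blast
    qed
    (* t1, t2 and t3 bound the three terms of the exponent in exp_cond_var_le. The constant 1728 in L
       is 2 * 54 * 16. *)
    have t1: "2 * b * K \<le> 8 * L"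
    proof -
      have "b * K \<le> b * (L * (real n)\<^sup>2)" using K b0 by (intro mult_left_mono)
      also have "\<dots> = L * (b * (real n)\<^sup>2)" by simp
      also have "\<dots> \<le> L * 4" using L bn2 by (intro mult_left_mono)
      finally have "b * K \<le> L * 4" .
      then show ?thesis by (simp only: mult.assoc)
    qed
    have t2: "real N * (b\<^sup>2 * K\<^sup>2 / 2) \<le> 8 * L\<^sup>2"
    proof -
      have "K\<^sup>2 \<le> (L * (real n)\<^sup>2)\<^sup>2" using K by (intro power_mono)
      then have "real N * (b\<^sup>2 * K\<^sup>2 / 2) \<le> real N * (b\<^sup>2 * (L * (real n)\<^sup>2)\<^sup>2 / 2)"
        by (intro mult_left_mono divide_right_mono) auto
      also have "\<dots> = L\<^sup>2 / 2 * ((b * real N) * (real n * (b * real n ^ 3)))"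
        by (simp add: power2_eq_square eval_nat_numeral)
      also have "(b * real N) * (real n * (b * real n ^ 3)) \<le> 16"
      proof -
        have "((b * real N) * (real n * (b * real n ^ 3))) * real N = 16 * ((y\<^sup>2 * y\<^sup>2) * real n ^ 4)"
        proof -
          have "((b * real N) * (real n * (b * real n ^ 3))) * real N = (b * real N) * (b * real N) * real n ^ 4"
            by (simp add: eval_nat_numeral)
          then show ?thesis unfolding bN by simp
        qed
        also have "\<dots> \<le> 16 * ((real n * real n) * real n ^ 4)"
          using y2n1 by (intro mult_left_mono mult_right_mono mult_mono) auto
        also have "(real n * real n) * real n ^ 4 = real n ^ 6" by (simp add: eval_nat_numeral)
        finally have "((b * real N) * (real n * (b * real n ^ 3))) * real N \<le> 16 * real N" using nN by linarith
        then show ?thesis using N1 by (simp add: mult_le_cancel_right)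
      qed
      finally show ?thesis by (simp add: mult_left_mono)
    qed
    have t3: "b * real N * (cov_form f f + 8 * c\<^sup>2 * (real n + 1) powr (- d)) \<le> 4 * A"
    proof -
      have "(real n + 1) powr (- d) \<le> real n powr (- d)" using n1 d_pos by (intro powr_mono2') auto
      then have p: "(real n + 1) powr (- d) \<le> \<sigma>" using st by (simp add: \<sigma>_def)
      have "cov_form f f \<le> cov_const * (t - s)" unfolding f_def by (rule cov_form_cind_diff[OF st])
      also have "\<dots> \<le> cov_const * \<sigma>" using cov_const_pos np by (intro mult_left_mono) (auto simp: \<sigma>_def)
      finally have "cov_form f f + 8 * c\<^sup>2 * (real n + 1) powr (- d) \<le> A * \<sigma>"
        using mult_left_mono[OF p, of "8 * c\<^sup>2"] by (simp add: A_def distrib_right)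
      then have "4 * y\<^sup>2 * (cov_form f f + 8 * c\<^sup>2 * (real n + 1) powr (- d)) \<le> 4 * y\<^sup>2 * (A * \<sigma>)"
        by (intro mult_left_mono) auto
      also have "\<dots> = 4 * A * (y\<^sup>2 * \<sigma>)" by simp
      also have "\<dots> \<le> 4 * A * 1" using A y2 by (intro mult_left_mono) auto
      finally show ?thesis unfolding bN by simp
    qed
    have V: "(\<integral>\<omega>. exp (b * (\<Sum>k<N. cond_var (poisson f) (S k \<omega>))) \<partial>M) \<le> exp (4 * A) * (2 * exp (8 * L + 8 * L\<^sup>2))"
    proof -
      have "(\<integral>\<omega>. exp (b * (\<Sum>k<N. cond_var (poisson f) (S k \<omega>))) \<partial>M)
        \<le> exp (b * real N * (cov_form f f + 8 * c\<^sup>2 * (real n + 1) powr (- d))) * (2 * exp (2 * b * K + real N * (b\<^sup>2 * K\<^sup>2 / 2)))"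
        using exp_cond_var_le[OF f mean b0, of N n] unfolding K_def c_def by simp
      also have "\<dots> \<le> exp (4 * A) * (2 * exp (8 * L + 8 * L\<^sup>2))"
        by (intro mult_mono mult_left_mono iffD2[OF exp_le_cancel_iff] add_mono t1 t2 t3) auto
      finally show ?thesis .
    qed
    have "(\<integral>\<omega>. exp (r * \<bar>\<Sum>k<N. f (S (Suc k) \<omega>)\<bar>) \<partial>M) \<le> C"
    proof -
      have "(\<integral>\<omega>. exp (r * \<bar>\<Sum>k<N. f (S (Suc k) \<omega>)\<bar>) \<partial>M)
        \<le> 2 * (1 + (\<integral>\<omega>. exp (b * (\<Sum>k<N. cond_var (poisson f) (S k \<omega>))) \<partial>M))"
        unfolding f_def b_def by (rule exp_increment_pointwise[OF st r0 r4])
      also have "\<dots> \<le> C" unfolding C_def by (intro mult_left_mono add_left_mono V) simp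
      finally show ?thesis .
    qed
    moreover have "\<kappa> / sqrt (t - s + real n powr (- d)) * \<bar>emp_process N t \<omega> - emp_process N s \<omega>\<bar> = r * \<bar>\<Sum>k<N. f (S (Suc k) \<omega>)\<bar>" for \<omega>
    proof -
      have "emp_process N t \<omega> - emp_process N s \<omega> = (\<Sum>k<N. f (S (Suc k) \<omega>)) / sqrt (real N)"
        using st by (simp add: emp_process_eq f_def sum_subtractf diff_divide_distrib)
      then show ?thesis by (simp add: r_def y_def \<sigma>_def[symmetric])
    qed
    ultimately show ?thesis by simp
  qed
  with that \<kappa>(1) show ?thesis by blast
qed

end

section \<open>Lipschitz functions of finitely many coordinates\<close>

text \<open>
  Finite linear combinations of the functions whose expectations are given by characteristic
  functions.
\<close>

inductive trig_poly :: "((nat \<Rightarrow> real) \<Rightarrow> real) \<Rightarrow> bool" where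
  trig_wave: "finite I \<Longrightarrow> trig_poly (\<lambda>x. Re (c * cis (\<Sum>i\<in>I. a i * x i)))"
| trig_add: "trig_poly F \<Longrightarrow> trig_poly G \<Longrightarrow> trig_poly (\<lambda>x. F x + G x)"

lemma trig_poly_mult:
  assumes "trig_poly F" "trig_poly G" shows "trig_poly (\<lambda>x. F x * G x)"
  using assms
proof (induction arbitrary: G rule: trig_poly.induct)
  case (trig_wave I c a)
  from trig_wave(2,1) show ?case
  proof (induction rule: trig_poly.induct)
    case (trig_wave J d b)
    let ?a = "\<lambda>i. if i \<in> I then a i else 0" and ?b = "\<lambda>i. if i \<in> J then b i else 0"
    have s: "(\<Sum>i\<in>I. a i * x i) = (\<Sum>i\<in>I \<union> J. ?a i * x i)" "(\<Sum>i\<in>J. b i * x i) = (\<Sum>i\<in>I \<union> J. ?b i * x i)" for x :: "nat \<Rightarrow> real"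
      using trig_wave by (auto intro!: sum.mono_neutral_cong_left)
    have re: "Re (c * cis \<alpha>) * Re (d * cis \<beta>) = Re (c * d / 2 * cis (\<alpha> + \<beta>)) + Re (c * cnj d / 2 * cis (\<alpha> - \<beta>))" for \<alpha> \<beta>
      by (simp add: cos_add sin_add cos_diff sin_diff algebra_simps) (simp add: field_simps)
    have "trig_poly (\<lambda>x. Re (c * d / 2 * cis (\<Sum>i\<in>I \<union> J. (?a i + ?b i) * x i)) + Re (c * cnj d / 2 * cis (\<Sum>i\<in>I \<union> J. (?a i - ?b i) * x i)))"
      using trig_wave by (intro trig_add trig_poly.trig_wave) auto
    then show ?case unfolding re s by (simp only: distrib_right left_diff_distrib sum.distrib sum_subtractf)
  next
    case (trig_add F' G')
    then show ?case by (simp add: distrib_left trig_poly.trig_add)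
  qed
next
  case (trig_add F F')
  then show ?case by (simp add: distrib_right trig_poly.trig_add)
qed

lemma trig_poly_const: "trig_poly (\<lambda>_. c)"
  using trig_wave[of "{}" "of_real c"] by simp

lemma trig_poly_sin: "trig_poly (\<lambda>x. sin (x i / R))"
  using trig_wave[of "{i}" "- \<i>" "\<lambda>_. 1 / R"] by simp

lemma trig_poly_bounded: "trig_poly F \<Longrightarrow> \<exists>B. \<forall>x. \<bar>F x\<bar> \<le> B"
proof (induction rule: trig_poly.induct)
  case (trig_wave I c a)
  have "\<bar>Re (c * cis t)\<bar> \<le> norm c" for t using abs_Re_le_cmod[of "c * cis t"] by (simp add: norm_mult)
  then show ?case by blast
next
  case (trig_add F G)
  then obtain B C where "\<forall>x. \<bar>F x\<bar> \<le> B" "\<forall>x. \<bar>G x\<bar> \<le> C" by blast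
  then have "\<forall>x. \<bar>F x + G x\<bar> \<le> B + C" by (metis abs_triangle_ineq add_mono order_trans)
  then show ?case by blast
qed

lemma trig_poly_measurable:
  assumes "trig_poly F" "\<And>i. Y i \<in> borel_measurable M" shows "(\<lambda>\<omega>. F (\<lambda>i. Y i \<omega>)) \<in> borel_measurable M"
  using assms
proof (induction rule: trig_poly.induct)
  case (trig_wave I c a)
  note [measurable] = trig_wave(2)
  show ?case unfolding cis_conv_exp by measurable
qed auto

lemma trig_poly_limit:
  fixes Z :: "nat \<Rightarrow> nat \<Rightarrow> 'a \<Rightarrow> real" and K :: "nat \<Rightarrow> 'b \<Rightarrow> real"
  assumes "trig_poly F" and M: "prob_space M" and P: "prob_space P"
    and Z [measurable]: "\<And>N i. Z N i \<in> borel_measurable M" and K [measurable]: "\<And>i. K i \<in> borel_measurable P"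
    and char: "\<And>I a. finite I \<Longrightarrow> (\<lambda>N. \<integral>\<omega>. cis (\<Sum>i\<in>I. a i * Z N i \<omega>) \<partial>M) \<longlonglongrightarrow> (\<integral>\<omega>. cis (\<Sum>i\<in>I. a i * K i \<omega>) \<partial>P)"
  shows "(\<lambda>N. \<integral>\<omega>. F (\<lambda>i. Z N i \<omega>) \<partial>M) \<longlonglongrightarrow> (\<integral>\<omega>. F (\<lambda>i. K i \<omega>) \<partial>P)"
  using assms(1)
proof (induction rule: trig_poly.induct)
  case (trig_wave I c a)
  interpret M: prob_space M by fact
  interpret P: prob_space P by fact
  have iM: "integrable M (\<lambda>\<omega>. c * cis (\<Sum>i\<in>I. a i * Z N i \<omega>))" for N
    unfolding cis_conv_exp by (rule M.integrable_const_bound[of _ "norm c"]) (auto simp: norm_mult)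
  have iP: "integrable P (\<lambda>\<omega>. c * cis (\<Sum>i\<in>I. a i * K i \<omega>))"
    unfolding cis_conv_exp by (rule P.integrable_const_bound[of _ "norm c"]) (auto simp: norm_mult)
  have "(\<lambda>N. Re (c * (\<integral>\<omega>. cis (\<Sum>i\<in>I. a i * Z N i \<omega>) \<partial>M))) \<longlonglongrightarrow> Re (c * (\<integral>\<omega>. cis (\<Sum>i\<in>I. a i * K i \<omega>) \<partial>P))"
    by (intro tendsto_Re tendsto_mult_left char trig_wave)
  then show ?case
    by (simp only: integral_Re[OF iM] integral_Re[OF iP] Bochner_Integration.integral_mult_right_zero)
next
  case (trig_add F G)
  interpret M: prob_space M by fact
  interpret P: prob_space P by fact
  obtain B C where B: "\<And>x. \<bar>F x\<bar> \<le> B" "\<And>x. \<bar>G x\<bar> \<le> C"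
    using trig_poly_bounded[OF trig_add.hyps(1)] trig_poly_bounded[OF trig_add.hyps(2)] by auto
  have int: "integrable N (\<lambda>\<omega>. G (\<lambda>i. Y i \<omega>))"
    if N: "prob_space N" and Y: "\<And>i. Y i \<in> borel_measurable N" and G: "trig_poly G" "\<And>x. \<bar>G x\<bar> \<le> B"
    for N :: "'c measure" and Y :: "nat \<Rightarrow> 'c \<Rightarrow> real" and G B
  proof -
    interpret prob_space N by fact
    show ?thesis
    proof (rule integrable_const_bound)
      show "AE \<omega> in N. norm (G (\<lambda>i. Y i \<omega>)) \<le> B" using G(2) by simp
    qed (rule trig_poly_measurable[OF G(1) Y])
  qed
  note i = int[OF M Z trig_add.hyps(1) B(1)] int[OF M Z trig_add.hyps(2) B(2)]
  note i' = int[OF P K trig_add.hyps(1) B(1)] int[OF P K trig_add.hyps(2) B(2)]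
  show ?case using tendsto_add[OF trig_add.IH] i i' by simp
qed

lemma sin_close: "\<bar>x - R * sin (x / R)\<bar> \<le> x\<^sup>2 / R" if "0 < R" for x R :: real
proof -
  have "\<bar>sin u - u\<bar> \<le> u\<^sup>2" for u :: real
  proof -
    have "\<bar>sin u - (\<Sum>m<2. sin_coeff m * u ^ m)\<bar> \<le> inverse (fact 2) * \<bar>u\<bar> ^ 2" by (rule Maclaurin_sin_bound)
    moreover have "(\<Sum>m<2. sin_coeff m * u ^ m) = u" by (simp add: eval_nat_numeral sin_coeff_def)
    moreover have "inverse (fact 2) * \<bar>u\<bar> ^ 2 = u\<^sup>2 / 2" by (simp add: field_simps)
    ultimately have "\<bar>sin u - u\<bar> \<le> u\<^sup>2 / 2" by (simp only:)
    also have "\<dots> \<le> u\<^sup>2" using zero_le_power2[of u] by simp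
    finally show ?thesis .
  qed
  from this[of "x / R"] have "R * \<bar>sin (x / R) - x / R\<bar> \<le> R * (x / R)\<^sup>2" using that by (intro mult_left_mono) auto
  moreover have "R * \<bar>sin (x / R) - x / R\<bar> = \<bar>x - R * sin (x / R)\<bar>"
  proof -
    have "R * \<bar>sin (x / R) - x / R\<bar> = \<bar>R * (sin (x / R) - x / R)\<bar>" using that by (simp add: abs_mult)
    also have "R * (sin (x / R) - x / R) = R * sin (x / R) - x" using that by (simp add: right_diff_distrib)
    finally show ?thesis by (simp add: abs_minus_commute)
  qed
  ultimately show ?thesis using that by (simp add: power2_eq_square)
qed

lemma compact_unit_box: "compact {s :: nat \<Rightarrow> real. \<forall>i. \<bar>s i\<bar> \<le> 1}"
proof -
  have "{s :: nat \<Rightarrow> real. \<forall>i. \<bar>s i\<bar> \<le> 1} = PiE UNIV (\<lambda>_. {-1..1})"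
    by (auto simp: PiE_UNIV_domain abs_le_iff minus_le_iff)
  moreover have "compactin (product_topology (\<lambda>_. euclidean) UNIV) (PiE UNIV (\<lambda>_::nat. {-1..1::real}))"
    by (subst compactin_PiE) auto
  ultimately show ?thesis by (simp only: euclidean_product_topology compactin_euclidean_iff)
qed

lemma continuous_finite_lipschitz:
  fixes H :: "(nat \<Rightarrow> real) \<Rightarrow> real"
  assumes "\<And>x y. \<bar>H x - H y\<bar> \<le> L * (\<Sum>i<q. \<bar>x i - y i\<bar>)"
  shows "continuous_on UNIV H"
  unfolding continuous_on_def
proof
  fix y :: "nat \<Rightarrow> real"
  have c: "((\<lambda>x. x i) \<longlongrightarrow> y i) (at y)" for i
    using continuous_on_product_coordinates[of i] by (auto simp: continuous_on_def)
  have "((\<lambda>x. L * (\<Sum>i<q. \<bar>x i - y i\<bar>)) \<longlongrightarrow> L * (\<Sum>i<q. \<bar>y i - y i\<bar>)) (at y)"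
    by (intro tendsto_intros c)
  then have lim: "((\<lambda>x. L * (\<Sum>i<q. \<bar>x i - y i\<bar>)) \<longlongrightarrow> 0) (at y)" by simp
  have "((\<lambda>x. H x - H y) \<longlongrightarrow> 0) (at y)"
  proof (rule Lim_null_comparison[OF always_eventually lim], rule allI)
    show "norm (H x - H y) \<le> L * (\<Sum>i<q. \<bar>x i - y i\<bar>)" for x unfolding real_norm_def by (rule assms)
  qed
  then show "(H \<longlongrightarrow> H y) (at y)" by (simp add: LIM_zero_iff)
qed

text \<open>
  The sines take values in a compact cube, on which Stone--Weierstrass applies to the algebra of
  functions that become trigonometric polynomials when composed with the sines.
\<close>

lemma sine_trig_approx:
  fixes H :: "(nat \<Rightarrow> real) \<Rightarrow> real"
  assumes lip: "\<And>x y. \<bar>H x - H y\<bar> \<le> L * (\<Sum>i<q. \<bar>x i - y i\<bar>)" and e: "0 < e"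
  obtains T where "trig_poly T" "\<And>x. \<bar>H (\<lambda>i. R * sin (x i / R)) - T x\<bar> < e"
proof -
  let ?S = "{s :: nat \<Rightarrow> real. \<forall>i. \<bar>s i\<bar> \<le> 1}"
  let ?R = "{F. continuous_on ?S F \<and> trig_poly (\<lambda>x. F (\<lambda>i. sin (x i / R)))}"
  interpret function_ring_on ?R ?S
  proof
    show "compact ?S" by (rule compact_unit_box)
    show "\<exists>f\<in>?R. f x \<noteq> f y" if xy: "x \<noteq> y" for x y
    proof -
      obtain i where i: "x i \<noteq> y i" using xy by blast
      have "continuous_on ?S (\<lambda>s. s i)"
        by (rule continuous_on_subset[OF continuous_on_product_coordinates]) simp
      then show ?thesis using i trig_poly_sin by (intro bexI[of _ "\<lambda>s. s i"]) auto
    qed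
  qed (auto intro: continuous_on_add continuous_on_mult continuous_on_const trig_add trig_poly_mult trig_poly_const)
  have "\<bar>H (\<lambda>i. R * x i) - H (\<lambda>i. R * y i)\<bar> \<le> (\<bar>L\<bar> * \<bar>R\<bar>) * (\<Sum>i<q. \<bar>x i - y i\<bar>)" for x y
  proof -
    have "\<bar>H (\<lambda>i. R * x i) - H (\<lambda>i. R * y i)\<bar> \<le> L * (\<Sum>i<q. \<bar>R * x i - R * y i\<bar>)" by (rule lip)
    also have "\<dots> = L * (\<bar>R\<bar> * (\<Sum>i<q. \<bar>x i - y i\<bar>))"
      by (simp add: sum_distrib_left abs_mult flip: right_diff_distrib)
    also have "\<dots> \<le> \<bar>L\<bar> * (\<bar>R\<bar> * (\<Sum>i<q. \<bar>x i - y i\<bar>))" by (intro mult_right_mono) (auto intro: sum_nonneg)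
    finally show ?thesis by (simp add: mult.assoc)
  qed
  then have "continuous_on UNIV (\<lambda>s. H (\<lambda>i. R * s i))" by (rule continuous_finite_lipschitz)
  then have "continuous_on ?S (\<lambda>s. H (\<lambda>i. R * s i))" by (rule continuous_on_subset) simp
  from Stone_Weierstrass_basic[OF this e] obtain g where g: "g \<in> ?R" "\<forall>s\<in>?S. \<bar>H (\<lambda>i. R * s i) - g s\<bar> < e" by blast
  show ?thesis
  proof (rule that)
    show "trig_poly (\<lambda>x. g (\<lambda>i. sin (x i / R)))" using g by simp
    show "\<bar>H (\<lambda>i. R * sin (x i / R)) - g (\<lambda>i. sin (x i / R))\<bar> < e" for x
      using g(2)[rule_format, of "\<lambda>i. sin (x i / R)"] by simp
  qed
qed

lemma finite_lipschitz_measurable: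
  fixes H :: "(nat \<Rightarrow> real) \<Rightarrow> real"
  assumes "\<And>x y. \<bar>H x - H y\<bar> \<le> L * (\<Sum>i<q. \<bar>x i - y i\<bar>)" and "\<And>i. Y i \<in> borel_measurable M"
  shows "(\<lambda>\<omega>. H (\<lambda>i. Y i \<omega>)) \<in> borel_measurable M"
proof -
  have "H \<in> borel_measurable borel"
    by (rule borel_measurable_continuous_onI, rule continuous_finite_lipschitz[where H = H and L = L and q = q]) (rule assms(1))
  moreover have "(\<lambda>\<omega> i. Y i \<omega>) \<in> borel_measurable M"
    using assms(2) by (rule measurable_coordinatewise_then_product)
  ultimately show ?thesis using measurable_compose[of "\<lambda>\<omega> i. Y i \<omega>" M borel H borel] by simp
qed

text \<open>
  Replacing each coordinate \<open>x\<close> by \<open>R sin (x / R)\<close> costs at most \<open>x\<^sup>2 / R\<close>, which second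
  moments control uniformly. This plays the role of tightness in Levy's continuity theorem.
\<close>

lemma finite_lipschitz_vs_trig:
  fixes H :: "(nat \<Rightarrow> real) \<Rightarrow> real"
  assumes M: "prob_space M" and Y [measurable]: "\<And>i. Y i \<in> borel_measurable M"
    and Y2: "\<And>i. integrable M (\<lambda>\<omega>. (Y i \<omega>)\<^sup>2)" "\<And>i. (\<integral>\<omega>. (Y i \<omega>)\<^sup>2 \<partial>M) \<le> V"
    and lip: "\<And>x y. \<bar>H x - H y\<bar> \<le> L * (\<Sum>i<q. \<bar>x i - y i\<bar>)" and L: "0 \<le> L"
    and bd: "\<And>x. \<bar>H x\<bar> \<le> B" and R: "0 < R"
    and T: "trig_poly T" "\<And>x. \<bar>H (\<lambda>i. R * sin (x i / R)) - T x\<bar> < e"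
  shows "\<bar>(\<integral>\<omega>. H (\<lambda>i. Y i \<omega>) \<partial>M) - (\<integral>\<omega>. T (\<lambda>i. Y i \<omega>) \<partial>M)\<bar> \<le> L * real q * V / R + e"
proof -
  interpret prob_space M by fact
  obtain C where C: "\<And>x. \<bar>T x\<bar> \<le> C" using trig_poly_bounded[OF T(1)] by blast
  have iH: "integrable M (\<lambda>\<omega>. H (\<lambda>i. Y i \<omega>))"
    using finite_lipschitz_measurable[where H = H and L = L and q = q and Y = Y, OF lip Y] bd by (intro integrable_const_bound[of _ B]) auto
  have iT: "integrable M (\<lambda>\<omega>. T (\<lambda>i. Y i \<omega>))"
    using trig_poly_measurable[OF T(1), of Y, OF Y] C by (intro integrable_const_bound[of _ C]) auto
  have iS: "integrable M (\<lambda>\<omega>. L * (\<Sum>i<q. (Y i \<omega>)\<^sup>2 / R) + e)" using Y2(1) by auto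
  have "\<bar>H (\<lambda>i. Y i \<omega>) - T (\<lambda>i. Y i \<omega>)\<bar> \<le> L * (\<Sum>i<q. (Y i \<omega>)\<^sup>2 / R) + e" for \<omega>
  proof -
    have "\<bar>H (\<lambda>i. Y i \<omega>) - H (\<lambda>i. R * sin (Y i \<omega> / R))\<bar> \<le> L * (\<Sum>i<q. \<bar>Y i \<omega> - R * sin (Y i \<omega> / R)\<bar>)" by (rule lip)
    also have "\<dots> \<le> L * (\<Sum>i<q. (Y i \<omega>)\<^sup>2 / R)" by (intro mult_left_mono sum_mono sin_close R L)
    finally show ?thesis using T(2)[of "\<lambda>i. Y i \<omega>"] by linarith
  qed
  then have "(\<integral>\<omega>. \<bar>H (\<lambda>i. Y i \<omega>) - T (\<lambda>i. Y i \<omega>)\<bar> \<partial>M) \<le> (\<integral>\<omega>. L * (\<Sum>i<q. (Y i \<omega>)\<^sup>2 / R) + e \<partial>M)"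
    using iH iT iS by (intro integral_mono) auto
  also have "\<dots> = L * (\<Sum>i<q. (\<integral>\<omega>. (Y i \<omega>)\<^sup>2 \<partial>M) / R) + e" using Y2(1) by (simp add: prob_space)
  also have "\<dots> \<le> L * (\<Sum>i<q. V / R) + e"
    using R L Y2(2) by (intro add_mono mult_left_mono sum_mono divide_right_mono) auto
  finally have "(\<integral>\<omega>. \<bar>H (\<lambda>i. Y i \<omega>) - T (\<lambda>i. Y i \<omega>)\<bar> \<partial>M) \<le> L * real q * V / R + e" by simp
  moreover have "(\<integral>\<omega>. H (\<lambda>i. Y i \<omega>) \<partial>M) - (\<integral>\<omega>. T (\<lambda>i. Y i \<omega>) \<partial>M) = (\<integral>\<omega>. H (\<lambda>i. Y i \<omega>) - T (\<lambda>i. Y i \<omega>) \<partial>M)"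
    using iH iT by simp
  ultimately show ?thesis using integral_abs_bound[of M "\<lambda>\<omega>. H (\<lambda>i. Y i \<omega>) - T (\<lambda>i. Y i \<omega>)"] by linarith
qed

text \<open>
  Letting \<open>R\<close> grow and then approximating by a trigonometric polynomial reduces the claim to the
  convergence of characteristic functions.
\<close>

theorem finite_dim_limit:
  fixes Z :: "nat \<Rightarrow> nat \<Rightarrow> 'a \<Rightarrow> real" and K :: "nat \<Rightarrow> 'b \<Rightarrow> real" and H :: "(nat \<Rightarrow> real) \<Rightarrow> real"
  assumes M: "prob_space M" and P: "prob_space P"
    and Z: "\<And>N i. Z N i \<in> borel_measurable M" and K: "\<And>i. K i \<in> borel_measurable P"
    and char: "\<And>I a. finite I \<Longrightarrow> (\<lambda>N. \<integral>\<omega>. cis (\<Sum>i\<in>I. a i * Z N i \<omega>) \<partial>M) \<longlonglongrightarrow> (\<integral>\<omega>. cis (\<Sum>i\<in>I. a i * K i \<omega>) \<partial>P)"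
    and Z2: "\<And>N i. integrable M (\<lambda>\<omega>. (Z N i \<omega>)\<^sup>2)" "\<And>N i. (\<integral>\<omega>. (Z N i \<omega>)\<^sup>2 \<partial>M) \<le> V"
    and K2: "\<And>i. integrable P (\<lambda>\<omega>. (K i \<omega>)\<^sup>2)" "\<And>i. (\<integral>\<omega>. (K i \<omega>)\<^sup>2 \<partial>P) \<le> V"
    and lip: "\<And>x y. \<bar>H x - H y\<bar> \<le> L * (\<Sum>i<q. \<bar>x i - y i\<bar>)" and L: "0 \<le> L" and bd: "\<And>x. \<bar>H x\<bar> \<le> B"
  shows "(\<lambda>N. \<integral>\<omega>. H (\<lambda>i. Z N i \<omega>) \<partial>M) \<longlonglongrightarrow> (\<integral>\<omega>. H (\<lambda>i. K i \<omega>) \<partial>P)"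
proof (rule LIMSEQ_I)
  fix \<epsilon> :: real assume \<epsilon>: "0 < \<epsilon>"
  have V: "0 \<le> V" using K2(2)[of 0] by (rule order_trans[rotated]) simp
  define R where "R = 8 * (L * real q * V + 1) / \<epsilon>"
  have R: "0 < R" using \<epsilon> L V by (simp add: R_def add_nonneg_pos)
  have LR: "L * real q * V / R \<le> \<epsilon> / 8"
  proof -
    have "\<epsilon> / 8 * R = L * real q * V + 1" using \<epsilon> by (simp add: R_def)
    then show ?thesis unfolding pos_divide_le_eq[OF R] by linarith
  qed
  obtain T where T: "trig_poly T" "\<And>x. \<bar>H (\<lambda>i. R * sin (x i / R)) - T x\<bar> < \<epsilon> / 8"

    by (rule sine_trig_approx[where H = H and L = L and q = q and R = R and e = "\<epsilon> / 8", OF lip]) (use \<epsilon> in auto)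
  note 1 = finite_lipschitz_vs_trig[where H = H and L = L and q = q and Y = "Z N" for N, OF M Z Z2 lip L bd R T]
  note 2 = finite_lipschitz_vs_trig[where H = H and L = L and q = q and Y = K, OF P K K2 lip L bd R T]
  obtain N0 where N0: "\<forall>N\<ge>N0. norm ((\<integral>\<omega>. T (\<lambda>i. Z N i \<omega>) \<partial>M) - (\<integral>\<omega>. T (\<lambda>i. K i \<omega>) \<partial>P)) < \<epsilon> / 4"
  proof -
    have "(\<lambda>N. \<integral>\<omega>. T (\<lambda>i. Z N i \<omega>) \<partial>M) \<longlonglongrightarrow> (\<integral>\<omega>. T (\<lambda>i. K i \<omega>) \<partial>P)"
      by (rule trig_poly_limit[OF T(1) M P Z K char])
    moreover have "0 < \<epsilon> / 4" using \<epsilon> by simp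
    ultimately have "\<exists>N0. \<forall>N\<ge>N0. norm ((\<integral>\<omega>. T (\<lambda>i. Z N i \<omega>) \<partial>M) - (\<integral>\<omega>. T (\<lambda>i. K i \<omega>) \<partial>P)) < \<epsilon> / 4" by (rule LIMSEQ_D)
    then show ?thesis using that by blast
  qed
  have "norm ((\<integral>\<omega>. H (\<lambda>i. Z N i \<omega>) \<partial>M) - (\<integral>\<omega>. H (\<lambda>i. K i \<omega>) \<partial>P)) < \<epsilon>" if "N0 \<le> N" for N
  proof -
    have 3: "\<bar>(\<integral>\<omega>. T (\<lambda>i. Z N i \<omega>) \<partial>M) - (\<integral>\<omega>. T (\<lambda>i. K i \<omega>) \<partial>P)\<bar> < \<epsilon> / 4" using N0 that by simp
    have e4: "\<epsilon> / 8 + \<epsilon> / 8 = \<epsilon> / 4" by simp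
    show ?thesis using 1[of N] 2 3 LR e4 \<epsilon> unfolding real_norm_def by linarith
  qed
  then show "\<exists>N0. \<forall>N\<ge>N0. norm ((\<integral>\<omega>. H (\<lambda>i. Z N i \<omega>) \<partial>M) - (\<integral>\<omega>. H (\<lambda>i. K i \<omega>) \<partial>P)) < \<epsilon>" by blast
qed

section \<open>Square roots of positive semidefinite kernels\<close>

definition psd_kernel :: "(nat \<Rightarrow> nat \<Rightarrow> real) \<Rightarrow> bool" where
  "psd_kernel G \<longleftrightarrow> (\<forall>n m. G n m = G m n) \<and>
     (\<forall>I c. finite I \<longrightarrow> 0 \<le> (\<Sum>n\<in>I. \<Sum>m\<in>I. c n * c m * G n m))"

lemma psd_kernelD:
  assumes "psd_kernel G"
  shows "G n m = G m n" "finite I \<Longrightarrow> 0 \<le> (\<Sum>n\<in>I. \<Sum>m\<in>I. c n * c m * G n m)" "0 \<le> G n n"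
proof -
  show sy: "G n m = G m n" and ps: "finite I \<Longrightarrow> 0 \<le> (\<Sum>n\<in>I. \<Sum>m\<in>I. c n * c m * G n m)" for n m I c
    using assms unfolding psd_kernel_def by blast+
  show "0 \<le> G n n" using ps[of "{n}" "\<lambda>_. 1"] by simp
qed

text \<open>
  If a diagonal entry vanishes, a nonzero entry in its row would make the quadratic form negative
  on a suitable vector supported on two indices.
\<close>

lemma psd_kernel_zero_row:
  assumes G: "psd_kernel G" and z: "G i i = 0" shows "G i m = 0"
proof (rule ccontr)
  assume nz: "G i m \<noteq> 0"
  then have im: "i \<noteq> m" using z by auto
  (* With this t the quadratic form takes the value -1. *)
  define t where "t = - (G m m + 1) / (2 * G i m)"
  have "0 \<le> (\<Sum>n\<in>{i, m}. \<Sum>k\<in>{i, m}. (if n = i then t else 1) * (if k = i then t else 1) * G n k)"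
    by (rule psd_kernelD(2)[OF G]) simp
  also have "\<dots> = t * G i m + t * G m i + G m m" using im z by simp
  also have "\<dots> = 2 * t * G i m + G m m" using psd_kernelD(1)[OF G, of m i] by simp
  also have "\<dots> = -1" using nz by (simp add: t_def field_simps)
  finally show False by simp
qed

text \<open>
  The Schur complement: the kernel that remains after projecting out the \<open>i\<close>-th variable. If
  \<open>G i i = 0\<close>, the quotient is \<open>0\<close> and the kernel does not change, which is right because the
  row then vanishes.
\<close>

definition schur :: "nat \<Rightarrow> (nat \<Rightarrow> nat \<Rightarrow> real) \<Rightarrow> nat \<Rightarrow> nat \<Rightarrow> real" where
  "schur i G n m = G n m - G n i * G i m / G i i"

text \<open>
  The quadratic form of the Schur complement at \<open>c\<close> is that of \<open>G\<close> at the vector obtained from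
  \<open>c\<close> by changing its \<open>i\<close>-th entry optimally, by \<open>\<alpha>\<close>.
\<close>

lemma psd_kernel_schur:
  assumes G: "psd_kernel G" shows "psd_kernel (schur i G)"
  unfolding psd_kernel_def
proof (intro conjI allI impI)
  note sy = psd_kernelD(1)[OF G]
  show "schur i G n m = schur i G m n" for n m
    by (simp add: schur_def sy[of n m] sy[of n i] sy[of i m])
  fix I :: "nat set" and c :: "nat \<Rightarrow> real" assume I: "finite I"
  define c0 where "c0 n = (if n \<in> I then c n else 0)" for n
  define J where "J = insert i I"
  have J: "finite J" "i \<in> J" using I by (auto simp: J_def)
  define b where "b = (\<Sum>n\<in>J. c0 n * G n i)"
  define \<alpha> where "\<alpha> = b / G i i"
  have ext: "(\<Sum>n\<in>I. \<Sum>m\<in>I. c n * c m * F n m) = (\<Sum>n\<in>J. \<Sum>m\<in>J. c0 n * c0 m * F n m)" for F :: "nat \<Rightarrow> nat \<Rightarrow> real"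
  proof -
    have "(\<Sum>n\<in>I. \<Sum>m\<in>I. c n * c m * F n m) = (\<Sum>n\<in>I. \<Sum>m\<in>J. c0 n * c0 m * F n m)"
      using I J by (intro sum.cong refl sum.mono_neutral_cong_left) (auto simp: c0_def J_def)
    also have "\<dots> = (\<Sum>n\<in>J. \<Sum>m\<in>J. c0 n * c0 m * F n m)"
      using I J by (intro sum.mono_neutral_left) (auto simp: c0_def J_def)
    finally show ?thesis .
  qed
  let ?\<delta> = "\<lambda>n. if n = i then 1 else 0 :: real"
  have "0 \<le> (\<Sum>n\<in>J. \<Sum>m\<in>J. (c0 n - \<alpha> * ?\<delta> n) * (c0 m - \<alpha> * ?\<delta> m) * G n m)"
    by (rule psd_kernelD(2)[OF G J(1)])
  also have "\<dots> = (\<Sum>n\<in>J. \<Sum>m\<in>J. c0 n * c0 m * G n m) - \<alpha> * (\<Sum>n\<in>J. c0 n * (\<Sum>m\<in>J. ?\<delta> m * G n m))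
      - \<alpha> * (\<Sum>n\<in>J. ?\<delta> n * (\<Sum>m\<in>J. c0 m * G n m)) + \<alpha> * \<alpha> * (\<Sum>n\<in>J. ?\<delta> n * (\<Sum>m\<in>J. ?\<delta> m * G n m))"
    by (simp add: algebra_simps sum.distrib sum_subtractf sum_distrib_left)
  also have "(\<Sum>n\<in>J. c0 n * (\<Sum>m\<in>J. ?\<delta> m * G n m)) = b"
    using J by (simp add: b_def if_distrib[of "\<lambda>x. x * _"] cong: if_cong)
  also have "(\<Sum>n\<in>J. ?\<delta> n * (\<Sum>m\<in>J. c0 m * G n m)) = b"
    using J sy by (simp add: b_def if_distrib[of "\<lambda>x. x * _"] cong: if_cong)
  also have "(\<Sum>n\<in>J. ?\<delta> n * (\<Sum>m\<in>J. ?\<delta> m * G n m)) = G i i"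
    using J by (simp add: if_distrib[of "\<lambda>x. x * _"] cong: if_cong)
  also have "(\<Sum>n\<in>J. \<Sum>m\<in>J. c0 n * c0 m * G n m) - \<alpha> * b - \<alpha> * b + \<alpha> * \<alpha> * G i i =
     (\<Sum>n\<in>J. \<Sum>m\<in>J. c0 n * c0 m * G n m) - b * b / G i i"
    by (cases "G i i = 0") (simp_all add: \<alpha>_def)
  also have "b * b / G i i = (\<Sum>n\<in>J. \<Sum>m\<in>J. c0 n * c0 m * (G n i * G i m / G i i))"
  proof -
    have "b * b = (\<Sum>n\<in>J. \<Sum>m\<in>J. (c0 n * G n i) * (c0 m * G m i))" by (simp add: b_def sum_product)
    also have "\<dots> = (\<Sum>n\<in>J. \<Sum>m\<in>J. c0 n * c0 m * (G n i * G i m))"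
      using sy[of _ i] by (intro sum.cong refl) simp
    finally show ?thesis by (simp add: sum_divide_distrib)
  qed
  also have "(\<Sum>n\<in>J. \<Sum>m\<in>J. c0 n * c0 m * G n m) - \<dots> = (\<Sum>n\<in>J. \<Sum>m\<in>J. c0 n * c0 m * schur i G n m)"
    by (simp add: schur_def right_diff_distrib sum_subtractf)
  finally show "0 \<le> (\<Sum>n\<in>I. \<Sum>m\<in>I. c n * c m * schur i G n m)" unfolding ext .
qed

text \<open>
  A lower triangular square root, obtained by taking Schur complements at \<open>0, 1, 2, \<dots>\<close> in turn:
  after \<open>k\<close> steps the first \<open>k\<close> rows and columns are zero.
\<close>

lemma cholesky:
  assumes G: "psd_kernel G"
  obtains a :: "nat \<Rightarrow> nat \<Rightarrow> real" where "\<And>n i. n < i \<Longrightarrow> a n i = 0" "\<And>n m k. n < k \<Longrightarrow> G n m = (\<Sum>i<k. a n i * a m i)"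
proof -
  define R where "R k = rec_nat G schur k" for k
  have R0: "R 0 = G" and RS: "R (Suc k) = schur k (R k)" for k by (simp_all add: R_def)
  have psd: "psd_kernel (R k)" for k by (induction k) (simp_all add: R0 RS G psd_kernel_schur)
  have row0: "i < k \<Longrightarrow> R k i m = 0" for i k m
  proof (induction k arbitrary: m)
    case (Suc k)
    show ?case
    proof (cases "i = k")
      case True
      then show ?thesis using psd_kernel_zero_row[OF psd, of k k m] by (cases "R k k k = 0") (auto simp: RS schur_def)
    next
      case False
      then show ?thesis using Suc by (simp add: RS schur_def)
    qed
  qed simp
  have col0: "i < k \<Longrightarrow> R k m i = 0" for i k m using row0[of i k m] psd_kernelD(1)[OF psd, of k m i] by simp
  define a where "a n i = R i n i / sqrt (R i i i)" for n i
  have step: "R i n m = a n i * a m i + R (Suc i) n m" for i n m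
  proof -
    have "sqrt (R i i i) * sqrt (R i i i) = R i i i" using psd_kernelD(3)[OF psd] by simp
    then have "a n i * a m i = R i n i * R i i m / R i i i"
      using psd_kernelD(1)[OF psd, of i m i] by (simp add: a_def)
    then show ?thesis by (simp add: RS schur_def)
  qed
  have dec: "G n m = (\<Sum>i<k. a n i * a m i) + R k n m" for n m k
  proof (induction k)
    case (Suc k)
    then show ?case using step[of k n m] by simp
  qed (simp add: R0)
  show ?thesis
  proof (rule that)
    show "a n i = 0" if "n < i" for n i using row0[OF that] by (simp add: a_def)
    show "G n m = (\<Sum>i<k. a n i * a m i)" if "n < k" for n m k using dec[of n m k] row0[OF that] by simp
  qed
qed

section \<open>Gaussian sequences\<close>

text \<open>
  A Gaussian sequence is a triangular linear combination of the independent coordinates at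
  \<open>real 0, real 1, \<dots>\<close>.
\<close>

abbreviation gauss_space :: "(real \<Rightarrow> real) measure" where
  "gauss_space \<equiv> PiM UNIV (\<lambda>_. std_normal_distribution)"

lemma prob_space_gauss_space: "prob_space gauss_space"
  using prob_space_normal_density by (intro prob_space_PiM) auto

lemma indep_gauss_coordinates:
  "prob_space.indep_vars gauss_space (\<lambda>_. borel) (\<lambda>(i::real) \<omega>. \<omega> i) UNIV"
proof -
  interpret prob_space gauss_space by (rule prob_space_gauss_space)
  have sb: "sets gauss_space = sets (PiM UNIV (\<lambda>_. borel :: real measure))" by (intro sets_PiM_cong) auto
  have rv: "random_variable borel (\<lambda>\<omega>. \<omega> i)" for i :: real
    using measurable_component_singleton[of i UNIV "\<lambda>_. std_normal_distribution"] by simp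
  have comp: "distr gauss_space borel (\<lambda>\<omega>. \<omega> i) = std_normal_distribution" for i
  proof -
    have "distr gauss_space std_normal_distribution (\<lambda>\<omega>. \<omega> i) = std_normal_distribution"
      using prob_space_normal_density by (intro distr_PiM_component) auto
    moreover have "distr gauss_space borel (\<lambda>\<omega>. \<omega> i) = distr gauss_space std_normal_distribution (\<lambda>\<omega>. \<omega> i)"
      by (intro distr_cong) auto
    ultimately show ?thesis by simp
  qed
  have "distr gauss_space (PiM UNIV (\<lambda>_. borel)) (\<lambda>x. \<lambda>i\<in>UNIV. x i) = gauss_space"
  proof -
    have "distr gauss_space (PiM UNIV (\<lambda>_. borel)) (\<lambda>x. x) = distr gauss_space gauss_space (\<lambda>x. x)"
      by (intro distr_cong) (auto simp: sb)
    then show ?thesis by (simp add: restrict_UNIV)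
  qed
  then show ?thesis
    by (subst indep_vars_iff_distr_eq_PiM') (auto simp: rv comp)
qed

lemma gauss_coordinate_char: "(\<integral>\<omega>. cis (b * \<omega> i) \<partial>gauss_space) = of_real (exp (- b\<^sup>2 / 2))"
proof -
  interpret prob_space gauss_space by (rule prob_space_gauss_space)
  have "(\<integral>x. cis (b * x) \<partial>std_normal_distribution) = (\<integral>\<omega>. cis (b * \<omega> i) \<partial>gauss_space)"
  proof -
    have "distr gauss_space std_normal_distribution (\<lambda>\<omega>. \<omega> i) = std_normal_distribution"
      using prob_space_normal_density by (intro distr_PiM_component) auto
    then have "(\<integral>x. cis (b * x) \<partial>std_normal_distribution) = (\<integral>x. cis (b * x) \<partial>distr gauss_space std_normal_distribution (\<lambda>\<omega>. \<omega> i))"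
      by simp
    also have "\<dots> = (\<integral>\<omega>. cis (b * \<omega> i) \<partial>gauss_space)"
      unfolding cis_conv_exp by (rule integral_distr) auto
    finally show ?thesis .
  qed
  moreover have "(\<integral>x. cis (b * x) \<partial>std_normal_distribution) = char std_normal_distribution b"
    by (simp add: char_def cis_conv_exp)
  ultimately show ?thesis by (simp add: char_std_normal_distribution)
qed

lemma gauss_coordinate_sum_char:
  assumes J: "finite J"
  shows "(\<integral>\<omega>. cis (\<Sum>x\<in>J. b x * \<omega> x) \<partial>gauss_space) = of_real (exp (- (\<Sum>x\<in>J. (b x)\<^sup>2) / 2))"
proof -
  interpret prob_space gauss_space by (rule prob_space_gauss_space)
  have rv [measurable]: "(\<lambda>\<omega>. \<omega> i) \<in> borel_measurable gauss_space" for i :: real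
    using measurable_component_singleton[of i UNIV "\<lambda>_. std_normal_distribution"] by simp
  have "indep_vars (\<lambda>_. borel) (\<lambda>x \<omega>. cis (b x * \<omega> x)) J"
    unfolding cis_conv_exp
    by (rule indep_vars_compose2[OF indep_vars_subset[OF indep_gauss_coordinates subset_UNIV]]) measurable
  moreover have "integrable gauss_space (\<lambda>\<omega>. cis (b x * \<omega> x))" for x
    unfolding cis_conv_exp by (rule integrable_const_bound[of _ 1]) auto
  ultimately have "(\<integral>\<omega>. (\<Prod>x\<in>J. cis (b x * \<omega> x)) \<partial>gauss_space) = (\<Prod>x\<in>J. \<integral>\<omega>. cis (b x * \<omega> x) \<partial>gauss_space)"
    using J by (intro indep_vars_lebesgue_integral)
  also have "\<dots> = (\<Prod>x\<in>J. of_real (exp (- (b x)\<^sup>2 / 2)))" by (simp only: gauss_coordinate_char)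
  also have "\<dots> = of_real (exp (\<Sum>x\<in>J. - (b x)\<^sup>2 / 2))" by (simp only: exp_sum[OF J] of_real_prod)
  also have "(\<Sum>x\<in>J. - (b x)\<^sup>2 / 2) = - (\<Sum>x\<in>J. (b x)\<^sup>2) / 2" by (simp add: sum_negf sum_divide_distrib)
  also have "(\<lambda>\<omega>. \<Prod>x\<in>J. cis (b x * \<omega> x)) = (\<lambda>\<omega>. cis (\<Sum>x\<in>J. b x * \<omega> x))"
    by (simp add: cis_conv_exp sum_distrib_left exp_sum[OF J])
  finally show ?thesis .
qed

lemma gauss_sum_char:
  "(\<integral>\<omega>. cis (\<Sum>i<k::nat. b i * \<omega> (real i)) \<partial>gauss_space) = of_real (exp (- (\<Sum>i<k. (b i)\<^sup>2) / 2))"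
  using gauss_coordinate_sum_char[of "real ` {..<k}" "\<lambda>x. b (nat \<lfloor>x\<rfloor>)"]
  by (simp add: sum.reindex)

text \<open>
  The variables are selected through \<open>e\<close>, which may repeat them; finite families indexed by an
  arbitrary type are covered in this way.
\<close>

lemma gaussian_sequence:
  assumes G: "psd_kernel G"
  obtains Z :: "nat \<Rightarrow> (real \<Rightarrow> real) \<Rightarrow> real" where "\<And>n. Z n \<in> borel_measurable gauss_space"
    "\<And>(I :: 'i set) c e. finite I \<Longrightarrow> (\<integral>\<omega>. cis (\<Sum>i\<in>I. c i * Z (e i) \<omega>) \<partial>gauss_space) =
       of_real (exp (- (\<Sum>i\<in>I. \<Sum>j\<in>I. c i * c j * G (e i) (e j)) / 2))"
proof -
  have rv [measurable]: "(\<lambda>\<omega>. \<omega> i) \<in> borel_measurable gauss_space" for i :: real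
    using measurable_component_singleton[of i UNIV "\<lambda>_. std_normal_distribution"] by simp
  obtain a where a: "\<And>n i. n < i \<Longrightarrow> a n i = 0" "\<And>n m k. n < k \<Longrightarrow> G n m = (\<Sum>i<k. a n i * a m i)"
    using cholesky[OF G] by metis
  define Z where "Z n \<omega> = (\<Sum>i<Suc n. a n i * \<omega> (real i))" for n and \<omega> :: "real \<Rightarrow> real"
  have Zk: "Z n \<omega> = (\<Sum>i<k. a n i * \<omega> (real i))" if "n < k" for n k \<omega>
    unfolding Z_def using that a(1) by (intro sum.mono_neutral_left) auto
  show ?thesis
  proof (rule that[of Z])
    show "Z n \<in> borel_measurable gauss_space" for n unfolding Z_def[abs_def] by measurable
    fix I :: "'i set" and c :: "'i \<Rightarrow> real" and e :: "'i \<Rightarrow> nat"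
    assume I: "finite I"
    define k where "k = Suc (\<Sum>i\<in>I. e i)"
    have k: "e i < k" if "i \<in> I" for i using member_le_sum[OF that, of e] I by (simp add: k_def)
    define b where "b j = (\<Sum>i\<in>I. c i * a (e i) j)" for j
    have "(\<Sum>i\<in>I. c i * Z (e i) \<omega>) = (\<Sum>j<k. b j * \<omega> (real j))" for \<omega>
    proof -
      have "(\<Sum>i\<in>I. c i * Z (e i) \<omega>) = (\<Sum>i\<in>I. \<Sum>j<k. c i * a (e i) j * \<omega> (real j))"
      proof (intro sum.cong refl)
        fix i assume "i \<in> I"
        then show "c i * Z (e i) \<omega> = (\<Sum>j<k. c i * a (e i) j * \<omega> (real j))"
          by (simp only: Zk[OF k] sum_distrib_left mult.assoc)
      qed
      then show ?thesis by (subst (asm) sum.swap) (simp add: b_def sum_distrib_right)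
    qed
    moreover have "(\<Sum>j<k. (b j)\<^sup>2) = (\<Sum>i\<in>I. \<Sum>j\<in>I. c i * c j * G (e i) (e j))"
    proof -
      have "(\<Sum>j<k. (b j)\<^sup>2) = (\<Sum>l<k. \<Sum>i\<in>I. \<Sum>j\<in>I. c i * c j * (a (e i) l * a (e j) l))"
        by (simp add: b_def power2_eq_square sum_product mult_ac)
      also have "\<dots> = (\<Sum>i\<in>I. \<Sum>j\<in>I. \<Sum>l<k. c i * c j * (a (e i) l * a (e j) l))"
        by (subst sum.swap) (intro sum.cong refl sum.swap)
      also have "\<dots> = (\<Sum>i\<in>I. \<Sum>j\<in>I. c i * c j * G (e i) (e j))"
        by (intro sum.cong refl) (simp only: a(2)[OF k] sum_distrib_left)
      finally show ?thesis .
    qed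
    ultimately show "(\<integral>\<omega>. cis (\<Sum>i\<in>I. c i * Z (e i) \<omega>) \<partial>gauss_space) =
       of_real (exp (- (\<Sum>i\<in>I. \<Sum>j\<in>I. c i * c j * G (e i) (e j)) / 2))"
      by (simp only: gauss_sum_char)
  qed
qed

section \<open>Centred normal laws from characteristic functions\<close>

text \<open>
  Uniqueness of characteristic functions; scaling the standard normal law includes the degenerate
  case \<open>Q = 0\<close>.
\<close>

lemma centered_normal_law:
  assumes P: "prob_space P" and W [measurable]: "W \<in> borel_measurable P" and Q: "0 \<le> Q"
    and char: "\<And>\<theta>. (\<integral>\<omega>. cis (\<theta> * W \<omega>) \<partial>P) = of_real (exp (- (\<theta>\<^sup>2 * Q) / 2))"
  shows "distr P borel W = distr std_normal_distribution borel (\<lambda>x. sqrt Q * x)"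
proof -
  interpret P: prob_space P by fact
  interpret N: real_distribution std_normal_distribution by (rule real_dist_normal_dist)
  have m: "(\<lambda>x. sqrt Q * x) \<in> borel_measurable std_normal_distribution" by simp
  show ?thesis
  proof (rule Levy_uniqueness)
    show "real_distribution (distr P borel W)" by (rule P.real_distribution_distr) simp
    show "real_distribution (distr std_normal_distribution borel (\<lambda>x. sqrt Q * x))"
      by (rule N.real_distribution_distr[OF m])
    show "char (distr P borel W) = char (distr std_normal_distribution borel (\<lambda>x. sqrt Q * x))"
    proof
      fix \<theta>
      have "char (distr P borel W) \<theta> = (\<integral>\<omega>. cis (\<theta> * W \<omega>) \<partial>P)"
        by (simp add: char_def integral_distr cis_conv_exp)
      moreover have "char (distr std_normal_distribution borel (\<lambda>x. sqrt Q * x)) \<theta> = char std_normal_distribution (\<theta> * sqrt Q)"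
        by (simp add: char_def integral_distr mult_ac)
      ultimately show "char (distr P borel W) \<theta> = char (distr std_normal_distribution borel (\<lambda>x. sqrt Q * x)) \<theta>"
        using Q by (simp add: char char_std_normal_distribution power_mult_distrib)
    qed
  qed
qed

lemma normal_law_scaled_std_normal:
  assumes Q: "0 \<le> Q" shows "normal_law (distr std_normal_distribution borel (\<lambda>x. sqrt Q * x))"
proof (cases "Q = 0")
  case True
  interpret N: real_distribution std_normal_distribution by (rule real_dist_normal_dist)
  have "distr std_normal_distribution borel (\<lambda>x. 0 :: real) = return borel 0"
    by (rule N.distr_const) simp
  moreover have "(\<lambda>x. sqrt Q * x) = (\<lambda>x. 0)" using True by auto
  ultimately show ?thesis unfolding normal_law_def by metis
next
  case False
  interpret N: real_distribution std_normal_distribution by (rule real_dist_normal_dist)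
  have "distributed std_normal_distribution lborel (\<lambda>x. x) (normal_density 0 1)"
    unfolding distributed_def by (auto simp: distr_id2)
  from N.normal_density_affine[OF this, of "sqrt Q" 0]
  have "distributed std_normal_distribution lborel (\<lambda>x. sqrt Q * x) (normal_density 0 (sqrt Q))"
    using False Q by simp
  then have "distr std_normal_distribution lborel (\<lambda>x. sqrt Q * x) = density lborel (normal_density 0 (sqrt Q))"
    by (simp add: distributed_def)
  moreover have "distr std_normal_distribution borel (\<lambda>x. sqrt Q * x) = distr std_normal_distribution lborel (\<lambda>x. sqrt Q * x)"
    by (intro distr_cong) auto
  ultimately show ?thesis unfolding normal_law_def using False Q
    by (intro disjI2 exI[of _ 0] exI[of _ "sqrt Q"]) auto
qed

lemma centered_normal_moments:
  assumes P: "prob_space P" and W [measurable]: "W \<in> borel_measurable P" and Q: "0 \<le> Q"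
    and char: "\<And>\<theta>. (\<integral>\<omega>. cis (\<theta> * W \<omega>) \<partial>P) = of_real (exp (- (\<theta>\<^sup>2 * Q) / 2))"
  shows "integrable P (\<lambda>\<omega>. W \<omega> ^ k)" "(\<integral>\<omega>. W \<omega> \<partial>P) = 0" "(\<integral>\<omega>. (W \<omega>)\<^sup>2 \<partial>P) = Q" "(\<integral>\<omega>. W \<omega> ^ 4 \<partial>P) = 3 * Q\<^sup>2"
proof -
  have law: "distr P borel W = distr std_normal_distribution borel (\<lambda>x. sqrt Q * x)"
    by (rule centered_normal_law[OF assms])
  have mom: "(\<integral>\<omega>. W \<omega> ^ k \<partial>P) = sqrt Q ^ k * (\<integral>x. x ^ k \<partial>std_normal_distribution)" for k
  proof -
    have "(\<integral>\<omega>. W \<omega> ^ k \<partial>P) = (\<integral>x. x ^ k \<partial>distr P borel W)" by (simp add: integral_distr)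
    also have "\<dots> = (\<integral>x. sqrt Q ^ k * x ^ k \<partial>std_normal_distribution)"
      unfolding law by (simp add: integral_distr power_mult_distrib)
    finally show ?thesis by simp
  qed
  have "integrable (distr P borel W) (\<lambda>x. x ^ k)"
    unfolding law using integrable_std_normal_distribution_moment[of k]
    by (subst integrable_distr_eq) (auto simp: power_mult_distrib)
  then show "integrable P (\<lambda>\<omega>. W \<omega> ^ k)" by (subst (asm) integrable_distr_eq) auto
  show "(\<integral>\<omega>. W \<omega> \<partial>P) = 0" using mom[of 1] integral_std_normal_distribution_moment_odd[of 1] by simp
  show "(\<integral>\<omega>. (W \<omega>)\<^sup>2 \<partial>P) = Q"
    using mom[of 2] std_normal_distribution_even_moments(1)[of 1] Q by (simp add: eval_nat_numeral)
  show "(\<integral>\<omega>. W \<omega> ^ 4 \<partial>P) = 3 * Q\<^sup>2"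
  proof -
    have "(\<integral>x. x ^ 4 \<partial>std_normal_distribution) = 3"
      using std_normal_distribution_even_moments(1)[of 2] by (simp add: eval_nat_numeral)
    moreover have "sqrt Q ^ 4 = Q\<^sup>2" using Q by (simp add: power4_eq_xxxx power2_eq_square)
    ultimately show ?thesis using mom[of 4] by simp
  qed
qed

section \<open>Left-continuous functions with right limits\<close>

text \<open>
  Functions on the whole line, where one-sided limits need no case distinction at the end points;
  elements of \<open>D01\<close> arise by restriction.
\<close>

definition lcrl :: "(real \<Rightarrow> real) \<Rightarrow> bool" where
  "lcrl f \<longleftrightarrow> (\<forall>t. (f \<longlongrightarrow> f t) (at_left t) \<and> (\<exists>l. (f \<longlongrightarrow> l) (at_right t)))"

lemma lcrl_add: "lcrl f \<Longrightarrow> lcrl g \<Longrightarrow> lcrl (\<lambda>t. f t + g t)"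
  unfolding lcrl_def by (blast intro: tendsto_add)

lemma lcrl_scale: "lcrl f \<Longrightarrow> lcrl (\<lambda>t. c * f t)"
  unfolding lcrl_def by (blast intro: tendsto_mult_left)

lemma lcrl_const: "lcrl (\<lambda>_. c)"
  unfolding lcrl_def by (blast intro: tendsto_const)

lemma lcrl_ident: "lcrl (\<lambda>t. t)"
  unfolding lcrl_def by (blast intro: tendsto_ident_at)

lemma lcrl_sum: "finite I \<Longrightarrow> (\<And>i. i \<in> I \<Longrightarrow> lcrl (f i)) \<Longrightarrow> lcrl (\<lambda>t. \<Sum>i\<in>I. f i t)"
  by (induction I rule: finite_induct) (auto intro: lcrl_const lcrl_add)

lemma lcrlI_eventually:
  assumes "\<And>t. \<forall>\<^sub>F s in at_left t. f s = f t" "\<And>t. \<exists>l. \<forall>\<^sub>F s in at_right t. f s = l"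
  shows "lcrl f"
  unfolding lcrl_def
proof (intro allI conjI)
  fix t
  show "(f \<longlongrightarrow> f t) (at_left t)" using assms(1) by (rule tendsto_eventually)
  obtain l where "\<forall>\<^sub>F s in at_right t. f s = l" using assms(2) by blast
  then show "\<exists>l. (f \<longlongrightarrow> l) (at_right t)" using tendsto_eventually by blast
qed

lemma lcrl_indicator: "lcrl (\<lambda>t. indicator {0..<t} u)"
proof (rule lcrlI_eventually)
  fix t :: real
  show "\<forall>\<^sub>F s in at_left t. indicator {0..<s} u = (indicator {0..<t} u :: real)"
    unfolding eventually_at_left_field
    by (rule exI[of _ "if u < t then u else t - 1"]) (auto simp: indicator_def)
  show "\<exists>l::real. \<forall>\<^sub>F s in at_right t. indicator {0..<s} u = l"
    unfolding eventually_at_right_field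
    by (rule exI[of _ "if 0 \<le> u \<and> u \<le> t then 1 else 0"], rule exI[of _ "if t < u then u else t + 1"]) (auto simp: indicator_def)
qed

text \<open>
  The number \<open>i\<close> of the left-open cell \<open>(i / 2 ^ m, (i + 1) / 2 ^ m]\<close> that contains \<open>t\<close>. Cells
  are open on the left to make step paths left-continuous; truncated subtraction puts \<open>t = 0\<close>
  into cell \<open>0\<close>.
\<close>

definition dyadic_cell :: "nat \<Rightarrow> real \<Rightarrow> nat" where
  "dyadic_cell m t = nat \<lceil>2 ^ m * t\<rceil> - 1"

lemma lcrl_dyadic_cell: "lcrl (\<lambda>t. z (dyadic_cell m t))"
proof (rule lcrlI_eventually)
  fix t :: real
  let ?c = "\<lceil>2 ^ m * t\<rceil>" and ?f = "\<lfloor>2 ^ m * t\<rfloor>"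
  have "dyadic_cell m s = dyadic_cell m t" if "real_of_int (?c - 1) / 2 ^ m < s" "s < t" for s
  proof -
    have "\<lceil>2 ^ m * s\<rceil> = ?c"
    proof (rule ceiling_unique)
      show "real_of_int ?c - 1 < 2 ^ m * s" using that(1) by (simp add: field_simps)
      have "2 ^ m * s \<le> 2 ^ m * t" using that(2) by simp
      then show "2 ^ m * s \<le> real_of_int ?c" by linarith
    qed
    then show ?thesis by (simp add: dyadic_cell_def)
  qed
  moreover have "real_of_int (?c - 1) / 2 ^ m < t"
  proof -
    have "real_of_int (?c - 1) < 2 ^ m * t" by linarith
    then show ?thesis by (simp add: field_simps)
  qed
  ultimately show "\<forall>\<^sub>F s in at_left t. z (dyadic_cell m s) = z (dyadic_cell m t)"
    unfolding eventually_at_left_field by (intro exI[of _ "real_of_int (?c - 1) / 2 ^ m"]) auto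
  have "\<lceil>2 ^ m * s\<rceil> = ?f + 1" if "t < s" "s < real_of_int (?f + 1) / 2 ^ m" for s
  proof (rule ceiling_unique)
    have "2 ^ m * t < 2 ^ m * s" using that(1) by simp
    then show "real_of_int (?f + 1) - 1 < 2 ^ m * s" by linarith
    show "2 ^ m * s \<le> real_of_int (?f + 1)" using that(2) by (simp add: field_simps)
  qed
  moreover have "t < real_of_int (?f + 1) / 2 ^ m"
  proof -
    have "2 ^ m * t < real_of_int (?f + 1)" by linarith
    then show ?thesis by (simp add: field_simps)
  qed
  ultimately show "\<exists>l. \<forall>\<^sub>F s in at_right t. z (dyadic_cell m s) = l"
    unfolding eventually_at_right_field
    by (intro exI[of _ "z (nat (?f + 1) - 1)"] exI[of _ "real_of_int (?f + 1) / 2 ^ m"]) (auto simp: dyadic_cell_def)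
qed

lemma restrict_lcrl_D01:
  assumes "lcrl f" shows "(\<lambda>t\<in>{0..1}. f t) \<in> D01"
  unfolding D01_def
proof (intro CollectI conjI ballI)
  let ?r = "\<lambda>t\<in>{0..1}. f t"
  show "?r \<in> extensional {0..1}" by simp
  fix t :: real assume t: "t \<in> {0<..1}"
  have "\<forall>\<^sub>F s in at_left t. f s = ?r s"
    unfolding eventually_at_left_field using t by (intro exI[of _ 0]) auto
  moreover have "(f \<longlongrightarrow> ?r t) (at_left t)" using assms t by (auto simp: lcrl_def)
  ultimately show "(?r \<longlongrightarrow> ?r t) (at_left t)" using tendsto_cong by blast
next
  let ?r = "\<lambda>t\<in>{0..1}. f t"
  fix t :: real assume t: "t \<in> {0..<1}"
  have "\<forall>\<^sub>F s in at_right t. f s = ?r s"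
    unfolding eventually_at_right_field using t by (intro exI[of _ 1]) auto
  moreover obtain l where "(f \<longlongrightarrow> l) (at_right t)" using assms by (auto simp: lcrl_def)
  ultimately show "\<exists>l. (?r \<longlongrightarrow> l) (at_right t)" using tendsto_cong by blast
qed

lemma restrict_continuous_D01:
  assumes f: "continuous_on {0..1} f" shows "(\<lambda>t\<in>{0..1}. f t) \<in> D01"
proof -
  let ?g = "\<lambda>t. f (max 0 (min 1 t))"
  have g: "continuous_on UNIV ?g"
    by (rule continuous_on_compose2[OF f]) (auto intro!: continuous_intros)
  have "lcrl ?g"
    unfolding lcrl_def using g by (auto simp: continuous_on_def dest: filterlim_at_split[THEN iffD1])
  moreover have "(\<lambda>t\<in>{0..1}. ?g t) = (\<lambda>t\<in>{0..1}. f t)" by (auto simp: restrict_def)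
  ultimately show ?thesis using restrict_lcrl_D01[of ?g] by simp
qed

section \<open>The Skorohod metric\<close>

interpretation J1: Metric_space D01 J1_dist by (rule Metric_space_J1)

lemma J1_dist_le_sup:
  assumes "x \<in> D01" "y \<in> D01" "\<And>t. t \<in> {0..1} \<Longrightarrow> \<bar>x t - y t\<bar> \<le> e"
  shows "J1_dist x y \<le> e"
proof -
  have "0 \<le> e" using assms(3)[of 0] by (rule order_trans[rotated]) auto
  then have "J1_cost x y (\<lambda>t. t) \<le> e"
    using J1_cost_le_iff[OF assms(1,2) id_time_change, of e] assms(3) by auto
  then show ?thesis using J1_dist_le_cost[OF assms(1,2) id_time_change] by linarith
qed

lemma space_J1_borel [simp]: "space J1_borel = D01"
  unfolding J1_borel_def
  by (rule space_measure_of) (use openin_subset[of J1_topology] in \<open>auto simp: J1_topology_def\<close>)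

lemma J1_open_subset: "openin J1_topology U \<Longrightarrow> U \<subseteq> D01"
  using openin_subset[of J1_topology U] by (simp add: J1_topology_def)

lemma sets_J1_borel: "sets J1_borel = sigma_sets D01 {U. openin J1_topology U}"
  unfolding J1_borel_def by (rule sets_measure_of) (auto dest: J1_open_subset)

lemma J1_open_in_sets: "openin J1_topology U \<Longrightarrow> U \<in> sets J1_borel"
  unfolding sets_J1_borel by (rule sigma_sets.Basic) simp

lemma J1_continuous_measurable:
  assumes "continuous_map J1_topology euclideanreal h" shows "h \<in> borel_measurable J1_borel"
proof (rule borel_measurableI)
  fix U :: "real set" assume "open U"
  then have "openin J1_topology {x \<in> topspace J1_topology. h x \<in> U}"
    using assms by (simp add: continuous_map)
  moreover have "{x \<in> topspace J1_topology. h x \<in> U} = h -` U \<inter> space J1_borel"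
    by (auto simp: J1_topology_def)
  ultimately show "h -` U \<inter> space J1_borel \<in> sets J1_borel" using J1_open_in_sets by simp
qed

definition J1_lipschitz :: "real \<Rightarrow> ((real \<Rightarrow> real) \<Rightarrow> real) \<Rightarrow> bool" where
  "J1_lipschitz L h \<longleftrightarrow> 0 \<le> L \<and> (\<forall>x\<in>D01. \<forall>y\<in>D01. \<bar>h x - h y\<bar> \<le> L * J1_dist x y)"

lemma J1_lipschitz_continuous:
  assumes "J1_lipschitz L h" shows "continuous_map J1_topology euclideanreal h"
  unfolding continuous_map
proof (intro conjI allI impI)
  show "h ` topspace J1_topology \<subseteq> topspace euclideanreal" by simp
  fix U :: "real set" assume "openin euclidean U"
  then have U: "open U" by simp
  show "openin J1_topology {x \<in> topspace J1_topology. h x \<in> U}"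
    unfolding J1_topology_def J1.openin_mtopology
  proof (intro conjI allI impI)
    fix x assume x: "x \<in> {x \<in> topspace J1.mtopology. h x \<in> U}"
    then have xD: "x \<in> D01" by simp
    obtain e where e: "0 < e" "\<And>y. dist y (h x) < e \<Longrightarrow> y \<in> U" using U x by (auto simp: open_dist)
    have L: "0 \<le> L" using assms by (simp add: J1_lipschitz_def)
    have "J1.mball x (e / (L + 1)) \<subseteq> {x \<in> topspace J1.mtopology. h x \<in> U}"
    proof
      fix y assume "y \<in> J1.mball x (e / (L + 1))"
      then have y: "y \<in> D01" "J1_dist x y < e / (L + 1)" by auto
      have "\<bar>h x - h y\<bar> \<le> L * J1_dist x y" using assms xD y by (auto simp: J1_lipschitz_def)
      also have "\<dots> \<le> (L + 1) * J1_dist x y" by (intro mult_right_mono) auto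
      also have "\<dots> < e" using y(2) L by (simp add: field_simps)
      finally have "h y \<in> U" by (intro e(2)) (simp add: dist_real_def abs_minus_commute)
      then show "y \<in> {x \<in> topspace J1.mtopology. h x \<in> U}" using y by simp
    qed
    then show "\<exists>r>0. J1.mball x r \<subseteq> {x \<in> topspace J1.mtopology. h x \<in> U}"
      using e L by (intro exI[of _ "e / (L + 1)"]) auto
  qed auto
qed

text \<open>
  An infimum of functions with a common Lipschitz constant. With \<open>h = 0\<close> it is the distance to
  \<open>A\<close>, with \<open>A = D01\<close> the Lipschitz envelope of \<open>h\<close>.
\<close>

lemma J1_lipschitz_INF:
  assumes k: "0 \<le> k" and A: "A \<subseteq> D01" "A \<noteq> {}" and h: "\<And>y. y \<in> A \<Longrightarrow> b \<le> h y"
  shows "J1_lipschitz k (\<lambda>x. INF y\<in>A. h y + k * J1_dist x y)"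
  unfolding J1_lipschitz_def
proof (intro conjI ballI k)
  have bdd: "bdd_below ((\<lambda>y. h y + k * J1_dist x y) ` A)" for x
    using h k by (intro bdd_belowI2[where m = b]) (auto intro: add_increasing2)
  have *: "(INF y\<in>A. h y + k * J1_dist x y) \<le> (INF y\<in>A. h y + k * J1_dist x' y) + k * J1_dist x x'"
    if "x \<in> D01" "x' \<in> D01" for x x'
  proof -
    have "(INF y\<in>A. h y + k * J1_dist x y) - k * J1_dist x x' \<le> h y + k * J1_dist x' y" if y: "y \<in> A" for y
    proof -
      have "(INF y\<in>A. h y + k * J1_dist x y) \<le> h y + k * J1_dist x y" by (rule cINF_lower[OF bdd y])
      moreover have "k * J1_dist x y \<le> k * (J1_dist x x' + J1_dist x' y)"
        using k A y \<open>x \<in> D01\<close> \<open>x' \<in> D01\<close> by (intro mult_left_mono J1.triangle) auto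
      ultimately show ?thesis by (simp add: distrib_left)
    qed
    then have "(INF y\<in>A. h y + k * J1_dist x y) - k * J1_dist x x' \<le> (INF y\<in>A. h y + k * J1_dist x' y)"
      using A by (intro cINF_greatest) auto
    then show ?thesis by linarith
  qed
  fix x x' assume "x \<in> D01" "x' \<in> D01"
  then show "\<bar>(INF y\<in>A. h y + k * J1_dist x y) - (INF y\<in>A. h y + k * J1_dist x' y)\<bar> \<le> k * J1_dist x x'"
    using *[of x x'] *[of x' x] J1.commute[of x x'] by (simp add: abs_le_iff)
qed

text \<open>
  Open sets are where the distance to the complement is positive, and this distance is continuous,
  so its values along the approximating maps converge.
\<close>

lemma measurable_J1_limit:
  assumes f: "\<And>k. f k \<in> measurable M J1_borel" and g: "\<And>\<omega>. \<omega> \<in> space M \<Longrightarrow> g \<omega> \<in> D01"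
    and lim: "\<And>\<omega>. \<omega> \<in> space M \<Longrightarrow> (\<lambda>k::nat. J1_dist (f k \<omega>) (g \<omega>)) \<longlonglongrightarrow> 0"
  shows "g \<in> measurable M J1_borel"
  unfolding J1_borel_def
proof (rule measurable_measure_of)
  show "{U. openin J1_topology U} \<subseteq> Pow D01" by (auto dest: J1_open_subset)
  show "g \<in> space M \<rightarrow> D01" using g by blast
  fix U assume "U \<in> {U. openin J1_topology U}"
  then have U: "openin J1_topology U" by simp
  show "g -` U \<inter> space M \<in> sets M"
  proof (cases "D01 - U = {}")
    case True
    then have "g -` U \<inter> space M = space M" using g by auto
    then show ?thesis by simp
  next
    case False
    (* The distance to the complement of U, written as an instance of J1_lipschitz_INF. *)
    define r where "r x = (INF y\<in>D01 - U. 0 + 1 * J1_dist x y)" for x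
    have L: "J1_lipschitz 1 r"
      unfolding r_def[abs_def] by (rule J1_lipschitz_INF[where b = 0]) (use False in auto)
    then have rm: "r \<in> borel_measurable J1_borel"
      by (rule J1_continuous_measurable[OF J1_lipschitz_continuous])
    have fD: "f k \<omega> \<in> D01" if "\<omega> \<in> space M" for k \<omega> using measurable_space[OF f that] by simp
    have "(\<lambda>\<omega>. r (g \<omega>)) \<in> borel_measurable M"
    proof (rule borel_measurable_LIMSEQ_real)
      show "(\<lambda>\<omega>. r (f k \<omega>)) \<in> borel_measurable M" for k by (rule measurable_compose[OF f rm])
      fix \<omega> assume w: "\<omega> \<in> space M"
      have "(\<lambda>k. r (f k \<omega>) - r (g \<omega>)) \<longlonglongrightarrow> 0"
      proof (rule Lim_null_comparison[OF always_eventually lim[OF w]], rule allI)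
        show "norm (r (f k \<omega>) - r (g \<omega>)) \<le> J1_dist (f k \<omega>) (g \<omega>)" for k
          using L fD[OF w, of k] g[OF w] by (simp add: J1_lipschitz_def)
      qed
      then show "(\<lambda>k. r (f k \<omega>)) \<longlonglongrightarrow> r (g \<omega>)" by (rule LIM_zero_cancel)
    qed
    then have "{\<omega> \<in> space M. 0 < r (g \<omega>)} \<in> sets M" by measurable
    moreover have "x \<in> U \<longleftrightarrow> 0 < r x" if x: "x \<in> D01" for x
    proof
      assume "x \<in> U"
      then obtain e where e: "0 < e" "J1.mball x e \<subseteq> U"
        using U unfolding J1_topology_def J1.openin_mtopology by blast
      have "e \<le> r x" unfolding r_def
      proof (rule cINF_greatest[OF False])
        fix y assume "y \<in> D01 - U"
        then show "e \<le> 0 + 1 * J1_dist x y" using e(2) x by (auto simp: J1.mball_def not_less[symmetric])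
      qed
      then show "0 < r x" using e by linarith
    next
      assume "0 < r x"
      show "x \<in> U"
      proof (rule ccontr)
        assume "x \<notin> U"
        then have "r x \<le> 0 + 1 * J1_dist x x" unfolding r_def
          using x by (intro cINF_lower bdd_belowI2[where m = 0]) auto
        then show False using \<open>0 < r x\<close> x by simp
      qed
    qed
    ultimately show ?thesis using g by (auto simp: vimage_def Int_def conj_commute cong: conj_cong)
  qed
qed

text \<open>
  A map that depends on integer parts only takes countably many values. This avoids any appeal to
  separability of the Skorohod space or to its coordinate maps.
\<close>

lemma measurable_J1_rounded:
  assumes Y: "\<And>i. i < n \<Longrightarrow> Y i \<in> borel_measurable M" and F: "\<And>l. F l \<in> D01"
  shows "(\<lambda>\<omega>. F (map (\<lambda>i. \<lfloor>c * Y i \<omega> :: real\<rfloor>) [0..<n])) \<in> measurable M J1_borel"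
proof -
  let ?g = "\<lambda>\<omega>. map (\<lambda>i. \<lfloor>c * Y i \<omega>\<rfloor>) [0..<n]"
  have pre: "?g -` {l} \<inter> space M \<in> sets M" for l
  proof (cases "length l = n")
    case True
    have "map f [0..<n] = l \<longleftrightarrow> (\<forall>i\<in>{..<n}. f i = l ! i)" for f :: "nat \<Rightarrow> int"
      using True by (simp add: list_eq_iff_nth_eq Ball_def)
    then have "?g -` {l} \<inter> space M = {\<omega> \<in> space M. \<forall>i\<in>{..<n}. \<lfloor>c * Y i \<omega>\<rfloor> = l ! i}"
      by (simp only: vimage_def singleton_iff mem_Collect_eq Int_def conj_commute)
    also have "\<dots> \<in> sets M"
    proof (intro sets.sets_Collect_finite_All)
      fix i assume "i \<in> {..<n}"
      then have [measurable]: "Y i \<in> borel_measurable M" by (intro Y) simp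
      show "{\<omega> \<in> space M. \<lfloor>c * Y i \<omega>\<rfloor> = l ! i} \<in> sets M" by measurable
    qed simp
    finally show ?thesis .
  next
    case False
    then have "?g -` {l} \<inter> space M = {}" by auto
    then show ?thesis by (simp only: sets.empty_sets)
  qed
  have "?g \<in> measurable M (count_space UNIV)"
    by (rule measurable_count_space_eq_countable[OF countableI_type, THEN iffD2]) (use pre in blast)
  moreover have "F \<in> measurable (count_space UNIV) J1_borel" using F by simp
  ultimately show ?thesis by (rule measurable_compose)
qed

lemma floor_approx: "\<bar>of_int \<lfloor>c * y\<rfloor> / c - y\<bar> \<le> 1 / c" if "0 < c" for c y :: real
proof -
  have "of_int \<lfloor>c * y\<rfloor> / c - y = (of_int \<lfloor>c * y\<rfloor> - c * y) / c" using that by (simp add: field_simps)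
  then have "\<bar>of_int \<lfloor>c * y\<rfloor> / c - y\<bar> = \<bar>of_int \<lfloor>c * y\<rfloor> - c * y\<bar> / c" using that by simp
  also have "\<dots> \<le> 1 / c" using that by (intro divide_right_mono) linarith+
  finally show ?thesis .
qed

lemma dyadic_cell_less: "t \<le> 1 \<Longrightarrow> dyadic_cell m t < 2 ^ m"
proof -
  assume "t \<le> 1"
  then have "\<lceil>2 ^ m * t\<rceil> \<le> 2 ^ m" by (simp add: ceiling_le_iff)
  then have "nat \<lceil>2 ^ m * t\<rceil> \<le> 2 ^ m" by (simp add: nat_le_iff)
  then show ?thesis unfolding dyadic_cell_def by (meson diff_le_self le_neq_implies_less less_imp_diff_less diff_less order_less_le_trans zero_less_numeral zero_less_power less_numeral_extra(1) le_less_trans not_le neq0_conv diff_is_0_eq)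
qed

lemma measurable_step_path:
  assumes Y: "\<And>i. i < 2 ^ m \<Longrightarrow> Y i \<in> borel_measurable M"
  shows "(\<lambda>\<omega>. \<lambda>t\<in>{0..1}. Y (dyadic_cell m t) \<omega>) \<in> measurable M J1_borel"
proof (rule measurable_J1_limit)
  let ?F = "\<lambda>c l. \<lambda>t\<in>{0..1}. real_of_int (l ! dyadic_cell m t) / c"
  let ?f = "\<lambda>k \<omega>. ?F (real (Suc k)) (map (\<lambda>i. \<lfloor>real (Suc k) * Y i \<omega>\<rfloor>) [0..<2 ^ m])"
  have FD: "?F c l \<in> D01" for c l by (rule restrict_lcrl_D01) (rule lcrl_dyadic_cell)
  show "?f k \<in> measurable M J1_borel" for k by (rule measurable_J1_rounded[OF Y FD])
  have gD: "(\<lambda>t\<in>{0..1}. Y (dyadic_cell m t) \<omega>) \<in> D01" for \<omega> by (rule restrict_lcrl_D01) (rule lcrl_dyadic_cell[of "\<lambda>i. Y i \<omega>"])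
  then show "(\<lambda>t\<in>{0..1}. Y (dyadic_cell m t) \<omega>) \<in> D01" for \<omega> .
  fix \<omega>
  have "J1_dist (?f k \<omega>) (\<lambda>t\<in>{0..1}. Y (dyadic_cell m t) \<omega>) \<le> 1 / real (Suc k)" for k
  proof (rule J1_dist_le_sup[OF FD gD])
    fix t :: real assume t: "t \<in> {0..1}"
    have "\<bar>real_of_int \<lfloor>real (Suc k) * Y (dyadic_cell m t) \<omega>\<rfloor> / real (Suc k) - Y (dyadic_cell m t) \<omega>\<bar> \<le> 1 / real (Suc k)"
      by (rule floor_approx) simp
    then show "\<bar>?f k \<omega> t - (\<lambda>t\<in>{0..1}. Y (dyadic_cell m t) \<omega>) t\<bar> \<le> 1 / real (Suc k)"
      using t dyadic_cell_less[of t m] by (simp del: of_nat_Suc)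
  qed
  then show "(\<lambda>k. J1_dist (?f k \<omega>) (\<lambda>t\<in>{0..1}. Y (dyadic_cell m t) \<omega>)) \<longlonglongrightarrow> 0"
    by (intro Lim_null_comparison[OF _ LIMSEQ_inverse_real_of_nat] always_eventually) (simp add: inverse_eq_divide)
qed

lemma dyadic_cell_bounds:
  assumes "0 \<le> t" shows "real (dyadic_cell m t) / 2 ^ m \<le> t" "t \<le> (real (dyadic_cell m t) + 1) / 2 ^ m"
proof -
  have c0: "0 \<le> \<lceil>2 ^ m * t\<rceil>" using assms by (simp add: ceiling_mono[of 0, simplified] less_le_trans[of "-1"])
  show "t \<le> (real (dyadic_cell m t) + 1) / 2 ^ m"
  proof -
    have "2 ^ m * t \<le> real_of_int \<lceil>2 ^ m * t\<rceil>" by linarith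
    also have "\<dots> \<le> real (dyadic_cell m t) + 1" using c0 unfolding dyadic_cell_def by linarith
    finally show ?thesis by (simp add: field_simps)
  qed
  show "real (dyadic_cell m t) / 2 ^ m \<le> t"
  proof (cases "\<lceil>2 ^ m * t\<rceil> = 0")
    case True
    then show ?thesis using assms by (simp add: dyadic_cell_def)
  next
    case False
    then have "real (dyadic_cell m t) = real_of_int \<lceil>2 ^ m * t\<rceil> - 1" using c0 unfolding dyadic_cell_def by linarith
    then have "real (dyadic_cell m t) \<le> 2 ^ m * t" by linarith
    then show ?thesis by (simp add: field_simps)
  qed
qed

lemma dyadic_cell_Suc: "0 \<le> t \<Longrightarrow> dyadic_cell (Suc j) t = 2 * dyadic_cell j t \<or> dyadic_cell (Suc j) t = 2 * dyadic_cell j t + 1"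
proof -
  assume t: "0 \<le> t"
  define y where "y = 2 ^ j * t"
  have y: "0 \<le> y" using t by (simp add: y_def)
  have e: "\<lceil>2 * y\<rceil> = 2 * \<lceil>y\<rceil> \<or> \<lceil>2 * y\<rceil> = 2 * \<lceil>y\<rceil> - 1" by linarith
  have c: "0 \<le> \<lceil>y\<rceil>" "\<lceil>y\<rceil> = 0 \<longrightarrow> \<lceil>2 * y\<rceil> = 0" using y by linarith+
  have "nat b - 1 = 2 * (nat a - 1) \<or> nat b - 1 = 2 * (nat a - 1) + 1"
    if "b = 2 * a \<or> b = 2 * a - 1" "0 \<le> a" "a = 0 \<longrightarrow> b = 0" for a b :: int
    using that by arith
  from this[OF e c] show ?thesis by (simp add: dyadic_cell_def y_def mult.assoc)
qed

text \<open>
  Passing from level \<open>j\<close> to \<open>j + 1\<close> the left end point of the cell of \<open>t\<close> stays or moves by one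
  mesh, so the increments along the chain add up to a geometric series.
\<close>

lemma dyadic_chain:
  fixes z :: "real \<Rightarrow> real"
  assumes r: "0 < r" "r < 1" and t: "t \<in> {0..1}"
    and inc: "\<And>j i. m < j \<Longrightarrow> j \<le> m + k \<Longrightarrow> i < 2 ^ j \<Longrightarrow> \<bar>z ((real i + 1) / 2 ^ j) - z (real i / 2 ^ j)\<bar> \<le> r ^ j"
  shows "\<bar>z (real (dyadic_cell (m + k) t) / 2 ^ (m + k)) - z (real (dyadic_cell m t) / 2 ^ m)\<bar> \<le> r ^ m / (1 - r)"
proof -
  have "\<bar>z (real (dyadic_cell (m + k) t) / 2 ^ (m + k)) - z (real (dyadic_cell m t) / 2 ^ m)\<bar> \<le> (r ^ m - r ^ (m + k)) / (1 - r)"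
    using inc
  proof (induction k)
    case (Suc k)
    let ?j = "m + k"
    have IH: "\<bar>z (real (dyadic_cell ?j t) / 2 ^ ?j) - z (real (dyadic_cell m t) / 2 ^ m)\<bar> \<le> (r ^ m - r ^ ?j) / (1 - r)"
      using Suc by auto
    have "\<bar>z (real (dyadic_cell (Suc ?j) t) / 2 ^ Suc ?j) - z (real (dyadic_cell ?j t) / 2 ^ ?j)\<bar> \<le> r ^ Suc ?j"
    proof -
      have same: "real (2 * dyadic_cell ?j t) / 2 ^ Suc ?j = real (dyadic_cell ?j t) / 2 ^ ?j" by simp
      have "2 * dyadic_cell ?j t < 2 ^ Suc ?j" using dyadic_cell_less[of t ?j] t by simp
      then have "\<bar>z ((real (2 * dyadic_cell ?j t) + 1) / 2 ^ Suc ?j) - z (real (2 * dyadic_cell ?j t) / 2 ^ Suc ?j)\<bar> \<le> r ^ Suc ?j"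
        by (intro Suc.prems) auto
      then show ?thesis using dyadic_cell_Suc[of t ?j] t r unfolding same by (auto simp: add.commute)
    qed
    also have "\<dots> \<le> r ^ ?j" using r by (simp add: mult_left_le_one_le)
    also have "r ^ ?j = (r ^ ?j - r ^ Suc ?j) / (1 - r)" using r by (simp add: field_simps)
    finally have "\<bar>z (real (dyadic_cell (Suc ?j) t) / 2 ^ Suc ?j) - z (real (dyadic_cell ?j t) / 2 ^ ?j)\<bar> \<le> (r ^ ?j - r ^ Suc ?j) / (1 - r)" .
    moreover have "(r ^ m - r ^ ?j) / (1 - r) + (r ^ ?j - r ^ Suc ?j) / (1 - r) = (r ^ m - r ^ Suc ?j) / (1 - r)"
      by (simp add: diff_divide_distrib)
    ultimately show ?case using IH unfolding add_Suc_right by linarith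
  qed simp
  also have "\<dots> \<le> r ^ m / (1 - r)" using r by (intro divide_right_mono) auto
  finally show ?thesis .
qed

text \<open>
  Markov's inequality for each of the \<open>2 ^ j\<close> increments of level \<open>j\<close>, and the union bound.
\<close>

lemma level_exceedance:
  fixes Y :: "nat \<Rightarrow> 'a \<Rightarrow> real"
  assumes M: "prob_space M" and Y: "\<And>i. i < 2 ^ j \<Longrightarrow> Y i \<in> borel_measurable M"
    and int: "\<And>i. i < 2 ^ j \<Longrightarrow> integrable M (\<lambda>\<omega>. \<bar>Y i \<omega>\<bar> ^ p)"
    and mom: "\<And>i. i < 2 ^ j \<Longrightarrow> (\<integral>\<omega>. \<bar>Y i \<omega>\<bar> ^ p \<partial>M) \<le> C / 4 ^ j" and r: "0 < r"
  shows "measure M {\<omega> \<in> space M. \<exists>i\<in>{..<2 ^ j}. r ^ j < \<bar>Y i \<omega>\<bar>} \<le> C * (1 / (2 * r ^ p)) ^ j"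
    "{\<omega> \<in> space M. \<exists>i\<in>{..<2 ^ j}. r ^ j < \<bar>Y i \<omega>\<bar>} \<in> sets M"
proof -
  interpret prob_space M by fact
  have s: "{\<omega> \<in> space M. r ^ j < \<bar>Y i \<omega>\<bar>} \<in> sets M" if "i < 2 ^ j" for i
  proof -
    have [measurable]: "Y i \<in> borel_measurable M" by (rule Y[OF that])
    show ?thesis by measurable
  qed
  then show "{\<omega> \<in> space M. \<exists>i\<in>{..<2 ^ j}. r ^ j < \<bar>Y i \<omega>\<bar>} \<in> sets M"
    by (intro sets.sets_Collect_finite_Ex) auto
  have one: "measure M {\<omega> \<in> space M. r ^ j < \<bar>Y i \<omega>\<bar>} \<le> C / 4 ^ j / (r ^ j) ^ p" if "i < 2 ^ j" for i
  proof -
    have "(r ^ j) ^ p * measure M {\<omega> \<in> space M. r ^ j < \<bar>Y i \<omega>\<bar>} = (\<integral>\<omega>. (r ^ j) ^ p * indicator {\<omega> \<in> space M. r ^ j < \<bar>Y i \<omega>\<bar>} \<omega> \<partial>M)"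
      using s[OF that] by simp
    also have "\<dots> \<le> (\<integral>\<omega>. \<bar>Y i \<omega>\<bar> ^ p \<partial>M)"
    proof (rule integral_mono[OF _ int[OF that]])
      show "integrable M (\<lambda>\<omega>. (r ^ j) ^ p * indicator {\<omega> \<in> space M. r ^ j < \<bar>Y i \<omega>\<bar>} \<omega>)"
        using s[OF that] by (intro integrable_mult_right integrable_real_indicator) (auto simp: emeasure_eq_measure)
      show "(r ^ j) ^ p * indicator {\<omega> \<in> space M. r ^ j < \<bar>Y i \<omega>\<bar>} \<omega> \<le> \<bar>Y i \<omega>\<bar> ^ p" for \<omega>
        using r power_mono[of "r ^ j" "\<bar>Y i \<omega>\<bar>" p] by (auto simp: indicator_def)
    qed
    also have "\<dots> \<le> C / 4 ^ j" by (rule mom[OF that])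
    finally show ?thesis using r by (simp add: pos_le_divide_eq mult_ac)
  qed
  have "{\<omega> \<in> space M. \<exists>i\<in>{..<2 ^ j}. r ^ j < \<bar>Y i \<omega>\<bar>} = (\<Union>i<2 ^ j. {\<omega> \<in> space M. r ^ j < \<bar>Y i \<omega>\<bar>})" by auto
  also have "measure M \<dots> \<le> (\<Sum>i<2 ^ j. measure M {\<omega> \<in> space M. r ^ j < \<bar>Y i \<omega>\<bar>})"
    using s by (intro finite_measure_subadditive_finite) auto
  also have "\<dots> \<le> (\<Sum>i<(2::nat) ^ j. C / 4 ^ j / (r ^ j) ^ p)" by (intro sum_mono one) simp
  also have "\<dots> = C * (1 / (2 * r ^ p)) ^ j"
  proof -
    have "(4::real) ^ j = 2 ^ j * 2 ^ j" by (simp flip: power_mult_distrib)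
    moreover have "(r ^ j) ^ p = (r ^ p) ^ j" by (simp add: power_mult[symmetric] mult.commute)
    ultimately show ?thesis by (simp add: power_mult_distrib power_divide)
  qed
  finally show "measure M {\<omega> \<in> space M. \<exists>i\<in>{..<2 ^ j}. r ^ j < \<bar>Y i \<omega>\<bar>} \<le> C * (1 / (2 * r ^ p)) ^ j" .
qed

section \<open>Measurability of jump paths\<close>

text \<open>
  The common shape of the paths of the normalised empirical process: unit jumps just after the
  points \<open>u i\<close>, scaled, plus a linear drift.
\<close>

definition jump_path :: "nat \<Rightarrow> real \<Rightarrow> real \<Rightarrow> (nat \<Rightarrow> real) \<Rightarrow> real \<Rightarrow> real" where
  "jump_path N a b u = (\<lambda>t\<in>{0..1}. a * (\<Sum>i<N. indicator {0..<t} (u i)) + b * t)"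

lemma jump_path_D01: "jump_path N a b u \<in> D01"
  unfolding jump_path_def
  by (intro restrict_lcrl_D01 lcrl_add lcrl_scale lcrl_sum lcrl_indicator lcrl_ident) simp

text \<open>
  Add to the identity a tent of half-width \<open>w\<close> at each point that has to move. The tents do not
  reach the other points, and their slopes add up to less than one if the displacements are small
  against \<open>w\<close>, so the sum is still strictly increasing.
\<close>

lemma time_change_moving_points:
  fixes q :: "real \<Rightarrow> real"
  assumes U: "finite U" "U \<subseteq> {0..<1}" and w: "0 < w" "\<forall>p\<in>U. \<forall>p'\<in>U. p \<noteq> p' \<longrightarrow> w \<le> \<bar>p - p'\<bar>"
    "\<forall>p\<in>U. (p \<noteq> 0 \<longrightarrow> w \<le> p) \<and> w \<le> 1 - p"
    and q: "\<And>p. \<bar>q p - p\<bar> \<le> \<eta>" "q 0 = 0" and small: "real (card U) * \<eta> < w"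
  obtains \<tau> where "\<tau> \<in> time_changes" "\<And>p. p \<in> U \<Longrightarrow> \<tau> p = q p"
    "\<And>t. \<bar>\<tau> t - t\<bar> \<le> real (card U) * \<eta>"
proof -
  let ?h = "\<lambda>p t. max 0 (1 - \<bar>t - p\<bar> / w)"
  (* The tent at 0 has height 0 because q 0 = 0, so both end points stay fixed. *)
  define \<tau> where "\<tau> t = t + (\<Sum>p\<in>U. (q p - p) * ?h p t)" for t
  have lip: "\<bar>?h p t - ?h p s\<bar> \<le> \<bar>t - s\<bar> / w" for p t s
  proof -
    have "\<bar>max 0 (1 - x) - max 0 (1 - y)\<bar> \<le> \<bar>x - y\<bar>" for x y :: real by (auto simp: max_def)
    then have "\<bar>?h p t - ?h p s\<bar> \<le> \<bar>\<bar>t - p\<bar> / w - \<bar>s - p\<bar> / w\<bar>" .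
    also have "\<dots> = \<bar>\<bar>t - p\<bar> - \<bar>s - p\<bar>\<bar> / w" using w(1) by (simp add: diff_divide_distrib[symmetric])
    also have "\<dots> \<le> \<bar>t - s\<bar> / w" using w(1) by (intro divide_right_mono) linarith+
    finally show ?thesis .
  qed
  have mono: "\<tau> s < \<tau> t" if "s < t" for s t
  proof -
    have "\<bar>(\<Sum>p\<in>U. (q p - p) * (?h p t - ?h p s))\<bar> \<le> (\<Sum>p\<in>U. \<eta> * (\<bar>t - s\<bar> / w))"
    proof (rule order_trans[OF sum_abs sum_mono])
      fix p assume p: "p \<in> U"
      show "\<bar>(q p - p) * (?h p t - ?h p s)\<bar> \<le> \<eta> * (\<bar>t - s\<bar> / w)"
        unfolding abs_mult using q(1)[of p] by (intro mult_mono lip) auto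
    qed
    also have "\<dots> = (real (card U) * \<eta>) * ((t - s) / w)" using that by simp
    also have "\<dots> < w * ((t - s) / w)" using small that w(1) by (intro mult_strict_right_mono) auto
    also have "\<dots> = t - s" using w(1) by simp
    finally have "\<bar>(\<Sum>p\<in>U. (q p - p) * (?h p t - ?h p s))\<bar> < t - s" .
    moreover have "\<tau> t - \<tau> s = (t - s) + (\<Sum>p\<in>U. (q p - p) * (?h p t - ?h p s))"
      by (simp add: \<tau>_def right_diff_distrib sum_subtractf)
    ultimately show ?thesis by linarith
  qed
  have cont: "continuous_on A \<tau>" for A
    unfolding \<tau>_def using w(1) by (intro continuous_intros) auto
  have \<tau>0: "\<tau> 0 = 0"
  proof -
    have "(q p - p) * ?h p 0 = 0" if "p \<in> U" for p
      using bspec[OF w(3) that] q(2) w(1) U(2) that by (cases "p = 0") (auto simp: max_def field_simps)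
    then have "(\<Sum>p\<in>U. (q p - p) * ?h p 0) = 0" by (intro sum.neutral ballI)
    then show ?thesis by (simp only: \<tau>_def add_0_right)
  qed
  have \<tau>1: "\<tau> 1 = 1"
  proof -
    have "(q p - p) * ?h p 1 = 0" if "p \<in> U" for p
      using bspec[OF w(3) that] w(1) U(2) that by (auto simp: max_def field_simps)
    then have "(\<Sum>p\<in>U. (q p - p) * ?h p 1) = 0" by (intro sum.neutral ballI)
    then show ?thesis by (simp only: \<tau>_def add_0_right)
  qed
  have image: "\<tau> ` {0..1} = {0..1}"
  proof (intro equalityI subsetI)
    fix y assume "y \<in> \<tau> ` {0..1}"
    then obtain t where t: "0 \<le> t" "t \<le> 1" "y = \<tau> t" by auto
    have "\<tau> 0 \<le> \<tau> t" "\<tau> t \<le> \<tau> 1" using mono[of 0 t] mono[of t 1] t by (auto simp: le_less)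
    then show "y \<in> {0..1}" using t \<tau>0 \<tau>1 by simp
  next
    fix y :: real assume "y \<in> {0..1}"
    then have "\<exists>t. 0 \<le> t \<and> t \<le> 1 \<and> \<tau> t = y" using cont \<tau>0 \<tau>1 by (intro IVT') auto
    then show "y \<in> \<tau> ` {0..1}" by force
  qed
  show ?thesis
  proof (rule that)
    show "\<tau> \<in> time_changes"
      unfolding time_changes_def using mono cont image by (auto intro!: strict_mono_onI)
    show "\<tau> p = q p" if p: "p \<in> U" for p
    proof -
      have "(\<Sum>p'\<in>U. (q p' - p') * ?h p' p) = (\<Sum>p'\<in>U. if p' = p then q p - p else 0)"
      proof (intro sum.cong refl)
        fix p' assume p': "p' \<in> U"
        show "(q p' - p') * ?h p' p = (if p' = p then q p - p else 0)"
          using bspec[OF bspec[OF w(2) p] p'] w(1) by (cases "p' = p") (auto simp: max_def field_simps)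
      qed
      then show ?thesis using U(1) p by (simp add: \<tau>_def)
    qed
    show "\<bar>\<tau> t - t\<bar> \<le> real (card U) * \<eta>" for t
    proof -
      have "\<bar>\<Sum>p\<in>U. (q p - p) * ?h p t\<bar> \<le> (\<Sum>p\<in>U. \<eta> * 1)"
      proof (rule order_trans[OF sum_abs sum_mono])
        fix p assume p: "p \<in> U"
        show "\<bar>(q p - p) * ?h p t\<bar> \<le> \<eta> * 1"
          unfolding abs_mult using q(1)[of p] w(1) by (intro mult_mono) auto
      qed
      then show ?thesis by (simp add: \<tau>_def)
    qed
  qed
qed

lemma separation_width:
  fixes U :: "real set"
  assumes U: "finite U" "U \<subseteq> {0..<1}"
  obtains w where "0 < w" "\<forall>p\<in>U. \<forall>p'\<in>U. p \<noteq> p' \<longrightarrow> w \<le> \<bar>p - p'\<bar>"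
    "\<forall>p\<in>U. (p \<noteq> 0 \<longrightarrow> w \<le> p) \<and> w \<le> 1 - p"
proof -
  define V where "V = insert 0 (insert 1 U)"
  define W where "W = insert 1 ((\<lambda>(p, p'). \<bar>p - p'\<bar>) ` {(p, p'). p \<in> V \<and> p' \<in> V \<and> p \<noteq> p'})"
  have "finite {(p, p'). p \<in> V \<and> p' \<in> V \<and> p \<noteq> p'}"
    by (rule finite_subset[of _ "V \<times> V"]) (use U in \<open>auto simp: V_def\<close>)
  then have W: "finite W" "W \<noteq> {}" by (auto simp: W_def)
  have le: "Min W \<le> \<bar>p - p'\<bar>" if "p \<in> V" "p' \<in> V" "p \<noteq> p'" for p p'
    using that W by (intro Min_le) (auto simp: W_def)
  show ?thesis
  proof (rule that)
    show "0 < Min W" using W by (subst Min_gr_iff) (auto simp: W_def)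
    show "\<forall>p\<in>U. \<forall>p'\<in>U. p \<noteq> p' \<longrightarrow> Min W \<le> \<bar>p - p'\<bar>" using le by (auto simp: V_def)
    show "\<forall>p\<in>U. (p \<noteq> 0 \<longrightarrow> Min W \<le> p) \<and> Min W \<le> 1 - p"
    proof (intro ballI conjI impI)
      show "Min W \<le> p" if "p \<in> U" "p \<noteq> 0" for p using le[of p 0] that U by (auto simp: V_def)
      show "Min W \<le> 1 - p" if "p \<in> U" for p using le[of p 1] that U by (auto simp: V_def)
    qed
  qed
qed

text \<open>
  Coinciding points are rounded to the same point, and a time change that carries each point to
  its rounding leaves only the drift to be compared. In the uniform distance the paths would stay
  apart.
\<close>

lemma jump_path_round:
  assumes u: "\<And>i. i < N \<Longrightarrow> u i \<in> {0..<1}"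
  shows "(\<lambda>k. J1_dist (jump_path N a b (\<lambda>i. of_int \<lfloor>real (Suc k) * u i\<rfloor> / real (Suc k))) (jump_path N a b u)) \<longlonglongrightarrow> 0"
proof -
  define U where "U = u ` {..<N}"
  have U: "finite U" "U \<subseteq> {0..<1}" using u by (auto simp: U_def)
  obtain w where w: "0 < w" "\<forall>p\<in>U. \<forall>p'\<in>U. p \<noteq> p' \<longrightarrow> w \<le> \<bar>p - p'\<bar>"
    "\<forall>p\<in>U. (p \<noteq> 0 \<longrightarrow> w \<le> p) \<and> w \<le> 1 - p"
    by (rule separation_width[OF U])
  define C where "C = real (card U)"
  let ?q = "\<lambda>k p. real_of_int \<lfloor>real (Suc k) * p\<rfloor> / real (Suc k)"
  have lim: "(\<lambda>k. (1 + \<bar>b\<bar>) * (C * inverse (real (Suc k)))) \<longlonglongrightarrow> (1 + \<bar>b\<bar>) * (C * 0)"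
    by (intro tendsto_mult_left LIMSEQ_inverse_real_of_nat)
  have limC: "(\<lambda>k. C * inverse (real (Suc k))) \<longlonglongrightarrow> C * 0"
    by (intro tendsto_mult_left LIMSEQ_inverse_real_of_nat)
  have bound: "J1_dist (jump_path N a b u) (jump_path N a b (\<lambda>i. ?q k (u i))) \<le> (1 + \<bar>b\<bar>) * (C * inverse (real (Suc k)))"
    if small: "C * inverse (real (Suc k)) < w" for k
  proof -
    let ?\<eta> = "inverse (real (Suc k))"
    have q1: "\<bar>?q k p - p\<bar> \<le> ?\<eta>" for p using floor_approx[of "real (Suc k)" p] by (simp add: inverse_eq_divide)
    have q0: "?q k 0 = 0" by simp
    obtain \<tau> where \<tau>: "\<tau> \<in> time_changes" "\<And>p. p \<in> U \<Longrightarrow> \<tau> p = ?q k p" "\<And>t. \<bar>\<tau> t - t\<bar> \<le> C * ?\<eta>"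
      unfolding C_def by (rule time_change_moving_points[OF U w q1 q0 small[unfolded C_def]]) blast
    have sm: "strict_mono_on {0..1} \<tau>" using \<tau>(1) by (simp add: time_changes_def)
    have C\<eta>: "0 \<le> C * ?\<eta>" by (simp add: C_def)
    have "J1_cost (jump_path N a b u) (jump_path N a b (\<lambda>i. ?q k (u i))) \<tau> \<le> (1 + \<bar>b\<bar>) * (C * ?\<eta>)"
      unfolding J1_cost_le_iff[OF jump_path_D01 jump_path_D01 \<tau>(1)]
    proof (intro conjI ballI)
      fix t :: real assume t: "t \<in> {0..1}"
      have "0 \<le> \<bar>b\<bar> * (C * ?\<eta>)" using C\<eta> by simp
      then show "\<bar>\<tau> t - t\<bar> \<le> (1 + \<bar>b\<bar>) * (C * ?\<eta>)"
        unfolding distrib_right mult_1 using \<tau>(3)[of t] by linarith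
      have "indicator {0..<\<tau> t} (?q k (u i)) = (indicator {0..<t} (u i) :: real)" if i: "i < N" for i
      proof -
        have ui: "u i \<in> U" "u i \<in> {0..1}" "0 \<le> u i" using i u[OF i] by (auto simp: U_def)
        have "0 \<le> ?q k (u i)" using ui by simp
        moreover have "\<tau> (u i) < \<tau> t \<longleftrightarrow> u i < t" using strict_mono_on_less[OF sm ui(2) t] .
        ultimately show ?thesis using \<tau>(2)[OF ui(1)] ui by (simp add: indicator_def)
      qed
      then have "(\<Sum>i<N. indicator {0..<\<tau> t} (?q k (u i))) = (\<Sum>i<N. indicator {0..<t} (u i) :: real)" by simp
      then have "jump_path N a b u t - jump_path N a b (\<lambda>i. ?q k (u i)) (\<tau> t) = b * (t - \<tau> t)"
        using t time_changes_mem[OF \<tau>(1) t] by (simp add: jump_path_def right_diff_distrib)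
      then have "\<bar>jump_path N a b u t - jump_path N a b (\<lambda>i. ?q k (u i)) (\<tau> t)\<bar> = \<bar>b\<bar> * \<bar>\<tau> t - t\<bar>"
        by (simp only: abs_mult abs_minus_commute)
      also have "\<dots> \<le> \<bar>b\<bar> * (C * ?\<eta>)" by (intro mult_left_mono \<tau>(3)) simp
      also have "\<dots> \<le> (1 + \<bar>b\<bar>) * (C * ?\<eta>)" using C\<eta> by (simp add: distrib_right)
      finally show "\<bar>jump_path N a b u t - jump_path N a b (\<lambda>i. ?q k (u i)) (\<tau> t)\<bar> \<le> (1 + \<bar>b\<bar>) * (C * ?\<eta>)" .
    qed
    then show ?thesis using J1_dist_le_cost[OF jump_path_D01 jump_path_D01 \<tau>(1)] by (rule order_trans[rotated])
  qed
  have "\<forall>\<^sub>F k in sequentially. C * inverse (real (Suc k)) < w"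
    using order_tendstoD(2)[OF limC, of w] w(1) by simp
  then have ev: "\<forall>\<^sub>F k in sequentially. norm (J1_dist (jump_path N a b (\<lambda>i. ?q k (u i))) (jump_path N a b u)) \<le> (1 + \<bar>b\<bar>) * (C * inverse (real (Suc k)))"
  proof (rule eventually_mono)
    fix k assume "C * inverse (real (Suc k)) < w"
    from bound[OF this]
    show "norm (J1_dist (jump_path N a b (\<lambda>i. ?q k (u i))) (jump_path N a b u)) \<le> (1 + \<bar>b\<bar>) * (C * inverse (real (Suc k)))"
      unfolding J1.commute[of "jump_path N a b u"] by simp
  qed
  show ?thesis using Lim_null_comparison[OF ev] lim by simp
qed

lemma measurable_jump_path:
  assumes Y: "\<And>i. i < N \<Longrightarrow> Y i \<in> borel_measurable M" and Y01: "\<And>i \<omega>. i < N \<Longrightarrow> Y i \<omega> \<in> {0..<1}"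
  shows "(\<lambda>\<omega>. jump_path N a b (\<lambda>i. Y i \<omega>)) \<in> measurable M J1_borel"
proof (rule measurable_J1_limit)
  let ?f = "\<lambda>k \<omega>. (\<lambda>l. jump_path N a b (\<lambda>i. of_int (l ! i) / real (Suc k))) (map (\<lambda>i. \<lfloor>real (Suc k) * Y i \<omega>\<rfloor>) [0..<N])"
  show "?f k \<in> measurable M J1_borel" for k
    by (rule measurable_J1_rounded[OF Y jump_path_D01])
  show "jump_path N a b (\<lambda>i. Y i \<omega>) \<in> D01" for \<omega> by (rule jump_path_D01)
  show "(\<lambda>k. J1_dist (?f k \<omega>) (jump_path N a b (\<lambda>i. Y i \<omega>))) \<longlonglongrightarrow> 0" for \<omega>
  proof -
    have "?f k \<omega> = jump_path N a b (\<lambda>i. of_int \<lfloor>real (Suc k) * Y i \<omega>\<rfloor> / real (Suc k))" for k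
      unfolding jump_path_def by (intro restrict_ext) simp
    then show ?thesis using jump_path_round[OF Y01, of N "\<lambda>i. i" ] jump_path_round[of N "\<lambda>i. Y i \<omega>" a b] Y01 by simp
  qed
qed

section \<open>Continuous paths\<close>

lemma dyadic_cell_grid_mem:
  assumes "t \<in> {0..1}" shows "real (dyadic_cell m t) / 2 ^ m \<in> {0..1}"
proof -
  have "real (dyadic_cell m t) / 2 ^ m \<le> t" using assms by (intro dyadic_cell_bounds) simp
  also have "t \<le> 1" using assms by simp
  finally show ?thesis unfolding atLeastAtMost_iff by (intro conjI) simp_all
qed

text \<open>
  A continuous function is uniformly close to its values at the left end points of small cells.
\<close>

lemma continuous_step_approx:
  assumes f: "continuous_on {0..1} f"
  shows "(\<lambda>m. J1_dist (\<lambda>t\<in>{0..1}. f (real (dyadic_cell m t) / 2 ^ m)) (\<lambda>t\<in>{0..1}. f t)) \<longlonglongrightarrow> 0"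
proof (rule LIMSEQ_I)
  fix e :: real assume e: "0 < e"
  have "uniformly_continuous_on {0..1} f" by (rule compact_uniformly_continuous[OF f]) simp
  then obtain \<delta> where \<delta>: "0 < \<delta>" "\<And>s t. s \<in> {0..1} \<Longrightarrow> t \<in> {0..1} \<Longrightarrow> dist s t < \<delta> \<Longrightarrow> dist (f s) (f t) < e / 2"
    using e unfolding uniformly_continuous_on_def by (metis half_gt_zero)
  have "(\<lambda>m. (1 / 2) ^ m :: real) \<longlonglongrightarrow> 0" by (rule LIMSEQ_power_zero) simp
  then obtain m0 where m0: "\<And>m. m0 \<le> m \<Longrightarrow> (1 / 2) ^ m < \<delta>"
    using \<delta>(1) by (metis (no_types, lifting) order_tendstoD(2) eventually_sequentially)
  have "norm (J1_dist (\<lambda>t\<in>{0..1}. f (real (dyadic_cell m t) / 2 ^ m)) (\<lambda>t\<in>{0..1}. f t) - 0) < e" if m: "m0 \<le> m" for m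
  proof -
    have "J1_dist (\<lambda>t\<in>{0..1}. f (real (dyadic_cell m t) / 2 ^ m)) (\<lambda>t\<in>{0..1}. f t) \<le> e / 2"
    proof (rule J1_dist_le_sup)
      show "(\<lambda>t\<in>{0..1}. f (real (dyadic_cell m t) / 2 ^ m)) \<in> D01"
        by (rule restrict_lcrl_D01) (rule lcrl_dyadic_cell[of "\<lambda>i. f (real i / 2 ^ m)"])
      show "(\<lambda>t\<in>{0..1}. f t) \<in> D01" by (rule restrict_continuous_D01[OF f])
      fix t :: real assume t: "t \<in> {0..1}"
      let ?s = "real (dyadic_cell m t) / 2 ^ m"
      have b: "?s \<le> t" "t \<le> ?s + (1 / 2) ^ m"
        using dyadic_cell_bounds[of t m] t by (auto simp: add_divide_distrib power_one_over inverse_eq_divide)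
      have s: "?s \<in> {0..1}" by (rule dyadic_cell_grid_mem[OF t])
      have "dist ?s t \<le> (1 / 2) ^ m" using b by (simp add: dist_real_def abs_le_iff)
      then have "dist (f ?s) (f t) < e / 2" using m0[OF m] by (intro \<delta>(2)[OF s t]) linarith
      then show "\<bar>(\<lambda>t\<in>{0..1}. f (real (dyadic_cell m t) / 2 ^ m)) t - (\<lambda>t\<in>{0..1}. f t) t\<bar> \<le> e / 2"
        using t by (simp add: dist_real_def)
    qed
    then show ?thesis using e by simp
  qed
  then show "\<exists>m0. \<forall>m\<ge>m0. norm (J1_dist (\<lambda>t\<in>{0..1}. f (real (dyadic_cell m t) / 2 ^ m)) (\<lambda>t\<in>{0..1}. f t) - 0) < e" by blast
qed

lemma measurable_continuous_path:
  assumes K: "\<And>t. t \<in> {0..1} \<Longrightarrow> K t \<in> borel_measurable P" and c: "\<And>\<omega>. \<omega> \<in> space P \<Longrightarrow> continuous_on {0..1} (\<lambda>t. K t \<omega>)"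
  shows "(\<lambda>\<omega>. \<lambda>t\<in>{0..1}. K t \<omega>) \<in> measurable P J1_borel"
proof (rule measurable_J1_limit)
  show "(\<lambda>\<omega>. \<lambda>t\<in>{0..1}. K (real (dyadic_cell m t) / 2 ^ m) \<omega>) \<in> measurable P J1_borel" for m
  proof (rule measurable_step_path[of m "\<lambda>i. K (real i / 2 ^ m)"])
    fix i :: nat assume "i < 2 ^ m"
    then have "real i \<le> 2 ^ m" by (metis less_imp_le of_nat_le_iff of_nat_numeral of_nat_power)
    then show "K (real i / 2 ^ m) \<in> borel_measurable P" by (intro K) auto
  qed
  show "(\<lambda>t\<in>{0..1}. K t \<omega>) \<in> D01" if "\<omega> \<in> space P" for \<omega> by (rule restrict_continuous_D01[OF c[OF that]])
  show "(\<lambda>m. J1_dist (\<lambda>t\<in>{0..1}. K (real (dyadic_cell m t) / 2 ^ m) \<omega>) (\<lambda>t\<in>{0..1}. K t \<omega>)) \<longlonglongrightarrow> 0" if "\<omega> \<in> space P" for \<omega>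
    by (rule continuous_step_approx[OF c[OF that]])
qed

section \<open>Weak convergence from Lipschitz test functions\<close>

text \<open>
  A bounded continuous function is the increasing limit of its Lipschitz envelopes: far from \<open>x\<close>
  the penalty exceeds the oscillation of \<open>h\<close>, and near \<open>x\<close> the values of \<open>h\<close> are close to
  \<open>h x\<close>.
\<close>

lemma J1_lipschitz_envelope:
  assumes h: "continuous_map J1_topology euclideanreal h" and B: "\<forall>x\<in>D01. \<bar>h x\<bar> \<le> B"
  defines "e \<equiv> \<lambda>k x. INF y\<in>D01. h y + real k * J1_dist x y"
  shows "J1_lipschitz (real k) (e k)" "x \<in> D01 \<Longrightarrow> e k x \<le> h x" "x \<in> D01 \<Longrightarrow> \<bar>e k x\<bar> \<le> B"
    "x \<in> D01 \<Longrightarrow> (\<lambda>k. e k x) \<longlonglongrightarrow> h x"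
proof -
  have ne: "D01 \<noteq> {}" using restrict_lcrl_D01[OF lcrl_const] by blast
  have hb: "- B \<le> h y" "h y \<le> B" if "y \<in> D01" for y using bspec[OF B that] by (auto simp: abs_le_iff)
  show "J1_lipschitz (real k) (e k)" for k
    unfolding e_def by (rule J1_lipschitz_INF[where b = "- B"]) (use ne hb in auto)
  have bdd: "bdd_below ((\<lambda>y. h y + real k * J1_dist x y) ` D01)" for k x
    using hb by (intro bdd_belowI2[where m = "- B"]) (auto intro: add_increasing2)
  show le: "e k x \<le> h x" if "x \<in> D01" for k x
    using cINF_lower[OF bdd that, of k x] that by (simp add: e_def)
  have ge: "- B \<le> e k x" for k x
    unfolding e_def using hb by (intro cINF_greatest ne) (auto intro: add_increasing2)
  show "\<bar>e k x\<bar> \<le> B" if "x \<in> D01" for k x using le[OF that, of k] ge[of k x] hb(2)[OF that] by (simp add: abs_le_iff)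
  show "(\<lambda>k. e k x) \<longlonglongrightarrow> h x" if x: "x \<in> D01"
  proof (rule LIMSEQ_I)
    fix \<epsilon> :: real assume \<epsilon>: "0 < \<epsilon>"
    have "openin euclidean {h x - \<epsilon> / 2<..}" by (simp add: open_openin[symmetric])
    then have "openin J1_topology {y \<in> topspace J1_topology. h y \<in> {h x - \<epsilon> / 2<..}}"
      using h unfolding continuous_map by blast
    moreover have "x \<in> {y \<in> topspace J1_topology. h y \<in> {h x - \<epsilon> / 2<..}}" using x \<epsilon> by (simp add: J1_topology_def)
    ultimately obtain r where r: "0 < r" "J1.mball x r \<subseteq> {y \<in> topspace J1_topology. h y \<in> {h x - \<epsilon> / 2<..}}"
      unfolding J1_topology_def J1.openin_mtopology by blast
    have B0: "0 \<le> B" using bspec[OF B x] by (rule order_trans[rotated]) simp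
    obtain k0 :: nat where k0: "2 * B / r \<le> real k0" using real_arch_simple by blast
    have "norm (e k x - h x) < \<epsilon>" if k: "k0 \<le> k" for k
    proof -
      have "h x - \<epsilon> / 2 \<le> e k x"
        unfolding e_def
      proof (rule cINF_greatest[OF ne])
        fix y assume y: "y \<in> D01"
        show "h x - \<epsilon> / 2 \<le> h y + real k * J1_dist x y"
        proof (cases "J1_dist x y < r")
          case True
          then have "h x - \<epsilon> / 2 < h y" using r(2) x y by auto
          moreover have "0 \<le> real k * J1_dist x y" by simp
          ultimately show ?thesis by linarith
        next
          case False
          have "2 * B \<le> real k0 * r" using k0 r(1) by (simp add: field_simps)
          also have "\<dots> \<le> real k * J1_dist x y" using k False r(1) by (intro mult_mono) auto
          finally show ?thesis using hb[OF x] hb[OF y] \<epsilon> by linarith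
        qed
      qed
      then show ?thesis using le[OF x, of k] \<epsilon> by simp
    qed
    then show "\<exists>k0. \<forall>k\<ge>k0. norm (e k x - h x) < \<epsilon>" by blast
  qed
qed

lemma liminf_lipschitz_test:
  assumes M: "prob_space M" and P: "prob_space P"
    and Y: "\<And>N. Y N \<in> measurable M J1_borel" and K: "K \<in> measurable P J1_borel"
    and lip: "\<And>L h B. J1_lipschitz L h \<Longrightarrow> \<forall>x\<in>D01. \<bar>h x\<bar> \<le> B \<Longrightarrow>
       (\<lambda>N. \<integral>\<omega>. h (Y N \<omega>) \<partial>M) \<longlonglongrightarrow> (\<integral>\<omega>. h (K \<omega>) \<partial>P)"
    and h: "continuous_map J1_topology euclideanreal h" and B: "\<forall>x\<in>D01. \<bar>h x\<bar> \<le> B" and \<epsilon>: "0 < \<epsilon>"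
  shows "\<forall>\<^sub>F N in sequentially. (\<integral>\<omega>. h (K \<omega>) \<partial>P) - \<epsilon> < (\<integral>\<omega>. h (Y N \<omega>) \<partial>M)"
proof -
  interpret M: prob_space M by fact
  interpret P: prob_space P by fact
  define e where "e k x = (INF y\<in>D01. h y + real k * J1_dist x y)" for k x
  note env = J1_lipschitz_envelope[OF h B, folded e_def]
  have YD: "Y N \<omega> \<in> D01" if "\<omega> \<in> space M" for N \<omega> using measurable_space[OF Y that] by simp
  have KD: "K \<omega> \<in> D01" if "\<omega> \<in> space P" for \<omega> using measurable_space[OF K that] by simp
  have hm: "h \<in> borel_measurable J1_borel" by (rule J1_continuous_measurable[OF h])
  have em: "e k \<in> borel_measurable J1_borel" for k
    by (rule J1_continuous_measurable[OF J1_lipschitz_continuous[OF env(1)]])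
  have "(\<lambda>k. \<integral>\<omega>. e k (K \<omega>) \<partial>P) \<longlonglongrightarrow> (\<integral>\<omega>. h (K \<omega>) \<partial>P)"
  proof (rule integral_dominated_convergence[where w = "\<lambda>_. B"])
    show "AE \<omega> in P. (\<lambda>k. e k (K \<omega>)) \<longlonglongrightarrow> h (K \<omega>)" using env(4) KD by (intro AE_I2) auto
    show "AE \<omega> in P. norm (e k (K \<omega>)) \<le> B" for k using env(3) KD by (intro AE_I2) auto
  qed (auto intro: measurable_compose[OF K hm] measurable_compose[OF K em])
  then have "\<forall>\<^sub>F k in sequentially. (\<integral>\<omega>. h (K \<omega>) \<partial>P) - \<epsilon> < (\<integral>\<omega>. e k (K \<omega>) \<partial>P)"
    using \<epsilon> by (intro order_tendstoD(1)) auto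
  then obtain k where k: "(\<integral>\<omega>. h (K \<omega>) \<partial>P) - \<epsilon> < (\<integral>\<omega>. e k (K \<omega>) \<partial>P)"
    by (auto simp: eventually_sequentially)
  have "(\<lambda>N. \<integral>\<omega>. e k (Y N \<omega>) \<partial>M) \<longlonglongrightarrow> (\<integral>\<omega>. e k (K \<omega>) \<partial>P)"
    by (rule lip[OF env(1), where B = B]) (use env(3) in blast)
  then have "\<forall>\<^sub>F N in sequentially. (\<integral>\<omega>. h (K \<omega>) \<partial>P) - \<epsilon> < (\<integral>\<omega>. e k (Y N \<omega>) \<partial>M)" using k by (rule order_tendstoD(1))
  moreover have "(\<integral>\<omega>. e k (Y N \<omega>) \<partial>M) \<le> (\<integral>\<omega>. h (Y N \<omega>) \<partial>M)" for N
  proof (rule integral_mono)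
    show "integrable M (\<lambda>\<omega>. e k (Y N \<omega>))" "integrable M (\<lambda>\<omega>. h (Y N \<omega>))"
      using env(3) B YD by (auto intro!: M.integrable_const_bound[of _ B] AE_I2 measurable_compose[OF Y hm] measurable_compose[OF Y em])
    show "e k (Y N \<omega>) \<le> h (Y N \<omega>)" if "\<omega> \<in> space M" for \<omega> by (rule env(2)[OF YD[OF that]])
  qed
  ultimately show ?thesis by (auto elim!: eventually_mono intro: less_le_trans)
qed

text \<open>
  Lower Lipschitz envelopes give the lower bound for the limit inferior; applied to \<open>- h\<close> they
  give the upper bound.
\<close>

theorem weak_limit_lipschitz_test:
  assumes "prob_space M" "prob_space P"
    and "\<And>N. Y N \<in> measurable M J1_borel" "K \<in> measurable P J1_borel"
    and "\<And>L h B. J1_lipschitz L h \<Longrightarrow> \<forall>x\<in>D01. \<bar>h x\<bar> \<le> B \<Longrightarrow>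
       (\<lambda>N. \<integral>\<omega>. h (Y N \<omega>) \<partial>M) \<longlonglongrightarrow> (\<integral>\<omega>. h (K \<omega>) \<partial>P)"
    and h: "continuous_map J1_topology euclideanreal h" and B: "\<forall>x\<in>D01. \<bar>h x\<bar> \<le> B"
  shows "(\<lambda>N. \<integral>\<omega>. h (Y N \<omega>) \<partial>M) \<longlonglongrightarrow> (\<integral>\<omega>. h (K \<omega>) \<partial>P)"
proof (rule order_tendstoI)
  fix a assume "a < (\<integral>\<omega>. h (K \<omega>) \<partial>P)"
  then show "\<forall>\<^sub>F N in sequentially. a < (\<integral>\<omega>. h (Y N \<omega>) \<partial>M)"
    using liminf_lipschitz_test[OF assms, where \<epsilon> = "(\<integral>\<omega>. h (K \<omega>) \<partial>P) - a"] by simp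
next
  fix a assume a: "(\<integral>\<omega>. h (K \<omega>) \<partial>P) < a"
  have "continuous_map J1_topology euclideanreal (\<lambda>x. - h x)" using h by (rule continuous_map_minus)
  then have "\<forall>\<^sub>F N in sequentially. (\<integral>\<omega>. - h (K \<omega>) \<partial>P) - (a - (\<integral>\<omega>. h (K \<omega>) \<partial>P)) < (\<integral>\<omega>. - h (Y N \<omega>) \<partial>M)"
    using B a by (intro liminf_lipschitz_test[OF assms(1-5), where B = B]) auto
  then show "\<forall>\<^sub>F N in sequentially. (\<integral>\<omega>. h (Y N \<omega>) \<partial>M) < a" by simp
qed

section \<open>Continuous Gaussian processes\<close>

lemma dyadic_cell_close:
  assumes "s \<le> t" "t \<le> s + (1 / 2) ^ m" "0 \<le> s" shows "dyadic_cell m t = dyadic_cell m s \<or> dyadic_cell m t = dyadic_cell m s + 1"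
proof -
  have st: "2 ^ m * s \<le> 2 ^ m * t" using assms(1) by simp
  have "2 ^ m * t \<le> 2 ^ m * (s + (1 / 2) ^ m)" using assms(2) by (rule mult_left_mono) simp
  also have "\<dots> = 2 ^ m * s + 1" by (simp add: distrib_left flip: power_mult_distrib)
  finally have 1: "2 ^ m * t \<le> 2 ^ m * s + 1" .
  have c0: "0 \<le> \<lceil>2 ^ m * s\<rceil>" using assms(3) by (simp add: le_ceiling_iff order.strict_trans2[of "-1" 0])
  have "\<lceil>2 ^ m * s\<rceil> \<le> \<lceil>2 ^ m * t\<rceil>" using st by (rule ceiling_mono)
  moreover have "\<lceil>2 ^ m * t\<rceil> \<le> \<lceil>2 ^ m * s\<rceil> + 1" using 1 by linarith
  ultimately show ?thesis using c0 unfolding dyadic_cell_def by linarith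
qed

lemma dyadic_cell_tendsto: "t \<in> {0..1} \<Longrightarrow> (\<lambda>j. real (dyadic_cell j t) / 2 ^ j) \<longlonglongrightarrow> t"
proof -
  assume t: "t \<in> {0..1}"
  have "(\<lambda>j. (1 / 2) ^ j :: real) \<longlonglongrightarrow> 0" by (rule LIMSEQ_power_zero) simp
  then have "(\<lambda>j. real (dyadic_cell j t) / 2 ^ j - t) \<longlonglongrightarrow> 0"
  proof (rule Lim_null_comparison[rotated, OF _ always_eventually], intro allI)
    show "norm (real (dyadic_cell j t) / 2 ^ j - t) \<le> (1 / 2) ^ j" for j
      using dyadic_cell_bounds[of t j] t by (auto simp: add_divide_distrib power_one_over inverse_eq_divide abs_le_iff)
  qed
  then show ?thesis by (rule LIM_zero_cancel)
qed

definition dyadics :: "real set" where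
  "dyadics = {real i / 2 ^ j | i j. i \<le> 2 ^ j}"

lemma dyadics_01: "dyadics \<subseteq> {0..1}"
proof
  fix x assume "x \<in> dyadics"
  then obtain i j :: nat where ij: "x = real i / 2 ^ j" "i \<le> 2 ^ j" by (auto simp: dyadics_def)
  then have "real i \<le> 2 ^ j" by (metis of_nat_le_iff of_nat_numeral of_nat_power)
  then show "x \<in> {0..1}" using ij by simp
qed

lemma countable_dyadics: "countable dyadics"
proof -
  have "dyadics \<subseteq> (\<lambda>(i, j). real i / 2 ^ j) ` (UNIV :: (nat \<times> nat) set)" by (auto simp: dyadics_def)
  then show ?thesis by (rule countable_subset) auto
qed

lemma dyadics_memI: "i \<le> 2 ^ j \<Longrightarrow> real i / 2 ^ j \<in> dyadics"
  unfolding dyadics_def by blast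

lemma dyadic_cell_dyadics: "t \<in> {0..1} \<Longrightarrow> real (dyadic_cell j t) / 2 ^ j \<in> dyadics"
  using dyadic_cell_less[of t j] by (intro dyadics_memI) auto

text \<open>
  Kolmogorov's continuity theorem for Gaussian increments. On the dyadic rationals the process is a
  Gaussian sequence. Its increments over a mesh \<open>2 ^ - j\<close> have fourth moments of order
  \<open>4 ^ - j\<close>, so by Borel--Cantelli they are eventually at most \<open>r ^ j\<close>, and chaining extends the
  process continuously. The characteristic functions pass to the limit.
\<close>

theorem continuous_gaussian_process:
  fixes G :: "real \<Rightarrow> real \<Rightarrow> real"
  assumes sym: "\<And>s t. s \<in> {0..1} \<Longrightarrow> t \<in> {0..1} \<Longrightarrow> G s t = G t s"
    and psd: "\<And>(I :: nat set) c t. finite I \<Longrightarrow> (\<And>i. i \<in> I \<Longrightarrow> t i \<in> {0..1}) \<Longrightarrow>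
        0 \<le> (\<Sum>i\<in>I. \<Sum>j\<in>I. c i * c j * G (t i) (t j))"
    and cont: "continuous_on ({0..1} \<times> {0..1}) (\<lambda>(s, t). G s t)"
    and incr: "\<And>s t. 0 \<le> s \<Longrightarrow> s \<le> t \<Longrightarrow> t \<le> 1 \<Longrightarrow> G t t - 2 * G s t + G s s \<le> A * (t - s)"
  obtains K :: "real \<Rightarrow> (real \<Rightarrow> real) \<Rightarrow> real" where
    "\<And>t. t \<in> {0..1} \<Longrightarrow> K t \<in> borel_measurable gauss_space"
    "\<And>\<omega>. continuous_on {0..1} (\<lambda>t. K t \<omega>)"
    "\<And>(I :: nat set) c t. finite I \<Longrightarrow> (\<And>i. i \<in> I \<Longrightarrow> t i \<in> {0..1}) \<Longrightarrow>
       (\<integral>\<omega>. cis (\<Sum>i\<in>I. c i * K (t i) \<omega>) \<partial>gauss_space) =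
       of_real (exp (- (\<Sum>i\<in>I. \<Sum>j\<in>I. c i * c j * G (t i) (t j)) / 2))"
proof -
  interpret P: prob_space gauss_space by (rule prob_space_gauss_space)
  define \<tau> where "\<tau> = from_nat_into dyadics"
  have "0 / 2 ^ 0 \<in> dyadics" using dyadics_memI[of 0 0] by simp
  then have ne: "dyadics \<noteq> {}" by blast
  have \<tau>01: "\<tau> n \<in> {0..1}" for n using from_nat_into[OF ne, of n] dyadics_01 by (auto simp: \<tau>_def)
  have \<tau>_inv: "\<tau> (to_nat_on dyadics t) = t" if "t \<in> dyadics" for t
    using from_nat_into_to_nat_on[OF countable_dyadics that] by (simp add: \<tau>_def)
  have "psd_kernel (\<lambda>n m. G (\<tau> n) (\<tau> m))"
    unfolding psd_kernel_def by (intro conjI allI impI sym psd \<tau>01)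
  note kernel = this
  obtain Z' :: "nat \<Rightarrow> (real \<Rightarrow> real) \<Rightarrow> real" where Z'm: "\<And>n. Z' n \<in> borel_measurable gauss_space"
    and Z'c: "\<And>(I :: nat set) c e. finite I \<Longrightarrow> (\<integral>\<omega>. cis (\<Sum>i\<in>I. c i * Z' (e i) \<omega>) \<partial>gauss_space) =
       of_real (exp (- (\<Sum>i\<in>I. \<Sum>j\<in>I. c i * c j * G (\<tau> (e i)) (\<tau> (e j))) / 2))"
    by (rule gaussian_sequence[OF kernel, where ?'i = nat]) (use that in fast)
  define Z where "Z t = Z' (to_nat_on dyadics t)" for t
  have Zm [measurable]: "Z t \<in> borel_measurable gauss_space" for t unfolding Z_def by (rule Z'm)
  have Zc: "(\<integral>\<omega>. cis (\<Sum>i\<in>I. c i * Z (t i) \<omega>) \<partial>gauss_space) =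
       of_real (exp (- (\<Sum>i\<in>I. \<Sum>j\<in>I. c i * c j * G (t i) (t j)) / 2))"
    if "finite I" "\<And>i. i \<in> I \<Longrightarrow> t i \<in> dyadics" for I :: "nat set" and c t
  proof -
    have "(\<Sum>i\<in>I. \<Sum>j\<in>I. c i * c j * G (\<tau> (to_nat_on dyadics (t i))) (\<tau> (to_nat_on dyadics (t j)))) =
        (\<Sum>i\<in>I. \<Sum>j\<in>I. c i * c j * G (t i) (t j))"
      by (intro sum.cong refl) (simp add: \<tau>_inv that)
    then show ?thesis using Z'c[OF that(1), of c "\<lambda>i. to_nat_on dyadics (t i)"] by (simp only: Z_def)
  qed
  have incZ: "integrable gauss_space (\<lambda>\<omega>. \<bar>Z t \<omega> - Z s \<omega>\<bar> ^ 4)" "(\<integral>\<omega>. \<bar>Z t \<omega> - Z s \<omega>\<bar> ^ 4 \<partial>gauss_space) \<le> 3 * (A * (t - s))\<^sup>2"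
    if st: "s \<in> dyadics" "t \<in> dyadics" "s \<le> t" for s t
  proof -
    have st01: "0 \<le> s" "t \<le> 1" "s \<in> {0..1}" "t \<in> {0..1}" using st dyadics_01 by auto
    define q where "q = G t t - 2 * G s t + G s s"
    let ?t = "\<lambda>i::nat. if i = 0 then t else s" and ?c = "\<lambda>\<theta> i::nat. if i = 0 then \<theta> else - \<theta> :: real"
    have two: "(\<Sum>i\<in>{0, 1::nat}. f i) = f 0 + f 1" for f :: "nat \<Rightarrow> real" by simp
    have dq: "(\<Sum>i\<in>{0, 1}. \<Sum>j\<in>{0, 1}. ?c \<theta> i * ?c \<theta> j * G (?t i) (?t j)) = \<theta>\<^sup>2 * q" for \<theta>
      unfolding two using sym[OF st01(3,4)] by (simp add: q_def power2_eq_square algebra_simps)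
    have "0 \<le> (\<Sum>i\<in>{0, 1}. \<Sum>j\<in>{0, 1}. ?c 1 i * ?c 1 j * G (?t i) (?t j))"
      by (rule psd) (use st01 in auto)
    then have q0: "0 \<le> q" unfolding dq by simp
    have W: "(\<integral>\<omega>. cis (\<theta> * (Z t \<omega> - Z s \<omega>)) \<partial>gauss_space) = of_real (exp (- (\<theta>\<^sup>2 * q) / 2))" for \<theta>
    proof -
      have "(\<Sum>i\<in>{0, 1}. ?c \<theta> i * Z (?t i) \<omega>) = \<theta> * (Z t \<omega> - Z s \<omega>)" for \<omega>
        by (simp add: two right_diff_distrib)
      moreover have "(\<integral>\<omega>. cis (\<Sum>i\<in>{0, 1}. ?c \<theta> i * Z (?t i) \<omega>) \<partial>gauss_space) = of_real (exp (- (\<theta>\<^sup>2 * q) / 2))"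
        unfolding dq[symmetric] by (rule Zc) (use st in auto)
      ultimately show ?thesis by simp
    qed
    have Wm: "(\<lambda>\<omega>. Z t \<omega> - Z s \<omega>) \<in> borel_measurable gauss_space" by measurable
    note mom = centered_normal_moments[OF P.prob_space_axioms Wm q0 W]
    show "integrable gauss_space (\<lambda>\<omega>. \<bar>Z t \<omega> - Z s \<omega>\<bar> ^ 4)" using mom(1)[of 4] by (simp add: power_even_abs)
    have "q \<le> A * (t - s)" unfolding q_def by (rule incr[OF st01(1) st(3) st01(2)])
    then have "q\<^sup>2 \<le> (A * (t - s))\<^sup>2" using q0 by (intro power_mono)
    then show "(\<integral>\<omega>. \<bar>Z t \<omega> - Z s \<omega>\<bar> ^ 4 \<partial>gauss_space) \<le> 3 * (A * (t - s))\<^sup>2"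
      using mom(4) by (simp add: power_even_abs)
  qed
  (* With r ^ 4 = 3 / 4 the exceedance probabilities are of order (2 / 3) ^ j. *)
  define r :: real where "r = (3 / 4) powr (1 / 4)"
  have r: "0 < r" "r < 1" "r ^ 4 = 3 / 4"
  proof -
    show "0 < r" by (simp add: r_def)
    show "r ^ 4 = 3 / 4" by (simp add: r_def powr_power)
    then show "r < 1" using one_le_power[of r 4] by linarith
  qed
  let ?d = "\<lambda>j i. real i / 2 ^ j"
  let ?e = "\<lambda>j i. (real i + 1) / 2 ^ j"
  have dy: "?d j i \<in> dyadics" "?e j i \<in> dyadics" if "i < 2 ^ j" for i j
    using dyadics_memI[of i j] dyadics_memI[of "Suc i" j] that by (auto simp: add.commute)
  define bad where "bad j = {\<omega> \<in> space gauss_space. \<exists>i\<in>{..<2 ^ j}. r ^ j < \<bar>Z (?e j i) \<omega> - Z (?d j i) \<omega>\<bar>}" for j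
  have bad: "measure gauss_space (bad j) \<le> 3 * A\<^sup>2 * (1 / (2 * r ^ 4)) ^ j" "bad j \<in> sets gauss_space" for j
  proof -
    have m: "(\<integral>\<omega>. \<bar>Z (?e j i) \<omega> - Z (?d j i) \<omega>\<bar> ^ 4 \<partial>gauss_space) \<le> 3 * A\<^sup>2 / 4 ^ j" if "i < 2 ^ j" for i
    proof -
      have "?e j i - ?d j i = 1 / 2 ^ j" by (simp add: diff_divide_distrib[symmetric])
      then have "(A * (?e j i - ?d j i))\<^sup>2 = A\<^sup>2 / 4 ^ j"
        by (simp add: power_divide power2_eq_square flip: power_mult_distrib)
      then show ?thesis using incZ(2)[OF dy[OF that]] by (simp add: divide_right_mono)
    qed
    have i: "integrable gauss_space (\<lambda>\<omega>. \<bar>Z (?e j i) \<omega> - Z (?d j i) \<omega>\<bar> ^ 4)" if "i < 2 ^ j" for i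
      by (rule incZ(1)[OF dy[OF that]]) (simp add: divide_right_mono)
    show "measure gauss_space (bad j) \<le> 3 * A\<^sup>2 * (1 / (2 * r ^ 4)) ^ j"
      unfolding bad_def by (rule level_exceedance(1)[OF P.prob_space_axioms _ i m r(1)]) auto
    show "bad j \<in> sets gauss_space"
      unfolding bad_def by (rule level_exceedance(2)[OF P.prob_space_axioms _ i m r(1)]) auto
  qed
  have summ: "summable (\<lambda>j. measure gauss_space (bad j))"
  proof (rule summable_comparison_test')
    show "summable (\<lambda>j. 3 * A\<^sup>2 * (1 / (2 * r ^ 4)) ^ j)" by (intro summable_mult summable_geometric) (simp add: r(3))
    show "norm (measure gauss_space (bad j)) \<le> 3 * A\<^sup>2 * (1 / (2 * r ^ 4)) ^ j" for j using bad(1)[of j] by simp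
  qed
  define good where "good = {\<omega> \<in> space gauss_space. \<exists>j0. \<forall>j\<ge>j0. \<omega> \<notin> bad j}"
  have good_meas [measurable]: "good \<in> sets gauss_space"
  proof -
    have [measurable]: "bad j \<in> sets gauss_space" for j by (rule bad(2))
    have "{\<omega> \<in> space gauss_space. \<forall>j\<ge>j0. \<omega> \<notin> bad j} \<in> sets gauss_space" for j0 by measurable
    then show ?thesis unfolding good_def by (rule sets.sets_Collect_countable_Ex)
  qed
  have AE_good: "AE \<omega> in gauss_space. \<omega> \<in> good"
  proof -
    have "AE \<omega> in gauss_space. \<forall>\<^sub>F j in sequentially. \<omega> \<in> space gauss_space - bad j"
      by (rule borel_cantelli_AE1[OF bad(2) _ summ]) (simp add: P.emeasure_eq_measure)
    then show ?thesis
    proof (rule AE_mp, intro AE_I2 impI)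
      fix \<omega> assume "\<omega> \<in> space gauss_space" "\<forall>\<^sub>F j in sequentially. \<omega> \<in> space gauss_space - bad j"
      then show "\<omega> \<in> good" unfolding good_def eventually_sequentially by blast
    qed
  qed
  define a where "a j t \<omega> = Z (real (dyadic_cell j t) / 2 ^ j) \<omega>" for j t \<omega>
  define K where "K t \<omega> = (if \<omega> \<in> good then lim (\<lambda>j. a j t \<omega>) else 0)" for t \<omega>
  have chain: "\<bar>a (m + k) t \<omega> - a m t \<omega>\<bar> \<le> r ^ m / (1 - r)"
    if j0: "\<forall>j\<ge>j0. \<omega> \<notin> bad j" "\<omega> \<in> space gauss_space" and m: "j0 \<le> m" and t: "t \<in> {0..1}" for j0 m k t \<omega>
    unfolding a_def
  proof (rule dyadic_chain[OF r(1,2) t, where z = "\<lambda>t. Z t \<omega>"])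
    fix j i assume "m < j" "i < (2::nat) ^ j"
    then show "\<bar>Z (?e j i) \<omega> - Z (?d j i) \<omega>\<bar> \<le> r ^ j" using j0 m by (force simp: bad_def not_less)
  qed
  have rlim: "(\<lambda>m. C * r ^ m) \<longlonglongrightarrow> 0" for C
    using tendsto_mult_left[OF LIMSEQ_power_zero[of r], of C] r by simp
  have conv: "(\<lambda>j. a j t \<omega>) \<longlonglongrightarrow> K t \<omega>" and tail: "\<And>j0 m. \<forall>j\<ge>j0. \<omega> \<notin> bad j \<Longrightarrow> j0 \<le> m \<Longrightarrow> \<bar>K t \<omega> - a m t \<omega>\<bar> \<le> r ^ m / (1 - r)"
    if g: "\<omega> \<in> good" and t: "t \<in> {0..1}" for t \<omega>
  proof -
    have sp: "\<omega> \<in> space gauss_space" using g by (simp add: good_def)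
    obtain j0 where j0: "\<forall>j\<ge>j0. \<omega> \<notin> bad j" using g by (auto simp: good_def)
    have "Cauchy (\<lambda>j. a j t \<omega>)"
    proof (rule CauchyI')
      fix e :: real assume "0 < e"
      then have "\<forall>\<^sub>F m in sequentially. 1 / (1 - r) * r ^ m < e" using rlim by (rule order_tendstoD(2)[rotated])
      then obtain m0 where m0: "\<And>m. m0 \<le> m \<Longrightarrow> 1 / (1 - r) * r ^ m < e" by (auto simp: eventually_sequentially)
      show "\<exists>M. \<forall>m\<ge>M. \<forall>n>m. dist (a m t \<omega>) (a n t \<omega>) < e"
      proof (intro exI allI impI)
        fix m n assume mn: "max m0 j0 \<le> m" "m < n"
        have "\<bar>a (m + (n - m)) t \<omega> - a m t \<omega>\<bar> \<le> r ^ m / (1 - r)" by (rule chain[OF j0 sp _ t]) (use mn in simp)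
        then show "dist (a m t \<omega>) (a n t \<omega>) < e" using m0[of m] mn by (simp add: dist_real_def abs_minus_commute)
      qed
    qed
    then have "convergent (\<lambda>j. a j t \<omega>)" by (simp add: Cauchy_convergent_iff)
    then show c: "(\<lambda>j. a j t \<omega>) \<longlonglongrightarrow> K t \<omega>" using g by (simp add: K_def convergent_LIMSEQ_iff)
    fix j0 m assume j0: "\<forall>j\<ge>j0. \<omega> \<notin> bad j" and m: "j0 \<le> m"
    have "(\<lambda>k. \<bar>a (m + k) t \<omega> - a m t \<omega>\<bar>) \<longlonglongrightarrow> \<bar>K t \<omega> - a m t \<omega>\<bar>"
      using LIMSEQ_ignore_initial_segment[OF c, of m] by (intro tendsto_intros) (simp add: add.commute)
    then show "\<bar>K t \<omega> - a m t \<omega>\<bar> \<le> r ^ m / (1 - r)"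
      by (rule LIMSEQ_le_const2) (use chain[OF j0 sp m t] in blast)
  qed
  have Kcont: "continuous_on {0..1} (\<lambda>t. K t \<omega>)" for \<omega>
  proof (cases "\<omega> \<in> good")
    case False then show ?thesis by (simp add: K_def)
  next
    case g: True
    have sp: "\<omega> \<in> space gauss_space" using g by (simp add: good_def)
    obtain j0 where j0: "\<forall>j\<ge>j0. \<omega> \<notin> bad j" using g by (auto simp: good_def)
    define C where "C = 1 + 2 / (1 - r)"
    have close: "\<bar>K t \<omega> - K s \<omega>\<bar> \<le> C * r ^ m"
      if m: "j0 \<le> m" and st: "s \<in> {0..1}" "t \<in> {0..1}" "s \<le> t" "t \<le> s + (1 / 2) ^ m" for s t m
    proof -
      have "\<bar>a m t \<omega> - a m s \<omega>\<bar> \<le> r ^ m"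
      proof (cases "dyadic_cell m t = dyadic_cell m s")
        case True then show ?thesis using r by (simp add: a_def)
      next
        case False
        then have eq: "dyadic_cell m t = dyadic_cell m s + 1" using dyadic_cell_close[OF st(3,4)] st by auto
        have "dyadic_cell m s < 2 ^ m" using st by (intro dyadic_cell_less) simp
        then have "\<bar>Z (?e m (dyadic_cell m s)) \<omega> - Z (?d m (dyadic_cell m s)) \<omega>\<bar> \<le> r ^ m" using j0 m sp by (force simp: bad_def not_less)
        then show ?thesis unfolding a_def eq by (simp add: add.commute)
      qed
      moreover have "\<bar>K t \<omega> - a m t \<omega>\<bar> \<le> r ^ m / (1 - r)" "\<bar>K s \<omega> - a m s \<omega>\<bar> \<le> r ^ m / (1 - r)"
        using tail[OF g st(2) j0 m] tail[OF g st(1) j0 m] .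
      moreover have "C * r ^ m = r ^ m + r ^ m / (1 - r) + r ^ m / (1 - r)" by (simp add: C_def distrib_right)
      ultimately show ?thesis by linarith
    qed
    show ?thesis
      unfolding continuous_on_iff
    proof (intro ballI allI impI)
      fix t e :: real assume t: "t \<in> {0..1}" and e: "0 < e"
      have "\<forall>\<^sub>F m in sequentially. C * r ^ m < e" using e rlim by (rule order_tendstoD(2)[rotated])
      then obtain m0 where m0: "\<And>m. m0 \<le> m \<Longrightarrow> C * r ^ m < e" by (auto simp: eventually_sequentially)
      define m where "m = max m0 j0"
      have m: "j0 \<le> m" "C * r ^ m < e" using m0[of m] by (auto simp: m_def)
      show "\<exists>\<delta>>0. \<forall>s\<in>{0..1}. dist s t < \<delta> \<longrightarrow> dist (K s \<omega>) (K t \<omega>) < e"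
      proof (intro exI[of _ "(1 / 2) ^ m"] conjI ballI impI)
        fix s :: real assume s: "s \<in> {0..1}" and d: "dist s t < (1 / 2) ^ m"
        have "\<bar>K s \<omega> - K t \<omega>\<bar> \<le> C * r ^ m"
        proof (cases "s \<le> t")
          case True
          then have "\<bar>K t \<omega> - K s \<omega>\<bar> \<le> C * r ^ m" using d by (intro close[OF m(1) s t]) (auto simp: dist_real_def)
          then show ?thesis by (simp add: abs_minus_commute)
        next
          case False
          then show ?thesis using d by (intro close[OF m(1) t s]) (auto simp: dist_real_def)
        qed
        then show "dist (K s \<omega>) (K t \<omega>) < e" using m(2) by (simp add: dist_real_def)
      qed simp
    qed
  qed
  have am [measurable]: "a j t \<in> borel_measurable gauss_space" for j t unfolding a_def[abs_def] by measurable
  have Km [measurable]: "K t \<in> borel_measurable gauss_space" for t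
    unfolding K_def[abs_def] by measurable
  show ?thesis
  proof (rule that[of K])
    show "K t \<in> borel_measurable gauss_space" for t by (rule Km)
    show "continuous_on {0..1} (\<lambda>t. K t \<omega>)" for \<omega> by (rule Kcont)
    fix I :: "nat set" and c :: "nat \<Rightarrow> real" and t :: "nat \<Rightarrow> real"
    assume I: "finite I" and t: "\<And>i. i \<in> I \<Longrightarrow> t i \<in> {0..1}"
    have "(\<lambda>j. \<integral>\<omega>. cis (\<Sum>i\<in>I. c i * a j (t i) \<omega>) \<partial>gauss_space) \<longlonglongrightarrow> (\<integral>\<omega>. cis (\<Sum>i\<in>I. c i * K (t i) \<omega>) \<partial>gauss_space)"
    proof (rule integral_dominated_convergence[where w = "\<lambda>_. 1"])
      show "(\<lambda>\<omega>. cis (\<Sum>i\<in>I. c i * K (t i) \<omega>)) \<in> borel_measurable gauss_space"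
        "(\<lambda>\<omega>. cis (\<Sum>i\<in>I. c i * a j (t i) \<omega>)) \<in> borel_measurable gauss_space" for j
        unfolding cis_conv_exp by measurable
      show "AE \<omega> in gauss_space. (\<lambda>j. cis (\<Sum>i\<in>I. c i * a j (t i) \<omega>)) \<longlonglongrightarrow> cis (\<Sum>i\<in>I. c i * K (t i) \<omega>)"
        using AE_good
      proof (rule AE_mp, intro AE_I2 impI)
        fix \<omega> assume g: "\<omega> \<in> good"
        have "(\<lambda>j. \<Sum>i\<in>I. c i * a j (t i) \<omega>) \<longlonglongrightarrow> (\<Sum>i\<in>I. c i * K (t i) \<omega>)"
          by (intro tendsto_sum tendsto_mult_left conv[OF g] t)
        then show "(\<lambda>j. cis (\<Sum>i\<in>I. c i * a j (t i) \<omega>)) \<longlonglongrightarrow> cis (\<Sum>i\<in>I. c i * K (t i) \<omega>)"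
          by (rule tendsto_cis)
      qed
    qed auto
    moreover have "(\<integral>\<omega>. cis (\<Sum>i\<in>I. c i * a j (t i) \<omega>) \<partial>gauss_space) =
        of_real (exp (- (\<Sum>i\<in>I. \<Sum>k\<in>I. c i * c k * G (real (dyadic_cell j (t i)) / 2 ^ j) (real (dyadic_cell j (t k)) / 2 ^ j)) / 2))" for j
      unfolding a_def by (rule Zc[OF I]) (rule dyadic_cell_dyadics[OF t])
    moreover have "(\<lambda>j. complex_of_real (exp (- (\<Sum>i\<in>I. \<Sum>k\<in>I. c i * c k * G (real (dyadic_cell j (t i)) / 2 ^ j) (real (dyadic_cell j (t k)) / 2 ^ j)) / 2)))
        \<longlonglongrightarrow> of_real (exp (- (\<Sum>i\<in>I. \<Sum>k\<in>I. c i * c k * G (t i) (t k)) / 2))"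
    proof -
      have "(\<lambda>j. G (real (dyadic_cell j (t i)) / 2 ^ j) (real (dyadic_cell j (t k)) / 2 ^ j)) \<longlonglongrightarrow> G (t i) (t k)" if "i \<in> I" "k \<in> I" for i k
      proof -
        have "(\<lambda>j. (\<lambda>(s, t). G s t) (real (dyadic_cell j (t i)) / 2 ^ j, real (dyadic_cell j (t k)) / 2 ^ j)) \<longlonglongrightarrow> (\<lambda>(s, t). G s t) (t i, t k)"
        proof (rule continuous_on_tendsto_compose[OF cont])
          show "(\<lambda>j. (real (dyadic_cell j (t i)) / 2 ^ j, real (dyadic_cell j (t k)) / 2 ^ j)) \<longlonglongrightarrow> (t i, t k)"
            by (intro tendsto_Pair dyadic_cell_tendsto t that)
          show "(t i, t k) \<in> {0..1} \<times> {0..1}" using t that by blast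
          show "\<forall>\<^sub>F j in sequentially. (real (dyadic_cell j (t i)) / 2 ^ j, real (dyadic_cell j (t k)) / 2 ^ j) \<in> {0..1} \<times> {0..1}"
            using dyadic_cell_grid_mem t that by (intro always_eventually allI) blast
        qed
        then show ?thesis by simp
      qed
      then show ?thesis by (intro tendsto_intros) auto
    qed
    ultimately show "(\<integral>\<omega>. cis (\<Sum>i\<in>I. c i * K (t i) \<omega>) \<partial>gauss_space) =
       of_real (exp (- (\<Sum>i\<in>I. \<Sum>j\<in>I. c i * c j * G (t i) (t j)) / 2))"
      by (simp add: LIMSEQ_unique)
  qed
qed

section \<open>Tightness of the empirical process\<close>

text \<open>
  One term of the exponential series.
\<close>

lemma power_le_fact_exp:
  assumes "0 \<le> (x::real)" shows "x ^ p \<le> fact p * exp x"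
proof -
  have s: "(\<lambda>n. x ^ n /\<^sub>R fact n) sums exp x" by (rule exp_converges)
  have "(\<Sum>n\<in>{p}. x ^ n /\<^sub>R fact n) \<le> (\<Sum>n. x ^ n /\<^sub>R fact n)"
    by (rule sum_le_suminf[OF sums_summable[OF s]]) (use assms in auto)
  then have "x ^ p / fact p \<le> exp x" using sums_unique[OF s] by (simp add: divide_inverse mult.commute)
  then show ?thesis by (simp add: field_simps)
qed

lemma empirical_df_mono: "s \<le> t \<Longrightarrow> empirical_df X N s \<omega> \<le> empirical_df X N t \<omega>"
  unfolding empirical_df_def by (intro mult_left_mono sum_mono) (auto simp: indicator_def)

context mixing_walk begin

lemma emp_process_zero: "emp_process 0 t \<omega> = 0" "emp_process N 0 \<omega> = 0"
  by (simp_all add: emp_process_def empirical_df_def)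

lemma emp_process_bound:
  assumes "0 \<le> t" "t \<le> 1" shows "\<bar>emp_process N t \<omega>\<bar> \<le> 2 * real N / sqrt (real N)"
proof -
  have "\<bar>\<Sum>k<N. cind t (S (Suc k) \<omega>)\<bar> \<le> (\<Sum>k<N. 2)"
    by (intro order_trans[OF sum_abs] sum_mono step_fn_bound[OF step_fn_cind[OF assms]])
  then show ?thesis using assms by (simp add: emp_process_eq divide_right_mono)
qed

lemma integrable_emp_increment:
  assumes "0 \<le> s" "s \<le> 1" "0 \<le> t" "t \<le> 1" and g: "continuous_on UNIV (g :: real \<Rightarrow> real)"
  shows "integrable M (\<lambda>\<omega>. g \<bar>emp_process N t \<omega> - emp_process N s \<omega>\<bar>)"
proof -
  let ?B = "4 * real N / sqrt (real N)"
  have "compact (g ` {0..?B})" by (intro compact_continuous_image continuous_on_subset[OF g]) auto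
  then obtain C where C: "\<forall>y\<in>g ` {0..?B}. norm y \<le> C" using compact_imp_bounded bounded_iff by metis
  have [measurable]: "g \<in> borel_measurable borel" by (rule borel_measurable_continuous_onI[OF g])
  have [measurable]: "emp_process N t \<in> borel_measurable M" "emp_process N s \<in> borel_measurable M"
    using assms by measurable
  have b: "\<bar>emp_process N t \<omega> - emp_process N s \<omega>\<bar> \<le> ?B" for \<omega>
  proof -
    have "?B = 2 * real N / sqrt (real N) + 2 * real N / sqrt (real N)" by (simp add: field_simps)
    then show ?thesis using emp_process_bound[OF assms(1,2), of N \<omega>] emp_process_bound[OF assms(3,4), of N \<omega>] by linarith
  qed
  show ?thesis by (rule bounded_integrable[where B = C]) (use C b in auto)
qed

text \<open>
  Exponential moments control all moments, with the scale raised to the corresponding power.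
\<close>

lemma increment_moment:
  obtains D :: "nat \<Rightarrow> real" where "\<forall>q. 0 \<le> D q"
    "\<forall>N n s t q. 1 \<le> n \<longrightarrow> n ^ 6 \<le> N \<longrightarrow> 0 \<le> s \<longrightarrow> s \<le> t \<longrightarrow> t \<le> 1 \<longrightarrow>
     (\<integral>\<omega>. \<bar>emp_process N t \<omega> - emp_process N s \<omega>\<bar> ^ (2 * q) \<partial>M) \<le> D q * (t - s + real n powr (- d)) ^ q"
proof -
  obtain \<kappa> C where \<kappa>: "0 < \<kappa>" and C: "\<And>N n s t. 1 \<le> n \<Longrightarrow> n ^ 6 \<le> N \<Longrightarrow> 0 \<le> s \<Longrightarrow> s \<le> t \<Longrightarrow> t \<le> 1 \<Longrightarrow>
     (\<integral>\<omega>. exp (\<kappa> / sqrt (t - s + real n powr (- d)) * \<bar>emp_process N t \<omega> - emp_process N s \<omega>\<bar>) \<partial>M) \<le> C"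
    by (rule exp_increment) (use that in fast)
  show ?thesis
  proof (rule that[of "\<lambda>q. fact (2 * q) * \<bar>C\<bar> / \<kappa> ^ (2 * q)"], goal_cases)
    case 1
    then show ?case using \<kappa> by simp
  next
    case 2
    show ?case
    proof (intro allI impI)
    fix N n :: nat and s t :: real and q :: nat
    assume n: "1 \<le> n" "n ^ 6 \<le> N" and st: "0 \<le> s" "s \<le> t" "t \<le> 1"
    define \<sigma> where "\<sigma> = t - s + real n powr (- d)"
    have \<sigma>: "0 < \<sigma>" unfolding \<sigma>_def using n st by (intro add_nonneg_pos) auto
    let ?Y = "\<lambda>\<omega>. \<bar>emp_process N t \<omega> - emp_process N s \<omega>\<bar>"
    let ?e = "\<lambda>\<omega>. exp (\<kappa> / sqrt \<sigma> * ?Y \<omega>)"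
    have int1: "integrable M (\<lambda>\<omega>. ?Y \<omega> ^ (2 * q))"
      by (rule integrable_emp_increment[where g = "\<lambda>x. x ^ (2 * q)"]) (use st in \<open>auto intro!: continuous_intros\<close>)
    have int2: "integrable M ?e"
    proof (rule integrable_emp_increment[where g = "\<lambda>x. exp (\<kappa> / sqrt \<sigma> * x)"])
      show "continuous_on UNIV (\<lambda>x. exp (\<kappa> / sqrt \<sigma> * x))" by (intro continuous_intros)
    qed (use st in auto)
    define A where "A = fact (2 * q) * \<sigma> ^ q / \<kappa> ^ (2 * q)"
    have A: "0 \<le> A" using \<sigma> \<kappa> by (simp add: A_def)
    have "?Y \<omega> ^ (2 * q) \<le> A * ?e \<omega>" for \<omega>
    proof -
      have "(\<kappa> / sqrt \<sigma> * ?Y \<omega>) ^ (2 * q) \<le> fact (2 * q) * ?e \<omega>"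
        by (rule power_le_fact_exp) (use \<kappa> \<sigma> in simp)
      moreover have "(\<kappa> / sqrt \<sigma> * ?Y \<omega>) ^ (2 * q) = \<kappa> ^ (2 * q) / \<sigma> ^ q * ?Y \<omega> ^ (2 * q)"
        using \<sigma> by (simp add: power_mult_distrib power_divide power_mult)
      ultimately have "\<kappa> ^ (2 * q) / \<sigma> ^ q * ?Y \<omega> ^ (2 * q) \<le> fact (2 * q) * ?e \<omega>" by metis
      then show ?thesis using \<kappa> \<sigma> by (simp add: A_def field_simps)
    qed
    then have "(\<integral>\<omega>. ?Y \<omega> ^ (2 * q) \<partial>M) \<le> (\<integral>\<omega>. A * ?e \<omega> \<partial>M)"
      by (intro integral_mono int1 int2 integrable_mult_right)
    also have "\<dots> = A * (\<integral>\<omega>. ?e \<omega> \<partial>M)" by simp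
    also have "\<dots> \<le> A * \<bar>C\<bar>"
      using C[OF n st] unfolding \<sigma>_def[symmetric] by (intro mult_left_mono A) linarith
    also have "A * \<bar>C\<bar> = fact (2 * q) * \<bar>C\<bar> / \<kappa> ^ (2 * q) * \<sigma> ^ q" by (simp add: A_def)
    finally show "(\<integral>\<omega>. ?Y \<omega> ^ (2 * q) \<partial>M) \<le> fact (2 * q) * \<bar>C\<bar> / \<kappa> ^ (2 * q) * (t - s + real n powr (- d)) ^ q"
      unfolding \<sigma>_def .
    qed
  qed
qed

lemma second_moment_bound:
  obtains V where "0 \<le> V" "\<And>N t. t \<in> {0..1} \<Longrightarrow> (\<integral>\<omega>. (emp_process N t \<omega>)\<^sup>2 \<partial>M) \<le> V"
proof -
  obtain D where D: "\<forall>q. 0 \<le> D q" "\<forall>N n s t q. 1 \<le> n \<longrightarrow> n ^ 6 \<le> N \<longrightarrow> 0 \<le> s \<longrightarrow> s \<le> t \<longrightarrow> t \<le> 1 \<longrightarrow>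
     (\<integral>\<omega>. \<bar>emp_process N t \<omega> - emp_process N s \<omega>\<bar> ^ (2 * q) \<partial>M) \<le> D q * (t - s + real n powr (- d)) ^ q"
    by (rule increment_moment)
  show ?thesis
  proof (rule that[of "D 1 * 2"])
    show "0 \<le> D 1 * 2" using spec[OF D(1), of 1] by simp
    fix N and t :: real assume t: "t \<in> {0..1}"
    show "(\<integral>\<omega>. (emp_process N t \<omega>)\<^sup>2 \<partial>M) \<le> D 1 * 2"
    proof (cases "N = 0")
      case True then show ?thesis using spec[OF D(1), of 1] by (simp add: emp_process_zero)
    next
      case False
      have "(\<integral>\<omega>. \<bar>emp_process N t \<omega> - emp_process N 0 \<omega>\<bar> ^ (2 * 1) \<partial>M) \<le> D 1 * (t - 0 + real 1 powr (- d)) ^ 1"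
        by (rule D(2)[rule_format]) (use t False in auto)
      also have "\<dots> \<le> D 1 * 2" using t spec[OF D(1), of 1] by (intro mult_left_mono) auto
      finally show ?thesis by (simp add: emp_process_zero)
    qed
  qed
qed

text \<open>
  A high moment brings \<open>(t - s) + n powr - d\<close> down to \<open>4 ^ - j\<close> on level \<open>j\<close>, if \<open>n\<close> is a fixed
  power of \<open>2 ^ j\<close>. The choice \<open>n = 2 ^ ((j - l) div 3)\<close> meets the condition \<open>n ^ 6 \<le> N\<close> as
  long as \<open>4 ^ (j - l) \<le> N\<close>, that is, down to meshes of order \<open>1 / sqrt N\<close>.
\<close>

lemma dyadic_moment:
  obtains p where "1 \<le> p" "\<forall>l. \<exists>C\<ge>0. \<forall>N j i. l \<le> j \<longrightarrow> 4 ^ (j - l) \<le> N \<longrightarrow> i < (2::nat) ^ j \<longrightarrow>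
     (\<integral>\<omega>. \<bar>emp_process N ((real i + 1) / 2 ^ j) \<omega> - emp_process N (real i / 2 ^ j) \<omega>\<bar> ^ p \<partial>M) \<le> C / 4 ^ j"
proof -
  obtain D where D: "\<forall>q. 0 \<le> D q" "\<forall>N n s t q. 1 \<le> n \<longrightarrow> n ^ 6 \<le> N \<longrightarrow> 0 \<le> s \<longrightarrow> s \<le> t \<longrightarrow> t \<le> 1 \<longrightarrow>
     (\<integral>\<omega>. \<bar>emp_process N t \<omega> - emp_process N s \<omega>\<bar> ^ (2 * q) \<partial>M) \<le> D q * (t - s + real n powr (- d)) ^ q"
    by (rule increment_moment)
  (* On level j the scale is of order 2 powr (- d j / 3); the power q turns this into 4 ^ - j. *)
  define q where "q = nat \<lceil>6 / d\<rceil>"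
  have dq: "6 \<le> d * real q"
  proof -
    have "6 / d \<le> real q" unfolding q_def by (rule real_nat_ceiling_ge)
    then show ?thesis using d_pos by (simp add: field_simps)
  qed
  have q1: "1 \<le> q"
  proof (rule ccontr)
    assume "\<not> 1 \<le> q" then have "q = 0" by simp
    then show False using dq by simp
  qed
  show ?thesis
  proof (rule that[of "2 * q"], use q1 in simp, rule allI)
    fix l :: nat
    define A where "A = 1 + 2 powr (d * (real l + 2) / 3)"
    have A: "0 \<le> A" by (simp add: A_def add_nonneg_nonneg)
    show "\<exists>C\<ge>0. \<forall>N j i. l \<le> j \<longrightarrow> 4 ^ (j - l) \<le> N \<longrightarrow> i < (2::nat) ^ j \<longrightarrow>
     (\<integral>\<omega>. \<bar>emp_process N ((real i + 1) / 2 ^ j) \<omega> - emp_process N (real i / 2 ^ j) \<omega>\<bar> ^ (2 * q) \<partial>M) \<le> C / 4 ^ j"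
    proof (rule exI[of _ "D q * A ^ q"], intro conjI allI impI)
      show "0 \<le> D q * A ^ q" using D(1) A by simp
      fix N j i :: nat assume lj: "l \<le> j" and N: "4 ^ (j - l) \<le> N" and i: "i < 2 ^ j"
      define n :: nat where "n = 2 ^ ((j - l) div 3)"
      have n6: "n ^ 6 \<le> N"
      proof -
        have "(4::nat) ^ (j - l) = 2 ^ (2 * (j - l))" by (simp add: power_mult)
        moreover have "n ^ 6 = 2 ^ ((j - l) div 3 * 6)" by (simp add: n_def power_mult)
        moreover have "(j - l) div 3 * 6 \<le> 2 * (j - l)" by simp
        ultimately have "n ^ 6 \<le> 4 ^ (j - l)" using power_increasing[of "(j - l) div 3 * 6" "2 * (j - l)" "2::nat"] by simp
        then show ?thesis using N by linarith
      qed
      have ij: "real i + 1 \<le> 2 ^ j"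
      proof -
        have "real (Suc i) \<le> real (2 ^ j)" using i by (intro of_nat_mono) simp
        then show ?thesis by simp
      qed
      define E where "E = 2 powr (- (d * real j / 3))"
      have E: "0 \<le> E" by (simp add: E_def)
      have E1: "1 / 2 ^ j \<le> E"
      proof -
        have "1 / 2 ^ j = 2 powr (- real j)" by (simp add: powr_minus powr_realpow divide_inverse)
        also have "\<dots> \<le> E" unfolding E_def
        proof (rule powr_mono)
          have "d * real j \<le> 1 * real j" using d_le_1 by (rule mult_right_mono) simp
          then show "- real j \<le> - (d * real j / 3)" by simp
        qed simp
        finally show ?thesis .
      qed
      have E2: "real n powr (- d) \<le> 2 powr (d * (real l + 2) / 3) * E"
      proof -
        have "real n = 2 powr real ((j - l) div 3)" by (simp add: n_def powr_realpow)
        then have "real n powr (- d) = 2 powr (- (d * real ((j - l) div 3)))" by (simp add: powr_powr mult.commute)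
        also have "\<dots> \<le> 2 powr (d * (real l + 2) / 3 - d * real j / 3)"
        proof (rule powr_mono)
          have "j - l \<le> 3 * ((j - l) div 3) + 2" by presburger
          then have "real j - real l - 2 \<le> 3 * real ((j - l) div 3)" using lj by linarith
          then have "d * (real j - real l - 2) \<le> d * (3 * real ((j - l) div 3))" using d_pos by (intro mult_left_mono) auto
          then show "- (d * real ((j - l) div 3)) \<le> d * (real l + 2) / 3 - d * real j / 3" by (simp add: field_simps)
        qed simp
        also have "\<dots> = 2 powr (d * (real l + 2) / 3) * E" unfolding E_def by (subst powr_add[symmetric]) simp
        finally show ?thesis .
      qed
      have step: "(real i + 1) / 2 ^ j - real i / 2 ^ j = 1 / 2 ^ j" by (simp add: diff_divide_distrib[symmetric])
      have "(\<integral>\<omega>. \<bar>emp_process N ((real i + 1) / 2 ^ j) \<omega> - emp_process N (real i / 2 ^ j) \<omega>\<bar> ^ (2 * q) \<partial>M)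
          \<le> D q * ((real i + 1) / 2 ^ j - real i / 2 ^ j + real n powr (- d)) ^ q"
        by (rule D(2)[rule_format]) (use n6 ij in \<open>auto simp: n_def divide_right_mono\<close>)
      also have "\<dots> \<le> D q * (A * E) ^ q" unfolding step
      proof (intro mult_left_mono D(1)[rule_format] power_mono)
        have "A * E = E + 2 powr (d * (real l + 2) / 3) * E" by (simp add: A_def distrib_right)
        then show "1 / 2 ^ j + real n powr (- d) \<le> A * E" using E1 E2 by linarith
      qed simp
      also have "\<dots> \<le> D q * (A ^ q * (1 / 4 ^ j))" unfolding power_mult_distrib
      proof (intro mult_left_mono D(1)[rule_format] zero_le_power A)
        have "E ^ q = 2 powr (- (d * real q * real j / 3))" by (simp add: E_def powr_power mult.commute mult.left_commute)
        also have "\<dots> \<le> 2 powr (- (2 * real j))"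
        proof (rule powr_mono)
          have "6 * real j \<le> d * real q * real j" using dq by (rule mult_right_mono) simp
          then show "- (d * real q * real j / 3) \<le> - (2 * real j)" by simp
        qed simp
        also have "2 powr (- (2 * real j)) = 1 / (2 powr 2) powr real j" by (simp only: powr_minus powr_powr divide_inverse mult_1)
        also have "\<dots> = 1 / 4 ^ j" by (simp add: powr_realpow)
        finally show "E ^ q \<le> 1 / 4 ^ j" .
      qed
      finally show "(\<integral>\<omega>. \<bar>emp_process N ((real i + 1) / 2 ^ j) \<omega> - emp_process N (real i / 2 ^ j) \<omega>\<bar> ^ (2 * q) \<partial>M) \<le> D q * A ^ q / 4 ^ j"
        by simp
    qed
  qed
qed

text \<open>
  The empirical distribution function is monotone, so between two grid points the process moves by
  at most the increment over the cell plus the drift.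
\<close>

lemma emp_process_between:
  assumes "a \<le> t" "t \<le> b"
  shows "\<bar>emp_process N t \<omega> - emp_process N a \<omega>\<bar> \<le> \<bar>emp_process N b \<omega> - emp_process N a \<omega>\<bar> + sqrt (real N) * (b - a)"
proof -
  define R F where "R = sqrt (real N)" and "F t = R * empirical_df X N t \<omega>" for t
  have R: "0 \<le> R" by (simp add: R_def)
  have Y: "emp_process N t \<omega> = F t - R * t" for t by (simp add: emp_process_def F_def R_def right_diff_distrib)
  have "F a \<le> F t" "F t \<le> F b" unfolding F_def using assms by (auto intro!: mult_left_mono empirical_df_mono R)
  moreover have "R * a \<le> R * t" "R * t \<le> R * b" using assms R by (auto intro: mult_left_mono)
  moreover have "sqrt (real N) * (b - a) = R * b - R * a" by (simp add: R_def right_diff_distrib)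
  ultimately show ?thesis unfolding Y by linarith
qed

text \<open>
  Chaining works on the levels from \<open>m\<close> to \<open>L\<close>, where the moment bound is available. The last
  mesh \<open>2 ^ - L\<close> is a small multiple of \<open>1 / sqrt N\<close>, and there monotonicity takes over: the
  drift over a cell is at most \<open>sqrt N / 2 ^ L\<close>, which \<open>l\<close> makes small.
\<close>

theorem emp_process_oscillation:
  assumes \<epsilon>: "0 < \<epsilon>" and \<eta>: "0 < \<eta>"
  shows "\<forall>\<^sub>F m in sequentially. \<forall>\<^sub>F N in sequentially. \<exists>A\<in>sets M. measure M A \<le> \<eta> \<and>
     (\<forall>\<omega>\<in>space M - A. \<forall>t\<in>{0..1}. \<bar>emp_process N t \<omega> - emp_process N (real (dyadic_cell m t) / 2 ^ m) \<omega>\<bar> \<le> \<epsilon>)"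
proof -
  obtain p where p1: "1 \<le> p" and mom: "\<forall>l. \<exists>C\<ge>0. \<forall>N j i. l \<le> j \<longrightarrow> 4 ^ (j - l) \<le> N \<longrightarrow> i < (2::nat) ^ j \<longrightarrow>
     (\<integral>\<omega>. \<bar>emp_process N ((real i + 1) / 2 ^ j) \<omega> - emp_process N (real i / 2 ^ j) \<omega>\<bar> ^ p \<partial>M) \<le> C / 4 ^ j"
    by (rule dyadic_moment)
  (* With r ^ p = 3 / 4 the exceedance probabilities are of order (2 / 3) ^ j. *)
  define r :: real where "r = (3 / 4) powr (1 / real p)"
  have r: "0 < r" "r < 1" "r ^ p = 3 / 4"
  proof -
    show "0 < r" by (simp add: r_def)
    show "r ^ p = 3 / 4" using p1 by (simp add: r_def powr_power)
    then show "r < 1" using one_le_power[of r p] by linarith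
  qed
  have lim_pow: "\<forall>\<^sub>F m in sequentially. c * x ^ m < e" if "0 < e" "0 \<le> x" "x < 1" for c x e :: real
  proof (rule order_tendstoD(2)[OF _ that(1)])
    show "(\<lambda>m. c * x ^ m) \<longlonglongrightarrow> 0" using tendsto_mult_left[OF LIMSEQ_power_zero[of x], of c] that by simp
  qed
  obtain l where l: "2 * (1 / 2) ^ l < \<epsilon> / 2"
    using lim_pow[of "\<epsilon> / 2" "1 / 2" 2] \<epsilon> by (auto simp: eventually_sequentially)
  obtain C where C0: "0 \<le> C" and C: "\<And>N j i. l \<le> j \<Longrightarrow> 4 ^ (j - l) \<le> N \<Longrightarrow> i < (2::nat) ^ j \<Longrightarrow>
     (\<integral>\<omega>. \<bar>emp_process N ((real i + 1) / 2 ^ j) \<omega> - emp_process N (real i / 2 ^ j) \<omega>\<bar> ^ p \<partial>M) \<le> C / 4 ^ j"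
    using spec[OF mom, of l] by blast
  have "\<forall>\<^sub>F m in sequentially. 2 * C * (2 / 3) ^ m < \<eta> \<and> (1 / (1 - r) + 1) * r ^ m < \<epsilon> / 2 \<and> l \<le> m"
    using \<epsilon> \<eta> r by (intro eventually_conj lim_pow eventually_ge_at_top) auto
  then show ?thesis
  proof (rule eventually_mono)
    fix m assume m: "2 * C * (2 / 3) ^ m < \<eta> \<and> (1 / (1 - r) + 1) * r ^ m < \<epsilon> / 2 \<and> l \<le> m"
    show "\<forall>\<^sub>F N in sequentially. \<exists>A\<in>sets M. measure M A \<le> \<eta> \<and>
     (\<forall>\<omega>\<in>space M - A. \<forall>t\<in>{0..1}. \<bar>emp_process N t \<omega> - emp_process N (real (dyadic_cell m t) / 2 ^ m) \<omega>\<bar> \<le> \<epsilon>)"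
      using eventually_ge_at_top[of "4 ^ Suc m"]
    proof (rule eventually_mono)
      fix N :: nat assume N: "4 ^ Suc m \<le> N"
      have "1 \<le> N" using N one_le_power[of "4::nat" "Suc m"] by linarith
      then obtain k where k: "4 ^ k \<le> N" "N < 4 ^ (k + 1)" using ex_power_ivl1[of 4 N] by auto
      have "(4::nat) ^ Suc m < 4 ^ (k + 1)" using N k by linarith
      then have "m < k" using power_less_imp_less_exp[of "4::nat" "Suc m" "k + 1"] by simp
      (* The finest level with 4 ^ (L - l) <= N. *)
      define L where "L = k + l"
      have mL: "m < L" using \<open>m < k\<close> by (simp add: L_def)
      have Lev: "4 ^ (j - l) \<le> N" if "j \<le> L" for j
      proof -
        have "(4::nat) ^ (j - l) \<le> 4 ^ k" using that by (intro power_increasing) (auto simp: L_def)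
        then show ?thesis using k by linarith
      qed
      have mesh: "sqrt (real N) * (1 / 2 ^ L) \<le> 2 * (1 / 2) ^ l"
      proof -
        have "real N \<le> (2 ^ (k + 1))\<^sup>2"
        proof -
          have "real N \<le> real (4 ^ (k + 1))" using k by (intro of_nat_mono) simp
          also have "\<dots> = (2 ^ (k + 1))\<^sup>2" by (simp add: power2_eq_square flip: power_mult_distrib)
          finally show ?thesis .
        qed
        then have "sqrt (real N) \<le> 2 ^ (k + 1)" by (intro real_le_lsqrt) auto
        then have "sqrt (real N) * (1 / 2 ^ L) \<le> 2 ^ (k + 1) * (1 / 2 ^ L)" by (rule mult_right_mono) simp
        also have "\<dots> = 2 * (1 / 2) ^ l" by (simp add: L_def power_add power_one_over field_simps)
        finally show ?thesis .
      qed
      let ?Y = "\<lambda>j i \<omega>. emp_process N ((real i + 1) / 2 ^ j) \<omega> - emp_process N (real i / 2 ^ j) \<omega>"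
      define bad where "bad j = {\<omega> \<in> space M. \<exists>i\<in>{..<2 ^ j}. r ^ j < \<bar>?Y j i \<omega>\<bar>}" for j
      have bad: "measure M (bad j) \<le> C * (2 / 3) ^ j" "bad j \<in> sets M" if j: "m < j" "j \<le> L" for j
      proof -
        have b: "0 \<le> real i / 2 ^ j" "real i / 2 ^ j \<le> 1" "0 \<le> (real i + 1) / 2 ^ j" "(real i + 1) / 2 ^ j \<le> 1" if "i < 2 ^ j" for i
        proof -
          have "real (Suc i) \<le> real (2 ^ j)" using that by (intro of_nat_mono) simp
          then show "0 \<le> real i / 2 ^ j" "real i / 2 ^ j \<le> 1" "0 \<le> (real i + 1) / 2 ^ j" "(real i + 1) / 2 ^ j \<le> 1" using that by auto
        qed
        have lj: "l \<le> j" using m j by simp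
        have me: "?Y j i \<in> borel_measurable M" if "i < 2 ^ j" for i
          by (intro borel_measurable_diff emp_process_measurable b that)
        have i: "integrable M (\<lambda>\<omega>. \<bar>?Y j i \<omega>\<bar> ^ p)" if "i < 2 ^ j" for i
          by (rule integrable_emp_increment[where g = "\<lambda>x. x ^ p"]) (use b[OF that] in \<open>auto intro!: continuous_intros\<close>)
        have "measure M (bad j) \<le> C * (1 / (2 * r ^ p)) ^ j"
          unfolding bad_def by (rule level_exceedance(1)[OF prob_space_axioms me i C[OF lj Lev[OF j(2)]] r(1)])
        then show "measure M (bad j) \<le> C * (2 / 3) ^ j" by (simp add: r(3))
        show "bad j \<in> sets M"
          unfolding bad_def by (rule level_exceedance(2)[OF prob_space_axioms me i C[OF lj Lev[OF j(2)]] r(1)])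
      qed
      define A where "A = (\<Union>j\<in>{m<..L}. bad j)"
      show "\<exists>A\<in>sets M. measure M A \<le> \<eta> \<and>
         (\<forall>\<omega>\<in>space M - A. \<forall>t\<in>{0..1}. \<bar>emp_process N t \<omega> - emp_process N (real (dyadic_cell m t) / 2 ^ m) \<omega>\<bar> \<le> \<epsilon>)"
      proof (rule bexI[of _ A], intro conjI ballI)
        show "A \<in> sets M" unfolding A_def using bad(2) by (intro sets.finite_UN) auto
        have "measure M A \<le> (\<Sum>j\<in>{m<..L}. measure M (bad j))"
          unfolding A_def using bad(2) by (intro measure_UNION_le) auto
        also have "\<dots> \<le> (\<Sum>j\<in>{m<..L}. C * (2 / 3) ^ j)" using bad(1) by (intro sum_mono) auto
        also have "\<dots> = C * (\<Sum>j\<in>{m<..L}. (2 / 3) ^ j)" by (simp add: sum_distrib_left)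
        also have "\<dots> \<le> C * (2 * (2 / 3) ^ m)"
        proof (intro mult_left_mono C0)
          have "(\<Sum>j\<in>{m<..m + k'}. (2 / 3 :: real) ^ j) = 2 * (2 / 3) ^ m - 2 * (2 / 3) ^ (m + k')" for k'
          proof (induction k')
            case (Suc k')
            have "{m<..m + Suc k'} = insert (m + Suc k') {m<..m + k'}" by auto
            then show ?case using Suc by simp
          qed simp
          from this[of "L - m"] show "(\<Sum>j\<in>{m<..L}. (2 / 3 :: real) ^ j) \<le> 2 * (2 / 3) ^ m" using mL by simp
        qed
        also have "\<dots> \<le> \<eta>" using m by simp
        finally show "measure M A \<le> \<eta>" .
        fix \<omega> t assume \<omega>: "\<omega> \<in> space M - A" and t: "t \<in> {0..1::real}"
        have good: "\<bar>?Y j i \<omega>\<bar> \<le> r ^ j" if "m < j" "j \<le> L" "i < 2 ^ j" for j i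
          using \<omega> that by (force simp: A_def bad_def not_less)
        have "\<bar>emp_process N (real (dyadic_cell (m + (L - m)) t) / 2 ^ (m + (L - m))) \<omega> - emp_process N (real (dyadic_cell m t) / 2 ^ m) \<omega>\<bar> \<le> r ^ m / (1 - r)"
          by (rule dyadic_chain[OF r(1,2) t, where z = "\<lambda>t. emp_process N t \<omega>"]) (use good mL in auto)
        then have 1: "\<bar>emp_process N (real (dyadic_cell L t) / 2 ^ L) \<omega> - emp_process N (real (dyadic_cell m t) / 2 ^ m) \<omega>\<bar> \<le> r ^ m / (1 - r)"
          using mL by simp
        have "\<bar>emp_process N t \<omega> - emp_process N (real (dyadic_cell L t) / 2 ^ L) \<omega>\<bar>
            \<le> \<bar>?Y L (dyadic_cell L t) \<omega>\<bar> + sqrt (real N) * ((real (dyadic_cell L t) + 1) / 2 ^ L - real (dyadic_cell L t) / 2 ^ L)"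
          using t by (intro emp_process_between dyadic_cell_bounds) auto
        moreover have "(real (dyadic_cell L t) + 1) / 2 ^ L - real (dyadic_cell L t) / 2 ^ L = 1 / 2 ^ L" by (simp add: diff_divide_distrib[symmetric])
        ultimately have 2: "\<bar>emp_process N t \<omega> - emp_process N (real (dyadic_cell L t) / 2 ^ L) \<omega>\<bar>
            \<le> \<bar>?Y L (dyadic_cell L t) \<omega>\<bar> + sqrt (real N) * (1 / 2 ^ L)" by (simp only:)
        have 3: "\<bar>?Y L (dyadic_cell L t) \<omega>\<bar> \<le> r ^ L" using t mL by (intro good dyadic_cell_less) auto
        have 4: "r ^ L \<le> r ^ m" using mL r by (intro power_decreasing) auto
        have 5: "r ^ m / (1 - r) + r ^ m < \<epsilon> / 2" using m by (simp add: distrib_right)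
        show "\<bar>emp_process N t \<omega> - emp_process N (real (dyadic_cell m t) / 2 ^ m) \<omega>\<bar> \<le> \<epsilon>"
        proof -
          have "\<bar>x - z\<bar> \<le> e" if "\<bar>y - z\<bar> \<le> c" "\<bar>x - y\<bar> \<le> w + s" "w \<le> u" "u \<le> v" "c + v < e / 2" "s \<le> h" "h < e / 2"
            for x y z c w s u v h e :: real
          proof -
            have "c + v + h < e" using that(5,7) by (simp add: field_simps)
            then show ?thesis using that(1-4,6) by linarith
          qed
          from this[OF 1 2 3 4 5 mesh l] show ?thesis .
        qed
      qed
    qed
  qed
qed

end

section \<open>Gaussian processes from characteristic functions\<close>

text \<open>
  Every linear combination has the characteristic function of a centred normal law. The covariance
  is obtained from the variances of the values and of their sum.
\<close>

lemma gaussian_process_of_char: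
  fixes K :: "real \<Rightarrow> 'b \<Rightarrow> real" and G :: "real \<Rightarrow> real \<Rightarrow> real"
  assumes P: "prob_space P" and Km: "\<And>t. t \<in> T \<Longrightarrow> K t \<in> borel_measurable P"
    and sym: "\<And>s t. s \<in> T \<Longrightarrow> t \<in> T \<Longrightarrow> G s t = G t s"
    and psd: "\<And>(I :: nat set) c t. finite I \<Longrightarrow> (\<And>i. i \<in> I \<Longrightarrow> t i \<in> T) \<Longrightarrow>
        0 \<le> (\<Sum>i\<in>I. \<Sum>j\<in>I. c i * c j * G (t i) (t j))"
    and char: "\<And>(I :: nat set) c t. finite I \<Longrightarrow> (\<And>i. i \<in> I \<Longrightarrow> t i \<in> T) \<Longrightarrow>
       (\<integral>\<omega>. cis (\<Sum>i\<in>I. c i * K (t i) \<omega>) \<partial>P) =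
       of_real (exp (- (\<Sum>i\<in>I. \<Sum>j\<in>I. c i * c j * G (t i) (t j)) / 2))"
  shows "gaussian_process P T K"
    and "\<And>t. t \<in> T \<Longrightarrow> (\<integral>\<omega>. K t \<omega> \<partial>P) = 0"
    and "\<And>t. t \<in> T \<Longrightarrow> integrable P (\<lambda>\<omega>. (K t \<omega>)\<^sup>2)" "\<And>t. t \<in> T \<Longrightarrow> (\<integral>\<omega>. (K t \<omega>)\<^sup>2 \<partial>P) = G t t"
    and "\<And>s t. s \<in> T \<Longrightarrow> t \<in> T \<Longrightarrow> covariance P (K s) (K t) = G s t"
proof -
  define W where "W I c t \<omega> = (\<Sum>i\<in>I. c i * K (t i) \<omega>)" for I :: "nat set" and c t \<omega>
  define Q where "Q I c t = (\<Sum>i\<in>I. \<Sum>j\<in>I. c i * c j * G (t i) (t j))" for I :: "nat set" and c t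
  have Wm: "W I c t \<in> borel_measurable P" if "\<And>i. i \<in> I \<Longrightarrow> t i \<in> T" for I c t
    unfolding W_def[abs_def] by (intro borel_measurable_sum borel_measurable_times borel_measurable_const Km that)
  have Q0: "0 \<le> Q I c t" if "finite I" "\<And>i. i \<in> I \<Longrightarrow> t i \<in> T" for I c t
    unfolding Q_def by (rule psd[OF that])
  have Wc: "(\<integral>\<omega>. cis (\<theta> * W I c t \<omega>) \<partial>P) = of_real (exp (- (\<theta>\<^sup>2 * Q I c t) / 2))"
    if "finite I" "\<And>i. i \<in> I \<Longrightarrow> t i \<in> T" for I c t \<theta>
  proof -
    have "\<theta> * W I c t \<omega> = (\<Sum>i\<in>I. (\<theta> * c i) * K (t i) \<omega>)" for \<omega>
      unfolding W_def sum_distrib_left by (simp only: mult.assoc)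
    moreover have "\<theta>\<^sup>2 * Q I c t = (\<Sum>i\<in>I. \<Sum>j\<in>I. (\<theta> * c i) * (\<theta> * c j) * G (t i) (t j))"
      unfolding Q_def sum_distrib_left by (simp only: power2_eq_square mult_ac)
    ultimately show ?thesis using char[OF that, where c = "\<lambda>i. \<theta> * c i"] by simp
  qed
  have law: "normal_law (distr P borel (W I c t))" if "finite I" "\<And>i. i \<in> I \<Longrightarrow> t i \<in> T" for I c t
    using centered_normal_law[OF P Wm[OF that(2)] Q0[OF that] Wc[OF that]] normal_law_scaled_std_normal[OF Q0[OF that]]
    by simp
  have mom: "integrable P (\<lambda>\<omega>. W I c t \<omega> ^ k)" "(\<integral>\<omega>. W I c t \<omega> \<partial>P) = 0" "(\<integral>\<omega>. (W I c t \<omega>)\<^sup>2 \<partial>P) = Q I c t"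
    if "finite I" "\<And>i. i \<in> I \<Longrightarrow> t i \<in> T" for I c t k
  proof -
    note m = centered_normal_moments[where W = "W I c t" and Q = "Q I c t", OF P Wm[OF that(2)] Q0[OF that] Wc[OF that]]
    show "integrable P (\<lambda>\<omega>. W I c t \<omega> ^ k)" by (rule m(1))
    show "(\<integral>\<omega>. W I c t \<omega> \<partial>P) = 0" by (rule m(2))
    show "(\<integral>\<omega>. (W I c t \<omega>)\<^sup>2 \<partial>P) = Q I c t" by (rule m(3))
  qed
  have one: "W {0} (\<lambda>_. 1) (\<lambda>_. t) = K t" "Q {0} (\<lambda>_. 1) (\<lambda>_. t) = G t t" for t
    by (simp_all add: W_def[abs_def] Q_def)
  have K1: "integrable P (\<lambda>\<omega>. K t \<omega> ^ k)" "(\<integral>\<omega>. K t \<omega> \<partial>P) = 0" "(\<integral>\<omega>. (K t \<omega>)\<^sup>2 \<partial>P) = G t t" if t: "t \<in> T" for t k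
  proof -
    show "integrable P (\<lambda>\<omega>. K t \<omega> ^ k)"
      using mom(1)[where I = "{0}" and c = "\<lambda>_. 1" and t = "\<lambda>_. t"] t unfolding one by simp
    show "(\<integral>\<omega>. K t \<omega> \<partial>P) = 0"
      using mom(2)[where I = "{0}" and c = "\<lambda>_. 1" and t = "\<lambda>_. t"] t unfolding one by simp
    show "(\<integral>\<omega>. (K t \<omega>)\<^sup>2 \<partial>P) = G t t"
      using mom(3)[where I = "{0}" and c = "\<lambda>_. 1" and t = "\<lambda>_. t"] t unfolding one by simp
  qed
  show "\<And>t. t \<in> T \<Longrightarrow> (\<integral>\<omega>. K t \<omega> \<partial>P) = 0" "\<And>t. t \<in> T \<Longrightarrow> integrable P (\<lambda>\<omega>. (K t \<omega>)\<^sup>2)"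
    "\<And>t. t \<in> T \<Longrightarrow> (\<integral>\<omega>. (K t \<omega>)\<^sup>2 \<partial>P) = G t t" using K1 by auto
  show "gaussian_process P T K"
    unfolding gaussian_process_def
  proof (intro conjI ballI allI impI)
    show "t \<in> T \<Longrightarrow> K t \<in> borel_measurable P" for t by (rule Km)
    fix I :: "real set" and c assume I: "finite I \<and> I \<subseteq> T"
    then obtain e where e: "bij_betw e {0..<card I} I" using ex_bij_betw_nat_finite by blast
    have eT: "e i \<in> T" if "i \<in> {0..<card I}" for i using bij_betwE[OF e] that I by blast
    have "W {0..<card I} (\<lambda>i. c (e i)) e \<omega> = (\<Sum>t\<in>I. c t * K t \<omega>)" for \<omega>
      unfolding W_def by (rule sum.reindex_bij_betw[OF e])
    then have "W {0..<card I} (\<lambda>i. c (e i)) e = (\<lambda>\<omega>. \<Sum>t\<in>I. c t * K t \<omega>)" by (rule ext)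
    then show "normal_law (distr P borel (\<lambda>\<omega>. \<Sum>t\<in>I. c t * K t \<omega>))"
      using law[where I = "{0..<card I}" and t = e and c = "\<lambda>i. c (e i)", OF finite_atLeastLessThan eT] by (simp only:)
  qed
  fix s t assume st: "s \<in> T" "t \<in> T"
  let ?t = "\<lambda>i::nat. if i = 0 then s else t"
  have 2: "finite {0::nat, 1}" "\<And>i::nat. i \<in> {0, 1} \<Longrightarrow> ?t i \<in> T" using st by auto
  have two: "(\<Sum>i\<in>{0, 1::nat}. f i) = f 0 + f 1" for f :: "nat \<Rightarrow> real" by simp
  have W2: "W {0, 1} (\<lambda>_. 1) ?t = (\<lambda>\<omega>. K s \<omega> + K t \<omega>)" by (simp add: W_def[abs_def])
  have Q2: "Q {0, 1} (\<lambda>_. 1) ?t = G s s + 2 * G s t + G t t"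
    unfolding Q_def two using sym[OF st] by simp
  have mi: "integrable P (\<lambda>\<omega>. (K s \<omega> + K t \<omega>)\<^sup>2)"
    using mom(1)[where c = "\<lambda>_. 1" and t = ?t and k = 2, OF 2] unfolding W2 .
  have m3: "(\<integral>\<omega>. (K s \<omega> + K t \<omega>)\<^sup>2 \<partial>P) = G s s + 2 * G s t + G t t"
    using mom(3)[where c = "\<lambda>_. 1" and t = ?t, OF 2] unfolding W2 Q2 .
  have "covariance P (K s) (K t) = (\<integral>\<omega>. K s \<omega> * K t \<omega> \<partial>P)" using K1(2) st by (simp add: covariance_def)
  also have "(\<lambda>\<omega>. K s \<omega> * K t \<omega>) = (\<lambda>\<omega>. (1 / 2) * ((K s \<omega> + K t \<omega>)\<^sup>2 - (K s \<omega>)\<^sup>2 - (K t \<omega>)\<^sup>2))"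
    by (rule ext) (simp add: power2_eq_square algebra_simps)
  also have "(\<integral>\<omega>. (1 / 2) * ((K s \<omega> + K t \<omega>)\<^sup>2 - (K s \<omega>)\<^sup>2 - (K t \<omega>)\<^sup>2) \<partial>P) =
      (1 / 2) * ((\<integral>\<omega>. (K s \<omega> + K t \<omega>)\<^sup>2 \<partial>P) - (\<integral>\<omega>. (K s \<omega>)\<^sup>2 \<partial>P) - (\<integral>\<omega>. (K t \<omega>)\<^sup>2 \<partial>P))"
    using mi K1(1)[OF st(1), of 2] K1(1)[OF st(2), of 2] by simp
  also have "\<dots> = G s t" unfolding m3 K1(3)[OF st(1)] K1(3)[OF st(2)] by simp
  finally show "covariance P (K s) (K t) = G s t" .
qed

section \<open>Weak convergence of the empirical process\<close>

context mixing_walk begin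

lemma path01_emp_process:
  "path01 (emp_process N) \<omega> = jump_path N (1 / sqrt (real N)) (- sqrt (real N)) (\<lambda>i. frac (S (Suc i) \<omega>))"
  unfolding path01_def jump_path_def
proof (rule restrict_ext)
  fix t :: real assume t: "t \<in> {0..1}"
  have "real N / sqrt (real N) = sqrt (real N)" by (cases "N = 0") (simp_all add: real_div_sqrt)
  then have "real N * t / sqrt (real N) = sqrt (real N) * t" by (metis times_divide_eq_left)
  then show "emp_process N t \<omega> = 1 / sqrt (real N) * (\<Sum>i<N. indicator {0..<t} (frac (S (Suc i) \<omega>))) + - sqrt (real N) * t"
    using t by (simp add: emp_process_eq cind_eq sum_subtractf diff_divide_distrib)
qed

lemma measurable_emp_path: "path01 (emp_process N) \<in> measurable M J1_borel"
proof -
  have "(\<lambda>\<omega>. jump_path N (1 / sqrt (real N)) (- sqrt (real N)) (\<lambda>i. frac (S (Suc i) \<omega>))) \<in> measurable M J1_borel"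
    by (rule measurable_jump_path) (auto simp: frac_ge_0 frac_lt_1)
  then show ?thesis unfolding path01_emp_process[symmetric] .
qed

text \<open>
  For Lipschitz test functions both processes may be replaced by their step paths of level \<open>m\<close>:
  for the empirical process by the oscillation estimate, for the limit by continuity. On step paths
  the test function depends on \<open>2 ^ m\<close> coordinates only, and their joint law converges.
\<close>

theorem emp_process_converges:
  assumes P: "prob_space P"
    and Km: "\<And>t. t \<in> {0..1} \<Longrightarrow> K t \<in> borel_measurable P"
    and Kc: "\<And>\<omega>. continuous_on {0..1} (\<lambda>t. K t \<omega>)"
    and char: "\<And>(I :: nat set) c t. finite I \<Longrightarrow> (\<And>i. i \<in> I \<Longrightarrow> t i \<in> {0..1}) \<Longrightarrow>
       (\<integral>\<omega>. cis (\<Sum>i\<in>I. c i * K (t i) \<omega>) \<partial>P) =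
       of_real (exp (- (\<Sum>i\<in>I. \<Sum>j\<in>I. c i * c j * Gamma_cov M X (t i) (t j)) / 2))"
    and K2: "\<And>t. t \<in> {0..1} \<Longrightarrow> integrable P (\<lambda>\<omega>. (K t \<omega>)\<^sup>2)"
      "\<And>t. t \<in> {0..1} \<Longrightarrow> (\<integral>\<omega>. (K t \<omega>)\<^sup>2 \<partial>P) = Gamma_cov M X t t"
  shows "converges_weakly_D01 M emp_process P K"
proof -
  interpret P: prob_space P by (rule P)
  obtain V0 where V0: "0 \<le> V0" "\<And>N t. t \<in> {0..1} \<Longrightarrow> (\<integral>\<omega>. (emp_process N t \<omega>)\<^sup>2 \<partial>M) \<le> V0"
    by (rule second_moment_bound) (use that in fast)
  have Gbd: "\<exists>B. \<forall>t\<in>{0..1}. Gamma_cov M X t t \<le> B"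
  proof -
    have "continuous_on {0..1} (\<lambda>t. (\<lambda>(s, t). Gamma_cov M X s t) (t, t))"
      by (rule continuous_on_compose2[OF continuous_Gamma_cov]) (auto intro!: continuous_intros)
    then have "compact ((\<lambda>t. Gamma_cov M X t t) ` {0..1})" by (intro compact_continuous_image) auto
    then have "bdd_above ((\<lambda>t. Gamma_cov M X t t) ` {0..1})" by (intro bounded_imp_bdd_above compact_imp_bounded)
    then show ?thesis by (auto simp: bdd_above_def)
  qed
  then obtain B1 where B1: "\<forall>t\<in>{0..1}. Gamma_cov M X t t \<le> B1" by blast
  define V where "V = max V0 B1"
  define A where "A m x = (\<lambda>t\<in>{0..1}. x (real (dyadic_cell m t) / 2 ^ m) :: real)" for m and x :: "real \<Rightarrow> real"
  (* Grid points for all indices; those beyond 2 ^ m are cut off at 1. *)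
  define g where "g m i = min 1 (real i / 2 ^ m)" for m i :: nat
  have g01: "g m i \<in> {0..1}" for m i by (simp add: g_def)
  have Ag: "A m x = (\<lambda>t\<in>{0..1}. x (g m (dyadic_cell m t)))" for m x
    unfolding A_def
  proof (rule restrict_ext)
    fix t :: real assume "t \<in> {0..1}"
    then have "real (dyadic_cell m t) / 2 ^ m \<le> 1" using dyadic_cell_grid_mem[of t m] by simp
    then show "x (real (dyadic_cell m t) / 2 ^ m) = x (g m (dyadic_cell m t))" by (simp add: g_def min_absorb2)
  qed
  have Ymeas: "path01 (emp_process N) \<in> measurable M J1_borel" for N by (rule measurable_emp_path)
  have Kmeas: "path01 K \<in> measurable P J1_borel"
    unfolding path01_def[abs_def] by (rule measurable_continuous_path[OF Km Kc])
  have em: "emp_process N (g m i) \<in> borel_measurable M" for N m i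
    by (rule emp_process_measurable) (use g01[of m i] in auto)
  have AYmeas: "(\<lambda>\<omega>. A m (\<lambda>t. emp_process N t \<omega>)) \<in> measurable M J1_borel" for N m
    unfolding Ag by (rule measurable_step_path[where Y = "\<lambda>i. emp_process N (g m i)"]) (rule em)
  have AKmeas: "(\<lambda>\<omega>. A m (\<lambda>t. K t \<omega>)) \<in> measurable P J1_borel" for m
    unfolding Ag by (rule measurable_step_path[where Y = "\<lambda>i. K (g m i)"]) (rule Km[OF g01])
  have AD: "A m x \<in> D01" for m x
    unfolding Ag by (rule restrict_lcrl_D01) (rule lcrl_dyadic_cell)
  show ?thesis
    unfolding converges_weakly_D01_def
  proof (intro conjI allI impI Ymeas Kmeas)
    fix h0 :: "(real \<Rightarrow> real) \<Rightarrow> real"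
    assume h0: "continuous_map J1_topology euclideanreal h0 \<and> bounded (h0 ` D01)"
    then obtain B0 where B0: "\<forall>x\<in>D01. \<bar>h0 x\<bar> \<le> B0" by (auto simp: bounded_iff)
    show "(\<lambda>N. \<integral>\<omega>. h0 (path01 (emp_process N) \<omega>) \<partial>M) \<longlonglongrightarrow> (\<integral>\<omega>. h0 (path01 K \<omega>) \<partial>P)"
    proof (rule weak_limit_lipschitz_test[OF prob_space_axioms P Ymeas Kmeas _ conjunct1[OF h0] B0])
      fix L B and h :: "(real \<Rightarrow> real) \<Rightarrow> real"
      assume h: "J1_lipschitz L h" and B: "\<forall>x\<in>D01. \<bar>h x\<bar> \<le> B"
      have L0: "0 \<le> L" and hL: "\<And>x y. x \<in> D01 \<Longrightarrow> y \<in> D01 \<Longrightarrow> \<bar>h x - h y\<bar> \<le> L * J1_dist x y"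
        using h by (auto simp: J1_lipschitz_def)
      have hm: "h \<in> borel_measurable J1_borel"
        by (rule J1_continuous_measurable[OF J1_lipschitz_continuous[OF h]])
      have B00: "0 \<le> B" using B AD[of 0 "\<lambda>_. 0"] abs_ge_zero order_trans by blast
      have hpm: "(\<lambda>\<omega>. h (f \<omega>)) \<in> borel_measurable R" if "f \<in> measurable R J1_borel" for f and R :: "'c measure"
        using measurable_comp[OF that hm] by (simp add: comp_def)
      have pD: "f \<omega> \<in> D01" if "f \<in> measurable R J1_borel" "\<omega> \<in> space R" for f \<omega> and R :: "'c measure"
        using measurable_space[OF that] by simp
      define IY where "IY N = (\<integral>\<omega>. h (path01 (emp_process N) \<omega>) \<partial>M)" for N
      define IA where "IA m N = (\<integral>\<omega>. h (A m (\<lambda>t. emp_process N t \<omega>)) \<partial>M)" for m N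
      define JA where "JA m = (\<integral>\<omega>. h (A m (\<lambda>t. K t \<omega>)) \<partial>P)" for m
      define JK where "JK = (\<integral>\<omega>. h (path01 K \<omega>) \<partial>P)"
      have fdd: "(\<lambda>N. IA m N) \<longlonglongrightarrow> JA m" for m
      proof -
        let ?H = "\<lambda>z. h (\<lambda>t\<in>{0..1}. z (dyadic_cell m t))"
        have HD: "(\<lambda>t\<in>{0..1}. z (dyadic_cell m t)) \<in> D01" for z :: "nat \<Rightarrow> real"
          by (rule restrict_lcrl_D01) (rule lcrl_dyadic_cell)
        have "(\<lambda>N. \<integral>\<omega>. ?H (\<lambda>i. emp_process N (g m i) \<omega>) \<partial>M) \<longlonglongrightarrow> (\<integral>\<omega>. ?H (\<lambda>i. K (g m i) \<omega>) \<partial>P)"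
        proof (rule finite_dim_limit[where Z = "\<lambda>N i. emp_process N (g m i)" and K = "\<lambda>i. K (g m i)" and H = ?H
              and V = V and L = L and q = "2 ^ m" and B = B, OF prob_space_axioms P])
          show "emp_process N (g m i) \<in> borel_measurable M" for N i by (rule em)
          show "K (g m i) \<in> borel_measurable P" for i by (rule Km[OF g01])
          show "(\<lambda>N. \<integral>\<omega>. cis (\<Sum>i\<in>I. a i * emp_process N (g m i) \<omega>) \<partial>M) \<longlonglongrightarrow> (\<integral>\<omega>. cis (\<Sum>i\<in>I. a i * K (g m i) \<omega>) \<partial>P)"
            if "finite I" for I a
            unfolding char[OF that g01] by (rule emp_process_char[OF that g01])
          show "integrable M (\<lambda>\<omega>. (emp_process N (g m i) \<omega>)\<^sup>2)" for N i
            using integrable_emp_increment[of 0 "g m i" "\<lambda>x. x\<^sup>2" N] g01[of m i] by (simp add: emp_process_zero continuous_intros)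
          show "(\<integral>\<omega>. (emp_process N (g m i) \<omega>)\<^sup>2 \<partial>M) \<le> V" for N i
            using V0(2)[OF g01] by (simp add: V_def le_max_iff_disj)
          show "integrable P (\<lambda>\<omega>. (K (g m i) \<omega>)\<^sup>2)" for i by (rule K2(1)[OF g01])
          show "(\<integral>\<omega>. (K (g m i) \<omega>)\<^sup>2 \<partial>P) \<le> V" for i
            using bspec[OF B1 g01[of m i]] K2(2)[OF g01[of m i]] by (simp add: V_def)
          show "0 \<le> L" by (rule L0)
          show "\<bar>?H x\<bar> \<le> B" for x using B HD by blast
          fix x y :: "nat \<Rightarrow> real"
          have "J1_dist (\<lambda>t\<in>{0..1}. x (dyadic_cell m t)) (\<lambda>t\<in>{0..1}. y (dyadic_cell m t)) \<le> (\<Sum>i<2 ^ m. \<bar>x i - y i\<bar>)"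
          proof (rule J1_dist_le_sup[OF HD HD])
            fix t :: real assume t: "t \<in> {0..1}"
            then have "dyadic_cell m t < 2 ^ m" by (intro dyadic_cell_less) simp
            then have "\<bar>x (dyadic_cell m t) - y (dyadic_cell m t)\<bar> \<le> (\<Sum>i<2 ^ m. \<bar>x i - y i\<bar>)"
              by (intro member_le_sum) auto
            then show "\<bar>(\<lambda>t\<in>{0..1}. x (dyadic_cell m t)) t - (\<lambda>t\<in>{0..1}. y (dyadic_cell m t)) t\<bar> \<le> (\<Sum>i<2 ^ m. \<bar>x i - y i\<bar>)"
              using t by simp
          qed
          then have "L * J1_dist (\<lambda>t\<in>{0..1}. x (dyadic_cell m t)) (\<lambda>t\<in>{0..1}. y (dyadic_cell m t)) \<le> L * (\<Sum>i<2 ^ m. \<bar>x i - y i\<bar>)"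
            by (rule mult_left_mono[OF _ L0])
          then show "\<bar>?H x - ?H y\<bar> \<le> L * (\<Sum>i<2 ^ m. \<bar>x i - y i\<bar>)"
            by (rule order_trans[OF hL[OF HD HD]])
        qed
        then show ?thesis unfolding IA_def JA_def Ag .
      qed
      have approx: "JA \<longlonglongrightarrow> JK"
        unfolding JA_def[abs_def] JK_def
      proof (rule integral_dominated_convergence[where w = "\<lambda>_. B"])
        show "(\<lambda>\<omega>. h (path01 K \<omega>)) \<in> borel_measurable P" by (rule hpm[OF Kmeas])
        show "(\<lambda>\<omega>. h (A m (\<lambda>t. K t \<omega>))) \<in> borel_measurable P" for m by (rule hpm[OF AKmeas])
        show "AE \<omega> in P. (\<lambda>m. h (A m (\<lambda>t. K t \<omega>))) \<longlonglongrightarrow> h (path01 K \<omega>)"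
        proof (rule AE_I2)
          fix \<omega> assume \<omega>: "\<omega> \<in> space P"
          have "(\<lambda>m. J1_dist (A m (\<lambda>t. K t \<omega>)) (path01 K \<omega>)) \<longlonglongrightarrow> 0"
            unfolding A_def path01_def by (rule continuous_step_approx[OF Kc])
          then have "(\<lambda>m. L * J1_dist (A m (\<lambda>t. K t \<omega>)) (path01 K \<omega>)) \<longlonglongrightarrow> 0"
            using tendsto_mult_right_zero by blast
          then have "(\<lambda>m. h (A m (\<lambda>t. K t \<omega>)) - h (path01 K \<omega>)) \<longlonglongrightarrow> 0"
          proof (rule Lim_null_comparison[rotated, OF _ always_eventually], intro allI)
            show "norm (h (A m (\<lambda>t. K t \<omega>)) - h (path01 K \<omega>)) \<le> L * J1_dist (A m (\<lambda>t. K t \<omega>)) (path01 K \<omega>)" for m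
              using hL[OF AD pD[OF Kmeas \<omega>]] by simp
          qed
          then show "(\<lambda>m. h (A m (\<lambda>t. K t \<omega>))) \<longlonglongrightarrow> h (path01 K \<omega>)" by (rule LIM_zero_cancel)
        qed
        show "AE \<omega> in P. norm (h (A m (\<lambda>t. K t \<omega>))) \<le> B" for m using B AD by auto
      qed simp
      have close: "\<bar>IY N - IA m N\<bar> \<le> L * \<epsilon> + 2 * B * \<eta>"
        if E: "E \<in> sets M" "measure M E \<le> \<eta>"
          and osc: "\<forall>\<omega>\<in>space M - E. \<forall>t\<in>{0..1}. \<bar>emp_process N t \<omega> - emp_process N (real (dyadic_cell m t) / 2 ^ m) \<omega>\<bar> \<le> \<epsilon>"
          and \<epsilon>: "0 < \<epsilon>" for \<epsilon> \<eta> m N E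
      proof -
        let ?p = "\<lambda>\<omega>. h (path01 (emp_process N) \<omega>)" and ?a = "\<lambda>\<omega>. h (A m (\<lambda>t. emp_process N t \<omega>))"
        have int: "integrable M ?p" "integrable M ?a"
          using hpm[OF Ymeas] hpm[OF AYmeas] B pD[OF Ymeas] AD by (auto intro!: bounded_integrable[where B = B])
        have pw: "\<bar>?p \<omega> - ?a \<omega>\<bar> \<le> L * \<epsilon> + 2 * B * indicator E \<omega>" if \<omega>: "\<omega> \<in> space M" for \<omega>
        proof (cases "\<omega> \<in> E")
          case True
          have "\<bar>?p \<omega>\<bar> \<le> B" "\<bar>?a \<omega>\<bar> \<le> B" using B pD[OF Ymeas \<omega>] AD by blast+
          moreover have "0 \<le> L * \<epsilon>" using L0 \<epsilon> by simp
          ultimately show ?thesis using True by simp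
        next
          case False
          have "J1_dist (path01 (emp_process N) \<omega>) (A m (\<lambda>t. emp_process N t \<omega>)) \<le> \<epsilon>"
            by (rule J1_dist_le_sup[OF pD[OF Ymeas \<omega>] AD]) (use osc \<omega> False in \<open>auto simp: path01_def A_def\<close>)
          then have "L * J1_dist (path01 (emp_process N) \<omega>) (A m (\<lambda>t. emp_process N t \<omega>)) \<le> L * \<epsilon>"
            by (rule mult_left_mono[OF _ L0])
          moreover have "\<bar>?p \<omega> - ?a \<omega>\<bar> \<le> L * J1_dist (path01 (emp_process N) \<omega>) (A m (\<lambda>t. emp_process N t \<omega>))"
            by (rule hL[OF pD[OF Ymeas \<omega>] AD])
          ultimately show ?thesis using False by simp
        qed
        have "\<bar>IY N - IA m N\<bar> = \<bar>\<integral>\<omega>. ?p \<omega> - ?a \<omega> \<partial>M\<bar>" unfolding IY_def IA_def using int by simp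
        also have "\<dots> \<le> (\<integral>\<omega>. \<bar>?p \<omega> - ?a \<omega>\<bar> \<partial>M)" by (rule integral_abs_bound)
        also have "\<dots> \<le> (\<integral>\<omega>. L * \<epsilon> + 2 * B * indicator E \<omega> \<partial>M)"
          by (rule integral_mono) (use int E pw in \<open>auto intro!: integrable_real_indicator simp: emeasure_eq_measure\<close>)
        also have "\<dots> = L * \<epsilon> + 2 * B * measure M E"
          using E by (simp add: prob_space emeasure_eq_measure)
        also have "\<dots> \<le> L * \<epsilon> + 2 * B * \<eta>" using E(2) B00 by (intro add_left_mono mult_left_mono) auto
        finally show ?thesis .
      qed
      have "IY \<longlonglongrightarrow> JK"
      proof (rule LIMSEQ_I)
        fix e :: real assume e: "0 < e"
        define \<epsilon> where "\<epsilon> = e / 6 / (L + 1)"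
        define \<eta> where "\<eta> = e / 12 / (B + 1)"
        have \<epsilon>: "0 < \<epsilon>" using e L0 by (simp add: \<epsilon>_def)
        have \<eta>: "0 < \<eta>" using e B00 by (simp add: \<eta>_def)
        have small: "L * \<epsilon> + 2 * B * \<eta> \<le> e / 3"
        proof -
          have "L + 1 \<noteq> 0" "B + 1 \<noteq> 0" using L0 B00 by linarith+
          then have "\<epsilon> * (L + 1) = e / 6" "\<eta> * (B + 1) = e / 12"
            using nonzero_eq_divide_eq \<epsilon>_def \<eta>_def by blast+
          then have "L * \<epsilon> = e / 6 - \<epsilon>" "B * \<eta> = e / 12 - \<eta>" by (simp_all add: distrib_left mult.commute)
          then show ?thesis using \<epsilon> \<eta> by simp
        qed
        have "\<forall>\<^sub>F m in sequentially. \<bar>JA m - JK\<bar> < e / 3"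
          using tendstoD[OF approx, of "e / 3"] e by (simp add: dist_real_def)
        then have "\<forall>\<^sub>F m in sequentially. \<bar>JA m - JK\<bar> < e / 3 \<and> (\<forall>\<^sub>F N in sequentially. \<exists>A\<in>sets M. measure M A \<le> \<eta> \<and>
           (\<forall>\<omega>\<in>space M - A. \<forall>t\<in>{0..1}. \<bar>emp_process N t \<omega> - emp_process N (real (dyadic_cell m t) / 2 ^ m) \<omega>\<bar> \<le> \<epsilon>))"
          by (rule eventually_conj[OF _ emp_process_oscillation[OF \<epsilon> \<eta>]])
        then obtain m where m: "\<bar>JA m - JK\<bar> < e / 3" "\<forall>\<^sub>F N in sequentially. \<exists>A\<in>sets M. measure M A \<le> \<eta> \<and>
           (\<forall>\<omega>\<in>space M - A. \<forall>t\<in>{0..1}. \<bar>emp_process N t \<omega> - emp_process N (real (dyadic_cell m t) / 2 ^ m) \<omega>\<bar> \<le> \<epsilon>)"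
          using eventually_happens'[OF sequentially_bot] by blast
        have "\<forall>\<^sub>F N in sequentially. \<bar>IA m N - JA m\<bar> < e / 3"
          using tendstoD[OF fdd[of m], of "e / 3"] e by (simp add: dist_real_def)
        then have "\<forall>\<^sub>F N in sequentially. norm (IY N - JK) < e"
          using m(2)
        proof (rule eventually_elim2)
          fix N assume 1: "\<bar>IA m N - JA m\<bar> < e / 3" and "\<exists>A\<in>sets M. measure M A \<le> \<eta> \<and>
           (\<forall>\<omega>\<in>space M - A. \<forall>t\<in>{0..1}. \<bar>emp_process N t \<omega> - emp_process N (real (dyadic_cell m t) / 2 ^ m) \<omega>\<bar> \<le> \<epsilon>)"
          then obtain E where "E \<in> sets M" "measure M E \<le> \<eta>"
            "\<forall>\<omega>\<in>space M - E. \<forall>t\<in>{0..1}. \<bar>emp_process N t \<omega> - emp_process N (real (dyadic_cell m t) / 2 ^ m) \<omega>\<bar> \<le> \<epsilon>" by blast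
          from close[OF this \<epsilon>] have "\<bar>IY N - IA m N\<bar> \<le> e / 3" using small by simp
          then show "norm (IY N - JK) < e" using 1 m(1) unfolding real_norm_def by (simp add: abs_if field_simps split: if_splits)
        qed
        then show "\<exists>no. \<forall>n\<ge>no. norm (IY n - JK) < e" by (simp only: eventually_sequentially)
      qed
      then show "(\<lambda>N. \<integral>\<omega>. h (path01 (emp_process N) \<omega>) \<partial>M) \<longlonglongrightarrow> (\<integral>\<omega>. h (path01 K \<omega>) \<partial>P)"
        unfolding IY_def JK_def .
    qed
  qed
qed

end

text \<open>
  Half of the surplus \<open>\<delta>\<close> in the decay exponent is spent on the weight \<open>(k + 1) powr d\<close>. The
  factor \<open>2 powr (1 + \<delta>)\<close> compares \<open>k\<close> with \<open>k + 1 \<le> 2 k\<close>.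
\<close>

lemma mixing_walk_of_psi_decay:
  fixes M :: "'a measure" and X :: "nat \<Rightarrow> 'a \<Rightarrow> real" and \<delta> :: real
  assumes "prob_space M"
    and "prob_space.indep_vars M (\<lambda>_. borel) X {1..}"
    and "\<And>j. j \<ge> 1 \<Longrightarrow> distr M borel (X j) = distr M borel (X 1)"
    and \<delta>: "\<delta> > 0"
    and bdd: "bdd_above ((\<lambda>k. real k powr (1 + \<delta>) * psi M X k) ` {1..})"
  obtains \<rho> d where "mixing_walk M X \<rho> d"
proof -
  obtain K0 where K0: "\<And>k. 1 \<le> k \<Longrightarrow> real k powr (1 + \<delta>) * psi M X k \<le> K0"
    using bdd by (auto simp: bdd_above_def)
  (* The maximum with 2 ensures the condition at k = 0 and makes the bound nonnegative. *)
  define A where "A = max 2 (K0 * 2 powr (1 + \<delta>))"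
  define d where "d = min 1 (\<delta> / 2)"
  define \<rho> where "\<rho> k = A * (real k + 1) powr (- (1 + \<delta>))" for k :: nat
  have A2: "2 \<le> A" by (simp add: A_def)
  have psi: "psi M X k \<le> \<rho> k" if k: "1 \<le> k" for k
  proof -
    have "(real k + 1) powr (1 + \<delta>) \<le> (2 * real k) powr (1 + \<delta>)" using k \<delta> by (intro powr_mono2) auto
    also have "\<dots> = 2 powr (1 + \<delta>) * real k powr (1 + \<delta>)" by (simp add: powr_mult)
    finally have le: "(real k + 1) powr (1 + \<delta>) \<le> 2 powr (1 + \<delta>) * real k powr (1 + \<delta>)" .
    show ?thesis
    proof (cases "0 \<le> psi M X k")
      case True
      have "(real k + 1) powr (1 + \<delta>) * psi M X k \<le> 2 powr (1 + \<delta>) * real k powr (1 + \<delta>) * psi M X k"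
        by (rule mult_right_mono[OF le True])
      also have "\<dots> = 2 powr (1 + \<delta>) * (real k powr (1 + \<delta>) * psi M X k)" by simp
      also have "\<dots> \<le> 2 powr (1 + \<delta>) * K0" by (rule mult_left_mono[OF K0[OF k]]) simp
      also have "\<dots> \<le> A" by (simp add: A_def mult.commute)
      finally have *: "(real k + 1) powr (1 + \<delta>) * psi M X k \<le> A" .
      have "(real k + 1) powr (1 + \<delta>) * (real k + 1) powr (- (1 + \<delta>)) = 1"
        by (subst powr_add[symmetric]) simp
      then have "psi M X k = (real k + 1) powr (1 + \<delta>) * psi M X k * (real k + 1) powr (- (1 + \<delta>))"
        by (metis mult.assoc mult.commute mult_1)
      also have "\<dots> \<le> A * (real k + 1) powr (- (1 + \<delta>))" by (rule mult_right_mono[OF *]) simp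
      finally show ?thesis unfolding \<rho>_def .
    next
      case False
      moreover have "0 \<le> \<rho> k" using A2 by (simp add: \<rho>_def)
      ultimately show ?thesis by linarith
    qed
  qed
  have "mixing_walk M X \<rho> d"
  proof (intro mixing_walk.intro iid_walk.intro assms(1) iid_walk_axioms.intro assms(2) assms(3) mixing_walk_axioms.intro psi)
    show "0 \<le> \<rho> k" for k using A2 by (simp add: \<rho>_def)
    show "2 \<le> \<rho> 0" using A2 by (simp add: \<rho>_def)
    show "0 < d" "d \<le> 1" using \<delta> by (auto simp: d_def)
    have "- (1 + \<delta>) + d < - 1" using \<delta> by (simp add: d_def min_def field_simps)
    then have "summable (\<lambda>k. real k powr (- (1 + \<delta>) + d))" by (simp add: summable_real_powr_iff)
    then have "summable (\<lambda>k. real (Suc k) powr (- (1 + \<delta>) + d))" by (subst summable_Suc_iff)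
    then have "summable (\<lambda>k. A * real (Suc k) powr (- (1 + \<delta>) + d))" by (rule summable_mult)
    moreover have "(\<lambda>k. A * real (Suc k) powr (- (1 + \<delta>) + d)) = (\<lambda>k. \<rho> k * (real k + 1) powr d)"
      unfolding \<rho>_def powr_add by (simp add: add.commute mult.assoc)
    ultimately show "summable (\<lambda>k. \<rho> k * (real k + 1) powr d)" by (simp only:)
  qed
  then show ?thesis by (rule that)
qed

theorem theorem2:
  fixes M :: "'a measure" and X :: "nat \<Rightarrow> 'a \<Rightarrow> real" and \<delta> :: real
  assumes "prob_space M"
    and "prob_space.indep_vars M (\<lambda>_. borel) X {1..}"
    and "\<And>j. j \<ge> 1 \<Longrightarrow> distr M borel (X j) = distr M borel (X 1)"
    and "\<delta> > 0"
    and "bdd_above ((\<lambda>k. real k powr (1 + \<delta>) * psi M X k) ` {1..})"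
  shows "(\<forall>s\<in>{0..1}. \<forall>t\<in>{0..1}. Gamma_cov M X s t = Gamma_cov M X t s)
    \<and> (\<forall>I c. finite I \<and> I \<subseteq> {0..1} \<longrightarrow>
          (\<Sum>s\<in>I. \<Sum>t\<in>I. c s * c t * Gamma_cov M X s t) \<ge> 0)
    \<and> continuous_on ({0..1} \<times> {0..1}) (\<lambda>(s, t). Gamma_cov M X s t)
    \<and> (\<exists>(P :: (real \<Rightarrow> real) measure) K.
          prob_space P
          \<and> gaussian_process P {0..1} K
          \<and> (\<forall>t\<in>{0..1}. (\<integral>\<omega>. K t \<omega> \<partial>P) = 0)
          \<and> (\<forall>s\<in>{0..1}. \<forall>t\<in>{0..1}. covariance P (K s) (K t) = Gamma_cov M X s t)
          \<and> converges_weakly_D01 M (\<lambda>N t \<omega>. sqrt (real N) * (empirical_df X N t \<omega> - t)) P K)"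
proof -
  obtain \<rho> d where "mixing_walk M X \<rho> d" by (rule mixing_walk_of_psi_decay[OF assms])
  then interpret mixing_walk M X \<rho> d .
  have psd: "0 \<le> (\<Sum>i\<in>I. \<Sum>j\<in>I. c i * c j * Gamma_cov M X (t i) (t j))"
    if "finite I" "\<And>i. i \<in> I \<Longrightarrow> t i \<in> {0..1}" for I :: "nat set" and c t
    by (rule Gamma_cov_psd[OF that])
  have process: "\<exists>(P :: (real \<Rightarrow> real) measure) K. prob_space P \<and> gaussian_process P {0..1} K
          \<and> (\<forall>t\<in>{0..1}. (\<integral>\<omega>. K t \<omega> \<partial>P) = 0)
          \<and> (\<forall>s\<in>{0..1}. \<forall>t\<in>{0..1}. covariance P (K s) (K t) = Gamma_cov M X s t)
          \<and> converges_weakly_D01 M (\<lambda>N t \<omega>. sqrt (real N) * (empirical_df X N t \<omega> - t)) P K"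
  proof (rule continuous_gaussian_process[OF Gamma_cov_commute psd continuous_Gamma_cov Gamma_cov_increment])
    fix K :: "real \<Rightarrow> (real \<Rightarrow> real) \<Rightarrow> real"
    assume Km: "\<And>t. t \<in> {0..1} \<Longrightarrow> K t \<in> borel_measurable gauss_space"
      and Kc: "\<And>\<omega>. continuous_on {0..1} (\<lambda>t. K t \<omega>)"
      and char: "\<And>(I :: nat set) c t. finite I \<Longrightarrow> (\<And>i. i \<in> I \<Longrightarrow> t i \<in> {0..1}) \<Longrightarrow>
       (\<integral>\<omega>. cis (\<Sum>i\<in>I. c i * K (t i) \<omega>) \<partial>gauss_space) =
       of_real (exp (- (\<Sum>i\<in>I. \<Sum>j\<in>I. c i * c j * Gamma_cov M X (t i) (t j)) / 2))"
    note gauss = gaussian_process_of_char[where P = gauss_space and T = "{0..1}" and K = K and G = "Gamma_cov M X",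
        OF prob_space_gauss_space Km Gamma_cov_commute psd char]
    have conv: "converges_weakly_D01 M (\<lambda>N t \<omega>. sqrt (real N) * (empirical_df X N t \<omega> - t)) gauss_space K"
      using emp_process_converges[where P = gauss_space and K = K, OF prob_space_gauss_space Km Kc char gauss(3,4)]
      unfolding emp_process_def[abs_def] .
    show ?thesis
      by (rule exI[of _ gauss_space], rule exI[of _ K])
        (intro conjI ballI prob_space_gauss_space gauss(1,2,5) conv)
  qed
  show ?thesis
  proof (intro conjI process ballI allI impI)
    show "continuous_on ({0..1} \<times> {0..1}) (\<lambda>(s, t). Gamma_cov M X s t)" by (rule continuous_Gamma_cov)
    show "Gamma_cov M X s t = Gamma_cov M X t s" if "s \<in> {0..1}" "t \<in> {0..1}" for s t by (rule Gamma_cov_commute[OF that])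
    show "0 \<le> (\<Sum>s\<in>I. \<Sum>t\<in>I. c s * c t * Gamma_cov M X s t)" if "finite I \<and> I \<subseteq> {0..1}" for I c
      by (rule Gamma_cov_psd[where t = "\<lambda>x. x"]) (use that in auto)
  qed
qed

end
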